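(* Let $(\Omega,T)$ be a topologically mixing countable Markov shift endowed with a null recurrent potential $\phi$ satisfying Walters' condition and $P_G(\phi)<+\infty$, and let $\mu$ be the associated invariant measure. Assume that the (non-decreasing) normalizing sequence $(a_n)$ of $(\Omega,T,\mu)$ is regularly varying of index $\alpha$ for some $0<\alpha\le1$. Let $x\in\Omega$ and $B_n:=[x_0^{n-1}]$ for $n\ge1$. Assume that $x$ is not periodic and that there exists $v\in V$ with $|\mathcal O(x)\cap[v]|=+\infty$. Then, as $n\to+\infty$, the point processes $N_{B_n}^\gamma$ converge in law to the fractional Poisson process $\mathrm{FPP}_\alpha(\Gamma(1+\alpha))$, both under every probability measure absolutely continuous with respect to $\mu$ and under $\mu_{B_n}$.
   Context: Topological Markov shifts. Let $V$ be an at most countable alphabet and $A:V\times V\to\{0,1\}$ a transition matrix. $\Omega=\{x=(x_n)_{n\ge0}\in V^{\mathbb N}: A(x_n,x_{n+1})=1\ \forall n\ge0\}$, $T$ is the left shift, topology given by $d(x,y)=\eta^{\min\{n\ge0:x_n\ne y_n\}}$, $\eta\in(0,1)$ fixed; this is a countable Markov shift (CMS) when $V$ is infinite. A word $v_0^{n-1}=(v_0,\dots,v_{n-1})$ is admissible if $A(v_i,v_{i+1})=1$ for all $i$; $[v_0^{n-1}]=\{x\in\Omega:x_i=v_i,\ 0\le i<n\}$. Topologically mixing: for all $v,w\in V$ there is $N$ such that for all $n\ge N$ there is an admissible path of $n$ steps from $v$ to $w$. $|\mathcal O(x)\cap[v]|$ denotes the number of visits $\#\{k\ge0:T^kx\in[v]\}$.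 Potentials. $\phi:\Omega\to\mathbb R$ is measurable, $S_n\phi=\sum_{k=0}^{n-1}\phi\circ T^k$, $\mathrm{var}_n(\phi)=\sup\{|\phi(x)-\phi(y)|:x_0^{n-1}=y_0^{n-1}\}$. Walters' condition: for all $k\ge1$, $W_k(\phi):=\sup_{n\ge1}\mathrm{var}_{n+k}(S_n\phi)<\infty$, and $W_k(\phi)\to0$ as $k\to\infty$. For measurable $B$, $r_B=r_B^{(1)}(x)=\inf\{n\ge1:T^nx\in B\}$, $r_B^{(k+1)}(x)=\inf\{n>r_B^{(k)}(x):T^nx\in B\}$. $Z_n(\phi,v)=\sum_{T^nx=x}e^{S_n\phi(x)}\mathbf 1_{[v]}(x)$, $Z_n^*(\phi,v)=\sum_{T^nx=x}e^{S_n\phi(x)}\mathbf 1_{\{r_{[v]}=n\}}(x)\mathbf 1_{[v]}(x)$. $P_G(\phi)=\lim_n\frac1n\log Z_n(\phi,v)$ (independent of $v$), $\lambda_\phi=e^{P_G(\phi)}$. $\phi$ is null recurrent if $\sum_n\lambda_\phi^{-n}Z_n(\phi,v)=\infty$ and $\sum_n n\lambda_\phi^{-n}Z_n^*(\phi,v)=\infty$ for some (all) $v$. Then, with $L_\phi f(x)=\sum_{Ty=x}e^{\phi(y)}f(y)$, there are a continuous $h_\phi>0$ and a conservative measure $\nu_\phi$, finite on cylinders, with $L_\phi h_\phi=\lambda_\phi h_\phi$, $L_\phi^*\nu_\phi=\lambda_\phi\nu_\phi$, $\int h_\phi\,d\nu_\phi=+\infty$; $\mu=h_\phi\nu_\phi$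 is a conservative ergodic shift-invariant $\sigma$-finite infinite measure. $(\Omega,T,\mu)$ is pointwise dual ergodic: with $\widehat T$ the transfer operator ($\int f\cdot g\circ T\,d\mu=\int(\widehat Tf)g\,d\mu$), there is a normalizing sequence $(a_n)$ with $\frac1{a_n}\sum_{k=0}^{n-1}\widehat T^kf\to\int f\,d\mu$ $\mu$-a.e. for all $f\in L^1(\mu)$; one has $a_n\sim\frac1{\mu[v]}\sum_{k=1}^n\lambda_\phi^{-k}Z_k(\phi,v)$. Scaling. With $a(s)=a_{\lfloor s\rfloor}$ and $a^{\leftarrow}(y)=\inf\{s\ge0:a(s)>y\}$, put $\gamma(s)=1/a^{\leftarrow}(1/s)$. For $\mu(B)>0$, $\mu_B=\mu(\cdot\cap B)/\mu(B)$ and $N_B^\gamma=\sum_{k\ge1}\delta_{\gamma(\mu(B))\,r_B^{(k)}}$. Point processes on $\mathbb R_+=[0,\infty)$ are random boundedly finite counting measures; convergence in law is for the weak$^*$ (vague) topology. $\mathrm{RPP}(W)=\sum_{i\ge1}\delta_{W_1+\dots+W_i}$, $(W_i)$ i.i.d. copies of $W\ge0$. $H_\alpha(\lambda)$ is the nonnegative random variable with $\mathbb E[e^{-sH_\alpha(\lambda)}]=\lambda/(\lambda+s^\alpha)$, $s\ge0$, and $\mathrm{FPP}_\alpha(\lambda)=\mathrm{RPP}(H_\alpha(\lambda))$. *)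

theory Defs
  imports "HOL-Probability.Probability"
begin

section \<open>Borel sets and weak convergence on a topological space\<close>

definition borel_of :: "'a topology \<Rightarrow> 'a measure" where
  "borel_of X = sigma (topspace X) {U. openin X U}"

lemma space_borel_of: "space (borel_of X) = topspace X"
  by (simp add: borel_of_def space_measure_of_conv)

lemma sets_borel_of: "sets (borel_of X) = sigma_sets (topspace X) {U. openin X U}"
  unfolding borel_of_def by (rule sets_measure_of) (auto dest: openin_subset)

definition weak_conv_on :: "'a topology \<Rightarrow> (nat \<Rightarrow> 'a measure) \<Rightarrow> 'a measure \<Rightarrow> bool" where
  "weak_conv_on X Ms M \<longleftrightarrow>
     (\<forall>F :: 'a \<Rightarrow> real. continuous_map X euclideanreal F \<and> bounded (F ` topspace X) \<longrightarrow>
        (\<lambda>n. \<integral>x. F x \<partial>Ms n) \<longlonglongrightarrow> (\<integral>x. F x \<partial>M))"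

text \<open>Random elements \<open>N n\<close> of \<open>X\<close>, each defined on its own probability space \<open>P n\<close>, converge
  in law to the distribution \<open>L\<close>. Measurability of the \<open>N n\<close> is part of the assertion.\<close>

definition converges_in_law ::
    "'x topology \<Rightarrow> (nat \<Rightarrow> 'w measure) \<Rightarrow> (nat \<Rightarrow> 'w \<Rightarrow> 'x) \<Rightarrow> 'x measure \<Rightarrow> bool" where
  "converges_in_law X P N L \<longleftrightarrow>
     (\<forall>n. N n \<in> P n \<rightarrow>\<^sub>M borel_of X) \<and>
     weak_conv_on X (\<lambda>n. distr (P n) (borel_of X) (N n)) L"


section \<open>Topological Markov shifts\<close>

definition shift_space :: "('v \<Rightarrow> 'v \<Rightarrow> bool) \<Rightarrow> (nat \<Rightarrow> 'v) set" where
  "shift_space A = {x. \<forall>n. A (x n) (x (Suc n))}"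

definition lshift :: "(nat \<Rightarrow> 'v) \<Rightarrow> nat \<Rightarrow> 'v" where
  "lshift x = (\<lambda>n. x (Suc n))"

definition shift_dist :: "real \<Rightarrow> (nat \<Rightarrow> 'v) \<Rightarrow> (nat \<Rightarrow> 'v) \<Rightarrow> real" where
  "shift_dist \<eta> x y = (if x = y then 0 else \<eta> ^ (LEAST n. x n \<noteq> y n))"

definition shift_topology :: "real \<Rightarrow> ('v \<Rightarrow> 'v \<Rightarrow> bool) \<Rightarrow> (nat \<Rightarrow> 'v) topology" where
  "shift_topology \<eta> A = Metric_space.mtopology (shift_space A) (shift_dist \<eta>)"

lemma Metric_space_shift:
  assumes "0 < \<eta>" "\<eta> < 1"
  shows "Metric_space (shift_space A) (shift_dist \<eta>)"
proof
  fix x y z :: "nat \<Rightarrow> 'a"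
  show "0 \<le> shift_dist \<eta> x y" "shift_dist \<eta> x y = shift_dist \<eta> y x"
    using assms by (simp_all add: shift_dist_def eq_commute[of x] eq_commute[of "x _"])
  show "(shift_dist \<eta> x y = 0) = (x = y)"
    using assms by (auto simp: shift_dist_def)
  show "shift_dist \<eta> x z \<le> shift_dist \<eta> x y + shift_dist \<eta> y z"
  proof (cases "x = y \<or> y = z \<or> x = z")
    case True
    then show ?thesis using assms by (auto simp: shift_dist_def)
  next
    case False
    define m where "m = (LEAST n. x n \<noteq> z n)"
    have m: "x m \<noteq> z m"
      unfolding m_def by (rule LeastI_ex) (use False in auto)
    have "x m \<noteq> y m \<or> y m \<noteq> z m" using m by auto
    then have "(LEAST n. x n \<noteq> y n) \<le> m \<or> (LEAST n. y n \<noteq> z n) \<le> m"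
      by (meson Least_le)
    then have "\<eta> ^ m \<le> \<eta> ^ (LEAST n. x n \<noteq> y n) \<or> \<eta> ^ m \<le> \<eta> ^ (LEAST n. y n \<noteq> z n)"
      by (meson assms less_imp_le power_decreasing)
    moreover have "0 < \<eta> ^ (LEAST n. x n \<noteq> y n)" "0 < \<eta> ^ (LEAST n. y n \<noteq> z n)"
      using assms by auto
    ultimately show ?thesis
      using False unfolding shift_dist_def m_def by auto
  qed
qed

lemma topspace_shift_topology:
  "0 < \<eta> \<Longrightarrow> \<eta> < 1 \<Longrightarrow> topspace (shift_topology \<eta> A) = shift_space A"
  by (simp add: shift_topology_def Metric_space.topspace_mtopology Metric_space_shift)

definition cyl :: "('v \<Rightarrow> 'v \<Rightarrow> bool) \<Rightarrow> 'v list \<Rightarrow> (nat \<Rightarrow> 'v) set" where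
  "cyl A w = {x \<in> shift_space A. \<forall>i<length w. x i = w ! i}"

definition admissible :: "('v \<Rightarrow> 'v \<Rightarrow> bool) \<Rightarrow> 'v list \<Rightarrow> bool" where
  "admissible A w \<longleftrightarrow> (\<forall>i. Suc i < length w \<longrightarrow> A (w ! i) (w ! Suc i))"

definition topologically_mixing :: "('v \<Rightarrow> 'v \<Rightarrow> bool) \<Rightarrow> bool" where
  "topologically_mixing A \<longleftrightarrow>
     (\<forall>v w. \<exists>N. \<forall>n\<ge>N. \<exists>p. length p = Suc n \<and> admissible A p \<and> hd p = v \<and> last p = w)"

text \<open>\<open>hit_time B k x\<close> is the \<open>k\<close>-th strictly positive time at which the orbit of \<open>x\<close> is in \<open>B\<close>,
  and \<open>\<infinity>\<close> if there are fewer than \<open>k\<close> such times.\<close>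

primrec hit_time :: "(nat \<Rightarrow> 'v) set \<Rightarrow> nat \<Rightarrow> (nat \<Rightarrow> 'v) \<Rightarrow> enat" where
  "hit_time B 0 x = 0"
| "hit_time B (Suc k) x = Inf {enat n | n. hit_time B k x < enat n \<and> (lshift ^^ n) x \<in> B}"


section \<open>Potentials\<close>

definition birkhoff_sum :: "((nat \<Rightarrow> 'v) \<Rightarrow> real) \<Rightarrow> nat \<Rightarrow> (nat \<Rightarrow> 'v) \<Rightarrow> real" where
  "birkhoff_sum \<phi> n x = (\<Sum>k<n. \<phi> ((lshift ^^ k) x))"

definition variation ::
    "('v \<Rightarrow> 'v \<Rightarrow> bool) \<Rightarrow> nat \<Rightarrow> ((nat \<Rightarrow> 'v) \<Rightarrow> real) \<Rightarrow> ennreal" where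
  "variation A n f =
     (SUP (x, y) \<in> {(x, y). x \<in> shift_space A \<and> y \<in> shift_space A \<and> (\<forall>i<n. x i = y i)}.
        ennreal \<bar>f x - f y\<bar>)"

definition walters_sup ::
    "('v \<Rightarrow> 'v \<Rightarrow> bool) \<Rightarrow> ((nat \<Rightarrow> 'v) \<Rightarrow> real) \<Rightarrow> nat \<Rightarrow> ennreal" where
  "walters_sup A \<phi> k = (SUP n\<in>{1..}. variation A (n + k) (birkhoff_sum \<phi> n))"

definition walters :: "('v \<Rightarrow> 'v \<Rightarrow> bool) \<Rightarrow> ((nat \<Rightarrow> 'v) \<Rightarrow> real) \<Rightarrow> bool" where
  "walters A \<phi> \<longleftrightarrow> (\<forall>k\<ge>1. walters_sup A \<phi> k < \<infinity>) \<and> walters_sup A \<phi> \<longlonglongrightarrow> 0"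

definition Zn :: "('v \<Rightarrow> 'v \<Rightarrow> bool) \<Rightarrow> ((nat \<Rightarrow> 'v) \<Rightarrow> real) \<Rightarrow> 'v \<Rightarrow> nat \<Rightarrow> ennreal" where
  "Zn A \<phi> v n =
     (\<Sum>\<^sub>\<infinity>x \<in> {x \<in> cyl A [v]. (lshift ^^ n) x = x}. ennreal (exp (birkhoff_sum \<phi> n x)))"

definition Zn_star :: "('v \<Rightarrow> 'v \<Rightarrow> bool) \<Rightarrow> ((nat \<Rightarrow> 'v) \<Rightarrow> real) \<Rightarrow> 'v \<Rightarrow> nat \<Rightarrow> ennreal" where
  "Zn_star A \<phi> v n =
     (\<Sum>\<^sub>\<infinity>x \<in> {x \<in> cyl A [v]. (lshift ^^ n) x = x \<and> hit_time (cyl A [v]) 1 x = enat n}.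
        ennreal (exp (birkhoff_sum \<phi> n x)))"

definition ln_ennreal :: "ennreal \<Rightarrow> ereal" where
  "ln_ennreal z = (if z = 0 then -\<infinity> else if z = \<infinity> then \<infinity> else ereal (ln (enn2real z)))"

definition gurevich_pressure :: "('v \<Rightarrow> 'v \<Rightarrow> bool) \<Rightarrow> ((nat \<Rightarrow> 'v) \<Rightarrow> real) \<Rightarrow> ereal" where
  "gurevich_pressure A \<phi> =
     (THE p. \<forall>v. (\<lambda>n. ln_ennreal (Zn A \<phi> v n) / ereal (real n)) \<longlonglongrightarrow> p)"

definition lam :: "('v \<Rightarrow> 'v \<Rightarrow> bool) \<Rightarrow> ((nat \<Rightarrow> 'v) \<Rightarrow> real) \<Rightarrow> real" where
  "lam A \<phi> = exp (real_of_ereal (gurevich_pressure A \<phi>))"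

text \<open>The series start at \<open>n = 1\<close>: every point is fixed by the zeroth iterate.\<close>

definition null_recurrent :: "('v \<Rightarrow> 'v \<Rightarrow> bool) \<Rightarrow> ((nat \<Rightarrow> 'v) \<Rightarrow> real) \<Rightarrow> bool" where
  "null_recurrent A \<phi> \<longleftrightarrow>
     (\<exists>v. (\<Sum>n. ennreal (inverse (lam A \<phi>) ^ Suc n) * Zn A \<phi> v (Suc n)) = \<infinity> \<and>
          (\<Sum>n. of_nat (Suc n) * ennreal (inverse (lam A \<phi>) ^ Suc n) * Zn_star A \<phi> v (Suc n)) = \<infinity>)"

definition ruelle_op :: "('v \<Rightarrow> 'v \<Rightarrow> bool) \<Rightarrow> ((nat \<Rightarrow> 'v) \<Rightarrow> real) \<Rightarrow>
    ((nat \<Rightarrow> 'v) \<Rightarrow> ennreal) \<Rightarrow> (nat \<Rightarrow> 'v) \<Rightarrow> ennreal" where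
  "ruelle_op A \<phi> f x = (\<Sum>\<^sub>\<infinity>y \<in> {y \<in> shift_space A. lshift y = x}. ennreal (exp (\<phi> y)) * f y)"

definition conservative :: "(nat \<Rightarrow> 'v) measure \<Rightarrow> bool" where
  "conservative M \<longleftrightarrow>
     (\<forall>W\<in>sets M. disjoint_family (\<lambda>n. (lshift ^^ n) -` W \<inter> space M) \<longrightarrow> emeasure M W = 0)"

text \<open>The eigenfunction and eigenmeasure of a null recurrent potential. The dual equation
  \<open>L* \<nu> = \<lambda> \<nu>\<close> is tested on all nonnegative measurable functions. The condition that \<open>h\<close> has
  infinite integral also rules out \<open>\<nu> = 0\<close>.\<close>

definition null_rpf ::
    "real \<Rightarrow> ('v \<Rightarrow> 'v \<Rightarrow> bool) \<Rightarrow> ((nat \<Rightarrow> 'v) \<Rightarrow> real) \<Rightarrow>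
     ((nat \<Rightarrow> 'v) \<Rightarrow> real) \<Rightarrow> (nat \<Rightarrow> 'v) measure \<Rightarrow> bool" where
  "null_rpf \<eta> A \<phi> h \<nu> \<longleftrightarrow>
     continuous_map (shift_topology \<eta> A) euclideanreal h \<and>
     (\<forall>x\<in>shift_space A. 0 < h x) \<and>
     sets \<nu> = sets (borel_of (shift_topology \<eta> A)) \<and>
     conservative \<nu> \<and>
     (\<forall>w. w \<noteq> [] \<longrightarrow> emeasure \<nu> (cyl A w) < \<infinity>) \<and>
     (\<forall>x\<in>shift_space A. ruelle_op A \<phi> (\<lambda>y. ennreal (h y)) x = ennreal (lam A \<phi> * h x)) \<and>
     (\<forall>f\<in>borel_measurable \<nu>.
        (\<integral>\<^sup>+x. ruelle_op A \<phi> f x \<partial>\<nu>) = ennreal (lam A \<phi>) * (\<integral>\<^sup>+x. f x \<partial>\<nu>)) \<and>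
     (\<integral>\<^sup>+x. ennreal (h x) \<partial>\<nu>) = \<infinity>"


section \<open>Normalizing sequences and scaling\<close>

text \<open>The transfer operator of the shift on integrable functions; the defining duality determines
  the image almost everywhere.\<close>

definition transfer_op :: "(nat \<Rightarrow> 'v) measure \<Rightarrow> ((nat \<Rightarrow> 'v) \<Rightarrow> real) \<Rightarrow> (nat \<Rightarrow> 'v) \<Rightarrow> real" where
  "transfer_op M f =
     (SOME f'. integrable M f' \<and>
        (\<forall>g\<in>borel_measurable M. bounded (g ` space M) \<longrightarrow>
           (\<integral>x. f x * g (lshift x) \<partial>M) = (\<integral>x. f' x * g x \<partial>M)))"

definition normalizing_seq :: "(nat \<Rightarrow> 'v) measure \<Rightarrow> (nat \<Rightarrow> real) \<Rightarrow> bool" where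
  "normalizing_seq M a \<longleftrightarrow>
     (\<forall>f. integrable M f \<longrightarrow>
        (AE x in M. (\<lambda>n. 1 / a n * (\<Sum>k<n. (transfer_op M ^^ k) f x)) \<longlonglongrightarrow> (\<integral>y. f y \<partial>M)))"

definition regularly_varying_seq :: "(nat \<Rightarrow> real) \<Rightarrow> real \<Rightarrow> bool" where
  "regularly_varying_seq a \<alpha> \<longleftrightarrow>
     (\<forall>\<^sub>F n in sequentially. 0 < a n) \<and>
     (\<forall>c>0. (\<lambda>n. a (nat \<lfloor>c * real n\<rfloor>) / a n) \<longlonglongrightarrow> c powr \<alpha>)"

text \<open>Extended values make the conventions \<open>inf {} = \<infinity>\<close>, \<open>1 / \<infinity> = 0\<close> and \<open>1 / 0 = \<infinity>\<close> available.\<close>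

definition gen_inverse :: "(nat \<Rightarrow> real) \<Rightarrow> real \<Rightarrow> ennreal" where
  "gen_inverse a y = Inf {ennreal s | s. 0 \<le> s \<and> a (nat \<lfloor>s\<rfloor>) > y}"

definition scaling :: "(nat \<Rightarrow> real) \<Rightarrow> real \<Rightarrow> ennreal" where
  "scaling a s = 1 / gen_inverse a (1 / s)"


section \<open>Point processes on the half-line\<close>

definition bf_counting_measures :: "real measure set" where
  "bf_counting_measures =
     {\<xi>. sets \<xi> = sets (restrict_space borel {0..}) \<and>
         (\<forall>B\<in>sets \<xi>. bounded B \<longrightarrow> (\<exists>k::nat. emeasure \<xi> B = of_nat k))}"

definition weak_sharp_topology :: "real measure topology" where
  "weak_sharp_topology = topology_generated_by
     {{\<xi> \<in> bf_counting_measures. (\<integral>x. f x \<partial>\<xi>) \<in> U} | (f :: real \<Rightarrow> real) U.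
        continuous_on {0..} f \<and> (\<exists>R. \<forall>x>R. f x = 0) \<and> open U}"

lemma topspace_weak_sharp: "topspace weak_sharp_topology = bf_counting_measures"
proof -
  have "bf_counting_measures \<in> {{\<xi> \<in> bf_counting_measures. (\<integral>x. f x \<partial>\<xi>) \<in> U} | (f :: real \<Rightarrow> real) U.
        continuous_on {0..} f \<and> (\<exists>R. \<forall>x>R. f x = 0) \<and> open U}"
    by (intro CollectI exI[of _ "\<lambda>_. 0"] exI[of _ UNIV]) auto
  then show ?thesis
    unfolding weak_sharp_topology_def topology_generated_by_topspace by blast
qed

text \<open>The sum of the unit masses at \<open>t 1, t 2, \<dots>\<close>, written as the image of a counting measure;
  points at infinity are not in the half-line and carry no mass.\<close>

definition dirac_sum :: "(nat \<Rightarrow> ennreal) \<Rightarrow> real measure" where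
  "dirac_sum t =
     distr (count_space {k. 1 \<le> k \<and> t k < \<infinity>}) (restrict_space borel {0..}) (\<lambda>k. enn2real (t k))"

definition N_proc :: "(nat \<Rightarrow> 'v) measure \<Rightarrow> (nat \<Rightarrow> real) \<Rightarrow> (nat \<Rightarrow> 'v) set \<Rightarrow>
    (nat \<Rightarrow> 'v) \<Rightarrow> real measure" where
  "N_proc M a B x =
     dirac_sum (\<lambda>k. scaling a (measure M B) * ennreal_of_enat (hit_time B k x))"

text \<open>The law of the renewal point process for i.i.d. waiting times with law \<open>H\<close>. If \<open>H\<close> lives on
  the nonnegative reals and is not the point mass at zero, the partial sums almost surely tend to
  infinity; on the exceptional null event, where their unit masses do not form a boundedly finite
  measure, the process is set to the zero measure.\<close>

definition rpp_law :: "real measure \<Rightarrow> real measure measure" where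
  "rpp_law H =
     distr (\<Pi>\<^sub>M i\<in>UNIV. H) (borel_of weak_sharp_topology)
       (\<lambda>W :: nat \<Rightarrow> real.
          let \<xi> = dirac_sum (\<lambda>k. ennreal (\<Sum>i<k. W i))
          in if \<xi> \<in> bf_counting_measures then \<xi> else null_measure (restrict_space borel {0..}))"

definition H_law :: "real \<Rightarrow> real \<Rightarrow> real measure" where
  "H_law \<alpha> l =
     (THE H. prob_space H \<and> sets H = sets borel \<and> (AE x in H. 0 \<le> x) \<and>
        (\<forall>s\<ge>0. (\<integral>x. exp (- s * x) \<partial>H) = l / (l + s powr \<alpha>)))"

definition fpp_law :: "real \<Rightarrow> real \<Rightarrow> real measure measure" where
  "fpp_law \<alpha> l = rpp_law (H_law \<alpha> l)"

end

theory Submission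
  imports Defs
begin

text \<open>Given a cylinder word, the future depends on the past only up to a factor \<open>exp (D m)\<close> once the
  next \<open>m\<close> symbols are known, and \<open>D m \<rightarrow> 0\<close> by Walters' condition; \<open>h\<close> inherits the regularity needed
  for this from the dual ergodic averages. Let \<open>N\<close> be the first index with \<open>a N > 1 / \<mu> B\<close>, so that the
  scaling is \<open>1 / N\<close>, and let \<open>\<phi> C\<close> be the Laplace transform at \<open>\<sigma> / N\<close> of the hitting time of \<open>B\<close> from
  the normalized restriction of \<open>\<mu>\<close> to \<open>C\<close>. Decomposing over the visits to \<open>B\<close> and inserting the dual
  ergodic averages gives \<open>\<phi> C \<approx> \<kappa> * (1 - \<phi> B)\<close> with \<open>\<kappa> = Gamma (1 + \<alpha>) / \<sigma> powr \<alpha>\<close> for every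
  fixed cylinder \<open>C\<close>.

  The visits of \<open>x\<close> to \<open>v\<close> yield \<open>\<phi> B \<approx> \<phi> C\<close>: the measure of the words of \<open>x\<close> decays geometrically in
  the number of visits, short returns to \<open>B\<close> are negligible by aperiodicity, the first entry to \<open>[v]\<close>
  after the word is negligible compared with \<open>N\<close>, and the position at that entry has an almost
  locally constant density on \<open>[v]\<close>. Hence both transforms tend to \<open>\<kappa> / (1 + \<kappa>)\<close>.

  The same comparison at successive visits to \<open>B\<close> makes the mixed moments of the variables
  \<open>exp (- gap / N)\<close> converge, which by the Stone--Weierstrass theorem is convergence in law, and the point
  process is a continuous function of these variables. Approximation by cylinders in \<open>L\<^sup>1\<close> covers the
  other initial laws.\<close>

text \<open>Every comparison costs a factor \<open>exp (D m)\<close>, so n tends to infinity for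
  fixed m before m is made large. The test function, the defect on \<open>B\<close>, changes with n,
  while dual ergodicity gives no rate. The kernel bound repairs this: all functions supported in one
  fixed prefix cylinder are compared with the indicator of a single set on which the averages
  converge boundedly, so the error constants do not depend on n. The constant \<kappa> is the limit
  of the Laplace integral of \<open>a\<close>, rescaled at \<open>N\<close> and divided by
  \<open>a N\<close>, since \<open>a N\<close> times the measure of \<open>B\<close> tends to 1.

  The visits of \<open>x\<close> to \<open>v\<close> may be separated by arbitrarily long gaps. A
  long gap is itself improbable, the tail of the return time to [v] being of order 1 / a, and this
  loss is played against the geometric decay in the number of visits.

  Waiting times are coded as numbers in [0, 1], with 0 for an infinite one. This makes the sequence
  space compact for polynomial approximation, although the point process depends continuously on the
  code only where its points do not accumulate. The law \<open>H_law\<close> is a definite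
  description; its existence is extracted from the convergence of the return time transforms, not
  from a density.\<close>

type_synonym 'v path = "nat \<Rightarrow> 'v"

abbreviation sh :: "nat \<Rightarrow> 'v path \<Rightarrow> 'v path" where "sh k \<equiv> lshift ^^ k"

abbreviation integ :: "'a measure \<Rightarrow> 'a set \<Rightarrow> ('a \<Rightarrow> real) \<Rightarrow> real" where
  "integ M X F \<equiv> LINT x|M. indicator X x * F x"

abbreviation ninteg :: "'a measure \<Rightarrow> 'a set \<Rightarrow> ('a \<Rightarrow> ennreal) \<Rightarrow> ennreal" where
  "ninteg M X F \<equiv> \<integral>\<^sup>+x. indicator X x * F x \<partial>M"

abbreviation corr :: "'v path measure \<Rightarrow> 'v path set \<Rightarrow> ('v path \<Rightarrow> real) \<Rightarrow> nat \<Rightarrow> real" where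
  "corr M X F k \<equiv> LINT x|M. indicator X x * F (sh k x)"

abbreviation ncorr :: "'v path measure \<Rightarrow> 'v path set \<Rightarrow> ('v path \<Rightarrow> ennreal) \<Rightarrow> nat \<Rightarrow> ennreal" where
  "ncorr M X F k \<equiv> \<integral>\<^sup>+x. indicator X x * F (sh k x) \<partial>M"

lemmas lint_cong = Bochner_Integration.integral_cong
  and lint_nonneg = Bochner_Integration.integral_nonneg
  and lint_bound = Bochner_Integration.integrable_bound
  and lint_add = Bochner_Integration.integral_add
  and lint_diff = Bochner_Integration.integral_diff

subsection \<open>Point measures\<close>

lemma dirac_sum_measurable_point:
 "(\<lambda>k. enn2real (t k)) \<in> count_space I \<rightarrow>\<^sub>M restrict_space borel {0::real..}"
 by (auto simp: space_restrict_space)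

lemma sets_dirac_sum [simp]: "sets (dirac_sum t) = sets (restrict_space borel {0..})"
 by (simp add: dirac_sum_def)

text \<open>Indices are counted, not values, so coinciding times keep their multiplicity. An
  infinite time lies below no \<open>of_nat R\<close> and is never counted.\<close>

definition locally_finite_seq :: "(nat \<Rightarrow> ennreal) \<Rightarrow> bool" where
 "locally_finite_seq t \<longleftrightarrow> (\<forall>R::nat. finite {k. 1 \<le> k \<and> t k \<le> of_nat R})"

lemma locally_finite_seqD:
 assumes "locally_finite_seq t"
 shows "finite {k. 1 \<le> k \<and> t k \<le> ennreal R}"
proof (rule finite_subset)
 have "ennreal R \<le> of_nat (nat \<lceil>R\<rceil>)"
  by (metis ennreal_leI ennreal_of_nat_eq_real_of_nat real_nat_ceiling_ge)
 then show "{k. 1 \<le> k \<and> t k \<le> ennreal R} \<subseteq> {k. 1 \<le> k \<and> t k \<le> of_nat (nat \<lceil>R\<rceil>)}"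
  using order_trans by blast
qed (use assms locally_finite_seq_def in auto)

lemma emeasure_dirac_sum:
 assumes "B \<in> sets (restrict_space borel {0..})"
 shows "emeasure (dirac_sum t) B =
  emeasure (count_space {k. 1 \<le> k \<and> t k < \<infinity>}) {k. 1 \<le> k \<and> t k < \<infinity> \<and> enn2real (t k) \<in> B}"
 unfolding dirac_sum_def
 by (subst emeasure_distr[OF dirac_sum_measurable_point assms])
   (auto intro!: arg_cong[where f = "emeasure _"])

text \<open>The mass of a set is a number of indices, and every bounded Borel set lies in some
  [0, R], so finiteness need only be tested on initial intervals.\<close>

lemma dirac_sum_in_bf_iff: "dirac_sum t \<in> bf_counting_measures \<longleftrightarrow> locally_finite_seq t"
proof
 assume bf: "dirac_sum t \<in> bf_counting_measures"
 show "locally_finite_seq t"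
  unfolding locally_finite_seq_def
 proof
  fix R :: nat
  have sets: "{0..real R} \<in> sets (restrict_space borel {0..})"
   by (auto simp: sets_restrict_space intro!: image_eqI[of _ _ "{0..real R}"])
  then obtain k :: nat where "emeasure (dirac_sum t) {0..real R} = of_nat k"
   using bf unfolding bf_counting_measures_def by fastforce
  then have "emeasure (count_space {k. 1 \<le> k \<and> t k < \<infinity>})
    {k. 1 \<le> k \<and> t k < \<infinity> \<and> enn2real (t k) \<in> {0..real R}} \<noteq> \<infinity>"
   by (simp add: emeasure_dirac_sum[OF sets])
  then have "finite {k. 1 \<le> k \<and> t k < \<infinity> \<and> enn2real (t k) \<in> {0..real R}}"
   by (subst (asm) emeasure_count_space) (auto split: if_splits)
  moreover have "{k. 1 \<le> k \<and> t k \<le> of_nat R} \<subseteq> {k. 1 \<le> k \<and> t k < \<infinity> \<and> enn2real (t k) \<in> {0..real R}}"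
    by (auto simp: enn2real_leI ennreal_of_nat_eq_real_of_nat
      intro: le_less_trans[OF _ ennreal_less_top])
  ultimately show "finite {k. 1 \<le> k \<and> t k \<le> of_nat R}"
   by (rule rev_finite_subset)
 qed
next
 assume lf: "locally_finite_seq t"
 have "\<exists>k::nat. emeasure (dirac_sum t) B = of_nat k"
  if B: "B \<in> sets (restrict_space borel {0..})" "bounded B" for B
 proof -
  obtain R where R: "\<And>x. x \<in> B \<Longrightarrow> x \<le> R"
   using B(2) by (meson bounded_imp_bdd_above bdd_above_def)
  have "finite {k. 1 \<le> k \<and> t k < \<infinity> \<and> enn2real (t k) \<in> B}"
  proof (rule finite_subset[OF _ locally_finite_seqD[OF lf, of R]], rule subsetI)
   fix k assume "k \<in> {k. 1 \<le> k \<and> t k < \<infinity> \<and> enn2real (t k) \<in> B}"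
   then show "k \<in> {k. 1 \<le> k \<and> t k \<le> ennreal R}"
    using R[of "enn2real (t k)"] ennreal_leI[of "enn2real (t k)" R] by auto
  qed
  then show ?thesis
   by (subst emeasure_dirac_sum[OF B(1)], subst emeasure_count_space) auto
 qed
 then show "dirac_sum t \<in> bf_counting_measures"
  by (simp add: bf_counting_measures_def)
qed

definition ext_fun :: "(real \<Rightarrow> real) \<Rightarrow> ennreal \<Rightarrow> real" where
 "ext_fun f e = (if e < \<infinity> then f (enn2real e) else 0)"

text \<open>Once all times with index at least \<open>K\<close> lie beyond the support of
  \<open>f\<close>, the range of summation no longer depends on the times. Continuity in
  \<open>t\<close> becomes visible in this form.\<close>

lemma integral_dirac_sum:
 assumes f: "continuous_on {0..} f" "\<And>x. x > R \<Longrightarrow> f x = 0"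
  and K: "\<And>k. K \<le> k \<Longrightarrow> 1 \<le> k \<Longrightarrow> t k > ennreal R"
 shows "(LINT x|(dirac_sum t). f x) = (\<Sum>k\<in>{1..<K}. ext_fun f (t k))"
proof -
 let ?I = "{k. 1 \<le> k \<and> t k < \<infinity>}"
 have fm: "f \<in> borel_measurable (restrict_space borel {0..})"
  by (rule borel_measurable_continuous_on_restrict[OF f(1)])
 have 0: "ext_fun f (t k) = 0" if "K \<le> k" "1 \<le> k" for k
  using K[OF that] f(2)
  by (auto simp: ext_fun_def)
    (metis ennreal_enn2real ennreal_leI infinity_ennreal_def leD leI)
 have sub: "{a \<in> ?I. f (enn2real (t a)) \<noteq> 0} \<subseteq> {1..<K}"
 proof
  fix k assume k: "k \<in> {a \<in> ?I. f (enn2real (t a)) \<noteq> 0}"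
  then have "ext_fun f (t k) \<noteq> 0" by (simp add: ext_fun_def)
  then show "k \<in> {1..<K}" using 0[of k] k by (cases "K \<le> k") auto
 qed
 have "(LINT x|(dirac_sum t). f x) = (\<integral>k. f (enn2real (t k)) \<partial>count_space ?I)"
  unfolding dirac_sum_def by (rule integral_distr[OF dirac_sum_measurable_point fm])
 also have "\<dots> = (\<Sum>k | k \<in> ?I \<and> f (enn2real (t k)) \<noteq> 0. f (enn2real (t k)))"
  by (rule lebesgue_integral_count_space_finite_support) (rule finite_subset[OF sub], simp)
 also have "\<dots> = (\<Sum>k | k \<in> ?I \<and> f (enn2real (t k)) \<noteq> 0. ext_fun f (t k))"
  by (rule sum.cong) (auto simp: ext_fun_def)
 also have "\<dots> = (\<Sum>k\<in>{1..<K}. ext_fun f (t k))"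
  by (rule sum.mono_neutral_left[OF _ sub]) (auto simp: ext_fun_def)
 finally show ?thesis .
qed

text \<open>Support bounded from above makes the extension by 0 at infinity continuous, so that
  finite times may converge to infinite ones.\<close>

lemma ext_fun_continuous:
 assumes f: "continuous_on {0..} f" "\<And>x. x > R \<Longrightarrow> f x = 0"
 shows "continuous_on UNIV (ext_fun f)"
proof -
 \<comment> \<open>A level strictly beyond the support: truncating at \<open>R'\<close> does not
   change the value, and \<open>enn2real\<close> is continuous on the truncated range.\<close>
 define R' where "R' = max R 0 + 1"
 have eq: "ext_fun f = (\<lambda>e. f (enn2real (min e (ennreal R'))))"
 proof
  fix e
  show "ext_fun f e = f (enn2real (min e (ennreal R')))"
  proof (cases "e \<le> ennreal R'")
   case True
   then show ?thesis
    using le_less_trans[OF True ennreal_less_top] by (auto simp: ext_fun_def min_def)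
  next
   case False
   have "e = \<infinity> \<or> enn2real e > R"
   proof (cases e)
    case (real r)
    then have "r > R'" using False ennreal_leI[of r R'] by (auto simp: not_le[symmetric])
    then show ?thesis using real by (simp add: R'_def)
   qed simp
   moreover have "f (enn2real (ennreal R')) = 0"
    by (rule f(2)) (simp add: R'_def del: ennreal_plus)
   ultimately show ?thesis
    using False f(2) by (auto simp: ext_fun_def min_def simp del: enn2real_ennreal)
  qed
 qed
 have "continuous_on UNIV (\<lambda>e. enn2real (min e (ennreal R')))"
  unfolding continuous_on_def
 proof
  fix e :: ennreal
  have "((\<lambda>e. min e (ennreal R')) \<longlongrightarrow> min e (ennreal R')) (at e)"
   by (intro tendsto_min) auto
  moreover have "min e (ennreal R') = ennreal (enn2real (min e (ennreal R')))"
   by (metis ennreal_enn2real ennreal_less_top infinity_ennreal_def min.strict_coboundedI2)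
  ultimately show "((\<lambda>e. enn2real (min e (ennreal R'))) \<longlongrightarrow> enn2real (min e (ennreal R'))) (at e)"
   by (intro tendsto_enn2real) auto
 qed
 then show ?thesis
  unfolding eq by (rule continuous_on_compose2[OF f(1)]) auto
qed

text \<open>Near each point the times exceed any given level from one common index on, so on that
  neighbourhood the integral of a test function is one fixed finite sum of continuous terms.\<close>

lemma continuous_map_dirac_sum:
 fixes t :: "'q::topological_space \<Rightarrow> nat \<Rightarrow> ennreal"
 assumes cont: "\<And>k. continuous_on X (\<lambda>q. t q k)"
  and unif: "\<And>q R. q \<in> X \<Longrightarrow>
   \<exists>K O'. open O' \<and> q \<in> O' \<and> (\<forall>q'\<in>O' \<inter> X. \<forall>k\<ge>K. 1 \<le> k \<longrightarrow> ennreal R < t q' k)"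
 shows "continuous_map (top_of_set X) weak_sharp_topology (\<lambda>q. dirac_sum (t q))"
proof -
 have bf: "dirac_sum (t q) \<in> bf_counting_measures" if q: "q \<in> X" for q
  unfolding dirac_sum_in_bf_iff locally_finite_seq_def
 proof
  fix R :: nat
  obtain K where "\<forall>k\<ge>K. 1 \<le> k \<longrightarrow> ennreal (real R) < t q k"
   using unif[OF q, of "real R"] q by blast
  then have "{k. 1 \<le> k \<and> t q k \<le> of_nat R} \<subseteq> {..<K}"
   by (auto simp: ennreal_of_nat_eq_real_of_nat) (meson not_le)
  then show "finite {k. 1 \<le> k \<and> t q k \<le> of_nat R}"
   using finite_subset by blast
 qed
 have int: "continuous_on X (\<lambda>q. LINT x|(dirac_sum (t q)). f x)"
  if f: "continuous_on {0..} f" "\<forall>x>R. f x = 0" for f :: "real \<Rightarrow> real" and R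
  unfolding continuous_on_def
 proof
  fix q assume q: "q \<in> X"
  obtain K O' where O': "open O'" "q \<in> O'"
    "\<forall>q'\<in>O' \<inter> X. \<forall>k\<ge>K. 1 \<le> k \<longrightarrow> ennreal R < t q' k"
   using unif[OF q, of R] by blast
  have eq: "(LINT x|(dirac_sum (t q')). f x) = (\<Sum>k\<in>{1..<K}. ext_fun f (t q' k))" if "q' \<in> O' \<inter> X" for q'
   by (rule integral_dirac_sum[of _ R]) (use f O'(3) that in auto)
  have "continuous_on X (\<lambda>q. \<Sum>k\<in>{1..<K}. ext_fun f (t q k))"
   by (intro continuous_on_sum continuous_on_compose2[OF ext_fun_continuous[of f R] cont]) (use f in auto)
  then have "((\<lambda>q. \<Sum>k\<in>{1..<K}. ext_fun f (t q k)) \<longlongrightarrow> (\<Sum>k\<in>{1..<K}. ext_fun f (t q k))) (at q within X)"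
   using q by (simp add: continuous_on_def)
  moreover have "\<forall>\<^sub>F q' in at q within X. q' \<in> O' \<inter> X"
   using O'(1,2) by (auto simp: eventually_at_topological)
  then have "\<forall>\<^sub>F q' in at q within X. (LINT x|(dirac_sum (t q')). f x) = (\<Sum>k\<in>{1..<K}. ext_fun f (t q' k))"
   by (rule eventually_mono) (rule eq)
  ultimately show "((\<lambda>q. LINT x|(dirac_sum (t q)). f x) \<longlongrightarrow> (LINT x|(dirac_sum (t q)). f x)) (at q within X)"
   unfolding eq[OF IntI[OF O'(2) q]] by (simp only: tendsto_cong)
 qed
 have op: "openin (top_of_set X) ((\<lambda>q. dirac_sum (t q)) -` {\<xi> \<in> bf_counting_measures. (LINT x|\<xi>. f x) \<in> U} \<inter> X)"
  if "continuous_on {0..} f" "\<forall>x>R. f x = 0" "open U" for f :: "real \<Rightarrow> real" and R U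
 proof -
  have "(\<lambda>q. dirac_sum (t q)) -` {\<xi> \<in> bf_counting_measures. (LINT x|\<xi>. f x) \<in> U} \<inter> X =
    X \<inter> (\<lambda>q. LINT x|(dirac_sum (t q)). f x) -` U"
   using bf by auto
  then show ?thesis
   using continuous_openin_preimage_gen[OF int[OF that(1,2)] that(3)] by simp
 qed
 show ?thesis
  unfolding weak_sharp_topology_def
 proof (rule continuous_on_generated_topo)
  fix S assume "S \<in> {{\<xi> \<in> bf_counting_measures. (LINT x|\<xi>. f x) \<in> U} | (f :: real \<Rightarrow> real) U.
    continuous_on {0..} f \<and> (\<exists>R. \<forall>x>R. f x = 0) \<and> open U}"
  then show "openin (top_of_set X) ((\<lambda>q. dirac_sum (t q)) -` S \<inter> topspace (top_of_set X))"
   unfolding topspace_euclidean_subtopology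
   by (elim CollectE exE conjE, hypsubst) (rule op)
 next
  have "bf_counting_measures \<in> {{\<xi> \<in> bf_counting_measures. (LINT x|\<xi>. f x) \<in> U} | (f :: real \<Rightarrow> real) U.
    continuous_on {0..} f \<and> (\<exists>R. \<forall>x>R. f x = 0) \<and> open U}"
   by (intro CollectI exI[of _ "\<lambda>_. 0"] exI[of _ UNIV]) auto
  then show "(\<lambda>q. dirac_sum (t q)) ` topspace (top_of_set X) \<subseteq>
   \<Union> {{\<xi> \<in> bf_counting_measures. (LINT x|\<xi>. f x) \<in> U} | (f :: real \<Rightarrow> real) U.
    continuous_on {0..} f \<and> (\<exists>R. \<forall>x>R. f x = 0) \<and> open U}"
   using bf by auto
 qed
qed

lemma measurable_borel_of:
 assumes "\<And>x. x \<in> space M \<Longrightarrow> f x \<in> topspace X"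
  and "\<And>U. openin X U \<Longrightarrow> f -` U \<inter> space M \<in> sets M"
 shows "f \<in> M \<rightarrow>\<^sub>M borel_of X"
 unfolding borel_of_def
 using openin_subset by (intro measurable_measure_of) (auto intro: assms)

text \<open>Adding the times after which the sequence stays above each level makes the passage to the
 point measure continuous, so that measurability needs no countable base of the target.\<close>

lemma measurable_dirac_sum:
 fixes t :: "'w \<Rightarrow> nat \<Rightarrow> ennreal"
 assumes meas [measurable]: "\<And>k. (\<lambda>\<omega>. t \<omega> k) \<in> borel_measurable M"
  and lf: "\<And>\<omega>. \<omega> \<in> space M \<Longrightarrow> locally_finite_seq (t \<omega>)"
 shows "(\<lambda>\<omega>. dirac_sum (t \<omega>)) \<in> M \<rightarrow>\<^sub>M borel_of weak_sharp_topology"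
proof -
 define P where "P \<omega> j L \<longleftrightarrow> (\<forall>k\<in>{L..}. 1 \<le> k \<longrightarrow> of_nat j < t \<omega> k)" for \<omega> and j L :: nat
 define l where "l \<omega> j = (LEAST L. P \<omega> j L)" for \<omega> and j :: nat
 define Q where "Q = {(s :: nat \<Rightarrow> ennreal, l :: nat \<Rightarrow> nat). \<forall>j k. l j \<le> k \<longrightarrow> 1 \<le> k \<longrightarrow> of_nat j < s k}"
 have [measurable]: "Measurable.pred M (\<lambda>\<omega>. P \<omega> j L)" for j L
  unfolding P_def by measurable
 have lm [measurable]: "(\<lambda>\<omega>. l \<omega> j) \<in> M \<rightarrow>\<^sub>M count_space UNIV" for j
  unfolding l_def by measurable
 have Pl: "P \<omega> j (l \<omega> j)" if "\<omega> \<in> space M" for \<omega> j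
 proof -
  have "finite {k. 1 \<le> k \<and> t \<omega> k \<le> of_nat j}"
   using lf[OF that] by (simp add: locally_finite_seq_def)
  then obtain L where "{k. 1 \<le> k \<and> t \<omega> k \<le> of_nat j} \<subseteq> {..<L}"
   by (meson finite_nat_iff_bounded)
  then have "P \<omega> j L"
   unfolding P_def by (force simp: not_le[symmetric])
  then show ?thesis unfolding l_def by (rule LeastI)
 qed
 have inQ: "(t \<omega>, l \<omega>) \<in> Q" if "\<omega> \<in> space M" for \<omega>
  using Pl[OF that] by (auto simp: Q_def P_def)
 have meas2: "(\<lambda>\<omega>. (t \<omega>, l \<omega>)) \<in> borel_measurable M"
 proof (rule borel_measurable_Pair)
  show "t \<in> borel_measurable M"
   by (rule measurable_coordinatewise_then_product) (rule meas)
  show "l \<in> borel_measurable M"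
   by (rule measurable_coordinatewise_then_product, rule measurable_compose[OF lm]) simp
 qed
 have cont: "continuous_map (top_of_set Q) weak_sharp_topology (\<lambda>q. dirac_sum (fst q))"
 proof (rule continuous_map_dirac_sum)
  fix k show "continuous_on Q (\<lambda>q. fst q k)"
   by (rule continuous_on_product_then_coordinatewise[OF continuous_on_fst[OF continuous_on_id]])
 next
  fix q :: "(nat \<Rightarrow> ennreal) \<times> (nat \<Rightarrow> nat)" and R :: real
  assume q: "q \<in> Q"
  define j where "j = nat \<lceil>R\<rceil>"
  have Rj: "ennreal R \<le> of_nat j"
   by (metis ennreal_leI ennreal_of_nat_eq_real_of_nat real_nat_ceiling_ge j_def)
  have "continuous_on UNIV (\<lambda>q :: (nat \<Rightarrow> ennreal) \<times> (nat \<Rightarrow> nat). snd q j)"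
   by (rule continuous_on_product_then_coordinatewise[OF continuous_on_snd[OF continuous_on_id]])
  \<comment> \<open>The natural numbers are discrete, so the tail index \<open>snd q j\<close> is
    constant on a neighbourhood and serves there as the common \<open>K\<close>.\<close>
  then have "open ((\<lambda>q :: (nat \<Rightarrow> ennreal) \<times> (nat \<Rightarrow> nat). snd q j) -` {snd q j})"
   by (rule open_vimage[rotated]) (rule discrete_topology_class.open_discrete)
  then show "\<exists>K O'. open O' \<and> q \<in> O' \<and> (\<forall>q'\<in>O' \<inter> Q. \<forall>k\<ge>K. 1 \<le> k \<longrightarrow> ennreal R < fst q' k)"
   using le_less_trans[OF Rj] by (intro exI[of _ "snd q j"] exI conjI) (auto simp: Q_def)
 qed
 show ?thesis
 proof (rule measurable_borel_of)
  show "dirac_sum (t \<omega>) \<in> topspace weak_sharp_topology" if "\<omega> \<in> space M" for \<omega>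
   using lf[OF that] by (simp add: topspace_weak_sharp dirac_sum_in_bf_iff)
 next
  fix U assume "openin weak_sharp_topology U"
  then have "openin (top_of_set Q) {q \<in> Q. dirac_sum (fst q) \<in> U}"
   using openin_continuous_map_preimage[OF cont] by simp
  then obtain O' where O': "open O'" "{q \<in> Q. dirac_sum (fst q) \<in> U} = Q \<inter> O'"
   by (auto simp: openin_open)
  have "dirac_sum (t \<omega>) \<in> U \<longleftrightarrow> (t \<omega>, l \<omega>) \<in> O'" if "\<omega> \<in> space M" for \<omega>
   using O'(2)[unfolded set_eq_iff, THEN spec, of "(t \<omega>, l \<omega>)"] inQ[OF that] by simp
  then have "(\<lambda>\<omega>. dirac_sum (t \<omega>)) -` U \<inter> space M = (\<lambda>\<omega>. (t \<omega>, l \<omega>)) -` O' \<inter> space M"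
   by auto
  then show "(\<lambda>\<omega>. dirac_sum (t \<omega>)) -` U \<inter> space M \<in> sets M"
   using measurable_sets[OF meas2] O'(1) by auto
 qed
qed

subsection \<open>Convergence of moments on the cube\<close>

definition unit_cube :: "(nat \<Rightarrow> real) set" where
 "unit_cube = {v. \<forall>i. v i \<in> {0..1}}"

lemma compact_unit_cube: "compact unit_cube"
proof -
 have "compactin (product_topology (\<lambda>i. euclidean) UNIV) (PiE UNIV (\<lambda>i::nat. {0..1::real}))"
  by (subst compactin_PiE) auto
 moreover have "PiE UNIV (\<lambda>i::nat. {0..1::real}) = unit_cube"
  by (auto simp: unit_cube_def)
 ultimately show ?thesis
  by (simp add: euclidean_product_topology)
qed

text \<open>Convergence of moments passes to sums by linearity, which dictates the two rules.
  Closure under products, required by Stone-Weierstrass, is derived afterwards.\<close>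

inductive_set cube_polys :: "((nat \<Rightarrow> real) \<Rightarrow> real) set" where
 monom: "(\<lambda>v. c * (\<Prod>i<k. v i ^ m i)) \<in> cube_polys"
| add: "f \<in> cube_polys \<Longrightarrow> g \<in> cube_polys \<Longrightarrow> (\<lambda>v. f v + g v) \<in> cube_polys"

lemma cube_polys_monom_mult:
 assumes "g \<in> cube_polys"
 shows "(\<lambda>v. (c * (\<Prod>i<k. v i ^ m i)) * g v) \<in> cube_polys"
 using assms
proof induction
 case (monom d n l)
 \<comment> \<open>Missing coordinates get exponent 0, so that both monomials range over the same
   coordinates and multiply by adding exponents.\<close>
 have ext: "(\<Prod>i<k. v i ^ m i) = (\<Prod>i<max k l. v i ^ (if i < k then m i else 0))"
  for v :: "nat \<Rightarrow> real" and k l :: nat and m :: "nat \<Rightarrow> nat"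
  by (rule prod.mono_neutral_cong_left) auto
 have "(c * (\<Prod>i<k. v i ^ m i)) * (d * (\<Prod>i<l. v i ^ n i)) =
   (c * d) * (\<Prod>i<max k l. v i ^ ((if i < k then m i else 0) + (if i < l then n i else 0)))" for v
  by (subst ext[of v m k l], subst ext[of v n l k], subst max.commute[of l k])
    (simp add: power_add prod.distrib)
 then show ?case by (simp only: cube_polys.monom)
next
 case (add f g)
 then show ?case
  using cube_polys.add by (simp add: distrib_left)
qed

lemma cube_polys_mult: "f \<in> cube_polys \<Longrightarrow> g \<in> cube_polys \<Longrightarrow> (\<lambda>v. f v * g v) \<in> cube_polys"
proof (induction rule: cube_polys.induct)
 case (monom c m k)
 then show ?case by (rule cube_polys_monom_mult)
next
 case (add f1 f2)
 then show ?case using cube_polys.add by (simp add: distrib_right)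
qed

lemma cube_polys_continuous:
 fixes S :: "(nat \<Rightarrow> real) set"
 shows "f \<in> cube_polys \<Longrightarrow> continuous_on S f"
 by (induction rule: cube_polys.induct)
   (auto intro!: continuous_intros continuous_on_subset[OF continuous_on_product_coordinates])

lemma cube_polys_dense:
 assumes "continuous_on unit_cube f" "0 < e"
 shows "\<exists>g\<in>cube_polys. \<forall>v\<in>unit_cube. \<bar>f v - g v\<bar> < e"
proof -
 interpret function_ring_on cube_polys unit_cube
 proof
  show "(\<lambda>_. c) \<in> cube_polys" for c
   using cube_polys.monom[where c = c and k = 0] by simp
  show "\<exists>f\<in>cube_polys. f x \<noteq> f y" if xy: "x \<noteq> y" for x y :: "nat \<Rightarrow> real"
  proof -
   obtain j where j: "x j \<noteq> y j" using xy by blast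
   \<comment> \<open>The coordinate that separates the two points is itself a monomial, with
     exponent 1 at \<open>j\<close> and 0 before it.\<close>
   have "(\<Prod>i<Suc j. v i ^ (if i = j then 1 else 0)) = v j" for v :: "nat \<Rightarrow> real"
    by (simp add: prod.lessThan_Suc)
   then show ?thesis
    using cube_polys.monom[where c = 1 and k = "Suc j" and m = "\<lambda>i. if i = j then 1 else 0"] j
    by (intro bexI[of _ "\<lambda>v. 1 * (\<Prod>i<Suc j. v i ^ (if i = j then 1 else 0))"]) auto
  qed
 qed (auto simp: compact_unit_cube cube_polys_mult cube_polys.add cube_polys_continuous)
 show ?thesis by (rule Stone_Weierstrass_basic[OF assms])
qed

text \<open>The set \<open>S\<close> carries all sequences involved but need not be closed in the
  cube. The test functions of interest are continuous on \<open>S\<close> only, hence uniform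
  approximation by polynomials alone does not suffice.\<close>

locale moment_convergence =
 fixes P :: "nat \<Rightarrow> 'w measure" and V :: "nat \<Rightarrow> 'w \<Rightarrow> nat \<Rightarrow> real"
  and M :: "'z measure" and U :: "'z \<Rightarrow> nat \<Rightarrow> real" and S :: "(nat \<Rightarrow> real) set"
 assumes prob_P: "\<And>n. prob_space (P n)" and prob_M: "prob_space M"
  and meas_V: "\<And>n i. (\<lambda>\<omega>. V n \<omega> i) \<in> borel_measurable (P n)"
  and meas_U: "\<And>i. (\<lambda>\<omega>. U \<omega> i) \<in> borel_measurable M"
  and V_S: "\<And>n \<omega>. \<omega> \<in> space (P n) \<Longrightarrow> V n \<omega> \<in> S"
  and U_S: "\<And>\<omega>. \<omega> \<in> space M \<Longrightarrow> U \<omega> \<in> S"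
  and S_cube: "S \<subseteq> unit_cube"
  and moments: "\<And>k m. (\<lambda>n. LINT \<omega>|(P n). (\<Prod>i<k. V n \<omega> i ^ m i)) \<longlonglongrightarrow> (LINT \<omega>|M. (\<Prod>i<k. U \<omega> i ^ m i))"
begin

lemma meas_comp_V:
 assumes "continuous_on S f"
 shows "(\<lambda>\<omega>. f (V n \<omega>)) \<in> borel_measurable (P n)"
proof (rule measurable_compose[of _ _ "restrict_space borel S"])
 show "V n \<in> P n \<rightarrow>\<^sub>M restrict_space borel S"
  by (intro measurable_restrict_space2 measurable_coordinatewise_then_product meas_V)
    (use V_S in auto)
qed (rule borel_measurable_continuous_on_restrict[OF assms])

lemma meas_comp_U:
 assumes "continuous_on S f"
 shows "(\<lambda>\<omega>. f (U \<omega>)) \<in> borel_measurable M"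
proof (rule measurable_compose[of _ _ "restrict_space borel S"])
 show "U \<in> M \<rightarrow>\<^sub>M restrict_space borel S"
  by (intro measurable_restrict_space2 measurable_coordinatewise_then_product meas_U)
    (use U_S in auto)
qed (rule borel_measurable_continuous_on_restrict[OF assms])

lemma integrable_V:
 fixes f :: "(nat \<Rightarrow> real) \<Rightarrow> real"
 assumes "continuous_on S f" "\<And>v. v \<in> S \<Longrightarrow> \<bar>f v\<bar> \<le> C"
 shows "integrable (P n) (\<lambda>\<omega>. f (V n \<omega>))"
proof -
 interpret prob_space "P n" by (rule prob_P)
 show ?thesis
  by (rule integrable_const_bound[of _ C]) (use assms(2) V_S in "auto intro!: AE_I2 meas_comp_V assms(1)")
qed

lemma integrable_U:
 fixes f :: "(nat \<Rightarrow> real) \<Rightarrow> real"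
 assumes "continuous_on S f" "\<And>v. v \<in> S \<Longrightarrow> \<bar>f v\<bar> \<le> C"
 shows "integrable M (\<lambda>\<omega>. f (U \<omega>))"
proof -
 interpret prob_space M by (rule prob_M)
 show ?thesis
  by (rule integrable_const_bound[of _ C]) (use assms(2) U_S in "auto intro!: AE_I2 meas_comp_U assms(1)")
qed

lemma cube_bounded:
 fixes f :: "(nat \<Rightarrow> real) \<Rightarrow> real"
 assumes "continuous_on unit_cube f"
 obtains C where "\<And>v. v \<in> S \<Longrightarrow> \<bar>f v\<bar> \<le> C"
proof -
 have "bounded (f ` unit_cube)"
  using compact_continuous_image[OF assms compact_unit_cube] by (rule compact_imp_bounded)
 then obtain C where "\<forall>y\<in>f ` unit_cube. \<bar>y\<bar> \<le> C" by (auto simp: bounded_iff)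
 then show thesis using S_cube by (intro that[of C]) blast
qed

lemma conv_cube_polys:
 assumes "g \<in> cube_polys"
 shows "(\<lambda>n. LINT \<omega>|(P n). g (V n \<omega>)) \<longlonglongrightarrow> (LINT \<omega>|M. g (U \<omega>))"
 using assms
proof induction
 case (monom c k m)
 then show ?case using tendsto_mult_left[OF moments] by simp
next
 case (add f g)
 have int: "integrable (P n) (\<lambda>\<omega>. f (V n \<omega>))" "integrable M (\<lambda>\<omega>. f (U \<omega>))"
  if f: "f \<in> cube_polys" for f n
 proof -
  obtain C where C: "\<And>v. v \<in> S \<Longrightarrow> \<bar>f v\<bar> \<le> C"
   by (rule cube_bounded[OF cube_polys_continuous[OF f]]) blast
  show "integrable (P n) (\<lambda>\<omega>. f (V n \<omega>))"
   by (rule integrable_V[OF cube_polys_continuous[OF f] C])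
  show "integrable M (\<lambda>\<omega>. f (U \<omega>))"
   by (rule integrable_U[OF cube_polys_continuous[OF f] C])
 qed
 show ?case
  using tendsto_add[OF add.IH] by (simp add: int add.hyps)
qed

lemma conv_cube:
 fixes f :: "(nat \<Rightarrow> real) \<Rightarrow> real"
 assumes f: "continuous_on unit_cube f"
 shows "(\<lambda>n. LINT \<omega>|(P n). f (V n \<omega>)) \<longlonglongrightarrow> (LINT \<omega>|M. f (U \<omega>))"
proof (rule LIMSEQ_I)
 fix e :: real assume "0 < e"
 then obtain g where g: "g \<in> cube_polys" "\<And>v. v \<in> unit_cube \<Longrightarrow> \<bar>f v - g v\<bar> < e / 3"
  using cube_polys_dense[OF f, of "e/3"] by auto
 have gc: "continuous_on unit_cube g" by (rule cube_polys_continuous[OF g(1)])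
 have fS: "continuous_on S f" and gS: "continuous_on S g"
  using f gc S_cube by (auto intro: continuous_on_subset)
 obtain C where C: "\<And>v. v \<in> S \<Longrightarrow> \<bar>f v\<bar> \<le> C" by (rule cube_bounded[OF f]) blast
 obtain D where D: "\<And>v. v \<in> S \<Longrightarrow> \<bar>g v\<bar> \<le> D" by (rule cube_bounded[OF gc]) blast
 have 1: "\<bar>(LINT \<omega>|(P n). f (V n \<omega>)) - (LINT \<omega>|(P n). g (V n \<omega>))\<bar> \<le> e / 3" for n
 proof -
  interpret prob_space "P n" by (rule prob_P)
  note i = integrable_V[OF fS C, of n] integrable_V[OF gS D, of n]
  have "\<bar>\<integral>\<omega>. f (V n \<omega>) - g (V n \<omega>) \<partial>P n\<bar> \<le> (LINT \<omega>|(P n). \<bar>f (V n \<omega>) - g (V n \<omega>)\<bar>)"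
   by (rule integral_abs_bound)
  also have "\<dots> \<le> (LINT \<omega>|(P n). e / 3)"
   using V_S S_cube g(2) by (intro integral_mono) (auto intro!: i less_imp_le)
  finally show ?thesis using i by (simp add: prob_space)
 qed
 have 2: "\<bar>(LINT \<omega>|M. f (U \<omega>)) - (LINT \<omega>|M. g (U \<omega>))\<bar> \<le> e / 3"
 proof -
  interpret prob_space M by (rule prob_M)
  note i = integrable_U[OF fS C] integrable_U[OF gS D]
  have "\<bar>\<integral>\<omega>. f (U \<omega>) - g (U \<omega>) \<partial>M\<bar> \<le> (LINT \<omega>|M. \<bar>f (U \<omega>) - g (U \<omega>)\<bar>)"
   by (rule integral_abs_bound)
  also have "\<dots> \<le> (LINT \<omega>|M. e / 3)"
   using U_S S_cube g(2) by (intro integral_mono) (auto intro!: i less_imp_le)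
  finally show ?thesis using i by (simp add: prob_space)
 qed
 obtain N where N: "\<And>n. n \<ge> N \<Longrightarrow> \<bar>(LINT \<omega>|(P n). g (V n \<omega>)) - (LINT \<omega>|M. g (U \<omega>))\<bar> < e / 3"
  using LIMSEQ_D[OF conv_cube_polys[OF g(1)], of "e/3"] \<open>0 < e\<close> by auto
 have "norm ((LINT \<omega>|(P n). f (V n \<omega>)) - (LINT \<omega>|M. f (U \<omega>))) < e" if "n \<ge> N" for n
  using 1[of n] 2 N[OF that] by (simp only: real_norm_def abs_le_iff abs_less_iff) linarith
 then show "\<exists>no. \<forall>n\<ge>no. norm ((LINT \<omega>|(P n). f (V n \<omega>)) - (LINT \<omega>|M. f (U \<omega>))) < e" by blast
qed

text \<open>A continuous function on the noncompact set \<open>S\<close> is the increasing limit of its Lipschitz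
 inf-convolutions, which are continuous on the whole cube.\<close>

lemma liminf_bound:
 fixes G :: "(nat \<Rightarrow> real) \<Rightarrow> real"
 assumes G: "continuous_on S G" "\<And>v. v \<in> S \<Longrightarrow> 0 \<le> G v" "\<And>v. v \<in> S \<Longrightarrow> G v \<le> 1" and "0 < e"
 shows "\<forall>\<^sub>F n in sequentially. (LINT \<omega>|M. G (U \<omega>)) - e < (LINT \<omega>|(P n). G (V n \<omega>))"
proof -
 interpret M: prob_space M by (rule prob_M)
 have S_ne: "S \<noteq> {}" using U_S M.not_empty by auto
 define H where "H k v = (INF y\<in>S. G y + real k * dist v y)" for k :: nat and v
 have bdd: "bdd_below ((\<lambda>y. G y + real k * dist v y) ` S)" for k v
  by (intro bdd_belowI[of _ 0]) (auto intro!: add_nonneg_nonneg G(2))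
 have H_le: "H k v \<le> G y + real k * dist v y" if "y \<in> S" for k v y
  unfolding H_def by (rule cINF_lower[OF bdd that])
 have H_le_G: "H k v \<le> G v" if "v \<in> S" for k v
  using H_le[OF that, of k v] by simp
 have H_nonneg: "0 \<le> H k v" for k v
  unfolding H_def using S_ne by (intro cINF_greatest) (auto intro!: add_nonneg_nonneg G(2))
 have H_lip: "H k v \<le> H k w + real k * dist v w" for k and v w :: "nat \<Rightarrow> real"
 proof -
  have "H k v - real k * dist v w \<le> H k w"
   unfolding H_def[of k w]
  proof (rule cINF_greatest[OF S_ne])
   fix y assume "y \<in> S"
   then have "H k v \<le> G y + real k * dist v y" by (rule H_le)
   also have "real k * dist v y \<le> real k * (dist v w + dist w y)"
    by (intro mult_left_mono dist_triangle) auto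
   finally show "H k v - real k * dist v w \<le> G y + real k * dist w y"
    by (simp add: algebra_simps)
  qed
  then show ?thesis by simp
 qed
 have H_cont: "continuous_on X (H k)" for k X
 proof (rule continuous_on_subset[OF uniformly_continuous_imp_continuous subset_UNIV])
  show "uniformly_continuous_on UNIV (H k)"
   unfolding uniformly_continuous_on_def
  proof (intro allI impI)
   fix e :: real assume "0 < e"
   have "dist (H k w) (H k v) < e" if "dist w v < e / (real k + 1)" for v w
   proof -
    have "real k * dist w v \<le> (real k + 1) * dist w v" by (simp add: mult_right_mono)
    also have "\<dots> < e" using that by (simp add: field_simps)
    finally show ?thesis
     using H_lip[of k v w] H_lip[of k w v] by (auto simp: dist_real_def dist_commute abs_less_iff)
   qed
   then show "\<exists>d>0. \<forall>x\<in>UNIV. \<forall>x'\<in>UNIV. dist x' x < d \<longrightarrow> dist (H k x') (H k x) < e"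
    using \<open>0 < e\<close> by (intro exI[of _ "e / (real k + 1)"]) auto
  qed
 qed
 have H_lim: "(\<lambda>k. H k v) \<longlonglongrightarrow> G v" if v: "v \<in> S" for v
 proof (rule LIMSEQ_I)
  fix r :: real assume "0 < r"
  then obtain d where d: "0 < d" "\<And>y. y \<in> S \<Longrightarrow> dist y v < d \<Longrightarrow> \<bar>G y - G v\<bar> < r / 2"
   using G(1)[unfolded continuous_on_iff, rule_format, OF v, of "r/2"]
   by (auto simp: dist_real_def)
  have "norm (H k v - G v) < r" if k: "k \<ge> nat \<lceil>1 / d\<rceil>" for k
  proof -
   \<comment> \<open>Outside the ball of radius d the penalty alone is at least 1, hence at least
     \<open>G v\<close>; only points close to v compete for the infimum. This uses the bound 1 on
     \<open>G\<close>.\<close>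
   have kd: "1 \<le> real k * d"
    using k d(1) by (simp add: nat_le_iff ceiling_le_iff field_simps)
   have "G v - r / 2 \<le> H k v"
    unfolding H_def
   proof (rule cINF_greatest[OF S_ne])
    fix y assume y: "y \<in> S"
    show "G v - r / 2 \<le> G y + real k * dist v y"
    proof (cases "dist y v < d")
     case True
     then show ?thesis
      using d(2)[OF y True] mult_nonneg_nonneg[OF of_nat_0_le_iff zero_le_dist[of v y], of k]
      by linarith
    next
     case False
     then have "real k * d \<le> real k * dist v y"
      by (intro mult_left_mono) (auto simp: dist_commute)
     then show ?thesis using kd G(3)[OF \<open>v \<in> S\<close>] G(2)[OF y] \<open>0 < r\<close> by linarith
    qed
   qed
   then show ?thesis using H_le_G[OF \<open>v \<in> S\<close>, of k] \<open>0 < r\<close> by auto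
  qed
  then show "\<exists>no. \<forall>k\<ge>no. norm (H k v - G v) < r" by blast
 qed
 have H1: "\<bar>H k v\<bar> \<le> 1" if "v \<in> S" for k v
  using H_nonneg[of k v] H_le_G[OF that, of k] G(3)[OF that] by simp
 have "(\<lambda>k. LINT \<omega>|M. H k (U \<omega>)) \<longlonglongrightarrow> (LINT \<omega>|M. G (U \<omega>))"
  by (rule integral_dominated_convergence[where w = "\<lambda>_. 1"])
    (use U_S H1 in "auto intro!: meas_comp_U H_cont G(1) AE_I2 H_lim")
 then obtain k where k: "\<bar>(LINT \<omega>|M. H k (U \<omega>)) - (LINT \<omega>|M. G (U \<omega>))\<bar> < e / 2"
  using LIMSEQ_D[of _ _ "e/2"] \<open>0 < e\<close> by fastforce
 have "\<forall>\<^sub>F n in sequentially. \<bar>(LINT \<omega>|(P n). H k (V n \<omega>)) - (LINT \<omega>|M. H k (U \<omega>))\<bar> < e / 2"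
  using tendstoD[OF conv_cube[OF H_cont], of "e/2" k] \<open>0 < e\<close> by (simp add: dist_real_def)
 then show ?thesis
 proof eventually_elim
  case (elim n)
  have "(LINT \<omega>|(P n). H k (V n \<omega>)) \<le> (LINT \<omega>|(P n). G (V n \<omega>))"
   by (intro integral_mono integrable_V[of _ 1]) (use V_S H1 G in "auto intro!: H_cont H_le_G")
  then show ?case using elim k by (simp only: abs_less_iff) linarith
 qed
qed

text \<open>The lower bound is applied to \<open>G\<close> and to its negative, each moved into
  [0, 1] by an affine map; together they give both halves of the limit.\<close>

lemma conv_bounded_continuous:
 fixes G :: "(nat \<Rightarrow> real) \<Rightarrow> real"
 assumes G: "continuous_on S G" "\<And>v. v \<in> S \<Longrightarrow> \<bar>G v\<bar> \<le> C"
 shows "(\<lambda>n. LINT \<omega>|(P n). G (V n \<omega>)) \<longlonglongrightarrow> (LINT \<omega>|M. G (U \<omega>))"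
proof -
 interpret M: prob_space M by (rule prob_M)
 define D where "D = \<bar>C\<bar> + 1"
 have D: "0 < D" "\<And>v. v \<in> S \<Longrightarrow> \<bar>G v\<bar> \<le> D"
  using G(2) by (auto simp: D_def) (smt (verit))
 define F where "F c v = (c * G v / D + 1) / 2" for c :: real and v
 have F_cont: "continuous_on S (F c)" for c
  unfolding F_def using D(1) by (intro continuous_intros G(1)) auto
 have F01: "0 \<le> F c v" "F c v \<le> 1" if "v \<in> S" "\<bar>c\<bar> = 1" for c v
 proof -
  have 1: "\<bar>c * G v / D\<bar> \<le> 1" using D(2)[OF that(1)] D(1) that(2) by (simp add: abs_mult)
  have "0 \<le> (y + 1) / 2 \<and> (y + 1) / 2 \<le> 1" if "\<bar>y\<bar> \<le> 1" for y :: real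
   using that by auto
  from this[OF 1] show "0 \<le> F c v" "F c v \<le> 1" unfolding F_def by auto
 qed
 have int: "(LINT \<omega>|(P n). F c (V n \<omega>)) = (c * (LINT \<omega>|(P n). G (V n \<omega>)) / D + 1) / 2"
  "(LINT \<omega>|M. F c (U \<omega>)) = (c * (LINT \<omega>|M. G (U \<omega>)) / D + 1) / 2" for c n
 proof -
  interpret prob_space "P n" by (rule prob_P)
  show "(LINT \<omega>|(P n). F c (V n \<omega>)) = (c * (LINT \<omega>|(P n). G (V n \<omega>)) / D + 1) / 2"
   unfolding F_def using integrable_V[OF G, of n] by (simp add: prob_space)
  show "(LINT \<omega>|M. F c (U \<omega>)) = (c * (LINT \<omega>|M. G (U \<omega>)) / D + 1) / 2"
   unfolding F_def using integrable_U[OF G] by (simp add: M.prob_space)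
 qed
 show ?thesis
 proof (rule tendstoI)
  fix e :: real assume "0 < e"
  then have e': "0 < e / (2 * D)" using D(1) by simp
  have ev: "\<forall>\<^sub>F n in sequentially. (LINT \<omega>|M. F c (U \<omega>)) - e / (2 * D) < (LINT \<omega>|(P n). F c (V n \<omega>))"
   if "\<bar>c\<bar> = 1" for c
   by (rule liminf_bound[OF F_cont F01 e']) (use that in auto)
  have "\<forall>\<^sub>F n in sequentially. (LINT \<omega>|M. G (U \<omega>)) - e < (LINT \<omega>|(P n). G (V n \<omega>)) \<and>
    (LINT \<omega>|(P n). G (V n \<omega>)) < (LINT \<omega>|M. G (U \<omega>)) + e"
   using ev[of 1, simplified] ev[of "-1", simplified]
  proof eventually_elim
   case (elim n)
   have "p - e < q" if "(p / D + 1) / 2 - e / (2 * D) < (q / D + 1) / 2" for p q :: real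
   proof -
    have "(p / D + 1) / 2 - e / (2 * D) - (q / D + 1) / 2 = (p - e - q) / (2 * D)"
     using D(1) by (simp add: diff_divide_distrib add_divide_distrib)
    then have "(p - e - q) / (2 * D) < 0" using that by linarith
    then show ?thesis using D(1) by (simp add: divide_less_0_iff)
   qed
   from this[OF elim(1)[unfolded int]] this[OF elim(2)[unfolded int]] show ?case by simp
  qed
  then show "\<forall>\<^sub>F n in sequentially. dist (LINT \<omega>|(P n). G (V n \<omega>)) (LINT \<omega>|M. G (U \<omega>)) < e"
   by eventually_elim (auto simp: dist_real_def abs_less_iff)
 qed
qed

end

section \<open>Coding waiting times by numbers in [0, 1]\<close>

definition neg_log :: "real \<Rightarrow> ennreal" where
 "neg_log u = (if u \<le> 0 then \<infinity> else ennreal (- ln u))"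

text \<open>Products tending to 0 mean that the partial sums of the waiting times diverge, so the
  points do not accumulate. The set is not closed in the cube: the constants 1 - 1/n belong to it,
  their limit 1 does not.\<close>

definition exp_seqs :: "(nat \<Rightarrow> real) set" where
 "exp_seqs = {v \<in> unit_cube. (\<lambda>k. \<Prod>i<k. v i) \<longlonglongrightarrow> 0}"

text \<open>The point measure whose waiting times are \<open>- ln (v i)\<close>; the value \<open>v i = 0\<close> encodes an
 infinite waiting time.\<close>

definition renewal_of :: "(nat \<Rightarrow> real) \<Rightarrow> real measure" where
 "renewal_of v = dirac_sum (\<lambda>k. neg_log (\<Prod>i<k. v i))"

lemma neg_log_gt_iff:
 assumes "u \<le> 1" "0 \<le> r"
 shows "ennreal r < neg_log u \<longleftrightarrow> u < exp (- r)"
proof (cases "u \<le> 0")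
 case True
 then show ?thesis by (auto simp: neg_log_def intro: le_less_trans[OF _ exp_gt_zero])
next
 case False
 then have "exp (ln u) < exp (- r) \<longleftrightarrow> u < exp (- r)" by simp
 then have "r < - ln u \<longleftrightarrow> u < exp (- r)" unfolding exp_less_cancel_iff by linarith
 then show ?thesis using False assms by (simp add: neg_log_def ennreal_less_iff)
qed

lemma continuous_on_neg_log: "continuous_on {0..1} neg_log"
 unfolding continuous_on_def
proof
 fix u :: real assume u: "u \<in> {0..1}"
 show "(neg_log \<longlongrightarrow> neg_log u) (at u within {0..1})"
 proof (cases "u = 0")
  case True
  have "\<forall>\<^sub>F w in at u within {0..1}. ennreal r < neg_log w" for r
  proof -
   have "\<forall>\<^sub>F w in at u within {0..1}. w < exp (- max r 0)"
    by (rule order_tendstoD[OF tendsto_ident_at]) (simp add: True)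
   moreover have "\<forall>\<^sub>F w in at u within {0..1}. w \<in> {0..1}"
    by (simp add: eventually_at_filter)
   ultimately show ?thesis
   proof eventually_elim
    case (elim w)
    then have "ennreal (max r 0) < neg_log w" by (subst neg_log_gt_iff) auto
    then show ?case by (rule le_less_trans[rotated]) (simp add: ennreal_leI)
   qed
  qed
  then show ?thesis
   unfolding True neg_log_def[of 0] by (simp add: tendsto_top_iff_ennreal)
 next
  case False
  then have "0 < u" using u by auto
  have "((\<lambda>w. ennreal (- ln w)) \<longlongrightarrow> ennreal (- ln u)) (at u within {0..1})"
   using \<open>0 < u\<close> by (intro tendsto_ennrealI tendsto_intros) auto
  moreover have "\<forall>\<^sub>F w in at u within {0..1}. ennreal (- ln w) = neg_log w"
   using order_tendstoD(1)[OF tendsto_ident_at \<open>0 < u\<close>]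
   by (rule eventually_mono) (simp add: neg_log_def)
  ultimately have "(neg_log \<longlongrightarrow> ennreal (- ln u)) (at u within {0..1})"
   by (rule Lim_transform_eventually)
  then show ?thesis
   using \<open>0 < u\<close> by (simp add: neg_log_def[of u])
 qed
qed

lemma prod_coord_in_01:
 assumes "v \<in> unit_cube"
 shows "(\<Prod>i<k. v i) \<in> {0..1::real}"
 using assms by (auto simp: unit_cube_def intro!: prod_nonneg prod_le_1)

lemma prod_coord_antimono:
 assumes "v \<in> unit_cube" "k \<le> l"
 shows "(\<Prod>i<l. v i) \<le> (\<Prod>i<k. v i :: real)"
 using assms(2)
proof (induction l rule: dec_induct)
 case (step n)
 have "(\<Prod>i<Suc n. v i) \<le> (\<Prod>i<n. v i)"
  using assms(1) prod_coord_in_01[OF assms(1), of n]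
  by (auto simp: unit_cube_def intro: mult_left_le)
 then show ?case using step.IH by simp
qed simp

lemma continuous_on_prod_coord: "continuous_on X (\<lambda>v :: nat \<Rightarrow> real. \<Prod>i<k. v i)"
 by (intro continuous_on_prod continuous_on_subset[OF continuous_on_product_coordinates]) auto

text \<open>A partial product below exp (- R) is an open condition, and since partial products
  decrease it bounds all later ones. This is the local uniformity that the tail of the times
  needs.\<close>

lemma continuous_map_renewal_of:
 "continuous_map (top_of_set exp_seqs) weak_sharp_topology renewal_of"
 unfolding renewal_of_def
proof (rule continuous_map_dirac_sum)
 fix k
 show "continuous_on exp_seqs (\<lambda>v. neg_log (\<Prod>i<k. v i))"
  by (rule continuous_on_compose2[OF continuous_on_neg_log continuous_on_prod_coord])
    (use prod_coord_in_01 in "auto simp: exp_seqs_def")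
next
 fix v and R :: real assume v: "v \<in> exp_seqs"
 have "(\<lambda>k. \<Prod>i<k. v i) \<longlonglongrightarrow> 0" using v by (simp add: exp_seqs_def)
 then have "\<forall>\<^sub>F k in sequentially. (\<Prod>i<k. v i) < exp (- max R 0)"
  by (rule order_tendstoD) simp
 then obtain K where K: "(\<Prod>i<K. v i) < exp (- max R 0)"
  by (auto simp: eventually_sequentially)
 have "open ((\<lambda>v :: nat \<Rightarrow> real. \<Prod>i<K. v i) -` {..<exp (- max R 0)})"
  by (rule open_vimage[OF _ continuous_on_prod_coord]) simp
 moreover have "ennreal R < neg_log (\<Prod>i<k. w i)"
  if w: "w \<in> exp_seqs" "(\<Prod>i<K. w i) < exp (- max R 0)" and k: "K \<le> k" for w k
 proof -
  have cube: "w \<in> unit_cube" using w(1) by (simp add: exp_seqs_def)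
  have "ennreal (max R 0) < neg_log (\<Prod>i<k. w i)"
   using prod_coord_antimono[OF cube k] w(2) prod_coord_in_01[OF cube, of k]
   by (subst neg_log_gt_iff) auto
  then show ?thesis by (rule le_less_trans[rotated]) (simp add: ennreal_leI)
 qed
 ultimately show "\<exists>K O'. open O' \<and> v \<in> O' \<and>
   (\<forall>q'\<in>O' \<inter> exp_seqs. \<forall>k\<ge>K. 1 \<le> k \<longrightarrow> ennreal R < neg_log (\<Prod>i<k. q' i))"
  using K by (intro exI[of _ K] exI[of _ "(\<lambda>v :: nat \<Rightarrow> real. \<Prod>i<K. v i) -` {..<exp (- max R 0)}"]) auto
qed

lemma (in moment_convergence) conv_renewal_of:
 assumes S: "S = exp_seqs"
  and F: "continuous_map weak_sharp_topology euclideanreal F" "bounded (F ` topspace weak_sharp_topology)"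
 shows "(\<lambda>n. LINT \<omega>|(P n). F (renewal_of (V n \<omega>))) \<longlonglongrightarrow> (LINT \<omega>|M. F (renewal_of (U \<omega>)))"
proof -
 obtain C where C: "\<And>\<xi>. \<xi> \<in> topspace weak_sharp_topology \<Longrightarrow> \<bar>F \<xi>\<bar> \<le> C"
  using F(2) by (auto simp: bounded_iff)
 have top: "renewal_of v \<in> topspace weak_sharp_topology" if "v \<in> S" for v
  using continuous_map_image_subset_topspace[OF continuous_map_renewal_of] that S by auto
 have "continuous_map (top_of_set S) euclideanreal (F \<circ> renewal_of)"
  unfolding S by (rule continuous_map_compose[OF continuous_map_renewal_of F(1)])
 then have "continuous_on S (\<lambda>v. F (renewal_of v))"
  by (simp add: o_def)
 then show ?thesis
  by (rule conv_bounded_continuous) (use C top in blast)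
qed

subsection \<open>The waiting time law\<close>

lemma iid_integral_prod:
 fixes f :: "'i \<Rightarrow> 'a \<Rightarrow> real"
 assumes H: "prob_space H" and J: "finite J" and int: "\<And>i. i \<in> J \<Longrightarrow> integrable H (f i)"
 shows "(\<integral>W. (\<Prod>i\<in>J. f i (W i)) \<partial>(\<Pi>\<^sub>M i\<in>UNIV. H)) = (\<Prod>i\<in>J. LINT x|H. f i x)"
proof -
 interpret prob_space H by (rule H)
 interpret product_prob_space "\<lambda>_. H" UNIV
  by unfold_locales
 have meas: "(\<lambda>y. \<Prod>i\<in>J. f i (y i)) \<in> borel_measurable (\<Pi>\<^sub>M i\<in>J. H)"
  by (intro borel_measurable_prod measurable_compose[OF measurable_component_singleton])
    (use int in auto)
 have "(\<integral>W. (\<Prod>i\<in>J. f i (W i)) \<partial>(\<Pi>\<^sub>M i\<in>UNIV. H)) =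
   (\<integral>W. (\<Prod>i\<in>J. f i (restrict W J i)) \<partial>(\<Pi>\<^sub>M i\<in>UNIV. H))"
  by (intro lint_cong prod.cong) auto
 also have "\<dots> = (LINT y|(distr (\<Pi>\<^sub>M i\<in>UNIV. H) (\<Pi>\<^sub>M i\<in>J. H) (\<lambda>W. restrict W J)). (\<Prod>i\<in>J. f i (y i)))"
  by (rule integral_distr[symmetric, OF measurable_restrict_subset meas]) simp
 also have "\<dots> = (\<integral>y. (\<Prod>i\<in>J. f i (y i)) \<partial>(\<Pi>\<^sub>M i\<in>J. H))"
  by (subst distr_PiM_restrict_finite[OF J]) auto
 also have "\<dots> = (\<Prod>i\<in>J. LINT x|H. f i x)"
  by (rule product_integral_prod[OF J int])
 finally show ?thesis .
qed

text \<open>Coded as exp (- x), the Laplace transform at the integers is the sequence of all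
  moments. The moment argument for a constant sequence of laws then identifies the integrals of
  bounded continuous functions, and characteristic functions finish.\<close>

lemma laplace_unique:
 assumes H1: "prob_space H1" "sets H1 = sets borel" "AE x in H1. 0 \<le> x"
  and H2: "prob_space H2" "sets H2 = sets borel" "AE x in H2. 0 \<le> (x::real)"
  and eq: "\<And>s. 0 \<le> s \<Longrightarrow> (LINT x|H1. exp (- s * x)) = (LINT x|H2. exp (- s * x))"
 shows "H1 = H2"
proof -
 \<comment> \<open>Truncation at 0 keeps the code in the cube for every x; both laws are carried by
   x \<ge> 0, so it changes nothing almost surely.\<close>
 define U :: "real \<Rightarrow> nat \<Rightarrow> real" where "U x i = (if i = 0 then exp (- max x 0) else 0)" for x i
 define S where "S = {v \<in> unit_cube. 0 < v 0}"
 have [measurable_cong]: "sets H1 = sets borel" "sets H2 = sets borel" by fact+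
 \<comment> \<open>All coordinates after the initial one vanish and contribute only a factor 0 or
   1.\<close>
 have prod_eq: "\<exists>c s. 0 \<le> s \<and> (\<forall>x\<ge>0. (\<Prod>i<k. U x i ^ m i) = c * exp (- s * x))" for k :: nat and m :: "nat \<Rightarrow> nat"
 proof (cases k)
  case 0
  then show ?thesis by (intro exI[of _ 1] exI[of _ 0]) auto
 next
  case (Suc l)
  have "(\<Prod>i<k. U x i ^ m i) = (\<Prod>i<l. 0 ^ m (Suc i)) * exp (- real (m 0) * x)" if "0 \<le> x" for x
   unfolding Suc prod.lessThan_Suc_shift using that
   by (simp add: U_def exp_of_nat_mult[symmetric] mult.commute)
  then show ?thesis by (intro exI[of _ "\<Prod>i<l. 0 ^ m (Suc i)"] exI[of _ "real (m 0)"]) auto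
 qed
 have meas [measurable]: "(\<lambda>x. U x i) \<in> borel_measurable borel" for i
  unfolding U_def by measurable
 interpret moment_convergence "\<lambda>_. H1" "\<lambda>_. U" H2 U S
 proof (rule moment_convergence.intro)
  have "U x \<in> S" for x by (auto simp: S_def U_def unit_cube_def)
  then show "U x \<in> S" "U x \<in> S" for x by auto
  show "(\<lambda>n. LINT x|H1. (\<Prod>i<k. U x i ^ m i)) \<longlonglongrightarrow> (LINT x|H2. (\<Prod>i<k. U x i ^ m i))" for k m
  proof -
   obtain c s where cs: "0 \<le> s" "\<And>x. 0 \<le> x \<Longrightarrow> (\<Prod>i<k. U x i ^ m i) = c * exp (- s * x)"
    using prod_eq[where k = k and m = m] by (elim exE conjE) (rule that; blast)
   have "(LINT x|H1. (\<Prod>i<k. U x i ^ m i)) = (LINT x|H1. c * exp (- s * x))"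
    by (rule integral_cong_AE) (use H1(3) cs(2) in auto)
   moreover have "(LINT x|H2. (\<Prod>i<k. U x i ^ m i)) = (LINT x|H2. c * exp (- s * x))"
    by (rule integral_cong_AE) (use H2(3) cs(2) in auto)
   ultimately show ?thesis by (simp only: integral_mult_right_zero eq[OF cs(1)] tendsto_const)
  qed
  show "prob_space H1" "prob_space H2" by fact+
  show "(\<lambda>x. U x i) \<in> borel_measurable H1" for i by measurable
  show "(\<lambda>x. U x i) \<in> borel_measurable H2" for i by measurable
  show "S \<subseteq> unit_cube" by (auto simp: S_def)
 qed
 interpret R1: real_distribution H1 using H1 by (simp add: real_distribution_def real_distribution_axioms_def)
 interpret R2: real_distribution H2 using H2 by (simp add: real_distribution_def real_distribution_axioms_def)
 have "weak_conv_m (\<lambda>_. H1) H2"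
 proof (rule integral_bdd_continuous_conv_imp_weak_conv)
  fix f :: "real \<Rightarrow> real"
  assume f: "\<And>x. isCont f x" "\<And>x. \<bar>f x\<bar> \<le> 1"
  have [measurable]: "f \<in> borel_measurable borel"
   using f(1) by (intro borel_measurable_continuous_onI continuous_at_imp_continuous_on) auto
  have "continuous_on S (\<lambda>v. f (- ln (v 0)))"
  proof (rule continuous_on_compose2[of UNIV f])
   show "continuous_on UNIV f" using f(1) by (intro continuous_at_imp_continuous_on) auto
   show "continuous_on S (\<lambda>v. - ln (v 0))"
    by (intro continuous_intros continuous_on_subset[OF continuous_on_product_coordinates])
      (auto simp: S_def)
  qed auto
  from conv_bounded_continuous[OF this f(2)]
  have "(LINT x|H1. f (- ln (U x 0))) = (LINT x|H2. f (- ln (U x 0)))"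
   using LIMSEQ_const_iff by blast
  moreover have "(LINT x|H1. f (- ln (U x 0))) = (LINT x|H1. f x)"
   by (rule integral_cong_AE) (use H1(3) in "auto simp: U_def")
  moreover have "(LINT x|H2. f (- ln (U x 0))) = (LINT x|H2. f x)"
   by (rule integral_cong_AE) (use H2(3) in "auto simp: U_def")
  ultimately show "(\<lambda>n. integral\<^sup>L H1 f) \<longlonglongrightarrow> integral\<^sup>L H2 f" by simp
 qed unfold_locales
 then have "(\<lambda>n. char H1 t) \<longlonglongrightarrow> char H2 t" for t
  by (intro levy_continuity1) unfold_locales
 then have "char H1 = char H2"
  by (auto simp: LIMSEQ_const_iff)
 then show ?thesis
  by (intro Levy_uniqueness) unfold_locales
qed

text \<open>Laws on [0, 1] are tight, so a subsequence converges weakly and its limit has the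
  prescribed moments. The limit 1 of \<open>\<psi>\<close> at 0 excludes an atom at 0, which would
  be an infinite waiting time, and minus the logarithm produces the required law.\<close>

lemma laplace_limit_exists:
 fixes P :: "nat \<Rightarrow> 'w measure" and V :: "nat \<Rightarrow> 'w \<Rightarrow> real" and \<psi> :: "real \<Rightarrow> real"
 assumes P: "\<And>n. prob_space (P n)"
  and meas: "\<And>n. V n \<in> borel_measurable (P n)"
  and V01: "\<And>n \<omega>. \<omega> \<in> space (P n) \<Longrightarrow> V n \<omega> \<in> {0..1}"
  and lim: "\<And>s. 0 < s \<Longrightarrow> (\<lambda>n. LINT \<omega>|(P n). V n \<omega> powr s) \<longlonglongrightarrow> \<psi> s"
  and \<psi>: "(\<psi> \<longlongrightarrow> 1) (at_right 0)"
 shows "\<exists>H. prob_space H \<and> sets H = sets borel \<and> (AE x in H. 0 \<le> x) \<and>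
  (\<forall>s>0. (LINT x|H. exp (- s * x)) = \<psi> s)"
proof -
 define Q where "Q n = distr (P n) borel (V n)" for n
 have Q: "real_distribution (Q n)" for n
  using prob_space.prob_space_distr[OF P meas]
  by (simp add: real_distribution_def real_distribution_axioms_def Q_def)
 have "tight Q"
  unfolding tight_def
 proof (intro conjI allI impI Q)
  fix e :: real assume "0 < e"
  have "measure (Q n) {-1<..1} = 1" for n
  proof -
   interpret prob_space "P n" by (rule P)
   have "V n -` {-1<..1} \<inter> space (P n) = space (P n)" using V01[of _ n] by fastforce
   then show ?thesis
    unfolding Q_def by (subst measure_distr[OF meas]) (auto simp: prob_space)
  qed
  then show "\<exists>a b. a < b \<and> (\<forall>n. 1 - e < measure (Q n) {a<..b})"
   using \<open>0 < e\<close> by (intro exI[of _ "-1"] exI[of _ 1]) auto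
 qed
 from tight_imp_convergent_subsubsequence[OF this strict_mono_id]
 obtain r M where r: "strict_mono (r :: nat \<Rightarrow> nat)" and M: "real_distribution M"
  and conv: "weak_conv_m (Q \<circ> id \<circ> r) M"
  by (auto simp: id_def)
 interpret M: real_distribution M by (rule M)
 \<comment> \<open>Clamping turns the power into a bounded continuous function on the whole line, as
   weak convergence of real distributions requires.\<close>
 define c where "c v = max 0 (min 1 v)" for v :: real
 have c01: "0 \<le> c v" "c v \<le> 1" for v by (auto simp: c_def)
 have cm [measurable]: "c \<in> borel_measurable borel" unfolding c_def by measurable
 have int: "(LINT v|M. c v powr s) = \<psi> s" if s: "0 < s" for s
 proof -
  have 1: "(\<lambda>n. integral\<^sup>L ((Q \<circ> id \<circ> r) n) (\<lambda>v. c v powr s)) \<longlonglongrightarrow> (LINT v|M. c v powr s)"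
  proof (rule weak_conv_imp_integral_bdd_continuous_conv[where B = 1, OF _ M conv])
   show "isCont (\<lambda>v. c v powr s) x" for x
   proof -
    have "continuous_on UNIV (\<lambda>v. c v powr s)"
     by (rule continuous_on_powr') (use s c01 in "auto simp: c_def intro!: continuous_intros")
    then show ?thesis by (simp add: continuous_on_eq_continuous_at)
   qed
   show "norm (c x powr s) \<le> 1" for x
    using powr_mono2[of s "c x" 1] c01[of x] s by simp
  qed (simp add: Q)
  have eq: "integral\<^sup>L (Q n) (\<lambda>v. c v powr s) = (LINT \<omega>|(P n). V n \<omega> powr s)" for n
  proof -
   have "c (V n \<omega>) = V n \<omega>" if "\<omega> \<in> space (P n)" for \<omega>
    using V01[OF that] by (auto simp: c_def)
   then show ?thesis
    unfolding Q_def by (subst integral_distr[OF meas]) (auto intro!: lint_cong)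
  qed
  have "(\<lambda>n. integral\<^sup>L ((Q \<circ> id \<circ> r) n) (\<lambda>v. c v powr s)) \<longlonglongrightarrow> \<psi> s"
   using LIMSEQ_subseq_LIMSEQ[OF lim[OF s] r] by (simp add: o_def eq)
  with 1 show ?thesis by (rule LIMSEQ_unique)
 qed
 have l1: "(\<lambda>n. 1 / real (Suc n)) \<longlonglongrightarrow> 0"
  by (rule LIMSEQ_Suc[OF lim_1_over_n])
 \<comment> \<open>As s decreases to 0 the power tends to the indicator of c v > 0, so the limit of
   \<open>\<psi>\<close> is the mass of that event.\<close>
 have "(\<lambda>n. LINT v|M. c v powr (1 / real (Suc n))) \<longlonglongrightarrow> (LINT v|M. indicator {v. 0 < c v} v)"
 proof (rule integral_dominated_convergence[where w = "\<lambda>_. 1"])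
  show "AE v in M. (\<lambda>n. c v powr (1 / real (Suc n))) \<longlonglongrightarrow> indicator {v. 0 < c v} v"
  proof (rule AE_I2)
   fix v
   show "(\<lambda>n. c v powr (1 / real (Suc n))) \<longlonglongrightarrow> indicator {v. 0 < c v} v"
   proof (cases "0 < c v")
    case True
    have "(\<lambda>n. c v powr (1 / real (Suc n))) \<longlonglongrightarrow> c v powr 0"
     using True by (intro tendsto_powr tendsto_const l1) auto
    then show ?thesis using True by simp
   next
    case False
    then have "c v = 0" using c01[of v] by simp
    then show ?thesis by simp
   qed
  qed
  show "AE v in M. norm (c v powr (1 / real (Suc n))) \<le> 1" for n
   using powr_mono2[of "1 / real (Suc n)" "c v" 1 for v] c01 by (intro AE_I2) simp
 qed auto
 moreover have "(\<lambda>n. \<psi> (1 / real (Suc n))) \<longlonglongrightarrow> 1"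
  by (rule filterlim_compose[OF \<psi>]) (simp add: filterlim_at l1 del: of_nat_Suc)
 ultimately have "(LINT v|M. indicator {v. 0 < c v} v) = (1::real)"
  using LIMSEQ_unique by (fastforce simp: int)
 then have "measure M {v. 0 < c v} = 1" by simp
 then have pos: "AE v in M. 0 < c v"
  by (subst (asm) M.prob_eq_1) auto
 define H where "H = distr M borel (\<lambda>v. - ln (c v))"
 have "prob_space H" unfolding H_def by (rule M.prob_space_distr) simp
 moreover have "AE x in H. 0 \<le> x"
  unfolding H_def by (subst AE_distr_iff) (use pos c01 in "auto simp: ln_le_zero_iff")
 moreover have "(LINT x|H. exp (- s * x)) = \<psi> s" if s: "0 < s" for s
 proof -
  have "(LINT x|H. exp (- s * x)) = (LINT v|M. exp (- s * (- ln (c v))))"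
   unfolding H_def by (rule integral_distr) auto
  also have "\<dots> = (LINT v|M. c v powr s)"
   by (rule integral_cong_AE) (use pos in "auto simp: powr_def")
  finally show ?thesis using int[OF s] by simp
 qed
 ultimately show ?thesis by (intro exI[of _ H]) (auto simp: H_def)
qed

text \<open>The condition inside the definite description \<open>H_law\<close>, named so that
  existence and uniqueness can be proved before the description is evaluated.\<close>

definition is_H_law :: "real \<Rightarrow> real \<Rightarrow> real measure \<Rightarrow> bool" where
 "is_H_law \<alpha> l H \<longleftrightarrow> prob_space H \<and> sets H = sets borel \<and> (AE x in H. 0 \<le> x) \<and>
    (\<forall>s\<ge>0. (LINT x|H. exp (- s * x)) = l / (l + s powr \<alpha>))"

text \<open>Uniqueness is Laplace inversion. Existence is drawn from any random variables whose
  transforms converge to the right formula; the return times will provide them.\<close>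

lemma is_H_law_H_law:
 assumes "0 < \<alpha>" "0 < l"
  and P: "\<And>n. prob_space (P n)"
  and meas: "\<And>n. V n \<in> borel_measurable (P n)"
  and V01: "\<And>n \<omega>. \<omega> \<in> space (P n) \<Longrightarrow> V n \<omega> \<in> {0..1}"
  and lim: "\<And>s. 0 < s \<Longrightarrow> (\<lambda>n. LINT \<omega>|(P n). V n \<omega> powr s) \<longlonglongrightarrow> l / (l + s powr \<alpha>)"
 shows "is_H_law \<alpha> l (H_law \<alpha> l)"
proof -
 have "((\<lambda>s. l / (l + s powr \<alpha>)) \<longlongrightarrow> l / (l + 0)) (at_right 0)"
 proof (intro tendsto_intros)
  show "((\<lambda>s. s powr \<alpha>) \<longlongrightarrow> 0) (at_right 0)"
   using assms(1) by (intro tendsto_zero_powrI[of _ _ _ \<alpha>]) (auto simp: eventually_at_filter intro!: tendsto_ident_at always_eventually)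
 qed (use assms(2) in auto)
 then have "((\<lambda>s. l / (l + s powr \<alpha>)) \<longlongrightarrow> 1) (at_right 0)" using assms(2) by simp
 from laplace_limit_exists[of P V, OF P meas V01 lim this]
 obtain H where H: "prob_space H" "sets H = sets borel" "AE x in H. 0 \<le> x"
  "\<And>s. 0 < s \<Longrightarrow> (LINT x|H. exp (- s * x)) = l / (l + s powr \<alpha>)" by auto
 have "is_H_law \<alpha> l H"
  unfolding is_H_law_def
 proof (intro conjI allI impI H(1,2,3))
  fix s :: real assume "0 \<le> s"
  interpret prob_space H by (rule H(1))
  show "(LINT x|H. exp (- s * x)) = l / (l + s powr \<alpha>)"
   using H(4)[of s] \<open>0 \<le> s\<close> assms(2) by (cases "s = 0") (auto simp: prob_space)
 qed
 moreover have "H' = H" if "is_H_law \<alpha> l H'" for H'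
  by (rule laplace_unique) (use that \<open>is_H_law \<alpha> l H\<close> in "auto simp: is_H_law_def")
 ultimately have "\<exists>!H. is_H_law \<alpha> l H" by blast
 then show ?thesis
  unfolding H_law_def is_H_law_def[symmetric] by (rule theI')
qed

lemma continuous_map_borel_of:
 fixes F :: "'a \<Rightarrow> real"
 assumes F: "continuous_map X euclideanreal F"
 shows "F \<in> borel_measurable (borel_of X)"
proof (rule borel_measurableI)
 fix S :: "real set" assume "open S"
 then have "openin X {x \<in> topspace X. F x \<in> S}"
  using openin_continuous_map_preimage[OF F] by simp
 moreover have "F -` S \<inter> space (borel_of X) = {x \<in> topspace X. F x \<in> S}"
  by (auto simp: space_borel_of)
 ultimately show "F -` S \<inter> space (borel_of X) \<in> sets (borel_of X)"
  by (simp add: sets_borel_of sigma_sets.Basic)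
qed

section \<open>The renewal process with independent waiting times\<close>

definition good_waits :: "(nat \<Rightarrow> real) \<Rightarrow> bool" where
 "good_waits W \<longleftrightarrow> (\<forall>i. 0 \<le> W i) \<and> (\<lambda>k. \<Prod>i<k. exp (- W i)) \<longlonglongrightarrow> 0"

text \<open>Bad sequences are sent to the zero sequence, the code of the empty process, so that the
  values lie in \<open>exp_seqs\<close> everywhere and not only almost surely.\<close>

definition exp_waits :: "(nat \<Rightarrow> real) \<Rightarrow> nat \<Rightarrow> real" where
 "exp_waits W i = (if good_waits W then exp (- W i) else 0)"

lemma zero_in_exp_seqs: "(\<lambda>i. 0) \<in> exp_seqs"
proof -
 have "(\<lambda>k. \<Prod>i<Suc k. (0::real)) \<longlonglongrightarrow> 0" by (simp add: prod.lessThan_Suc)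
 then have "(\<lambda>k. \<Prod>i<k. (0::real)) \<longlonglongrightarrow> 0" by (rule LIMSEQ_imp_Suc)
 then show ?thesis by (simp add: exp_seqs_def unit_cube_def)
qed

lemma exp_waits_in_exp_seqs: "exp_waits W \<in> exp_seqs"
proof (cases "good_waits W")
 case True
 then have "exp_waits W = (\<lambda>i. exp (- W i))" by (auto simp: exp_waits_def)
 then show ?thesis using True by (auto simp: good_waits_def exp_seqs_def unit_cube_def)
next
 case False
 then have "exp_waits W = (\<lambda>i. 0)" by (auto simp: exp_waits_def)
 then show ?thesis using zero_in_exp_seqs by simp
qed

lemma renewal_of_exp_waits:
 assumes "good_waits W"
 shows "renewal_of (exp_waits W) = dirac_sum (\<lambda>k. ennreal (\<Sum>i<k. W i))"
proof -
 have "neg_log (\<Prod>i<k. exp_waits W i) = ennreal (\<Sum>i<k. W i)" for k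
 proof -
  have "(\<Prod>i<k. exp_waits W i) = exp (- (\<Sum>i<k. W i))"
   using assms by (simp add: exp_waits_def exp_sum sum_negf[symmetric])
  then show ?thesis by (simp add: neg_log_def)
 qed
 then show ?thesis by (simp add: renewal_of_def)
qed

lemma renewal_of_in_bf: "v \<in> exp_seqs \<Longrightarrow> renewal_of v \<in> bf_counting_measures"
 using continuous_map_image_subset_topspace[OF continuous_map_renewal_of]
 by (auto simp: topspace_weak_sharp)

lemma null_measure_eq_dirac_sum:
 "null_measure (restrict_space borel {0..}) = dirac_sum (\<lambda>k. \<infinity>)"
 by (rule measure_eqI) (auto simp: emeasure_dirac_sum)

lemma measurable_exp_waits:
 assumes [measurable_cong]: "sets H = sets borel"
 shows "(\<lambda>W. exp_waits W i) \<in> borel_measurable (\<Pi>\<^sub>M i\<in>UNIV. H)"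
proof -
 have [measurable]: "(\<lambda>W. W i) \<in> borel_measurable (\<Pi>\<^sub>M i\<in>UNIV. H)" for i
  by (rule measurable_compose[OF measurable_component_singleton]) auto
 have "Measurable.pred (\<Pi>\<^sub>M i\<in>UNIV. H) good_waits"
  unfolding good_waits_def by measurable
 then show ?thesis unfolding exp_waits_def by measurable
qed

text \<open>Setting all times to infinity off the locally finite sequences produces the null
  measure, so the case distinction of the renewal law is absorbed into one \<open>dirac_sum\<close>
  of measurable times.\<close>

lemma measurable_rpp_map:
 assumes [measurable_cong]: "sets H = sets borel"
 shows "(\<lambda>W :: nat \<Rightarrow> real.
     let \<xi> = dirac_sum (\<lambda>k. ennreal (\<Sum>i<k. W i))
     in if \<xi> \<in> bf_counting_measures then \<xi> else null_measure (restrict_space borel {0..}))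
  \<in> (\<Pi>\<^sub>M i\<in>UNIV. H) \<rightarrow>\<^sub>M borel_of weak_sharp_topology"
proof -
 define lf where "lf W \<longleftrightarrow> (\<forall>R::nat. \<exists>K. \<forall>k\<in>{K..}. 1 \<le> k \<longrightarrow> of_nat R < ennreal (\<Sum>i<k. W i))"
  for W :: "nat \<Rightarrow> real"
 have lf_iff: "locally_finite_seq (\<lambda>k. ennreal (\<Sum>i<k. W i)) \<longleftrightarrow> lf W" for W
 proof -
  have "finite {k. 1 \<le> k \<and> ennreal (\<Sum>i<k. W i) \<le> of_nat R} \<longleftrightarrow>
    (\<exists>K. \<forall>k\<in>{K..}. 1 \<le> k \<longrightarrow> of_nat R < ennreal (\<Sum>i<k. W i))" for R
   unfolding finite_nat_iff_bounded by (auto simp: subset_eq not_le[symmetric])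
  then show ?thesis unfolding locally_finite_seq_def lf_def by blast
 qed
 have [measurable]: "(\<lambda>W. W i) \<in> borel_measurable (\<Pi>\<^sub>M i\<in>UNIV. H)" for i
  by (rule measurable_compose[OF measurable_component_singleton]) auto
 have [measurable]: "Measurable.pred (\<Pi>\<^sub>M i\<in>UNIV. H) lf"
  unfolding lf_def by measurable
 define t :: "(nat \<Rightarrow> real) \<Rightarrow> nat \<Rightarrow> ennreal"
  where "t W k = (if lf W then ennreal (\<Sum>i<k. W i) else \<infinity>)" for W k
 have "(\<lambda>W. dirac_sum (t W)) \<in> (\<Pi>\<^sub>M i\<in>UNIV. H) \<rightarrow>\<^sub>M borel_of weak_sharp_topology"
 proof (rule measurable_dirac_sum)
  show "(\<lambda>W. t W k) \<in> borel_measurable (\<Pi>\<^sub>M i\<in>UNIV. H)" for k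
   unfolding t_def by measurable
  show "locally_finite_seq (t W)" for W
  proof (cases "lf W")
   case True
   then show ?thesis using lf_iff[of W] by (simp add: t_def[abs_def])
  next
   case False
   then show ?thesis by (simp add: t_def locally_finite_seq_def top_unique of_nat_less_top[THEN less_imp_neq])
  qed
 qed
 moreover have "(let \<xi> = dirac_sum (\<lambda>k. ennreal (\<Sum>i<k. W i))
     in if \<xi> \<in> bf_counting_measures then \<xi> else null_measure (restrict_space borel {0..})) =
   dirac_sum (t W)" for W
  by (simp add: Let_def dirac_sum_in_bf_iff lf_iff null_measure_eq_dirac_sum t_def[abs_def])
 ultimately show ?thesis by simp
qed

context
 fixes \<alpha> l :: real and H :: "real measure"
 assumes pos: "0 < \<alpha>" "0 < l" and H: "is_H_law \<alpha> l H"
begin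

lemma prob_space_H: "prob_space H" and sets_H: "sets H = sets borel"
 and AE_H: "AE x in H. 0 \<le> x"
 and laplace_H: "0 \<le> s \<Longrightarrow> (LINT x|H. exp (- s * x)) = l / (l + s powr \<alpha>)"
 using H by (auto simp: is_H_law_def)

lemma prod_exp_waits:
 "(\<integral>W. (\<Prod>i<k. exp (- real (m i) * max 0 (W i))) \<partial>(\<Pi>\<^sub>M i\<in>(UNIV :: nat set). H)) =
  (\<Prod>i<k. l / (l + real (m i) powr \<alpha>))"
proof -
 interpret prob_space H by (rule prob_space_H)
 have [measurable_cong]: "sets H = sets borel" by (rule sets_H)
 have int: "integrable H (\<lambda>x. exp (- real n * max 0 x))" for n
  by (rule integrable_const_bound[of _ 1]) auto
 have "(LINT x|H. exp (- real n * max 0 x)) = (LINT x|H. exp (- real n * x))" for n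
  by (rule integral_cong_AE) (use AE_H in "auto elim!: eventually_mono simp: max_def")
 then have "(LINT x|H. exp (- real n * max 0 x)) = l / (l + real n powr \<alpha>)" for n
  using laplace_H[of "real n"] by simp
 then show ?thesis
  by (subst iid_integral_prod[OF prob_space_H, of "{..<k}" "\<lambda>i x. exp (- real (m i) * max 0 x)"])
    (use int in auto)
qed

lemma AE_nonneg_waits: "AE W in (\<Pi>\<^sub>M i\<in>UNIV. H). \<forall>i::nat. 0 \<le> W i"
 unfolding AE_all_countable using AE_PiM_component[of UNIV "\<lambda>_. H" _ "\<lambda>x. 0 \<le> x"] prob_space_H AE_H by auto

text \<open>The decreasing products have expectation (l / (l + 1)) ^ k, so their nonnegative limit
  has expectation 0 and vanishes almost surely.\<close>

lemma AE_good_waits: "AE W in (\<Pi>\<^sub>M i\<in>UNIV. H). good_waits W"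
proof -
 let ?M = "\<Pi>\<^sub>M i\<in>(UNIV :: nat set). H"
 have [measurable_cong]: "sets H = sets borel" by (rule sets_H)
 interpret M: prob_space ?M by (rule prob_space_PiM) (rule prob_space_H)
 define X where "X k W = (\<Prod>i<k. exp (- max 0 (W i)))" for k :: nat and W :: "nat \<Rightarrow> real"
 have [measurable]: "(\<lambda>W. W i) \<in> borel_measurable ?M" for i
  by (rule measurable_compose[OF measurable_component_singleton]) auto
 have Xm [measurable]: "X k \<in> borel_measurable ?M" for k
  unfolding X_def by measurable
 have X01: "0 \<le> X k W" "X k W \<le> 1" for k W
  by (auto simp: X_def intro!: prod_nonneg prod_le_1)
 have "decseq (\<lambda>k. X k W)" for W
  unfolding decseq_Suc_iff by (auto simp: X_def intro!: mult_left_le prod_nonneg)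
 then have conv: "(\<lambda>k. X k W) \<longlonglongrightarrow> lim (\<lambda>k. X k W)" for W
  using decseq_convergent[of "\<lambda>k. X k W" 0] X01 convergent_LIMSEQ_iff convergent_def by metis
 have lim_nonneg: "0 \<le> lim (\<lambda>k. X k W)" for W
  by (rule LIMSEQ_le_const[OF conv]) (use X01 in auto)
 have lim_m [measurable]: "(\<lambda>W. lim (\<lambda>k. X k W)) \<in> borel_measurable ?M"
  by (rule borel_measurable_LIMSEQ_real[OF conv]) measurable
 have "(\<lambda>k. LINT W|?M. X k W) \<longlonglongrightarrow> (LINT W|?M. lim (\<lambda>k. X k W))"
  by (rule integral_dominated_convergence[where w = "\<lambda>_. 1"]) (use X01 conv in auto)
 moreover have "(LINT W|?M. X k W) = (l / (l + 1)) ^ k" for k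
  using prod_exp_waits[where k = k and m = "\<lambda>_. 1"] by (simp add: X_def)
 moreover have "(\<lambda>k. (l / (l + 1)) ^ k) \<longlonglongrightarrow> 0"
  using pos by (intro LIMSEQ_realpow_zero) auto
 ultimately have "(LINT W|?M. lim (\<lambda>k. X k W)) = 0"
  using LIMSEQ_unique by fastforce
 moreover have "integrable ?M (\<lambda>W. lim (\<lambda>k. X k W))"
 proof (rule integrable_dominated_convergence[where w = "\<lambda>_. 1" and s = X])
 qed (use X01 conv in auto)
 ultimately have "AE W in ?M. lim (\<lambda>k. X k W) = 0"
  using lim_nonneg by (subst (asm) integral_nonneg_eq_0_iff_AE) auto
 then show ?thesis
  using AE_nonneg_waits
 proof eventually_elim
  case (elim W)
  then have "X k W = (\<Prod>i<k. exp (- W i))" for k by (simp add: X_def)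
  then show ?case using conv[of W] elim by (simp add: good_waits_def)
 qed
qed

lemma moments_exp_waits:
 "(\<integral>W. (\<Prod>i<k. exp_waits W i ^ m i) \<partial>(\<Pi>\<^sub>M i\<in>UNIV. H)) = (\<Prod>i<k. l / (l + real (m i) powr \<alpha>))"
proof -
 have [measurable_cong]: "sets H = sets borel" by (rule sets_H)
 have [measurable]: "(\<lambda>W. exp_waits W i) \<in> borel_measurable (\<Pi>\<^sub>M i\<in>UNIV. H)" for i
  by (rule measurable_exp_waits[OF sets_H])
 have [measurable]: "(\<lambda>W. W i) \<in> borel_measurable (\<Pi>\<^sub>M i\<in>UNIV. H)" for i
  by (rule measurable_compose[OF measurable_component_singleton]) auto
 have "(\<integral>W. (\<Prod>i<k. exp_waits W i ^ m i) \<partial>(\<Pi>\<^sub>M i\<in>UNIV. H)) =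
   (\<integral>W. (\<Prod>i<k. exp (- real (m i) * max 0 (W i))) \<partial>(\<Pi>\<^sub>M i\<in>UNIV. H))"
 proof (rule integral_cong_AE)
  show "AE W in (\<Pi>\<^sub>M i\<in>UNIV. H). (\<Prod>i<k. exp_waits W i ^ m i) = (\<Prod>i<k. exp (- real (m i) * max 0 (W i)))"
   using AE_good_waits
  proof eventually_elim
   case (elim W)
   then show ?case
    by (intro prod.cong) (auto simp: exp_waits_def good_waits_def max_def exp_of_nat_mult[symmetric])
  qed
 qed measurable
 then show ?thesis unfolding prod_exp_waits .
qed

text \<open>Both processes agree on good waiting times, hence almost surely; the right-hand form
  depends continuously on the codes.\<close>

lemma integral_rpp_law:
 assumes F: "continuous_map weak_sharp_topology euclideanreal F"
 shows "(LINT \<xi>|(rpp_law H). F \<xi>) = (\<integral>W. F (renewal_of (exp_waits W)) \<partial>(\<Pi>\<^sub>M i\<in>UNIV. H))"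
proof -
 note Fm = continuous_map_borel_of[OF F]
 let ?M = "\<Pi>\<^sub>M i\<in>(UNIV :: nat set). H"
 have rm: "(\<lambda>W. renewal_of (exp_waits W)) \<in> ?M \<rightarrow>\<^sub>M borel_of weak_sharp_topology"
  unfolding renewal_of_def
 proof (rule measurable_dirac_sum)
  have [measurable]: "(\<lambda>W. exp_waits W i) \<in> borel_measurable ?M" for i
   by (rule measurable_exp_waits[OF sets_H])
  show "(\<lambda>W. neg_log (\<Prod>i<k. exp_waits W i)) \<in> borel_measurable ?M" for k
   unfolding neg_log_def by measurable
  show "locally_finite_seq (\<lambda>k. neg_log (\<Prod>i<k. exp_waits W i))" for W
   using renewal_of_in_bf[OF exp_waits_in_exp_seqs[of W]]
   by (simp add: renewal_of_def dirac_sum_in_bf_iff)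
 qed
 show ?thesis
  unfolding rpp_law_def
  by (subst integral_distr[OF measurable_rpp_map[OF sets_H] Fm], rule integral_cong_AE)
    (use AE_good_waits renewal_of_in_bf[OF exp_waits_in_exp_seqs] in
     \<open>auto simp: Let_def renewal_of_exp_waits[symmetric] elim!: eventually_mono
      intro!: measurable_compose[OF _ Fm] rm measurable_rpp_map[OF sets_H, unfolded Let_def]\<close>)
qed

end

text \<open>The probabilistic interface for the dynamics: \<open>V n\<close> will list exp (- gap /
  N n), and only convergence of mixed moments remains to be shown. The identification of the
  processes is asked for large n only, since the scale may be artificial for small n.\<close>

lemma converges_in_law_fpp:
 fixes P :: "nat \<Rightarrow> 'w measure" and V :: "nat \<Rightarrow> 'w \<Rightarrow> nat \<Rightarrow> real"
 assumes pos: "0 < \<alpha>" "0 < l" and H: "is_H_law \<alpha> l (H_law \<alpha> l)"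
  and P: "\<And>n. prob_space (P n)"
  and V: "\<And>n i. (\<lambda>\<omega>. V n \<omega> i) \<in> borel_measurable (P n)"
  and V_S: "\<And>n \<omega>. \<omega> \<in> space (P n) \<Longrightarrow> V n \<omega> \<in> exp_seqs"
  and mom: "\<And>k m. (\<lambda>n. LINT \<omega>|(P n). (\<Prod>i<k. V n \<omega> i ^ m i)) \<longlonglongrightarrow> (\<Prod>i<k. l / (l + real (m i) powr \<alpha>))"
  and N: "\<And>n. N n \<in> P n \<rightarrow>\<^sub>M borel_of weak_sharp_topology"
  and N_eq: "\<forall>\<^sub>F n in sequentially. \<forall>\<omega>\<in>space (P n). N n \<omega> = renewal_of (V n \<omega>)"
 shows "converges_in_law weak_sharp_topology P N (fpp_law \<alpha> l)"
 unfolding converges_in_law_def weak_conv_on_def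
proof (intro conjI allI impI N)
 fix F :: "real measure \<Rightarrow> real"
 assume F: "continuous_map weak_sharp_topology euclideanreal F \<and> bounded (F ` topspace weak_sharp_topology)"
 let ?H = "H_law \<alpha> l"
 let ?M = "\<Pi>\<^sub>M i\<in>(UNIV :: nat set). ?H"
 have sets_H: "sets ?H = sets borel" using H by (simp add: is_H_law_def)
 interpret moment_convergence P V ?M exp_waits exp_seqs
 proof (rule moment_convergence.intro)
  show "prob_space ?M" by (rule prob_space_PiM) (use H in "simp add: is_H_law_def")
  show "exp_seqs \<subseteq> unit_cube" by (auto simp: exp_seqs_def)
 qed (use P V V_S exp_waits_in_exp_seqs measurable_exp_waits[OF sets_H] mom
    moments_exp_waits[OF pos H] in auto)
 have "(\<lambda>n. LINT \<omega>|(P n). F (renewal_of (V n \<omega>))) \<longlonglongrightarrow> (LINT W|?M. F (renewal_of (exp_waits W)))"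
  by (rule conv_renewal_of) (use F in auto)
 moreover have "(LINT W|?M. F (renewal_of (exp_waits W))) = (\<integral>\<xi>. F \<xi> \<partial>fpp_law \<alpha> l)"
  unfolding fpp_law_def using integral_rpp_law[OF pos H] F by auto
 moreover have "\<forall>\<^sub>F n in sequentially. (LINT \<omega>|(P n). F (renewal_of (V n \<omega>))) =
   (LINT \<xi>|(distr (P n) (borel_of weak_sharp_topology) (N n)). F \<xi>)"
  using N_eq
 proof eventually_elim
  case (elim n)
  have Fm: "F \<in> borel_measurable (borel_of weak_sharp_topology)"
   using F by (intro continuous_map_borel_of) auto
  have "(LINT \<xi>|(distr (P n) (borel_of weak_sharp_topology) (N n)). F \<xi>) = (LINT \<omega>|(P n). F (N n \<omega>))"
   by (rule integral_distr[OF N Fm])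
  also have "\<dots> = (LINT \<omega>|(P n). F (renewal_of (V n \<omega>)))"
   using elim by (intro lint_cong) auto
  finally show ?case by simp
 qed
 ultimately show "(\<lambda>n. LINT \<xi>|(distr (P n) (borel_of weak_sharp_topology) (N n)). F \<xi>) \<longlonglongrightarrow>
   (\<integral>\<xi>. F \<xi> \<partial>fpp_law \<alpha> l)"
  using Lim_transform_eventually by fastforce
qed

subsection \<open>Cylinders and hitting times\<close>

lemma funpow_lshift: "sh k x = (\<lambda>i. x (i + k))"
 by (induction k) (auto simp: lshift_def)

lemma funpow_lshift_apply [simp]: "sh k x i = x (i + k)"
 by (simp add: funpow_lshift)

lemma lshift_in_shift_space: "x \<in> shift_space A \<Longrightarrow> lshift x \<in> shift_space A"
 by (simp add: shift_space_def lshift_def)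

lemma funpow_lshift_in_shift_space: "x \<in> shift_space A \<Longrightarrow> sh k x \<in> shift_space A"
 by (simp add: shift_space_def)

lemma funpow_lshift_lshift: "sh k (lshift x) = sh (Suc k) x"
 by (simp add: funpow_lshift lshift_def)

definition agree :: "nat \<Rightarrow> 'v path \<Rightarrow> 'v path \<Rightarrow> bool" where
 "agree j x y \<longleftrightarrow> (\<forall>i<j. x i = y i)"

definition determined :: "('v \<Rightarrow> 'v \<Rightarrow> bool) \<Rightarrow> nat \<Rightarrow> 'v path set \<Rightarrow> bool" where
 "determined A j X \<longleftrightarrow> X \<subseteq> shift_space A \<and> (\<forall>x\<in>X. \<forall>y\<in>shift_space A. agree j x y \<longrightarrow> y \<in> X)"

lemma determinedD: "determined A j X \<Longrightarrow> x \<in> X \<Longrightarrow> y \<in> shift_space A \<Longrightarrow> agree j x y \<Longrightarrow> y \<in> X"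
 by (simp add: determined_def)

lemma agree_sym: "agree j x y \<Longrightarrow> agree j y x"
 by (simp add: agree_def)

lemma agree_trans: "agree j x y \<Longrightarrow> agree j y z \<Longrightarrow> agree j x z"
 by (simp add: agree_def)

lemma agree_mono: "agree j x y \<Longrightarrow> i \<le> j \<Longrightarrow> agree i x y"
 by (simp add: agree_def)

lemma agree_funpow: "agree (j + k) x y \<Longrightarrow> agree j (sh k x) (sh k y)"
 by (simp add: agree_def)

lemma determined_mono: "determined A i X \<Longrightarrow> i \<le> j \<Longrightarrow> determined A j X"
 unfolding determined_def using agree_mono by blast

lemma determined_cyl: "determined A (length w) (cyl A w)"
 by (auto simp: determined_def cyl_def agree_def)

lemma determined_Int: "determined A j X \<Longrightarrow> determined A j Y \<Longrightarrow> determined A j (X \<inter> Y)"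
 unfolding determined_def by blast

lemma determined_vimage:
 "determined A j X \<Longrightarrow> determined A (j + k) (sh k -` X \<inter> shift_space A)"
 unfolding determined_def
proof (intro conjI ballI impI)
 fix x y
 assume X: "X \<subseteq> shift_space A \<and> (\<forall>x\<in>X. \<forall>y\<in>shift_space A. agree j x y \<longrightarrow> y \<in> X)"
  and x: "x \<in> sh k -` X \<inter> shift_space A" and y: "y \<in> shift_space A" and xy: "agree (j + k) x y"
 have "sh k y \<in> X"
  using X x agree_funpow[OF xy] funpow_lshift_in_shift_space[OF y] by blast
 then show "y \<in> sh k -` X \<inter> shift_space A" using y by simp
qed auto

lemma cyl_subset: "cyl A w \<subseteq> shift_space A"
 by (auto simp: cyl_def)

lemma cyl_eq_Collect: "x \<in> shift_space A \<Longrightarrow> cyl A (map x [0..<n]) = {y \<in> shift_space A. agree n x y}"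
 by (auto simp: cyl_def agree_def)

lemma mem_cyl_prefix: "x \<in> shift_space A \<Longrightarrow> x \<in> cyl A (map x [0..<n])"
 by (simp add: cyl_def)

lemma cyl_prefix_eq:
 assumes "x \<in> cyl A w"
 shows "cyl A w = cyl A (map x [0..<length w])"
 using assms by (auto simp: cyl_def)

lemma determined_eq_UN:
 assumes "determined A j X"
 shows "X = (\<Union>w\<in>{w. length w = j \<and> cyl A w \<subseteq> X}. cyl A w)"
proof (intro equalityI subsetI)
 fix x assume x: "x \<in> X"
 then have xs: "x \<in> shift_space A" using assms by (auto simp: determined_def)
 have "cyl A (map x [0..<j]) \<subseteq> X"
  using determinedD[OF assms x] by (auto simp: cyl_eq_Collect[OF xs])
 then show "x \<in> (\<Union>w\<in>{w. length w = j \<and> cyl A w \<subseteq> X}. cyl A w)"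
  using mem_cyl_prefix[OF xs, of j] by (intro UN_I[of "map x [0..<j]"]) auto
qed auto

lemma cyl_disjoint:
 assumes "length u = length w" "u \<noteq> w"
 shows "cyl A u \<inter> cyl A w = {}"
 using assms by (auto simp: cyl_def list_eq_iff_nth_eq)

lemma Inf_enat_eq_iff:
 "Inf {enat n | n. P n} = enat n \<longleftrightarrow> P n \<and> (\<forall>m. P m \<longrightarrow> n \<le> m)"
proof
 assume L: "Inf {enat n | n. P n} = enat n"
 then have ne: "{enat n | n. P n} \<noteq> {}" by (metis Inf_enat_def enat.distinct(1))
 then have "Inf {enat n | n. P n} \<in> {enat n | n. P n}"
  unfolding Inf_enat_def by (simp only: if_False) (rule LeastI_ex, blast)
 then have "P n" unfolding L by auto
 moreover have "n \<le> m" if "P m" for m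
  using Inf_lower[of "enat m" "{enat n | n. P n}"] that unfolding L by auto
 ultimately show "P n \<and> (\<forall>m. P m \<longrightarrow> n \<le> m)" by blast
next
 assume R: "P n \<and> (\<forall>m. P m \<longrightarrow> n \<le> m)"
 show "Inf {enat n | n. P n} = enat n"
  by (rule antisym) (use R in "auto intro!: Inf_lower Inf_greatest")
qed

lemma Inf_enat_eq_infinity_iff: "Inf {enat n | n. P n} = \<infinity> \<longleftrightarrow> (\<forall>n. \<not> P n)"
proof
 show "\<forall>n. \<not> P n" if "Inf {enat n | n. P n} = \<infinity>"
  using that Inf_lower[of _ "{enat n | n. P n}"] by (auto simp flip: that) (metis (mono_tags, lifting) enat_ord_simps(5) mem_Collect_eq that infinity_ileE)
qed (simp add: Inf_enat_def)

lemma hit_time_Suc_eq_enat: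
 "hit_time B (Suc k) x = enat n \<longleftrightarrow> hit_time B k x < enat n \<and> sh n x \<in> B \<and>
  (\<forall>m. hit_time B k x < enat m \<and> sh m x \<in> B \<longrightarrow> n \<le> m)"
 unfolding hit_time.simps Inf_enat_eq_iff by blast

lemma hit_time_Suc_eq_infinity:
 "hit_time B (Suc k) x = \<infinity> \<longleftrightarrow> (\<forall>n. \<not> (hit_time B k x < enat n \<and> sh n x \<in> B))"
 unfolding hit_time.simps by (rule Inf_enat_eq_infinity_iff)

lemma hit_time_1_eq_enat:
 "hit_time B 1 x = enat n \<longleftrightarrow> 0 < n \<and> sh n x \<in> B \<and> (\<forall>m. 0 < m \<and> sh m x \<in> B \<longrightarrow> n \<le> m)"
 unfolding One_nat_def hit_time_Suc_eq_enat by (simp add: zero_enat_def)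

lemma hit_time_1_eq_infinity:
 "hit_time B 1 x = \<infinity> \<longleftrightarrow> (\<forall>n>0. sh n x \<notin> B)"
 unfolding One_nat_def hit_time_Suc_eq_infinity hit_time.simps(1) zero_enat_def enat_ord_simps by blast

lemma hit_time_ge: "enat k \<le> hit_time B k x"
proof (induction k)
 case (Suc k)
 show ?case
 proof (cases "hit_time B (Suc k) x")
  case (enat n)
  then have "hit_time B k x < enat n" unfolding hit_time_Suc_eq_enat by blast
  with Suc have "enat k < enat n" by (rule le_less_trans)
  then show ?thesis using enat by simp
 qed simp
qed (simp add: zero_enat_def)

text \<open>The definition recurses at the last hit, whereas conditioning and the induced map work
  from the earliest one; this is the passage between the two.\<close>

lemma hit_time_first:
 "hit_time B (Suc k) x =
  (case hit_time B 1 x of enat r \<Rightarrow> enat r + hit_time B k (sh r x) | \<infinity> \<Rightarrow> \<infinity>)"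
proof (induction k)
 case 0
 show ?case
  by (simp only: One_nat_def hit_time.simps(1) add_0_right) (simp del: hit_time.simps split: enat.split)
next
 case (Suc k)
 show ?case
 proof (cases "hit_time B 1 x")
  case (enat r)
  then have IH: "hit_time B (Suc k) x = enat r + hit_time B k (sh r x)"
   using Suc by simp
  show ?thesis
  proof (cases "hit_time B (Suc k) (sh r x)")
   case (enat n)
   then have n: "hit_time B k (sh r x) < enat n" "sh n (sh r x) \<in> B"
    "\<And>m. hit_time B k (sh r x) < enat m \<Longrightarrow> sh m (sh r x) \<in> B \<Longrightarrow> n \<le> m"
    unfolding hit_time_Suc_eq_enat by auto
   obtain j where j: "hit_time B k (sh r x) = enat j" "j < n"
    using n(1) by (cases "hit_time B k (sh r x)") auto
   have comp: "sh m (sh r x) = sh ((r + m)) x" for m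
    by (simp add: funpow_lshift add_ac)
   have "hit_time B (Suc (Suc k)) x = enat (r + n)"
    unfolding hit_time_Suc_eq_enat[of B "Suc k"] IH j
   proof (intro conjI allI impI)
    show "enat r + enat j < enat (r + n)" using j by simp
    show "sh ((r + n)) x \<in> B" using n(2) by (simp only: comp)
    fix m assume m: "enat r + enat j < enat m \<and> sh m x \<in> B"
    then have "r + j < m" by simp
    moreover have "n \<le> m - r" using \<open>r + j < m\<close> n(3)[of "m - r"] m j by (simp add: comp)
    ultimately show "r + n \<le> m" by simp
   qed
   then show ?thesis using \<open>hit_time B 1 x = enat r\<close> enat by simp
  next
   case infinity
   have "hit_time B (Suc (Suc k)) x = \<infinity>"
    unfolding hit_time_Suc_eq_infinity[of B "Suc k"] IH
   proof (intro allI notI)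
    fix m assume m: "enat r + hit_time B k (sh r x) < enat m \<and> sh m x \<in> B"
    then obtain j where j: "hit_time B k (sh r x) = enat j" "r + j < m"
     by (cases "hit_time B k (sh r x)") auto
    have "sh ((m - r)) (sh r x) = sh m x"
     using j by (simp add: funpow_lshift)
    then show False
     using infinity[unfolded hit_time_Suc_eq_infinity, rule_format, of "m - r"] m j by auto
   qed
   then show ?thesis using \<open>hit_time B 1 x = enat r\<close> infinity by simp
  qed
 next
  case infinity
  then have "hit_time B (Suc k) x = \<infinity>" using Suc by simp
  then have "hit_time B (Suc (Suc k)) x = \<infinity>"
   unfolding hit_time_Suc_eq_infinity[of B "Suc k"] by simp
  then show ?thesis using infinity by simp
 qed
qed

locale shift_measure =
 fixes A :: "'v::countable \<Rightarrow> 'v \<Rightarrow> bool" and M :: "'v path measure"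
 assumes sets_M: "sets M = sigma_sets (shift_space A) (range (cyl A))"
begin

lemma space_M: "space M = shift_space A"
proof -
 have "sets M = sets (sigma (shift_space A) (range (cyl A)))"
  by (subst sets_measure_of) (auto simp: sets_M cyl_def)
 then show ?thesis
  by (auto dest: sets_eq_imp_space_eq simp: space_measure_of_conv)
qed

lemma cyl_sets [measurable]: "cyl A w \<in> sets M"
 by (simp add: sets_M sigma_sets.Basic)

lemma determined_sets:
 assumes "determined A j X"
 shows "X \<in> sets M"
 by (subst determined_eq_UN[OF assms]) (intro sets.countable_UN', auto)

lemma measurable_lshift: "lshift \<in> M \<rightarrow>\<^sub>M M"
proof (rule measurable_sigma_sets[OF sets_M])
 show "range (cyl A) \<subseteq> Pow (shift_space A)" by (auto simp: cyl_def)
 show "lshift \<in> space M \<rightarrow> shift_space A"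
  using lshift_in_shift_space by (auto simp: space_M)
 fix Y assume "Y \<in> range (cyl A)"
 then obtain w where "Y = cyl A w" by auto
 then show "lshift -` Y \<inter> space M \<in> sets M"
  using determined_sets[OF determined_vimage[OF determined_cyl, where k = 1]] by (simp add: space_M)
qed

lemma measurable_funpow_lshift [measurable]: "sh k \<in> M \<rightarrow>\<^sub>M M"
proof (induction k)
 case (Suc k)
 then show ?case unfolding funpow.simps by (rule measurable_comp[OF _ measurable_lshift])
qed simp

lemma measurable_hit_time [measurable]:
 assumes [measurable]: "B \<in> sets M"
 shows "hit_time B k \<in> M \<rightarrow>\<^sub>M count_space UNIV"
proof (induction k)
 case (Suc k)
 note Suc [measurable]
 have en: "Measurable.pred M (\<lambda>x. hit_time B (Suc k) x = enat n)" for n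
  unfolding hit_time_Suc_eq_enat by measurable
 have inf: "Measurable.pred M (\<lambda>x. hit_time B (Suc k) x = \<infinity>)"
  unfolding hit_time_Suc_eq_infinity by measurable
 have "hit_time B (Suc k) -` {e} \<inter> space M \<in> sets M" for e
 proof -
  have "hit_time B (Suc k) -` {e} \<inter> space M = {x \<in> space M. hit_time B (Suc k) x = e}" by auto
  then show ?thesis using en inf by (cases e) (simp_all del: hit_time.simps add: pred_def)
 qed
 then show ?case by (subst measurable_count_space_eq2_countable) auto
qed simp

end

subsection \<open>Disintegration over words\<close>

definition scons :: "'v \<Rightarrow> 'v path \<Rightarrow> nat \<Rightarrow> 'v" where
 "scons b y = case_nat b y"

primrec sapp :: "'v list \<Rightarrow> 'v path \<Rightarrow> nat \<Rightarrow> 'v" where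
 "sapp [] y = y"
| "sapp (b # u) y = scons b (sapp u y)"

lemma lshift_scons [simp]: "lshift (scons b y) = y"
 by (auto simp: lshift_def scons_def)

lemma scons_lshift: "scons (x 0) (lshift x) = x"
 by (auto simp: lshift_def scons_def split: nat.split)

lemma sapp_nth: "sapp u y i = (if i < length u then u ! i else y (i - length u))"
 by (induction u arbitrary: i) (auto simp: scons_def split: nat.split)

lemma funpow_sapp [simp]: "sh (length u) (sapp u y) = y"
 by (auto simp: sapp_nth)

lemma scons_in_shift_space: "scons b y \<in> shift_space A \<longleftrightarrow> A b (y 0) \<and> y \<in> shift_space A"
 by (auto simp: shift_space_def scons_def split: nat.split)

lemma sapp_in_shift_space_cong:
 assumes "y \<in> shift_space A" "y' \<in> shift_space A" "y 0 = y' 0"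
 shows "sapp u y \<in> shift_space A \<longleftrightarrow> sapp u y' \<in> shift_space A"
proof (induction u)
 case (Cons b u)
 have "sapp u y 0 = sapp u y' 0" using assms(3) by (auto simp: sapp_nth)
 then show ?case using Cons by (simp add: scons_in_shift_space)
qed (use assms in simp)

lemma agree_sapp: "agree m y y' \<Longrightarrow> agree (length u + m) (sapp u y) (sapp u y')"
 by (auto simp: agree_def sapp_nth)

text \<open>An inadmissible concatenation is replaced by \<open>y\<close> to stay inside the shift
  space; the weights that will multiply it vanish there.\<close>

lemma (in shift_measure) measurable_sapp:
 "(\<lambda>y. if sapp u y \<in> shift_space A then sapp u y else y) \<in> M \<rightarrow>\<^sub>M M"
proof (rule measurable_sigma_sets[OF sets_M])
 show "range (cyl A) \<subseteq> Pow (shift_space A)" by (auto simp: cyl_def)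
 show "(\<lambda>y. if sapp u y \<in> shift_space A then sapp u y else y) \<in> space M \<rightarrow> shift_space A"
  by (auto simp: space_M)
 fix Y assume "Y \<in> range (cyl A)"
 then obtain w where Y: "Y = cyl A w" by auto
 let ?f = "\<lambda>y. if sapp u y \<in> shift_space A then sapp u y else y"
 \<comment> \<open>One coordinate more than \<open>w\<close>: the initial letter of \<open>y\<close>
   decides whether \<open>u\<close> may precede it, even when \<open>w\<close> is empty.\<close>
 have "determined A (length w + 1) (?f -` Y \<inter> shift_space A)"
  unfolding determined_def
 proof (intro conjI ballI impI)
  fix x y assume x: "x \<in> ?f -` Y \<inter> shift_space A" and y: "y \<in> shift_space A"
   and xy: "agree (length w + 1) x y"
  have "sapp u x \<in> shift_space A \<longleftrightarrow> sapp u y \<in> shift_space A"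
   using x y xy by (intro sapp_in_shift_space_cong) (auto simp: agree_def)
  moreover have "agree (length w) (sapp u x) (sapp u y)"
   using agree_sapp[OF xy, of u] agree_mono by fastforce
  moreover have "agree (length w) x y" using xy by (rule agree_mono) simp
  ultimately have "agree (length w) (?f x) (?f y)" "?f y \<in> shift_space A" using y by auto
  moreover have "?f x \<in> cyl A w" using x Y by simp
  ultimately have "?f y \<in> cyl A w" using determinedD[OF determined_cyl] by blast
  then show "y \<in> ?f -` Y \<inter> shift_space A" using y Y by simp
 qed auto
 then show "?f -` Y \<inter> space M \<in> sets M" unfolding space_M by (rule determined_sets)
qed

text \<open>Disintegration of \<open>M\<close> over \<open>k\<close>-cylinders, with a density of bounded oscillation.\<close>

definition word_kernel ::
  "('v::countable \<Rightarrow> 'v \<Rightarrow> bool) \<Rightarrow> 'v path measure \<Rightarrow> (nat \<Rightarrow> real) \<Rightarrow>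
   ('v list \<Rightarrow> 'v path \<Rightarrow> real) \<Rightarrow> bool" where
 "word_kernel A M D \<kappa> \<longleftrightarrow>
  (\<forall>u. \<kappa> u \<in> borel_measurable M) \<and> (\<forall>u. \<forall>y\<in>shift_space A. 0 \<le> \<kappa> u y) \<and>
  (\<forall>u. \<forall>F\<in>borel_measurable M.
   (ncorr M (cyl A u) F (length u)) = (\<integral>\<^sup>+y. ennreal (\<kappa> u y) * F y \<partial>M)) \<and>
  (\<forall>u m y y'. 1 \<le> m \<longrightarrow> y \<in> shift_space A \<longrightarrow> y' \<in> shift_space A \<longrightarrow> agree m y y' \<longrightarrow>
   \<kappa> u y \<le> exp (D m) * \<kappa> u y')"

text \<open>Kernels of words are summed over the words of a set. The oscillation factor is common to
  all words and survives the sum, while the density may become infinite, hence its values in the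
  extended reals.\<close>

definition set_kernel ::
  "('v::countable \<Rightarrow> 'v \<Rightarrow> bool) \<Rightarrow> 'v path measure \<Rightarrow> (nat \<Rightarrow> real) \<Rightarrow> bool" where
 "set_kernel A M D \<longleftrightarrow>
  (\<forall>k X. determined A k X \<longrightarrow> (\<exists>\<kappa>\<in>borel_measurable M.
   (\<forall>F\<in>borel_measurable M.
    (ncorr M X F k) = (\<integral>\<^sup>+y. \<kappa> y * F y \<partial>M)) \<and>
   (\<forall>m y y'. 1 \<le> m \<longrightarrow> y \<in> shift_space A \<longrightarrow> y' \<in> shift_space A \<longrightarrow> agree m y y' \<longrightarrow>
    \<kappa> y \<le> ennreal (exp (D m)) * \<kappa> y')))"

lemma (in shift_measure) word_kernel_imp_set_kernel:
 assumes "word_kernel A M D \<kappa>"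
 shows "set_kernel A M D"
 unfolding set_kernel_def
proof (intro allI impI)
 fix k X assume X: "determined A k X"
 have [measurable]: "\<kappa> u \<in> borel_measurable M" for u
  using assms by (simp add: word_kernel_def)
 have nonneg: "0 \<le> \<kappa> u y" if "y \<in> shift_space A" for u y
  using assms that by (simp add: word_kernel_def)
 define I where "I = {u. length u = k \<and> cyl A u \<subseteq> X}"
 define K where "K y = (\<integral>\<^sup>+u. ennreal (\<kappa> u y) \<partial>count_space I)" for y
 have K_m: "K \<in> borel_measurable M"
 proof -
  interpret sigma_finite_measure "count_space I"
   by (rule sigma_finite_measure_count_space_countable) simp
  have "(\<lambda>(y, u). ennreal (\<kappa> u y)) \<in> borel_measurable (M \<Otimes>\<^sub>M count_space I)"
  proof -
   have "(\<lambda>(u, y). ennreal (\<kappa> u y)) \<in> borel_measurable (count_space I \<Otimes>\<^sub>M M)"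
    by (rule measurable_pair_measure_countable1) auto
   from measurable_compose[OF measurable_pair_swap' this] show ?thesis
    by (simp add: split_beta)
  qed
  then show ?thesis unfolding K_def by (rule borel_measurable_nn_integral)
 qed
 show "\<exists>\<kappa>\<in>borel_measurable M.
   (\<forall>F\<in>borel_measurable M.
    (ncorr M X F k) = (\<integral>\<^sup>+y. \<kappa> y * F y \<partial>M)) \<and>
   (\<forall>m y y'. 1 \<le> m \<longrightarrow> y \<in> shift_space A \<longrightarrow> y' \<in> shift_space A \<longrightarrow> agree m y y' \<longrightarrow>
    \<kappa> y \<le> ennreal (exp (D m)) * \<kappa> y')"
 proof (intro bexI[of _ K] conjI ballI allI impI K_m)
  fix F :: "'v path \<Rightarrow> ennreal" assume F [measurable]: "F \<in> borel_measurable M"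
  have ind: "indicator X x = (\<integral>\<^sup>+u. indicator (cyl A u) x \<partial>count_space I)" for x
  proof (cases "x \<in> X")
   case True
   then obtain u where u: "u \<in> I" "x \<in> cyl A u"
    using determined_eq_UN[OF X] unfolding I_def by blast
   have "x \<notin> cyl A u'" if "u' \<in> I" "u' \<noteq> u" for u'
    using cyl_disjoint[of u' u A] u that by (auto simp: I_def)
   then have "(\<integral>\<^sup>+u. indicator (cyl A u) x \<partial>count_space I) = (\<integral>\<^sup>+u'. indicator {u} u' \<partial>count_space I)"
    using u by (intro nn_integral_cong) (auto simp: indicator_def)
   also have "\<dots> = 1" using u by (simp add: one_ennreal_def)
   finally show ?thesis using True by simp
  next
   case False
   then have "(\<integral>\<^sup>+u. indicator (cyl A u) x \<partial>count_space I) = (\<integral>\<^sup>+u. 0 \<partial>count_space I)"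
    by (intro nn_integral_cong) (auto simp: I_def indicator_def)
   then show ?thesis using False by simp
  qed
  have "ncorr M X F k =
    (\<integral>\<^sup>+x. \<integral>\<^sup>+u. indicator (cyl A u) x * F (sh k x) \<partial>count_space I \<partial>M)"
   unfolding ind by (subst nn_integral_multc) auto
  also have "\<dots> = (\<integral>\<^sup>+u. \<integral>\<^sup>+x. indicator (cyl A u) x * F (sh k x) \<partial>M \<partial>count_space I)"
   by (rule nn_integral_count_space_nn_integral) auto
  also have "\<dots> = (\<integral>\<^sup>+u. \<integral>\<^sup>+y. ennreal (\<kappa> u y) * F y \<partial>M \<partial>count_space I)"
  proof (rule nn_integral_cong)
   fix u assume "u \<in> space (count_space I)"
   then have "length u = k" by (simp add: I_def)
   then show "ncorr M (cyl A u) F k = (\<integral>\<^sup>+y. ennreal (\<kappa> u y) * F y \<partial>M)"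
    using assms F unfolding word_kernel_def by blast
  qed
  also have "\<dots> = (\<integral>\<^sup>+y. \<integral>\<^sup>+u. ennreal (\<kappa> u y) * F y \<partial>count_space I \<partial>M)"
   by (rule nn_integral_count_space_nn_integral[symmetric]) auto
  also have "\<dots> = (\<integral>\<^sup>+y. K y * F y \<partial>M)"
   unfolding K_def by (subst nn_integral_multc) auto
  finally show "ncorr M X F k = (\<integral>\<^sup>+y. K y * F y \<partial>M)" .
 next
  fix m y y' assume m: "1 \<le> m" and y: "y \<in> shift_space A" "y' \<in> shift_space A" "agree m y y'"
  have "K y \<le> (\<integral>\<^sup>+u. ennreal (exp (D m)) * ennreal (\<kappa> u y') \<partial>count_space I)"
   unfolding K_def
   using assms m y nonneg[OF y(2)]
   by (intro nn_integral_mono) (auto simp: word_kernel_def ennreal_mult[symmetric] intro!: ennreal_leI)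
  also have "\<dots> = ennreal (exp (D m)) * K y'"
   unfolding K_def by (rule nn_integral_cmult) simp
  finally show "K y \<le> ennreal (exp (D m)) * K y'" .
 qed
qed

lemma nn_integral_prod_sep:
 fixes c :: ennreal
 assumes [measurable]: "a \<in> borel_measurable M" "b \<in> borel_measurable M"
 shows "(\<integral>\<^sup>+y. \<integral>\<^sup>+y'. c * (a y * b y') \<partial>M \<partial>M) = c * ((\<integral>\<^sup>+y. a y \<partial>M) * (\<integral>\<^sup>+y. b y \<partial>M))"
proof -
 have "(\<integral>\<^sup>+y'. c * (a y * b y') \<partial>M) = c * (a y * (\<integral>\<^sup>+y. b y \<partial>M))" for y
  by (simp add: nn_integral_cmult)
 then show ?thesis by (simp add: nn_integral_cmult nn_integral_multc)
qed

text \<open>The approximate Markov property: what happens after time \<open>j\<close> depends on the past only up to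
 the factor \<open>exp (D m)\<close> once the next \<open>m\<close> symbols are known.\<close>

lemma (in shift_measure) set_kernel_renewal:
 assumes K: "set_kernel A M D" and w: "w \<noteq> []"
  and Y: "determined A (j + length w) Y" "Y \<subseteq> sh j -` cyl A w"
  and F [measurable]: "F \<in> borel_measurable M"
 shows "ncorr M Y F j * emeasure M (cyl A w)
   \<le> ennreal (exp (D (length w))) * (emeasure M Y * ninteg M (cyl A w) F)"
  and "emeasure M Y * ninteg M (cyl A w) F
   \<le> ennreal (exp (D (length w))) * (ncorr M Y F j * emeasure M (cyl A w))"
proof -
 let ?m = "length w" and ?P = "cyl A w"
 \<comment> \<open>The pasts of \<open>Y\<close>. As \<open>Y\<close> is known at time j + length w
   and shows \<open>w\<close> after time j, it is the event that such a past is followed by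
   \<open>w\<close>.\<close>
 define X where "X = {y \<in> shift_space A. \<exists>x\<in>Y. agree j x y}"
 have X: "determined A j X"
  unfolding determined_def X_def using agree_trans by blast
 have Y_eq: "y \<in> Y \<longleftrightarrow> y \<in> X \<and> sh j y \<in> ?P" if ys: "y \<in> shift_space A" for y
 proof
  assume "y \<in> Y"
  then show "y \<in> X \<and> sh j y \<in> ?P"
   using Y ys by (auto simp: X_def agree_def)
 next
  assume "y \<in> X \<and> sh j y \<in> ?P"
  then obtain x where x: "x \<in> Y" "agree j x y" "sh j y \<in> ?P" by (auto simp: X_def)
  then have "sh j x \<in> ?P" using Y by auto
  have "x i = y i" if "i < j + ?m" for i
  proof (cases "i < j")
   case True
   then show ?thesis using x(2) by (simp add: agree_def)
  next
   case False
   then have "i - j < ?m" using that by simp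
   then have "sh j x (i - j) = sh j y (i - j)"
    using \<open>sh j x \<in> ?P\<close> x(3) unfolding cyl_def mem_Collect_eq by metis
   then show ?thesis using False by simp
  qed
  then have "agree (j + ?m) x y" by (simp add: agree_def)
  then show "y \<in> Y" using determinedD[OF Y(1) x(1) ys] by blast
 qed
 obtain \<kappa> where \<kappa> [measurable]: "\<kappa> \<in> borel_measurable M"
  and int: "\<And>F. F \<in> borel_measurable M \<Longrightarrow>
    (ncorr M X F j) = (\<integral>\<^sup>+y. \<kappa> y * F y \<partial>M)"
  and osc: "\<And>y y'. y \<in> shift_space A \<Longrightarrow> y' \<in> shift_space A \<Longrightarrow> agree ?m y y' \<Longrightarrow>
    \<kappa> y \<le> ennreal (exp (D ?m)) * \<kappa> y'"
 proof -
  have "1 \<le> ?m" using w by (cases w) auto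
  then show thesis using K[unfolded set_kernel_def, rule_format, OF X] that by blast
 qed
 have oscP: "\<kappa> y \<le> ennreal (exp (D ?m)) * \<kappa> y'" if "y \<in> ?P" "y' \<in> ?P" for y y'
  using that by (intro osc) (auto simp: cyl_def agree_def)
 have Y_int: "ncorr M Y G j = (\<integral>\<^sup>+y. \<kappa> y * (indicator ?P y * G y) \<partial>M)"
  if [measurable]: "G \<in> borel_measurable M" for G
 proof -
  have "ncorr M Y G j =
    (\<integral>\<^sup>+x. indicator X x * (indicator ?P (sh j x) * G (sh j x)) \<partial>M)"
   using Y_eq by (intro nn_integral_cong) (auto simp: indicator_def space_M)
  also have "\<dots> = (\<integral>\<^sup>+y. \<kappa> y * (indicator ?P y * G y) \<partial>M)"
   by (rule int) measurable
  finally show ?thesis .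
 qed
 have [measurable]: "Y \<in> sets M" by (rule determined_sets[OF Y(1)])
 have MY: "emeasure M Y = (\<integral>\<^sup>+y. \<kappa> y * indicator ?P y \<partial>M)"
  using Y_int[of "\<lambda>_. 1"] by simp
 have MP: "emeasure M ?P = (\<integral>\<^sup>+y. indicator ?P y \<partial>M)" by simp
 show "ncorr M Y F j * emeasure M ?P
   \<le> ennreal (exp (D ?m)) * (emeasure M Y * ninteg M ?P F)"
 proof -
  \<comment> \<open>Written as a double integral over two points of the cylinder, the product lets
    the kernel move from one point to the other at the cost of the oscillation factor.\<close>
  have "ncorr M Y F j * emeasure M ?P =
    (\<integral>\<^sup>+y. \<integral>\<^sup>+y'. (\<kappa> y * (indicator ?P y * F y)) * indicator ?P y' \<partial>M \<partial>M)"
   unfolding Y_int[OF F] MP by (subst nn_integral_multc[symmetric]) (auto simp: nn_integral_cmult)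
  also have "\<dots> \<le> (\<integral>\<^sup>+y. \<integral>\<^sup>+y'. ennreal (exp (D ?m)) * ((indicator ?P y * F y) * (\<kappa> y' * indicator ?P y')) \<partial>M \<partial>M)"
  proof (intro nn_integral_mono)
   fix y y'
   show "(\<kappa> y * (indicator ?P y * F y)) * indicator ?P y' \<le>
     ennreal (exp (D ?m)) * ((indicator ?P y * F y) * (\<kappa> y' * indicator ?P y'))"
    using mult_right_mono[OF oscP[of y y'], of "F y"] by (auto simp: indicator_def ac_simps)
  qed
  also have "\<dots> = ennreal (exp (D ?m)) * (emeasure M Y * ninteg M ?P F)"
   unfolding MY by (subst nn_integral_prod_sep) (auto simp: mult.commute)
  finally show ?thesis .
 qed
 show "emeasure M Y * ninteg M ?P F
   \<le> ennreal (exp (D ?m)) * (ncorr M Y F j * emeasure M ?P)"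
 proof -
  have "emeasure M Y * ninteg M ?P F =
    (\<integral>\<^sup>+y. \<integral>\<^sup>+y'. (\<kappa> y * indicator ?P y) * (indicator ?P y' * F y') \<partial>M \<partial>M)"
   unfolding MY by (subst nn_integral_multc[symmetric]) (auto simp: nn_integral_cmult)
  also have "\<dots> \<le> (\<integral>\<^sup>+y. \<integral>\<^sup>+y'. ennreal (exp (D ?m)) * (indicator ?P y * (\<kappa> y' * (indicator ?P y' * F y'))) \<partial>M \<partial>M)"
  proof (intro nn_integral_mono)
   fix y y'
   show "(\<kappa> y * indicator ?P y) * (indicator ?P y' * F y') \<le>
     ennreal (exp (D ?m)) * (indicator ?P y * (\<kappa> y' * (indicator ?P y' * F y')))"
    using mult_right_mono[OF oscP[of y y'], of "F y'"] by (auto simp: indicator_def ac_simps)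
  qed
  also have "\<dots> = ennreal (exp (D ?m)) * (ncorr M Y F j * emeasure M ?P)"
   unfolding Y_int[OF F] MP by (subst nn_integral_prod_sep) (auto simp: mult.commute)
  finally show ?thesis .
 qed
qed

subsection \<open>The topology of the shift\<close>

lemma shift_dist_le:
 assumes "0 < \<eta>" "\<eta> < 1" "agree n x y"
 shows "shift_dist \<eta> x y \<le> \<eta> ^ n"
proof (cases "x = y")
 case False
 define l where "l = (LEAST n. x n \<noteq> y n)"
 have "x l \<noteq> y l" unfolding l_def by (rule LeastI_ex) (use False in auto)
 then have "n \<le> l" using assms(3) by (auto simp: agree_def not_le[symmetric])
 then show ?thesis using False assms by (simp add: shift_dist_def l_def[symmetric] power_decreasing)
qed (use assms in "simp add: shift_dist_def")

lemma agree_of_shift_dist: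
 assumes "0 < \<eta>" "\<eta> < 1" "shift_dist \<eta> x y < \<eta> ^ n"
 shows "agree n x y"
proof (cases "x = y")
 case False
 define l where "l = (LEAST n. x n \<noteq> y n)"
 have "\<eta> ^ l < \<eta> ^ n" using assms(3) False by (simp add: shift_dist_def l_def)
 then have "n < l" using power_decreasing[of l n \<eta>] assms by (auto simp: not_less[symmetric])
 then show ?thesis
  unfolding agree_def l_def using not_less_Least less_trans by blast
qed (simp add: agree_def)

lemma openin_shift_topology:
 assumes \<eta>: "0 < \<eta>" "\<eta> < 1"
 shows "openin (shift_topology \<eta> A) U \<longleftrightarrow>
  U \<subseteq> shift_space A \<and> (\<forall>x\<in>U. \<exists>n. cyl A (map x [0..<n]) \<subseteq> U)"
proof -
 interpret Metric_space "shift_space A" "shift_dist \<eta>"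
  by (rule Metric_space_shift[OF \<eta>])
 have "(\<exists>r>0. mball x r \<subseteq> U) \<longleftrightarrow> (\<exists>n. cyl A (map x [0..<n]) \<subseteq> U)" if x: "x \<in> shift_space A" for x
 proof
  assume "\<exists>r>0. mball x r \<subseteq> U"
  then obtain r where r: "0 < r" "mball x r \<subseteq> U" by auto
  obtain n where n: "\<eta> ^ n < r" using real_arch_pow_inv[OF r(1) \<eta>(2)] by auto
  have "cyl A (map x [0..<n]) \<subseteq> mball x r"
   unfolding cyl_eq_Collect[OF x] in_mball subset_eq
   using shift_dist_le[OF \<eta>, of n x] n x by fastforce
  then show "\<exists>n. cyl A (map x [0..<n]) \<subseteq> U" using r(2) by blast
 next
  assume "\<exists>n. cyl A (map x [0..<n]) \<subseteq> U"
  then obtain n where n: "cyl A (map x [0..<n]) \<subseteq> U" by auto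
  have "mball x (\<eta> ^ n) \<subseteq> cyl A (map x [0..<n])"
   unfolding cyl_eq_Collect[OF x] using agree_of_shift_dist[OF \<eta>] by auto
  then show "\<exists>r>0. mball x r \<subseteq> U" using n \<eta> by (intro exI[of _ "\<eta> ^ n"]) auto
 qed
 then show ?thesis
  unfolding shift_topology_def openin_mtopology by blast
qed

text \<open>There are only countably many words, so every open set is a countable union of
  cylinders.\<close>

lemma sets_borel_of_shift:
 fixes A :: "'v::countable \<Rightarrow> 'v \<Rightarrow> bool"
 assumes \<eta>: "0 < \<eta>" "\<eta> < 1"
 shows "sets (borel_of (shift_topology \<eta> A)) = sigma_sets (shift_space A) (range (cyl A))"
 unfolding sets_borel_of topspace_shift_topology[OF \<eta>]
proof (rule sigma_sets_eqI)
 fix U assume "U \<in> {U. openin (shift_topology \<eta> A) U}"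
 then have U: "U \<subseteq> shift_space A" "\<And>x. x \<in> U \<Longrightarrow> \<exists>n. cyl A (map x [0..<n]) \<subseteq> U"
  by (auto simp: openin_shift_topology[OF \<eta>])
 have "U = (\<Union>w\<in>{w. cyl A w \<subseteq> U}. cyl A w)"
 proof (intro equalityI subsetI)
  fix x assume "x \<in> U"
  then obtain n where "cyl A (map x [0..<n]) \<subseteq> U" using U(2) by blast
  moreover have "x \<in> cyl A (map x [0..<n])" using \<open>x \<in> U\<close> U(1) mem_cyl_prefix by blast
  ultimately show "x \<in> (\<Union>w\<in>{w. cyl A w \<subseteq> U}. cyl A w)" by blast
 qed auto
 also have "\<dots> \<in> sigma_sets (shift_space A) (range (cyl A))"
  by (rule sigma_sets_UNION) auto
 finally show "U \<in> sigma_sets (shift_space A) (range (cyl A))" .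
next
 fix Y assume "Y \<in> range (cyl A)"
 then obtain w where Y: "Y = cyl A w" by auto
 have "openin (shift_topology \<eta> A) Y"
  unfolding openin_shift_topology[OF \<eta>] Y using cyl_prefix_eq cyl_subset by blast
 then show "Y \<in> sigma_sets (shift_space A) {U. openin (shift_topology \<eta> A) U}"
  by (intro sigma_sets.Basic) simp
qed

subsection \<open>Walters variation bounds\<close>

definition walters_bound :: "('v \<Rightarrow> 'v \<Rightarrow> bool) \<Rightarrow> ('v path \<Rightarrow> real) \<Rightarrow> nat \<Rightarrow> real" where
 "walters_bound A \<phi> m = enn2real (walters_sup A \<phi> m)"

lemma walters_bound_nonneg: "0 \<le> walters_bound A \<phi> m"
 by (simp add: walters_bound_def)

lemma walters_bound_tendsto:
 assumes "walters A \<phi>"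
 shows "walters_bound A \<phi> \<longlonglongrightarrow> 0"
 unfolding walters_bound_def using assms by (intro tendsto_enn2real) (auto simp: walters_def)

lemma birkhoff_variation:
 assumes w: "walters A \<phi>" and m: "1 \<le> m"
  and x: "x \<in> shift_space A" "y \<in> shift_space A" "agree (n + m) x y"
 shows "birkhoff_sum \<phi> n x \<le> birkhoff_sum \<phi> n y + walters_bound A \<phi> m"
proof (cases "n = 0")
 case True
 then show ?thesis using walters_bound_nonneg by (simp add: birkhoff_sum_def)
next
 case False
 have "ennreal \<bar>birkhoff_sum \<phi> n x - birkhoff_sum \<phi> n y\<bar> \<le> variation A (n + m) (birkhoff_sum \<phi> n)"
  unfolding variation_def by (rule SUP_upper2[of "(x, y)"]) (use x in "auto simp: agree_def")
 also have "\<dots> \<le> walters_sup A \<phi> m"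
  unfolding walters_sup_def by (rule SUP_upper) (use False in auto)
 also have "walters_sup A \<phi> m = ennreal (walters_bound A \<phi> m)"
  using w m by (simp add: walters_def walters_bound_def)
 finally have "\<bar>birkhoff_sum \<phi> n x - birkhoff_sum \<phi> n y\<bar> \<le> walters_bound A \<phi> m"
  by (simp add: walters_bound_nonneg)
 then show ?thesis by linarith
qed

lemma birkhoff_sum_Suc: "birkhoff_sum \<phi> (Suc n) x = \<phi> x + birkhoff_sum \<phi> n (lshift x)"
 unfolding birkhoff_sum_def by (subst sum.lessThan_Suc_shift) (simp add: funpow_lshift_lshift)

subsection \<open>The conformal measure\<close>

locale conformal_measure = shift_measure A M
 for A :: "'v::countable \<Rightarrow> 'v \<Rightarrow> bool" and M :: "'v path measure" +
 fixes \<phi> :: "'v path \<Rightarrow> real" and l :: real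
 assumes \<phi>_meas [measurable]: "\<phi> \<in> borel_measurable M" and l_pos: "0 < l"
  and dual: "\<And>f. f \<in> borel_measurable M \<Longrightarrow> (\<integral>\<^sup>+x. ruelle_op A \<phi> f x \<partial>M) = ennreal l * (\<integral>\<^sup>+x. f x \<partial>M)"
begin

text \<open>The Jacobian of the inverse branch given by \<open>u\<close>: the density with respect
  to \<open>M\<close> of the image, under the shift by \<open>length u\<close>, of \<open>M\<close>
  restricted to the cylinder of \<open>u\<close>.\<close>

definition weight :: "'v list \<Rightarrow> 'v path \<Rightarrow> real" where
 "weight u y = (if sapp u y \<in> shift_space A
   then exp (birkhoff_sum \<phi> (length u) (sapp u y)) / l ^ length u else 0)"

lemma measurable_sapp_comp:
 assumes [measurable]: "f \<in> borel_measurable M"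
 shows "(\<lambda>y. if sapp u y \<in> shift_space A then f (sapp u y) else (0 :: 'b :: {second_countable_topology, t2_space, zero})) \<in> borel_measurable M"
proof -
 let ?R = "\<lambda>y. if sapp u y \<in> shift_space A then sapp u y else y"
 have "determined A 1 {y \<in> shift_space A. sapp u y \<in> shift_space A}"
  unfolding determined_def
 proof (intro conjI ballI impI)
  fix x y assume "x \<in> {y \<in> shift_space A. sapp u y \<in> shift_space A}" "y \<in> shift_space A" "agree 1 x y"
  then show "y \<in> {y \<in> shift_space A. sapp u y \<in> shift_space A}"
   using sapp_in_shift_space_cong[of x A y u] by (auto simp: agree_def)
 qed auto
 then have "{y \<in> space M. sapp u y \<in> shift_space A} \<in> sets M"
  unfolding space_M by (rule determined_sets)
 then have [measurable]: "Measurable.pred M (\<lambda>y. sapp u y \<in> shift_space A)"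
  by (simp add: pred_def)
 have "(\<lambda>y. f (?R y)) \<in> borel_measurable M"
  by (rule measurable_compose[OF measurable_sapp assms])
 then have "(\<lambda>y. if sapp u y \<in> shift_space A then f (?R y) else 0) \<in> borel_measurable M"
  by measurable
 then show ?thesis by (rule measurable_cong[THEN iffD1, rotated]) auto
qed

lemma birkhoff_sum_measurable [measurable]: "birkhoff_sum \<phi> n \<in> borel_measurable M"
 unfolding birkhoff_sum_def[abs_def]
 by (intro borel_measurable_sum measurable_compose[OF measurable_funpow_lshift \<phi>_meas])

lemma weight_measurable [measurable]: "weight u \<in> borel_measurable M"
 unfolding weight_def[abs_def] by (rule measurable_sapp_comp) measurable

lemma weight_nonneg: "0 \<le> weight u y"
 using l_pos by (simp add: weight_def)

lemma weight_measurable_comp: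
 assumes f [measurable]: "f \<in> borel_measurable M"
 shows "(\<lambda>y. ennreal (weight u y) * f (sapp u y)) \<in> borel_measurable M"
proof -
 have "(\<lambda>y. ennreal (weight u y) * (if sapp u y \<in> shift_space A then f (sapp u y) else 0)) \<in> borel_measurable M"
  using measurable_sapp_comp[OF f, of u] by measurable
 then show ?thesis by (rule measurable_cong[THEN iffD1, rotated]) (auto simp: weight_def)
qed

lemma ruelle_op_cyl:
 assumes y: "y \<in> shift_space A"
 shows "ruelle_op A \<phi> (\<lambda>x. indicator (cyl A (b # u)) x * f x) y =
  (if scons b y \<in> shift_space A then ennreal (exp (\<phi> (scons b y))) * (indicator (cyl A u) y * f (scons b y)) else 0)"
proof (cases "scons b y \<in> shift_space A")
 case True
 have "scons b y \<in> cyl A (b # u) \<longleftrightarrow> y \<in> cyl A u"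
  using True y by (auto simp: cyl_def scons_def less_Suc_eq_0_disj)
 moreover have "ruelle_op A \<phi> (\<lambda>x. indicator (cyl A (b # u)) x * f x) y =
   (\<Sum>\<^sub>\<infinity>x\<in>{scons b y}. ennreal (exp (\<phi> x)) * (indicator (cyl A (b # u)) x * f x))"
  unfolding ruelle_op_def
 proof (rule infsum_cong_neutral)
  fix x assume "x \<in> {x \<in> shift_space A. lshift x = y} - {scons b y}"
  then have "x 0 \<noteq> b" using scons_lshift[of x] by auto
  then show "ennreal (exp (\<phi> x)) * (indicator (cyl A (b # u)) x * f x) = 0"
   by (auto simp: cyl_def indicator_def)
 qed (use True in auto)
 ultimately show ?thesis using True by (auto simp: indicator_def)
next
 case False
 have "ruelle_op A \<phi> (\<lambda>x. indicator (cyl A (b # u)) x * f x) y =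
   (\<Sum>\<^sub>\<infinity>x\<in>{x \<in> shift_space A. lshift x = y}. 0)"
  unfolding ruelle_op_def
 proof (rule infsum_cong)
  fix x assume "x \<in> {x \<in> shift_space A. lshift x = y}"
  then have "x 0 \<noteq> b" using scons_lshift[of x] False by auto
  then show "ennreal (exp (\<phi> x)) * (indicator (cyl A (b # u)) x * f x) = 0"
   by (auto simp: cyl_def indicator_def)
 qed
 then show ?thesis using False by simp
qed

text \<open>Each use of the dual equation strips one letter, because restriction to a cylinder
  leaves a single term of the transfer sum.\<close>

lemma integral_cyl:
 assumes "f \<in> borel_measurable M"
 shows "ninteg M (cyl A u) f = (\<integral>\<^sup>+y. ennreal (weight u y) * f (sapp u y) \<partial>M)"
 using assms
proof (induction u arbitrary: f)
 case Nil
 then show ?case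
  by (intro nn_integral_cong) (auto simp: weight_def birkhoff_sum_def space_M cyl_def indicator_def)
next
 case (Cons b u)
 note Cons.prems [measurable]
 define g where "g y = (if scons b y \<in> shift_space A then ennreal (exp (\<phi> (scons b y))) * f (scons b y) else 0)" for y
 have g [measurable]: "g \<in> borel_measurable M"
  using measurable_sapp_comp[of "\<lambda>x. ennreal (exp (\<phi> x)) * f x" "[b]"] by (simp add: g_def[abs_def] cong: if_cong)
 have "ennreal l * ninteg M (cyl A (b # u)) f =
   (\<integral>\<^sup>+y. ruelle_op A \<phi> (\<lambda>x. indicator (cyl A (b # u)) x * f x) y \<partial>M)"
  by (rule dual[symmetric]) measurable
 also have "\<dots> = ninteg M (cyl A u) g"
  by (intro nn_integral_cong) (simp only: space_M ruelle_op_cyl, auto simp: g_def ac_simps)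
 also have "\<dots> = (\<integral>\<^sup>+y. ennreal (weight u y) * g (sapp u y) \<partial>M)"
  by (rule Cons.IH[OF g])
 also have "\<dots> = (\<integral>\<^sup>+y. ennreal l * (ennreal (weight (b # u) y) * f (sapp (b # u) y)) \<partial>M)"
 proof (intro nn_integral_cong)
  fix y
  show "ennreal (weight u y) * g (sapp u y) = ennreal l * (ennreal (weight (b # u) y) * f (sapp (b # u) y))"
  proof (cases "scons b (sapp u y) \<in> shift_space A")
   case True
   then have "sapp u y \<in> shift_space A" by (simp add: scons_in_shift_space)
   then have "weight u y * exp (\<phi> (scons b (sapp u y))) = l * weight (b # u) y"
    using True l_pos by (simp add: weight_def birkhoff_sum_Suc exp_add)
   then have "ennreal (weight u y) * ennreal (exp (\<phi> (scons b (sapp u y)))) = ennreal l * ennreal (weight (b # u) y)"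
    using l_pos by (simp add: ennreal_mult[symmetric] weight_nonneg)
   then show ?thesis using True by (simp add: g_def mult.assoc[symmetric])
  qed (simp add: g_def weight_def)
 qed
 also have "\<dots> = ennreal l * (\<integral>\<^sup>+y. ennreal (weight (b # u) y) * f (sapp (b # u) y) \<partial>M)"
  by (rule nn_integral_cmult) (rule weight_measurable_comp, measurable)
 finally have eq: "ennreal l * ninteg M (cyl A (b # u)) f =
   ennreal l * (\<integral>\<^sup>+y. ennreal (weight (b # u) y) * f (sapp (b # u) y) \<partial>M)" .
 then show ?case
  using l_pos by (simp add: ennreal_mult_cancel_left)
qed

lemma weight_distortion:
 assumes w: "walters A \<phi>" and m: "1 \<le> m"
  and y: "y \<in> shift_space A" "y' \<in> shift_space A" "agree m y y'"
 shows "weight u y \<le> exp (walters_bound A \<phi> m) * weight u y'"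
proof (cases "sapp u y \<in> shift_space A")
 case True
 have "y 0 = y' 0" using y(3) m by (auto simp: agree_def)
 then have y': "sapp u y' \<in> shift_space A" using sapp_in_shift_space_cong[OF y(1,2)] True by simp
 have "birkhoff_sum \<phi> (length u) (sapp u y) \<le> birkhoff_sum \<phi> (length u) (sapp u y') + walters_bound A \<phi> m"
  by (rule birkhoff_variation[OF w m True y' agree_sapp[OF y(3)]])
 then have "exp (birkhoff_sum \<phi> (length u) (sapp u y)) \<le>
   exp (walters_bound A \<phi> m) * exp (birkhoff_sum \<phi> (length u) (sapp u y'))"
  by (simp add: exp_add[symmetric] add.commute)
 then show ?thesis using True y' l_pos by (simp add: weight_def divide_right_mono)
qed (simp add: weight_def weight_nonneg[unfolded weight_def] l_pos less_imp_le)

lemma word_kernel_conformal: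
 assumes "walters A \<phi>"
 shows "word_kernel A M (walters_bound A \<phi>) weight"
 unfolding word_kernel_def
 using weight_distortion[OF assms] weight_nonneg
  integral_cyl[OF measurable_compose[OF measurable_funpow_lshift]] by simp

text \<open>The factor 3 counts three distortions: of the weight, of \<open>h\<close> at the
  prefixed point, and of \<open>h\<close> at the point itself, which stands in the
  denominator.\<close>

lemma word_kernel_density:
 assumes w: "walters A \<phi>"
  and h [measurable]: "h \<in> borel_measurable M" and h_pos: "\<And>x. x \<in> shift_space A \<Longrightarrow> 0 < h x"
  and h_reg: "\<And>m x y. 1 \<le> m \<Longrightarrow> x \<in> shift_space A \<Longrightarrow> y \<in> shift_space A \<Longrightarrow> agree m x y \<Longrightarrow>
    h x \<le> exp (walters_bound A \<phi> m) * h y"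
 shows "word_kernel A (density M (\<lambda>x. ennreal (h x))) (\<lambda>m. 3 * walters_bound A \<phi> m)
  (\<lambda>u y. weight u y * h (sapp u y) / h y)"
proof -
 have meas: "(\<lambda>y. weight u y * h (sapp u y) / h y) \<in> borel_measurable M" for u
 proof -
  have "(\<lambda>y. weight u y * (if sapp u y \<in> shift_space A then h (sapp u y) else 0) / h y) \<in> borel_measurable M"
   using measurable_sapp_comp[OF h, of u] by measurable
  then show ?thesis by (rule measurable_cong[THEN iffD1, rotated]) (auto simp: weight_def)
 qed
 have nonneg: "0 \<le> weight u y * h (sapp u y)" for u y
 proof (cases "sapp u y \<in> shift_space A")
  case True
  then show ?thesis by (intro mult_nonneg_nonneg weight_nonneg less_imp_le[OF h_pos])
 qed (simp add: weight_def)
 show ?thesis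
  unfolding word_kernel_def
 proof (intro conjI allI ballI impI)
  fix u
  show "(\<lambda>y. weight u y * h (sapp u y) / h y) \<in> borel_measurable (density M (\<lambda>x. ennreal (h x)))"
   using meas by simp
  show "0 \<le> weight u y * h (sapp u y) / h y" if "y \<in> shift_space A" for y
   using nonneg h_pos[OF that] by simp
 next
  fix u and F :: "'v path \<Rightarrow> ennreal"
  assume "F \<in> borel_measurable (density M (\<lambda>x. ennreal (h x)))"
  then have F [measurable]: "F \<in> borel_measurable M" by simp
  have "(\<integral>\<^sup>+x. indicator (cyl A u) x * F (sh (length u) x) \<partial>density M (\<lambda>x. ennreal (h x))) =
    (\<integral>\<^sup>+x. indicator (cyl A u) x * (ennreal (h x) * F (sh (length u) x)) \<partial>M)"
   by (subst nn_integral_density) (auto simp: ac_simps)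
  also have "\<dots> = (\<integral>\<^sup>+y. ennreal (weight u y) * (ennreal (h (sapp u y)) * F y) \<partial>M)"
   by (subst integral_cyl) auto
  also have "\<dots> = (\<integral>\<^sup>+y. ennreal (h y) * (ennreal (weight u y * h (sapp u y) / h y) * F y) \<partial>M)"
  proof (rule nn_integral_cong)
   fix y assume "y \<in> space M"
   then have y: "0 < h y" using h_pos by (simp add: space_M)
   have "ennreal (weight u y) * ennreal (h (sapp u y)) = ennreal (weight u y * h (sapp u y))"
   proof (cases "sapp u y \<in> shift_space A")
    case True
    then show ?thesis using weight_nonneg h_pos by (simp add: ennreal_mult less_imp_le)
   qed (simp add: weight_def)
   also have "\<dots> = ennreal (h y) * ennreal (weight u y * h (sapp u y) / h y)"
    using y nonneg by (simp add: ennreal_mult[symmetric])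
   finally show "ennreal (weight u y) * (ennreal (h (sapp u y)) * F y) =
     ennreal (h y) * (ennreal (weight u y * h (sapp u y) / h y) * F y)"
    by (simp add: mult.assoc[symmetric])
  qed
  also have "\<dots> = (\<integral>\<^sup>+y. ennreal (weight u y * h (sapp u y) / h y) * F y \<partial>density M (\<lambda>x. ennreal (h x)))"
   using meas[of u] by (subst nn_integral_density) auto
  finally show "(\<integral>\<^sup>+x. indicator (cyl A u) x * F (sh (length u) x) \<partial>density M (\<lambda>x. ennreal (h x))) =
    (\<integral>\<^sup>+y. ennreal (weight u y * h (sapp u y) / h y) * F y \<partial>density M (\<lambda>x. ennreal (h x)))" .
 next
  fix u m and y y' :: "nat \<Rightarrow> 'v"
  assume m: "1 \<le> m" and y: "y \<in> shift_space A" "y' \<in> shift_space A" "agree m y y'"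
  let ?E = "exp (walters_bound A \<phi> m)"
  show "weight u y * h (sapp u y) / h y \<le> exp (3 * walters_bound A \<phi> m) * (weight u y' * h (sapp u y') / h y')"
  proof (cases "sapp u y \<in> shift_space A")
   case True
   have "y 0 = y' 0" using y(3) m by (auto simp: agree_def)
   then have y': "sapp u y' \<in> shift_space A" using sapp_in_shift_space_cong[OF y(1,2)] True by simp
   have ag: "agree m (sapp u y) (sapp u y')" by (rule agree_mono[OF agree_sapp[OF y(3)]]) simp
   have 1: "weight u y \<le> ?E * weight u y'" by (rule weight_distortion[OF w m y])
   have 2: "h (sapp u y) \<le> ?E * h (sapp u y')" by (rule h_reg[OF m True y' ag])
   have 3: "1 / h y \<le> ?E * (1 / h y')"
    using h_reg[OF m y(2,1) agree_sym[OF y(3)]] h_pos[OF y(1)] h_pos[OF y(2)] by (simp add: field_simps)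
   have "weight u y * h (sapp u y) * (1 / h y) \<le> (?E * weight u y') * (?E * h (sapp u y')) * (?E * (1 / h y'))"
    by (intro mult_mono 1 2 3) (use weight_nonneg h_pos True y' y in "auto simp: less_imp_le intro!: mult_nonneg_nonneg")
   moreover have "exp (3 * walters_bound A \<phi> m) = ?E * ?E * ?E"
    by (simp add: exp_add[symmetric])
   ultimately show ?thesis by (simp add: ac_simps)
  next
   case False
   then show ?thesis using nonneg[of u y'] h_pos[OF y(2)] by (simp add: weight_def)
  qed
 qed
qed

end

subsection \<open>The transfer operator\<close>

locale invariant_measure = shift_measure A M + sigma_finite_measure M
 for A :: "'v::countable \<Rightarrow> 'v \<Rightarrow> bool" and M :: "'v path measure" +
 assumes invariant: "distr M M lshift = M"
begin

lemma nn_integral_lshift: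
 assumes [measurable]: "F \<in> borel_measurable M"
 shows "(\<integral>\<^sup>+x. F (lshift x) \<partial>M) = (\<integral>\<^sup>+x. F x \<partial>M)"
 using nn_integral_distr[OF measurable_lshift, of F] by (simp add: invariant)

lemma nn_integral_funpow_lshift:
 assumes F: "F \<in> borel_measurable M"
 shows "(\<integral>\<^sup>+x. F (sh k x) \<partial>M) = (\<integral>\<^sup>+x. F x \<partial>M)"
proof (induction k)
 case (Suc k)
 have "(\<integral>\<^sup>+x. F (sh (Suc k) x) \<partial>M) = (\<integral>\<^sup>+x. F (sh k (lshift x)) \<partial>M)"
  by (simp only: funpow_lshift_lshift)
 also have "\<dots> = (\<integral>\<^sup>+x. F (sh k x) \<partial>M)"
  by (rule nn_integral_lshift) (rule measurable_compose[OF measurable_funpow_lshift F])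
 finally show ?case using Suc by simp
qed simp

lemma emeasure_funpow_vimage:
 assumes [measurable]: "E \<in> sets M"
 shows "emeasure M (sh k -` E \<inter> space M) = emeasure M E"
proof -
 have "(\<integral>\<^sup>+x. indicator E (sh k x) \<partial>M) = emeasure M (sh k -` E \<inter> space M)"
 proof -
  have "(\<integral>\<^sup>+x. indicator E (sh k x) \<partial>M) =
    (\<integral>\<^sup>+x. indicator (sh k -` E \<inter> space M) x \<partial>M)"
   by (intro nn_integral_cong) (simp split: split_indicator)
  then show ?thesis by simp
 qed
 then show ?thesis using nn_integral_funpow_lshift[of "indicator E" k] by simp
qed

lemma integrable_density_exists:
 assumes N: "finite_measure N" "absolutely_continuous M N" "sets N = sets M"
 obtains D where "integrable M D" "\<And>x. 0 \<le> D x" "N = density M (\<lambda>x. ennreal (D x))"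
  "(LINT x|M. D x) = measure N (space N)"
proof -
 interpret N: finite_measure N by (rule N)
 obtain D where D [measurable]: "D \<in> borel_measurable M"
  and RN: "AE x in M. RN_deriv M N x = ennreal (D x)" and D0: "\<And>x. 0 \<le> D x"
  by (rule real_RN_deriv[OF N]) (rule that)
 have N_D: "N = density M (\<lambda>x. ennreal (D x))"
  using density_RN_deriv[OF N(2,3)] density_cong[OF _ _ RN] by simp
 have "emeasure N (space N) = (\<integral>\<^sup>+x. ennreal (D x) \<partial>M)"
  unfolding N_D by (simp add: emeasure_density cong: nn_integral_cong)
 then have *: "(\<integral>\<^sup>+x. ennreal (D x) \<partial>M) = ennreal (measure N (space N))"
  by (simp add: N.emeasure_eq_measure)
 then have i: "integrable M D" using D0 by (intro integrableI_nonneg) auto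
 have "(LINT x|M. D x) = measure N (space N)"
  using * D0 by (simp add: nn_integral_eq_integral[OF i] lint_nonneg)
 then show thesis by (rule that[OF i D0 N_D])
qed

text \<open>The shift image of the measure with density \<open>f\<close> is finite and, by
  invariance, absolutely continuous; its Radon-Nikodym density is the transfer image.\<close>

lemma transfer_exists_nonneg:
 fixes f :: "'v path \<Rightarrow> real"
 assumes f: "integrable M f" and nonneg: "\<And>x. 0 \<le> f x"
 shows "\<exists>f'. integrable M f' \<and> (\<forall>g\<in>borel_measurable M. bounded (g ` space M) \<longrightarrow>
   (LINT x|M. f x * g (lshift x)) = (LINT x|M. f' x * g x))"
proof -
 note measurable_lshift [measurable]
 have [measurable]: "f \<in> borel_measurable M" using f by auto
 define N where "N = distr (density M (\<lambda>x. ennreal (f x))) M lshift"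
 have "emeasure (density M (\<lambda>x. ennreal (f x))) (space M) < \<infinity>"
  using f nonneg by (simp add: emeasure_density nn_integral_eq_integral cong: nn_integral_cong)
 then have "emeasure N (space N) < \<infinity>"
  unfolding N_def using measurable_space[OF measurable_lshift]
  by (subst emeasure_distr) (auto simp: Int_absorb1 subset_eq)
 then have "finite_measure N" by (intro finite_measureI) simp
 moreover have "absolutely_continuous M N"
  unfolding absolutely_continuous_def
 proof
  fix E assume E: "E \<in> null_sets M"
  then have [measurable]: "E \<in> sets M" by auto
  have "emeasure M (lshift -` E \<inter> space M) = 0"
   using emeasure_distr[OF measurable_lshift, of E] E by (auto simp: invariant)
  then have "AE x in M. x \<notin> lshift -` E \<inter> space M"
   by (intro AE_not_in) (auto intro: null_setsI)
  then have "(\<integral>\<^sup>+x. ennreal (f x) * indicator (lshift -` E \<inter> space M) x \<partial>M) = (\<integral>\<^sup>+x. 0 \<partial>M)"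
   by (intro nn_integral_cong_AE) (auto elim!: eventually_mono)
  then have "emeasure N E = 0"
   unfolding N_def by (simp add: emeasure_distr emeasure_density)
  then show "E \<in> null_sets N" by (auto simp: N_def intro: null_setsI)
 qed
 moreover have sets_N: "sets N = sets M" by (simp add: N_def)
 ultimately obtain D where D: "integrable M D" and D0: "\<And>x. 0 \<le> D x"
  and N_D: "N = density M (\<lambda>x. ennreal (D x))"
  by (rule integrable_density_exists) (rule that)
 have [measurable]: "D \<in> borel_measurable M" using D by auto
 have "(LINT x|M. f x * g (lshift x)) = (LINT x|M. D x * g x)"
  if [measurable]: "g \<in> borel_measurable M" for g
 proof -
  have "(LINT x|M. f x * g (lshift x)) = (LINT x|(density M (\<lambda>x. ennreal (f x))). g (lshift x))"
   using nonneg by (subst integral_density) auto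
  also have "\<dots> = (LINT x|N. g x)"
   unfolding N_def by (rule integral_distr[symmetric]) auto
  also have "\<dots> = (LINT x|M. D x * g x)"
   unfolding N_D using D0 by (subst integral_density) auto
  finally show ?thesis .
 qed
 then show ?thesis using D by blast
qed

lemma integrable_mult_bounded:
 fixes f g :: "'v path \<Rightarrow> real"
 assumes f: "integrable M f" and g [measurable]: "g \<in> borel_measurable M" and b: "bounded (g ` space M)"
 shows "integrable M (\<lambda>x. f x * g x)"
proof -
 have [measurable]: "f \<in> borel_measurable M" using f by auto
 obtain C where C: "\<And>x. x \<in> space M \<Longrightarrow> \<bar>g x\<bar> \<le> C" using b by (auto simp: bounded_iff)
 show ?thesis
 proof (rule lint_bound)
  show "integrable M (\<lambda>x. C * f x)" using f by simp
  show "AE x in M. norm (f x * g x) \<le> norm (C * f x)"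
  proof (rule AE_I2)
   fix x assume "x \<in> space M"
   then have "\<bar>g x\<bar> \<le> \<bar>C\<bar>" using C[of x] by linarith
   then show "norm (f x * g x) \<le> norm (C * f x)"
    using mult_left_mono[of "\<bar>g x\<bar>" "\<bar>C\<bar>" "\<bar>f x\<bar>"] by (simp add: abs_mult mult.commute)
  qed
 qed measurable
qed

lemma bounded_lshift_image: "bounded (g ` space M) \<Longrightarrow> bounded ((\<lambda>x. g (sh k x)) ` space M)"
 by (rule bounded_subset) (use funpow_lshift_in_shift_space in "auto simp: space_M")

lemma transfer_exists:
 fixes f :: "'v path \<Rightarrow> real"
 assumes f: "integrable M f"
 shows "\<exists>f'. integrable M f' \<and> (\<forall>g\<in>borel_measurable M. bounded (g ` space M) \<longrightarrow>
   (LINT x|M. f x * g (lshift x)) = (LINT x|M. f' x * g x))"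
proof -
 note measurable_lshift [measurable]
 have [measurable]: "f \<in> borel_measurable M" using f by auto
 have p: "integrable M (\<lambda>x. max 0 (f x))" and n: "integrable M (\<lambda>x. max 0 (- f x))"
  using f by auto
 obtain p' where p': "integrable M p'" "\<And>g. g \<in> borel_measurable M \<Longrightarrow> bounded (g ` space M) \<Longrightarrow>
   (LINT x|M. max 0 (f x) * g (lshift x)) = (LINT x|M. p' x * g x)"
  using transfer_exists_nonneg[OF p] by auto
 obtain n' where n': "integrable M n'" "\<And>g. g \<in> borel_measurable M \<Longrightarrow> bounded (g ` space M) \<Longrightarrow>
   (LINT x|M. max 0 (- f x) * g (lshift x)) = (LINT x|M. n' x * g x)"
  using transfer_exists_nonneg[OF n] by auto
 show ?thesis
 proof (intro exI conjI ballI impI)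
  show "integrable M (\<lambda>x. p' x - n' x)" using p' n' by simp
  fix g :: "'v path \<Rightarrow> real" assume g [measurable]: "g \<in> borel_measurable M" and b: "bounded (g ` space M)"
  have gm: "(\<lambda>x. g (lshift x)) \<in> borel_measurable M" by measurable
  have gb: "bounded ((\<lambda>x. g (lshift x)) ` space M)" using bounded_lshift_image[OF b, of 1] by simp
  have "(LINT x|M. f x * g (lshift x)) =
    (LINT x|M. max 0 (f x) * g (lshift x) - max 0 (- f x) * g (lshift x))"
   by (intro lint_cong) (auto simp: max_def algebra_simps)
  also have "\<dots> = (LINT x|M. p' x * g x) - (LINT x|M. n' x * g x)"
   using p'(2)[OF g b] n'(2)[OF g b]
   by (subst lint_diff) (auto intro!: integrable_mult_bounded gm gb p n)
  also have "\<dots> = (LINT x|M. (p' x - n' x) * g x)"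
   unfolding left_diff_distrib
   by (rule lint_diff[symmetric]) (auto intro!: integrable_mult_bounded b p' n')
  finally show "(LINT x|M. f x * g (lshift x)) = (LINT x|M. (p' x - n' x) * g x)" .
 qed
qed

lemma transfer_op:
 assumes "integrable M f"
 shows "integrable M (transfer_op M f)"
  and "g \<in> borel_measurable M \<Longrightarrow> bounded (g ` space M) \<Longrightarrow>
   (LINT x|M. f x * g (lshift x)) = (LINT x|M. transfer_op M f x * g x)"
 using someI_ex[OF transfer_exists[OF assms]] unfolding transfer_op_def by blast+

lemma transfer_op_funpow:
 assumes f: "integrable M f"
 shows "integrable M ((transfer_op M ^^ k) f) \<and>
  (\<forall>g. g \<in> borel_measurable M \<longrightarrow> bounded (g ` space M) \<longrightarrow>
   (LINT x|M. f x * g (sh k x)) = (LINT x|M. (transfer_op M ^^ k) f x * g x))"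
proof (induction k)
 case (Suc k)
 show ?case
 proof (intro conjI allI impI)
  show "integrable M ((transfer_op M ^^ Suc k) f)" using transfer_op(1) Suc by simp
  fix g :: "'v path \<Rightarrow> real" assume g [measurable]: "g \<in> borel_measurable M" and b: "bounded (g ` space M)"
  have gm: "(\<lambda>x. g (lshift x)) \<in> borel_measurable M" by (rule measurable_compose[OF measurable_lshift g])
  have gb: "bounded ((\<lambda>x. g (lshift x)) ` space M)" using bounded_lshift_image[OF b, of 1] by simp
  have "(LINT x|M. f x * g (sh (Suc k) x)) = (LINT x|M. (transfer_op M ^^ k) f x * g (lshift x))"
   unfolding funpow.simps o_apply by (rule conjunct2[OF Suc, rule_format, OF gm gb])
  also have "\<dots> = (LINT x|M. (transfer_op M ^^ Suc k) f x * g x)"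
   using transfer_op(2)[OF conjunct1[OF Suc] g b] by simp
  finally show "(LINT x|M. f x * g (sh (Suc k) x)) = (LINT x|M. (transfer_op M ^^ Suc k) f x * g x)" .
 qed
qed (use f in simp)

text \<open>Pointwise dual ergodicity, integrated over a suitable part of a given set.\<close>

lemma normalizing_good_set:
 fixes f :: "'v path \<Rightarrow> real"
 assumes a: "normalizing_seq M a" and f: "integrable M f"
  and E1 [measurable]: "E1 \<in> sets M" and pos: "0 < emeasure M E1"
 obtains E where "E \<in> sets M" "E \<subseteq> E1" "0 < emeasure M E" "emeasure M E < \<infinity>"
  "(\<lambda>n. 1 / a n * (\<Sum>k<n. LINT x|M. f x * indicator E (sh k x))) \<longlonglongrightarrow>
   (LINT x|M. f x) * measure M E"
proof -
 define c where "c = (LINT x|M. f x)"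
 define G where "G n x = 1 / a n * (\<Sum>k<n. (transfer_op M ^^ k) f x)" for n x
 have [measurable]: "(transfer_op M ^^ k) f \<in> borel_measurable M" for k
  using transfer_op_funpow[OF f] by auto
 have G_m [measurable]: "G n \<in> borel_measurable M" for n unfolding G_def by measurable
 have G_lim: "AE x in M. (\<lambda>n. G n x) \<longlonglongrightarrow> c"
  using a f unfolding normalizing_seq_def G_def c_def by blast
 obtain S :: "nat \<Rightarrow> _" where S: "range S \<subseteq> sets M" "(\<Union>i. S i) = space M"
  "\<And>i. emeasure M (S i) \<noteq> \<infinity>" "incseq S"
  by (rule sigma_finite_incseq) blast
 have [measurable]: "S i \<in> sets M" for i using S(1) by auto
 \<comment> \<open>Convergent averages are bounded, so these sets exhaust \<open>E1\<close> up to a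
   null set. On each of them the averages have an integrable majorant, which allows integration of
   the pointwise limit.\<close>
 define E where "E i = {x \<in> space M. x \<in> E1 \<and> x \<in> S i \<and> (\<forall>n. \<bar>G n x\<bar> \<le> real i)}" for i
 have E_m [measurable]: "E i \<in> sets M" for i unfolding E_def by measurable
 have "\<exists>i. 0 < emeasure M (E i)"
 proof (rule ccontr)
  assume "\<not> (\<exists>i. 0 < emeasure M (E i))"
  then have "emeasure M (\<Union>i. E i) = 0" by (intro emeasure_UN_eq_0) auto
  then have "AE x in M. x \<notin> (\<Union>i. E i)" by (intro AE_not_in null_setsI) auto
  with G_lim have "AE x in M. x \<notin> E1"
  proof eventually_elim
   case (elim x)
   show ?case
   proof
    assume x: "x \<in> E1"
    then have xs: "x \<in> space M" using sets.sets_into_space[OF E1] by auto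
    then obtain i where i: "x \<in> S i" using S(2) by auto
    have "Bseq (\<lambda>n. G n x)" using elim(1) convergent_def convergent_imp_Bseq by blast
    then obtain C where C: "\<And>n. \<bar>G n x\<bar> \<le> C" by (auto simp: Bseq_def)
    define j where "j = max i (nat \<lceil>C\<rceil>)"
    have "x \<in> S j" using i incseqD[OF S(4), of i j] by (auto simp: j_def)
    moreover have "\<bar>G n x\<bar> \<le> real j" for n
     using C[of n] by (auto simp: j_def intro: order_trans[OF _ real_nat_ceiling_ge] order_trans)
    ultimately have "x \<in> E j" using x xs by (simp add: E_def)
    then show False using elim(2) by blast
   qed
  qed
  then have "emeasure M E1 = 0"
   by (subst (asm) AE_iff_measurable[OF E1]) (use sets.sets_into_space[OF E1] in auto)
  then show False using pos by simp
 qed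
 then obtain i where i: "0 < emeasure M (E i)" by auto
 have fin: "emeasure M (E i) < \<infinity>"
 proof -
  have "emeasure M (E i) \<le> emeasure M (S i)" by (intro emeasure_mono) (auto simp: E_def)
  then show ?thesis using S(3)[of i] by (simp add: less_top[symmetric] neq_top_trans)
 qed
 have "(\<lambda>n. LINT x|M. G n x * indicator (E i) x) \<longlonglongrightarrow> (LINT x|M. c * indicator (E i) x)"
 proof (rule integral_dominated_convergence[where w = "\<lambda>x. real i * indicator (E i) x"])
  show "integrable M (\<lambda>x. real i * indicator (E i) x)" using fin by simp
  show "AE x in M. (\<lambda>n. G n x * indicator (E i) x) \<longlonglongrightarrow> c * indicator (E i) x"
   using G_lim by eventually_elim (auto intro!: tendsto_mult)
  show "AE x in M. norm (G n x * indicator (E i) x) \<le> real i * indicator (E i) x" for n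
   by (rule AE_I2) (auto simp: indicator_def E_def)
 qed measurable
 moreover have "(LINT x|M. c * indicator (E i) x) = c * measure M (E i)"
  by simp
 moreover have "(LINT x|M. G n x * indicator (E i) x) =
   1 / a n * (\<Sum>k<n. LINT x|M. f x * indicator (E i) (sh k x))" for n
 proof -
  have b: "bounded ((indicator (E i) :: _ \<Rightarrow> real) ` space M)"
   by (rule boundedI[of _ 1]) auto
  have int: "integrable M (\<lambda>x. (transfer_op M ^^ k) f x * indicator (E i) x)" for k
   by (rule integrable_mult_bounded) (use transfer_op_funpow[OF f] b in auto)
  have "(LINT x|M. G n x * indicator (E i) x) =
    (LINT x|M. 1 / a n * (\<Sum>k<n. (transfer_op M ^^ k) f x * indicator (E i) x))"
   by (simp add: G_def sum_distrib_right)
  also have "\<dots> = 1 / a n * (\<Sum>k<n. LINT x|M. (transfer_op M ^^ k) f x * indicator (E i) x)"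
   using int by (subst integral_mult_right_zero, subst Bochner_Integration.integral_sum) auto
  also have "(\<lambda>k. LINT x|M. (transfer_op M ^^ k) f x * indicator (E i) x) =
    (\<lambda>k. LINT x|M. f x * indicator (E i) (sh k x))"
   using transfer_op_funpow[OF f] b by (intro ext) simp
  finally show ?thesis .
 qed
 ultimately have "(\<lambda>n. 1 / a n * (\<Sum>k<n. LINT x|M. f x * indicator (E i) (sh k x))) \<longlonglongrightarrow> c * measure M (E i)"
  by simp
 then show thesis using i fin unfolding c_def by (intro that[of "E i"]) (auto simp: E_def)
qed

end

text \<open>On one cylinder the kernel of \<open>X\<close> is nearly constant, so the past
  distinguishes functions supported there only through their integrals. This transfers asymptotics
  from one such function to all others.\<close>

lemma (in shift_measure) set_kernel_compare:
 assumes K: "set_kernel A M D" and w: "w \<noteq> []" and X: "determined A k X"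
  and F [measurable]: "F \<in> borel_measurable M" and G [measurable]: "G \<in> borel_measurable M"
  and supp: "\<And>y. y \<in> space M \<Longrightarrow> y \<notin> cyl A w \<Longrightarrow> F y = 0" "\<And>y. y \<in> space M \<Longrightarrow> y \<notin> cyl A w \<Longrightarrow> G y = 0"
 shows "ncorr M X F k * (\<integral>\<^sup>+y. G y \<partial>M)
  \<le> ennreal (exp (D (length w))) * ((\<integral>\<^sup>+y. F y \<partial>M) * ncorr M X G k)"
proof -
 have "1 \<le> length w" using w by (cases w) auto
 then obtain \<kappa> where \<kappa> [measurable]: "\<kappa> \<in> borel_measurable M"
  and int: "\<And>F. F \<in> borel_measurable M \<Longrightarrow>
    (ncorr M X F k) = (\<integral>\<^sup>+y. \<kappa> y * F y \<partial>M)"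
  and osc: "\<And>y y'. y \<in> shift_space A \<Longrightarrow> y' \<in> shift_space A \<Longrightarrow> agree (length w) y y' \<Longrightarrow>
    \<kappa> y \<le> ennreal (exp (D (length w))) * \<kappa> y'"
  using K[unfolded set_kernel_def, rule_format, OF X] by blast
 have "(\<integral>\<^sup>+y. \<kappa> y * F y \<partial>M) * (\<integral>\<^sup>+y. G y \<partial>M) = (\<integral>\<^sup>+y. \<integral>\<^sup>+y'. 1 * ((\<kappa> y * F y) * G y') \<partial>M \<partial>M)"
  by (subst nn_integral_prod_sep) auto
 also have "\<dots> \<le> (\<integral>\<^sup>+y. \<integral>\<^sup>+y'. ennreal (exp (D (length w))) * (F y * (\<kappa> y' * G y')) \<partial>M \<partial>M)"
 proof (intro nn_integral_mono)
  fix y y' assume y: "y \<in> space M" "y' \<in> space M"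
  show "1 * ((\<kappa> y * F y) * G y') \<le> ennreal (exp (D (length w))) * (F y * (\<kappa> y' * G y'))"
  proof (cases "y \<in> cyl A w \<and> y' \<in> cyl A w")
   case True
   then have "\<kappa> y \<le> ennreal (exp (D (length w))) * \<kappa> y'"
    by (intro osc) (auto simp: cyl_def agree_def)
   from mult_right_mono[OF this, of "F y * G y'"] show ?thesis by (simp add: ac_simps)
  next
   case False
   then have "F y = 0 \<or> G y' = 0" using supp y by auto
   then show ?thesis by auto
  qed
 qed
 also have "\<dots> = ennreal (exp (D (length w))) * ((\<integral>\<^sup>+y. F y \<partial>M) * (\<integral>\<^sup>+y. \<kappa> y * G y \<partial>M))"
  by (rule nn_integral_prod_sep) auto
 finally show ?thesis by (simp add: int)
qed

section \<open>The eigenfunction and the invariant measure: positivity, invariance,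
  regularity\<close>

lemma ennreal_infsum_multc:
 fixes f :: "'a \<Rightarrow> ennreal"
 shows "(\<Sum>\<^sub>\<infinity>x\<in>S. f x * c) = (\<Sum>\<^sub>\<infinity>x\<in>S. f x) * c"
 by (simp add: nonneg_infsum_complete sum_distrib_right[symmetric] SUP_mult_right_ennreal)

lemma sapp_append: "sapp (u @ w) y = sapp u (sapp w y)"
 by (induction u) auto

text \<open>The last letter of the path coincides with the initial letter of \<open>y\<close>, so it
  is dropped before prefixing.\<close>

lemma sapp_path:
 assumes "admissible A p" "p \<noteq> []" "y \<in> shift_space A" "last p = y 0"
 shows "sapp (butlast p) y \<in> shift_space A \<and> sapp (butlast p) y 0 = hd p"
 using assms
proof (induction p)
 case (Cons b p)
 show ?case
 proof (cases "p = []")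
  case False
  have "admissible A p"
   using Cons.prems(1) unfolding admissible_def by (metis Suc_less_eq length_Cons nth_Cons_Suc)
  then have IH: "sapp (butlast p) y \<in> shift_space A" "sapp (butlast p) y 0 = hd p"
   using Cons False by auto
  have "A b (hd p)"
   using Cons.prems(1) False unfolding admissible_def by (force simp: hd_conv_nth)
  then show ?thesis using IH False by (simp add: scons_in_shift_space) (simp add: scons_def)
 qed (use Cons in auto)
qed simp

lemma admissible_of_cyl:
 assumes "x \<in> cyl A w"
 shows "admissible A w"
 unfolding admissible_def
proof (intro allI impI)
 fix i assume "Suc i < length w"
 then have "w ! i = x i" "w ! Suc i = x (Suc i)" using assms by (auto simp: cyl_def)
 then show "A (w ! i) (w ! Suc i)" using assms by (auto simp: cyl_def shift_space_def)
qed

text \<open>The abstract setting for the asymptotic analysis: an invariant measure with a kernel of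
  vanishing oscillation, finite and positive on nonempty cylinders of nonempty words, with a
  divergent normalizing sequence.\<close>

locale recurrent_shift = invariant_measure A M
 for A :: "'v::countable \<Rightarrow> 'v \<Rightarrow> bool" and M :: "'v path measure" +
 fixes D :: "nat \<Rightarrow> real" and a :: "nat \<Rightarrow> real"
 assumes kernel: "set_kernel A M D"
  and D_nonneg: "\<And>m. 0 \<le> D m" and D_lim: "D \<longlonglongrightarrow> 0"
  and cyl_finite: "\<And>w. w \<noteq> [] \<Longrightarrow> emeasure M (cyl A w) < \<infinity>"
  and cyl_pos: "\<And>w. w \<noteq> [] \<Longrightarrow> cyl A w \<noteq> {} \<Longrightarrow> 0 < emeasure M (cyl A w)"
  and norm_a: "normalizing_seq M a" and mono_a: "mono a" and a_top: "filterlim a at_top sequentially"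

text \<open>Continuity of \<open>h\<close> is expressed through cylinders and split into its two
  semicontinuous halves; a quantitative regularity of \<open>h\<close> is derived, not
  assumed.\<close>

locale walters_eigen = conformal_measure A N \<phi> l
 for A :: "'v::countable \<Rightarrow> 'v \<Rightarrow> bool" and N :: "'v path measure"
  and \<phi> :: "'v path \<Rightarrow> real" and l :: real +
 fixes h :: "'v path \<Rightarrow> real" and a :: "nat \<Rightarrow> real"
 assumes walt: "walters A \<phi>" and mixing: "topologically_mixing A"
  and N_finite: "\<And>w. w \<noteq> [] \<Longrightarrow> emeasure N (cyl A w) < \<infinity>"
  and h_meas [measurable]: "h \<in> borel_measurable N"
  and h_pos: "\<And>x. x \<in> shift_space A \<Longrightarrow> 0 < h x"
  and h_lower: "\<And>x c. x \<in> shift_space A \<Longrightarrow> c < h x \<Longrightarrow> \<exists>n. \<forall>y\<in>cyl A (map x [0..<n]). c < h y"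
  and h_upper: "\<And>x c. x \<in> shift_space A \<Longrightarrow> h x < c \<Longrightarrow> \<exists>n. \<forall>y\<in>cyl A (map x [0..<n]). h y < c"
  and h_eigen: "\<And>x. x \<in> shift_space A \<Longrightarrow> ruelle_op A \<phi> (\<lambda>y. ennreal (h y)) x = ennreal (l * h x)"
  and h_infinite: "(\<integral>\<^sup>+x. ennreal (h x) \<partial>N) = \<infinity>"
  and norm_a: "normalizing_seq (density N (\<lambda>x. ennreal (h x))) a"
  and mono_a: "mono a" and a_top: "filterlim a at_top sequentially"
begin

abbreviation M' :: "'v path measure" where "M' \<equiv> density N (\<lambda>x. ennreal (h x))"

text \<open>By mixing, every one-letter cylinder is carried into \<open>w\<close> by prefixing a
  suitable word, with positive weight. If the cylinder of \<open>w\<close> were null, so would be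
  all letters, and the integral of \<open>h\<close> could not be infinite.\<close>

lemma N_cyl_pos:
 assumes w: "w \<noteq> []" and ne: "cyl A w \<noteq> {}"
 shows "0 < emeasure N (cyl A w)"
proof (rule ccontr)
 assume "\<not> 0 < emeasure N (cyl A w)"
 then have null: "emeasure N (cyl A w) = 0" by simp
 obtain x where x: "x \<in> cyl A w" using ne by auto
 have "emeasure N (cyl A [b]) = 0" for b
 proof -
  obtain p where p: "p \<noteq> []" "admissible A p" "hd p = last w" "last p = b"
   using mixing[unfolded topologically_mixing_def] by (metis le_refl length_0_conv nat.distinct(1))
  \<comment> \<open>Adjacent pieces share their junction letter: \<open>p\<close> starts with the
    last letter of \<open>w\<close> and ends with the letter b that starts the continuation.\<close>
  let ?u = "butlast w @ butlast p"
  have in_w: "sapp ?u y \<in> cyl A w" if y: "y \<in> cyl A [b]" for y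
  proof -
   have y0: "y \<in> shift_space A" "y 0 = b" using y by (auto simp: cyl_def)
   have 1: "sapp (butlast p) y \<in> shift_space A" "sapp (butlast p) y 0 = hd p"
    using sapp_path[OF p(2,1) y0(1)] p(4) y0(2) by auto
   have 2: "sapp ?u y \<in> shift_space A"
    using sapp_path[OF admissible_of_cyl[OF x] w 1(1)] 1(2) p(3) by (simp add: sapp_append)
   have "sapp ?u y i = w ! i" if "i < length w" for i
   proof (cases "i < length w - 1")
    case True
    then show ?thesis by (simp add: sapp_append sapp_nth[of "butlast w"] nth_butlast)
   next
    case False
    then have "i = length w - 1" using that by simp
    then show ?thesis
     using 1(2) p(3) w by (simp add: sapp_append sapp_nth[of "butlast w"] last_conv_nth)
   qed
   with 2 show ?thesis by (simp add: cyl_def)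
  qed
  have "(\<integral>\<^sup>+y. ennreal (weight ?u y) * indicator (cyl A [b]) y \<partial>N) =
    (ncorr N (cyl A ?u) (indicator (cyl A [b])) (length ?u))"
   by (subst integral_cyl) (auto simp del: length_append)
  also have "\<dots> \<le> (\<integral>\<^sup>+x. indicator (cyl A w) x \<partial>N)"
  proof (rule nn_integral_mono)
   fix z assume "z \<in> space N"
   have "z \<in> cyl A w" if z: "z \<in> cyl A ?u" "sh (length ?u) z \<in> cyl A [b]"
   proof -
    have "z i = sapp ?u (sh (length ?u) z) i" for i
     using z(1) by (auto simp: sapp_nth cyl_def simp del: length_append)
    then have "z = sapp ?u (sh (length ?u) z)" by blast
    then show ?thesis using in_w[OF z(2)] by simp
   qed
   then show "indicator (cyl A ?u) z * indicator (cyl A [b]) (sh (length ?u) z)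
     \<le> (indicator (cyl A w) z :: ennreal)"
    by (auto simp: indicator_def simp del: length_append)
  qed
  also have "\<dots> = 0" using null by simp
  finally have "AE y in N. ennreal (weight ?u y) * indicator (cyl A [b]) y = 0"
   by (subst (asm) le_zero_eq, subst (asm) nn_integral_0_iff_AE) auto
  then have "AE y in N. y \<notin> cyl A [b]"
  proof eventually_elim
   case (elim y)
   show ?case
   proof
    assume y: "y \<in> cyl A [b]"
    have "0 < weight ?u y"
     using in_w[OF y] l_pos by (auto simp: weight_def cyl_def)
    then show False using elim y by simp
   qed
  qed
  then show ?thesis
   by (subst (asm) AE_iff_measurable[OF cyl_sets[of "[b]"]]) (auto simp: cyl_def space_M)
 qed
 then have "AE y in N. \<forall>b. y \<notin> cyl A [b]"
  unfolding AE_all_countable by (intro allI AE_not_in null_setsI) auto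
 then have "AE y in N. ennreal (h y) = 0"
  by (rule AE_mp) (auto intro!: AE_I2 simp: cyl_def space_M)
 then have "(\<integral>\<^sup>+x. ennreal (h x) \<partial>N) = (\<integral>\<^sup>+x. 0 \<partial>N)"
  by (rule nn_integral_cong_AE)
 then show False using h_infinite by simp
qed

lemma M'_pos_iff:
 assumes [measurable]: "E \<in> sets N"
 shows "0 < emeasure M' E \<longleftrightarrow> 0 < emeasure N E"
proof -
 have "emeasure M' E = 0 \<longleftrightarrow> (AE x in N. ennreal (h x) * indicator E x = 0)"
  by (simp add: emeasure_density nn_integral_0_iff_AE)
 also have "\<dots> \<longleftrightarrow> (AE x in N. x \<notin> E)"
 proof (rule AE_cong)
  fix x assume "x \<in> space N"
  then have "ennreal (h x) \<noteq> 0" using h_pos[of x] by (simp add: space_M ennreal_eq_0_iff)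
  then show "ennreal (h x) * indicator E x = 0 \<longleftrightarrow> x \<notin> E" by (simp add: indicator_def)
 qed
 also have "\<dots> \<longleftrightarrow> emeasure N E = 0"
  by (rule AE_iff_measurable) (use sets.sets_into_space[OF assms] in auto)
 finally show ?thesis by (metis zero_less_iff_neq_zero)
qed

text \<open>In the transfer sum all preimages have the same image, so \<open>F\<close> composed with
  the shift can be pulled out and the eigenvalue equation for \<open>h\<close> remains.\<close>

lemma M'_invariant:
 assumes F [measurable]: "F \<in> borel_measurable N"
 shows "(\<integral>\<^sup>+x. F (lshift x) \<partial>M') = (\<integral>\<^sup>+x. F x \<partial>M')"
proof -
 note measurable_lshift [measurable]
 have "ennreal l * (\<integral>\<^sup>+x. ennreal (h x) * F (lshift x) \<partial>N) =
   (\<integral>\<^sup>+y. ruelle_op A \<phi> (\<lambda>x. ennreal (h x) * F (lshift x)) y \<partial>N)"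
  by (rule dual[symmetric]) measurable
 also have "\<dots> = (\<integral>\<^sup>+y. ennreal l * (ennreal (h y) * F y) \<partial>N)"
 proof (rule nn_integral_cong)
  fix y assume "y \<in> space N"
  then have y: "y \<in> shift_space A" by (simp add: space_M)
  have "ruelle_op A \<phi> (\<lambda>x. ennreal (h x) * F (lshift x)) y =
    (\<Sum>\<^sub>\<infinity>x\<in>{x \<in> shift_space A. lshift x = y}. (ennreal (exp (\<phi> x)) * ennreal (h x)) * F y)"
   unfolding ruelle_op_def by (rule infsum_cong) (auto simp: ac_simps)
  also have "\<dots> = ruelle_op A \<phi> (\<lambda>x. ennreal (h x)) y * F y"
   unfolding ruelle_op_def by (rule ennreal_infsum_multc)
  also have "\<dots> = ennreal l * (ennreal (h y) * F y)"
   using h_eigen[OF y] l_pos h_pos[OF y] by (simp add: ennreal_mult mult.assoc)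
  finally show "ruelle_op A \<phi> (\<lambda>x. ennreal (h x) * F (lshift x)) y = ennreal l * (ennreal (h y) * F y)" .
 qed
 also have "\<dots> = ennreal l * (\<integral>\<^sup>+y. ennreal (h y) * F y \<partial>N)"
  by (rule nn_integral_cmult) measurable
 finally show ?thesis
  using l_pos by (simp add: nn_integral_density ennreal_mult_cancel_left)
qed

lemma shift_measure_M': "shift_measure A M'"
 by unfold_locales (simp add: sets_M)

lemma invariant_measure_M': "invariant_measure A M'"
proof -
 interpret M': shift_measure A M' by (rule shift_measure_M')
 have "sigma_finite_measure M'"
 proof (rule sigma_finite_measure.intro, intro exI conjI)
  \<comment> \<open>The bound on \<open>h\<close> is part of the pieces because finiteness of
    \<open>M'\<close> on cylinders is available only after the regularity of
    \<open>h\<close>.\<close>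
  let ?S = "(\<lambda>(b, i). {x \<in> space N. x \<in> cyl A [b] \<and> h x \<le> real i}) ` (UNIV :: ('v \<times> nat) set)"
  show "countable ?S" by simp
  show "?S \<subseteq> sets M'" by auto
  show "\<Union> ?S = space M'"
  proof (intro equalityI subsetI)
   fix x assume x: "x \<in> space M'"
   obtain i :: nat where "h x \<le> real i" using real_arch_simple by blast
   then show "x \<in> \<Union> ?S" using x by (auto simp: cyl_def space_M intro!: exI[of _ "x 0"])
  qed auto
  show "\<forall>a\<in>?S. emeasure M' a \<noteq> \<infinity>"
  proof
   fix Q assume "Q \<in> ?S"
   then obtain b i where Q: "Q = {x \<in> space N. x \<in> cyl A [b] \<and> h x \<le> real i}" by auto
   have [measurable]: "Q \<in> sets N" unfolding Q by measurable
   have "emeasure M' Q \<le> (\<integral>\<^sup>+x. ennreal (real i) * indicator (cyl A [b]) x \<partial>N)"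
    by (subst emeasure_density) (auto intro!: nn_integral_mono ennreal_leI simp: Q indicator_def)
   also have "\<dots> = ennreal (real i) * emeasure N (cyl A [b])"
    by (simp add: nn_integral_cmult)
   also have "\<dots> < \<infinity>" using N_finite[of "[b]"] by (simp add: ennreal_mult_less_top)
   finally show "emeasure M' Q \<noteq> \<infinity>" by simp
  qed
 qed
 moreover have "distr M' M' lshift = M'"
 proof (rule measure_eqI)
  fix E assume "E \<in> sets (distr M' M' lshift)"
  then have [measurable]: "E \<in> sets N" by simp
  have "emeasure (distr M' M' lshift) E = (\<integral>\<^sup>+x. indicator E x \<partial>distr M' M' lshift)" by simp
  also have "\<dots> = (\<integral>\<^sup>+x. indicator E (lshift x) \<partial>M')"
   by (rule nn_integral_distr[OF M'.measurable_lshift]) simp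
  also have "\<dots> = (\<integral>\<^sup>+x. indicator E x \<partial>M')" by (rule M'_invariant) measurable
  finally show "emeasure (distr M' M' lshift) E = emeasure M' E" by simp
 qed simp
 ultimately show ?thesis
  by (intro invariant_measure.intro shift_measure_M' invariant_measure_axioms.intro)
qed

end

lemma filterlim_const_over_top:
 fixes a :: "nat \<Rightarrow> real"
 assumes "filterlim a at_top sequentially"
 shows "(\<lambda>n. c / a n) \<longlonglongrightarrow> 0"
 using tendsto_divide_0[OF tendsto_const filterlim_at_top_imp_at_infinity[OF assms]] .

lemma (in shift_measure) nn_integral_indicator_funpow:
 assumes [measurable]: "C \<in> sets M" "G \<in> sets M"
 shows "ncorr M C (indicator G) k =
  emeasure M (C \<inter> (sh k -` G \<inter> space M))"
proof -
 have "ncorr M C (indicator G) k =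
   (\<integral>\<^sup>+z. indicator (C \<inter> (sh k -` G \<inter> space M)) z \<partial>M)"
  by (intro nn_integral_cong) (simp split: split_indicator)
 then show ?thesis by simp
qed

context walters_eigen
begin

text \<open>Division by \<open>h\<close> turns correlations of \<open>M'\<close> into correlations
  of \<open>N\<close>. Dual ergodicity of \<open>M'\<close> thus speaks about \<open>N\<close>,
  whose kernel has an oscillation bound that does not involve \<open>h\<close>; this avoids
  circularity in the regularity proof.\<close>

lemma integral_quotient:
 assumes C [measurable]: "C \<in> sets N" and E [measurable]: "E \<in> sets N"
 shows "(LINT x|M'. (indicator C x / h x) * indicator E (sh k x)) =
  measure N (C \<inter> (sh k -` E \<inter> space N))"
proof -
 have "(LINT x|M'. (indicator C x / h x) * indicator E (sh k x)) =
   (LINT x|N. h x *\<^sub>R ((indicator C x / h x) * indicator E (sh k x)))"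
  by (rule integral_density) (use h_pos in "auto intro!: AE_I2 less_imp_le simp: space_M")
 also have "\<dots> = (LINT x|N. indicator (C \<inter> (sh k -` E \<inter> space N)) x)"
  by (intro lint_cong) (use h_pos in "force simp: space_M indicator_def")+
 also have "\<dots> = measure N (C \<inter> (sh k -` E \<inter> space N) \<inter> space N)"
  by (rule Bochner_Integration.integral_indicator)
 finally show ?thesis by (simp add: Int_assoc)
qed

lemma integrable_quotient:
 assumes C [measurable]: "C \<in> sets N" and fin: "emeasure N C < \<infinity>"
 shows "integrable M' (\<lambda>x. indicator C x / h x)"
proof -
 have "integrable N (\<lambda>x. h x *\<^sub>R (indicator C x / h x)) \<longleftrightarrow> integrable N (indicator C :: _ \<Rightarrow> real)"
  by (intro Bochner_Integration.integrable_cong) (use h_pos in "force simp: space_M indicator_def")+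
 then have "integrable N (\<lambda>x. h x *\<^sub>R (indicator C x / h x))" using fin by simp
 then show ?thesis
  by (subst integrable_density) (use h_pos in "auto intro!: AE_I2 less_imp_le simp: space_M")
qed

lemma M'_measure_bounds:
 assumes E [measurable]: "E \<in> sets N" and fin: "emeasure N E < \<infinity>" "emeasure M' E < \<infinity>"
 shows "(\<And>x. x \<in> E \<Longrightarrow> d \<le> h x) \<Longrightarrow> d * measure N E \<le> measure M' E"
  and "(\<And>x. x \<in> E \<Longrightarrow> h x \<le> d) \<Longrightarrow> 0 \<le> d \<Longrightarrow> measure M' E \<le> d * measure N E"
proof -
 have eq: "emeasure M' E = (\<integral>\<^sup>+x. ennreal (h x) * indicator E x \<partial>N)"
  by (rule emeasure_density) auto
 { assume d: "\<And>x. x \<in> E \<Longrightarrow> d \<le> h x"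
  show "d * measure N E \<le> measure M' E"
  proof (cases "0 \<le> d")
   case True
   have "ennreal d * emeasure N E = (\<integral>\<^sup>+x. ennreal d * indicator E x \<partial>N)"
    by (simp add: nn_integral_cmult)
   also have "\<dots> \<le> emeasure M' E"
    unfolding eq by (intro nn_integral_mono) (use d in "auto simp: indicator_def ennreal_leI")
   finally have "ennreal d * ennreal (measure N E) \<le> ennreal (measure M' E)"
    using fin by (simp add: emeasure_eq_ennreal_measure less_top[symmetric])
   then show ?thesis using True by (simp add: ennreal_mult[symmetric])
  next
   case False
   then have "d * measure N E \<le> 0" by (simp add: mult_nonpos_nonneg)
   then show ?thesis using measure_nonneg order_trans by blast
  qed }
 { assume d: "\<And>x. x \<in> E \<Longrightarrow> h x \<le> d" and "0 \<le> d"
  have "emeasure M' E \<le> (\<integral>\<^sup>+x. ennreal d * indicator E x \<partial>N)"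
   unfolding eq by (intro nn_integral_mono) (use d in "auto simp: indicator_def ennreal_leI")
  also have "\<dots> = ennreal d * emeasure N E"
   by (simp add: nn_integral_cmult)
  finally have "ennreal (measure M' E) \<le> ennreal d * ennreal (measure N E)"
   using fin by (simp add: emeasure_eq_ennreal_measure less_top[symmetric])
  then show "measure M' E \<le> d * measure N E"
   using \<open>0 \<le> d\<close> by (simp add: ennreal_mult[symmetric]) }
qed

lemma N_cyl_prefix_pos:
 assumes "x \<in> shift_space A" "1 \<le> n"
 shows "0 < emeasure N (cyl A (map x [0..<n]))"
 using assms mem_cyl_prefix[OF assms(1), of n] by (intro N_cyl_pos) auto

text \<open>The density is regular because it is, up to a constant, the limit of the averages
 \<open>(\<Sum>k<n. ruelle_op ^^ k applied to a cylinder) / a n\<close>, all of which have bounded oscillation.\<close>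

lemma h_regular:
 assumes m: "1 \<le> m" and x: "x \<in> shift_space A" and y: "y \<in> shift_space A" and xy: "agree m x y"
 shows "h x \<le> exp (walters_bound A \<phi> m) * h y"
proof (rule ccontr)
 let ?E = "exp (walters_bound A \<phi> m)"
 assume "\<not> h x \<le> ?E * h y"
 then have "h y < h x / ?E" by (simp add: field_simps)
 \<comment> \<open>Two levels d < d' separate the values of \<open>h\<close> strictly; the
   comparison below will force d' \<le> d.\<close>
 then obtain d where d: "h y < d" "d < h x / ?E" using dense by blast
 then obtain d' where d': "d < d'" "d' < h x / ?E" using dense by blast
 have d_pos: "0 < d" using h_pos[OF y] d by simp
 define P where "P = cyl A (map x [0..<m])"
 have P [measurable]: "P \<in> sets N" and P_fin: "emeasure N P < \<infinity>"
  using N_finite m by (auto simp: P_def)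
 \<comment> \<open>Near x and near y, but inside their common cylinder of length m, \<open>h\<close>
   lies above and below the two levels; by continuity both sets contain cylinders and have positive
   measure.\<close>
 define E1 where "E1 = {z \<in> space N. z \<in> P \<and> ?E * d' < h z}"
 define F1 where "F1 = {z \<in> space N. z \<in> P \<and> h z < d}"
 have [measurable]: "E1 \<in> sets N" "F1 \<in> sets N" unfolding E1_def F1_def by measurable
 have E1_pos: "0 < emeasure N E1"
 proof -
  have "?E * d' < h x" using d'(2) by (simp add: field_simps)
  then obtain n where n: "\<forall>z\<in>cyl A (map x [0..<n]). ?E * d' < h z" using h_lower[OF x] by blast
  have "cyl A (map x [0..<max n m]) \<subseteq> E1"
   using n agree_mono[of "max n m" x] unfolding E1_def P_def space_M cyl_eq_Collect[OF x] by auto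
  then have "emeasure N (cyl A (map x [0..<max n m])) \<le> emeasure N E1" by (intro emeasure_mono) auto
  with N_cyl_prefix_pos[OF x, of "max n m"] m show ?thesis by (meson le_max_iff_disj less_le_trans)
 qed
 have F1_pos: "0 < emeasure N F1"
 proof -
  obtain n where n: "\<forall>z\<in>cyl A (map y [0..<n]). h z < d" using h_upper[OF y d(1)] by blast
  have "cyl A (map y [0..<max n m]) \<subseteq> F1"
   using n agree_mono[of "max n m" y] agree_trans[OF xy]
   unfolding F1_def P_def space_M cyl_eq_Collect[OF x] cyl_eq_Collect[OF y] by auto
  then have "emeasure N (cyl A (map y [0..<max n m])) \<le> emeasure N F1" by (intro emeasure_mono) auto
  with N_cyl_prefix_pos[OF y, of "max n m"] m show ?thesis by (meson le_max_iff_disj less_le_trans)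
 qed
 interpret M': invariant_measure A M' by (rule invariant_measure_M')
 define C where "C = cyl A [x 0]"
 have C [measurable]: "C \<in> sets N" and C_fin: "emeasure N C < \<infinity>"
  using N_finite by (auto simp: C_def)
 define f where "f z = indicator C z / h z" for z
 have f_int: "integrable M' f" unfolding f_def[abs_def] by (rule integrable_quotient[OF C C_fin])
 define c where "c = (LINT z|M'. f z)"
 have "c = measure N C"
  using integral_quotient[OF C sets.top, of 0] sets.sets_into_space[OF C]
  unfolding c_def f_def by (subst (asm) lint_cong[OF refl, of M' _ "\<lambda>x. indicator C x / h x"])
   (auto simp: Int_absorb2)
 then have c_pos: "0 < c"
  using N_cyl_prefix_pos[OF x, of 1] C_fin by (simp add: C_def measure_def enn2real_positive_iff)
 have good: "\<exists>E. E \<in> sets N \<and> E \<subseteq> E0 \<and> 0 < measure N E \<and> emeasure N E < \<infinity> \<and> emeasure M' E < \<infinity> \<and>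
   (\<lambda>n. 1 / a n * (\<Sum>k<n. measure N (C \<inter> (sh k -` E \<inter> space N)))) \<longlonglongrightarrow> c * measure M' E"
  if E0 [measurable]: "E0 \<in> sets N" and E0_pos: "0 < emeasure N E0" and E0P: "E0 \<subseteq> P" for E0
 proof -
  have "0 < emeasure M' E0" using M'_pos_iff[OF E0] E0_pos by simp
  then obtain E where E: "E \<in> sets M'" "E \<subseteq> E0" "0 < emeasure M' E" "emeasure M' E < \<infinity>"
   "(\<lambda>n. 1 / a n * (\<Sum>k<n. LINT x|M'. f x * indicator E (sh k x))) \<longlonglongrightarrow> (LINT x|M'. f x) * measure M' E"
   using M'.normalizing_good_set[OF norm_a f_int, of E0] E0 by auto
  have EN: "E \<in> sets N" using E(1) by simp
  have "emeasure N E \<le> emeasure N P" using E(2) E0P by (intro emeasure_mono) auto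
  then have fin: "emeasure N E < \<infinity>" using P_fin by (rule le_less_trans)
  moreover have "0 < measure N E"
   using M'_pos_iff[OF EN] E(3) fin by (simp add: measure_def enn2real_positive_iff)
  ultimately show ?thesis
  proof (intro exI[of _ E] conjI EN E(2,4) fin)
   show "(\<lambda>n. 1 / a n * (\<Sum>k<n. measure N (C \<inter> (sh k -` E \<inter> space N)))) \<longlonglongrightarrow> c * measure M' E"
    using E(5) unfolding c_def f_def integral_quotient[OF C EN] .
  qed
 qed
 have E1P: "E1 \<subseteq> P" and F1P: "F1 \<subseteq> P" by (auto simp: E1_def F1_def)
 obtain E where E [measurable]: "E \<in> sets N" "E \<subseteq> E1" "0 < measure N E" "emeasure N E < \<infinity>" "emeasure M' E < \<infinity>"
   "(\<lambda>n. 1 / a n * (\<Sum>k<n. measure N (C \<inter> (sh k -` E \<inter> space N)))) \<longlonglongrightarrow> c * measure M' E"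
  using good[OF _ E1_pos E1P] by auto
 obtain F where F [measurable]: "F \<in> sets N" "F \<subseteq> F1" "0 < measure N F" "emeasure N F < \<infinity>" "emeasure M' F < \<infinity>"
   "(\<lambda>n. 1 / a n * (\<Sum>k<n. measure N (C \<inter> (sh k -` F \<inter> space N)))) \<longlonglongrightarrow> c * measure M' F"
  using good[OF _ F1_pos F1P] by auto
 let ?S = "\<lambda>E k. measure N (C \<inter> (sh k -` E \<inter> space N))"
 have S_fin: "emeasure N (C \<inter> X) < \<infinity>" if "X \<in> sets N" for X
 proof -
  have "emeasure N (C \<inter> X) \<le> emeasure N C" by (intro emeasure_mono) auto
  then show ?thesis using C_fin by (rule le_less_trans)
 qed
 \<comment> \<open>From time 1 on the one-letter cylinder \<open>C\<close> belongs to the past, so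
   the kernel of \<open>N\<close> compares visits to \<open>E\<close> with visits to
   \<open>F\<close>.\<close>
 have step: "?S E k * measure N F \<le> ?E * (measure N E * ?S F k)" if k: "1 \<le> k" for k
 proof -
  have ind: "ncorr N C (indicator G) k = emeasure N (C \<inter> (sh k -` G \<inter> space N))"
   if [measurable]: "G \<in> sets N" for G
   by (rule nn_integral_indicator_funpow) measurable
  have "ncorr N C (indicator E) k * (\<integral>\<^sup>+z. indicator F z \<partial>N) \<le>
    ennreal (exp (walters_bound A \<phi> (length (map x [0..<m])))) *
    ((\<integral>\<^sup>+z. indicator E z \<partial>N) * ncorr N C (indicator F) k)"
  proof (rule set_kernel_compare[OF word_kernel_imp_set_kernel[OF word_kernel_conformal[OF walt]]])
   show "map x [0..<m] \<noteq> []" using m by simp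
   show "determined A k C"
    unfolding C_def using determined_mono[OF determined_cyl[of A "[x 0]"], of k] k by simp
   show "indicator E y = (0 :: ennreal)" if "y \<notin> cyl A (map x [0..<m])" for y
    using that E(2) E1P unfolding P_def by (auto simp: indicator_def)
   show "indicator F y = (0 :: ennreal)" if "y \<notin> cyl A (map x [0..<m])" for y
    using that F(2) F1P unfolding P_def by (auto simp: indicator_def)
  qed measurable
  then have "emeasure N (C \<inter> (sh k -` E \<inter> space N)) * emeasure N F \<le>
    ennreal ?E * (emeasure N E * emeasure N (C \<inter> (sh k -` F \<inter> space N)))"
   by (simp only: ind[OF E(1)] ind[OF F(1)] nn_integral_indicator E(1) F(1) length_map length_upt diff_zero)
  then have "ennreal (?S E k) * ennreal (measure N F) \<le> ennreal ?E * (ennreal (measure N E) * ennreal (?S F k))"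
   using S_fin E(4) F(4) by (simp add: emeasure_eq_ennreal_measure less_top[symmetric])
  then show ?thesis by (simp add: ennreal_mult[symmetric])
 qed
 have sum_le: "(\<Sum>k<n. ?S E k) * measure N F \<le> measure N C * measure N F + ?E * (measure N E * (\<Sum>k<n. ?S F k))" for n
 proof -
  have le: "?S E k * measure N F \<le> (if k = 0 then measure N C * measure N F else 0) + ?E * (measure N E * ?S F k)" for k
  proof (cases "k = 0")
   case True
   have "?S E k \<le> measure N C"
    using C_fin by (intro measure_mono_fmeasurable) (auto simp: fmeasurable_def)
   then have "?S E k * measure N F \<le> measure N C * measure N F" by (rule mult_right_mono) simp
   then show ?thesis using True by (simp add: add_increasing2)
  qed (use step[of k] in auto)
  have "(\<Sum>k<n. ?S E k) * measure N F \<le> (\<Sum>k<n. (if k = 0 then measure N C * measure N F else 0) + ?E * (measure N E * ?S F k))"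
   unfolding sum_distrib_right by (rule sum_mono) (rule le)
  also have "\<dots> \<le> measure N C * measure N F + ?E * (measure N E * (\<Sum>k<n. ?S F k))"
   by (simp add: sum.distrib sum_distrib_left sum.delta')
  finally show ?thesis .
 qed
 \<comment> \<open>Dividing by a n removes the uncontrolled term k = 0. The limits see
   \<open>E\<close> and \<open>F\<close> through \<open>M'\<close>, the comparison sees them through
   \<open>N\<close>, and the quotient of the two is governed by \<open>h\<close>.\<close>
 have "c * measure M' E * measure N F \<le> 0 + ?E * (measure N E * (c * measure M' F))"
 proof (rule LIMSEQ_le)
  show "(\<lambda>n. (1 / a n * (\<Sum>k<n. ?S E k)) * measure N F) \<longlonglongrightarrow> c * measure M' E * measure N F"
   by (intro tendsto_intros E(6))
  show "(\<lambda>n. (measure N C * measure N F) / a n + ?E * (measure N E * (1 / a n * (\<Sum>k<n. ?S F k)))) \<longlonglongrightarrow>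
    0 + ?E * (measure N E * (c * measure M' F))"
   by (intro tendsto_intros F(6) filterlim_const_over_top a_top)
  have "\<forall>\<^sub>F n in sequentially. 0 < a n" using a_top by (simp add: filterlim_at_top_dense)
  then have "\<forall>\<^sub>F n in sequentially. (1 / a n * (\<Sum>k<n. ?S E k)) * measure N F \<le>
    (measure N C * measure N F) / a n + ?E * (measure N E * (1 / a n * (\<Sum>k<n. ?S F k)))"
  proof eventually_elim
   case (elim n)
   from divide_right_mono[OF sum_le[of n] less_imp_le[OF elim]] show ?case
    by (simp add: add_divide_distrib ac_simps)
  qed
  then show "\<exists>N'. \<forall>n\<ge>N'. (1 / a n * (\<Sum>k<n. ?S E k)) * measure N F \<le>
    (measure N C * measure N F) / a n + ?E * (measure N E * (1 / a n * (\<Sum>k<n. ?S F k)))"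
   by (simp add: eventually_sequentially)
 qed
 then have "c * (measure M' E * measure N F) \<le> c * (?E * (measure N E * measure M' F))" by (simp add: ac_simps)
 then have 1: "measure M' E * measure N F \<le> ?E * (measure N E * measure M' F)"
  using c_pos by (simp add: mult_le_cancel_left)
 have "?E * d' * measure N E \<le> measure M' E"
  by (rule M'_measure_bounds(1)[OF E(1,4,5)]) (use E(2) in "auto simp: E1_def less_imp_le")
 from mult_right_mono[OF this, of "measure N F"] 
 have 2: "?E * d' * measure N E * measure N F \<le> measure M' E * measure N F" by simp
 have "measure M' F \<le> d * measure N F"
  by (rule M'_measure_bounds(2)[OF F(1,4,5)]) (use F(2) d_pos in "auto simp: F1_def less_imp_le")
 from mult_left_mono[OF this, of "?E * measure N E"]
 have 3: "?E * (measure N E * measure M' F) \<le> ?E * measure N E * (d * measure N F)" by (simp add: ac_simps)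
 have "(?E * measure N E * measure N F) * d' \<le> (?E * measure N E * measure N F) * d"
  using 1 2 3 by (simp add: ac_simps)
 then have "d' \<le> d" using E(3) F(3) by (simp add: mult_le_cancel_left)
 then show False using d'(1) by simp
qed

lemma recurrent_shift_M': "recurrent_shift A M' (\<lambda>m. 3 * walters_bound A \<phi> m) a"
proof (intro recurrent_shift.intro invariant_measure_M' recurrent_shift_axioms.intro norm_a mono_a a_top)
 interpret M': shift_measure A M' by (rule shift_measure_M')
 show "set_kernel A M' (\<lambda>m. 3 * walters_bound A \<phi> m)"
  by (rule M'.word_kernel_imp_set_kernel[OF word_kernel_density[OF walt h_meas h_pos h_regular]])
 show "0 \<le> 3 * walters_bound A \<phi> m" for m by (simp add: walters_bound_nonneg)
 show "(\<lambda>m. 3 * walters_bound A \<phi> m) \<longlonglongrightarrow> 0"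
  using tendsto_mult_left[OF walters_bound_tendsto[OF walt], of 3] by simp
 show "0 < emeasure M' (cyl A w)" if "w \<noteq> []" "cyl A w \<noteq> {}" for w
  using N_cyl_pos[OF that] M'_pos_iff by simp
 show "emeasure M' (cyl A w) < \<infinity>" if w: "w \<noteq> []" for w
 proof (cases "cyl A w = {}")
  case False
  then obtain x where x: "x \<in> cyl A w" by auto
  have "emeasure M' (cyl A w) = (\<integral>\<^sup>+y. ennreal (h y) * indicator (cyl A w) y \<partial>N)"
   by (rule emeasure_density) auto
  also have "\<dots> \<le> (\<integral>\<^sup>+y. ennreal (exp (walters_bound A \<phi> 1) * h x) * indicator (cyl A w) y \<partial>N)"
  proof (rule nn_integral_mono)
   fix y assume "y \<in> space N"
   \<comment> \<open>Points of one cylinder share at least one letter, which is enough for the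
     regularity bound and makes \<open>h\<close> bounded there.\<close>
   have "h y \<le> exp (walters_bound A \<phi> 1) * h x" if "y \<in> cyl A w"
    using x that w by (intro h_regular) (auto simp: cyl_def agree_def)
   then show "ennreal (h y) * indicator (cyl A w) y \<le> ennreal (exp (walters_bound A \<phi> 1) * h x) * indicator (cyl A w) y"
    by (auto simp: indicator_def ennreal_leI)
  qed
  also have "\<dots> = ennreal (exp (walters_bound A \<phi> 1) * h x) * emeasure N (cyl A w)"
   by (simp add: nn_integral_cmult)
  also have "\<dots> < \<infinity>" using N_finite[OF w] by (simp add: ennreal_mult_less_top)
  finally show ?thesis .
 qed simp
qed

end

subsection \<open>Regularly varying sequences\<close>

locale rv_seq =
 fixes a :: "nat \<Rightarrow> real" and \<alpha> :: real
 assumes mono_a: "mono a" and \<alpha>: "0 < \<alpha>" and rv: "regularly_varying_seq a \<alpha>"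
begin

lemma a_ev_pos: "\<forall>\<^sub>F n in sequentially. 0 < a n"
 and a_rv: "0 < c \<Longrightarrow> (\<lambda>n. a (nat \<lfloor>c * real n\<rfloor>) / a n) \<longlonglongrightarrow> c powr \<alpha>"
 using rv by (auto simp: regularly_varying_seq_def)

text \<open>A bounded monotone sequence would converge to a positive limit, and the ratio at 2 n and
  n would tend to 1 instead of 2 powr \<alpha>.\<close>

lemma a_top: "filterlim a at_top sequentially"
proof (rule ccontr)
 assume not_top: "\<not> filterlim a at_top sequentially"
 obtain C where C: "\<And>n. a n \<le> C"
 proof -
  from not_top obtain Z where "\<not> (\<forall>\<^sub>F n in sequentially. Z \<le> a n)"
   unfolding filterlim_at_top by blast
  then have "\<And>n. \<exists>m\<ge>n. a m < Z" unfolding eventually_sequentially by (meson not_le)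
  then have "a n \<le> Z" for n using monoD[OF mono_a] by (meson le_less_trans less_imp_le)
  then show thesis by (rule that)
 qed
 then obtain L where L: "a \<longlonglongrightarrow> L" "\<And>n. a n \<le> L"
  using incseq_convergent[of a C] mono_a by (auto simp: mono_def incseq_def)
 obtain n0 where "0 < a n0" using a_ev_pos by (auto simp: eventually_sequentially)
 then have L_pos: "0 < L" using L(2)[of n0] by simp
 have "(\<lambda>n. a (nat \<lfloor>2 * real n\<rfloor>) / a n) \<longlonglongrightarrow> L / L"
 proof (intro tendsto_divide L(1))
  have "nat \<lfloor>2 * real n\<rfloor> = 2 * n" for n
   by (metis floor_of_nat nat_int of_nat_mult of_nat_numeral)
  then show "(\<lambda>n. a (nat \<lfloor>2 * real n\<rfloor>)) \<longlonglongrightarrow> L"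
   using filterlim_compose[OF L(1) filterlim_subseq[of "\<lambda>n. 2 * n"]] by (simp add: strict_mono_def)
 qed (use L_pos in simp)
 moreover have "(\<lambda>n. a (nat \<lfloor>2 * real n\<rfloor>) / a n) \<longlonglongrightarrow> 2 powr \<alpha>" by (rule a_rv) simp
 ultimately have "2 powr \<alpha> = L / L" using LIMSEQ_unique by blast
 then have "2 powr \<alpha> = (1 :: real)" using L_pos by simp
 then show False using \<alpha> by (simp add: powr_eq_one_iff)
qed

text \<open>Iterated doubling with a rate slightly too large: the exponent \<alpha> + 1 is a
  convenient choice above \<alpha>, and \<open>K\<close> pays for rounding k up to a power of
  2.\<close>

lemma potter:
 obtains x0 K where "0 < K" "\<And>x k. x0 \<le> x \<Longrightarrow> 1 \<le> k \<Longrightarrow> 0 < a x \<and> a (k * x) \<le> K * real k powr (\<alpha> + 1) * a x"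
proof -
 define \<beta> where "\<beta> = (2 :: real) powr (\<alpha> + 1)"
 have "(\<lambda>n. a (nat \<lfloor>2 * real n\<rfloor>) / a n) \<longlonglongrightarrow> 2 powr \<alpha>" by (rule a_rv) simp
 moreover have "(2 :: real) powr \<alpha> < \<beta>" unfolding \<beta>_def by (rule powr_less_mono) auto
 ultimately have "\<forall>\<^sub>F n in sequentially. a (nat \<lfloor>2 * real n\<rfloor>) / a n < \<beta>" by (rule order_tendstoD)
 then have "\<forall>\<^sub>F n in sequentially. 0 < a n \<and> a (2 * n) \<le> \<beta> * a n"
  using a_ev_pos
 proof eventually_elim
  case (elim n)
  have "nat \<lfloor>2 * real n\<rfloor> = 2 * n" by (metis floor_of_nat nat_int of_nat_mult of_nat_numeral)
  then show ?case using elim by (simp add: divide_simps)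
 qed
 then obtain x0 where x0: "\<And>n. x0 \<le> n \<Longrightarrow> 0 < a n \<and> a (2 * n) \<le> \<beta> * a n"
  by (auto simp: eventually_sequentially)
 have \<beta>_pos: "0 < \<beta>" by (simp add: \<beta>_def)
 have dbl: "a (2 ^ j * x) \<le> \<beta> ^ j * a x" if x: "x0 \<le> x" for j x
 proof (induction j)
  case (Suc j)
  have "x \<le> 2 ^ j * x" by simp
  then have "a (2 * (2 ^ j * x)) \<le> \<beta> * a (2 ^ j * x)" using x0[of "2 ^ j * x"] x by linarith
  also have "\<dots> \<le> \<beta> * (\<beta> ^ j * a x)" using Suc \<beta>_pos by simp
  finally show ?case by (simp add: ac_simps)
 qed simp
 show thesis
 proof (rule that[of \<beta> x0])
  show "0 < \<beta>" by (rule \<beta>_pos)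
  fix x k :: nat assume x: "x0 \<le> x" and k: "1 \<le> k"
  have "\<exists>j. 2 ^ j \<le> k \<and> k < 2 ^ Suc j"
   using ex_power_ivl1[of 2 k] k by (auto)
  then obtain j where j: "2 ^ j \<le> k" "k < 2 ^ Suc j" by blast
  have "a (k * x) \<le> a (2 ^ Suc j * x)"
   using j(2) by (intro monoD[OF mono_a] mult_right_mono) auto
  also have "\<dots> \<le> \<beta> ^ Suc j * a x" by (rule dbl[OF x])
  also have "\<dots> \<le> \<beta> * real k powr (\<alpha> + 1) * a x"
  proof (intro mult_right_mono)
   have "\<beta> ^ j = \<beta> powr real j"
    using \<beta>_pos by (simp add: powr_realpow)
   also have "\<dots> = (2 powr real j) powr (\<alpha> + 1)"
    unfolding \<beta>_def by (simp only: powr_powr mult.commute)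
   also have "2 powr real j = real (2 ^ j)"
    by (simp add: powr_realpow)
   also have "real (2 ^ j) powr (\<alpha> + 1) \<le> real k powr (\<alpha> + 1)"
    using j(1) \<alpha> by (intro powr_mono2 of_nat_mono) auto
   finally show "\<beta> ^ Suc j \<le> \<beta> * real k powr (\<alpha> + 1)" using \<beta>_pos by simp
  qed (use x0[OF x] in simp)
  finally show "0 < a x \<and> a (k * x) \<le> \<beta> * real k powr (\<alpha> + 1) * a x" using x0[OF x] by simp
 qed
qed

text \<open>The extra index is absorbed by a slightly larger multiple d of N: the number c N + 1
  stays below d N for large N, and d powr \<alpha> tends to c powr \<alpha>.\<close>

lemma a_rv_shift:
 assumes c: "0 < c" and N: "filterlim N at_top sequentially"
 shows "(\<lambda>n. a (nat \<lfloor>c * real (N n)\<rfloor> + 1) / a (N n)) \<longlonglongrightarrow> c powr \<alpha>"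
proof (rule order_tendstoI)
 have lim: "(\<lambda>n. a (nat \<lfloor>d * real (N n)\<rfloor>) / a (N n)) \<longlonglongrightarrow> d powr \<alpha>" if "0 < d" for d
  by (rule filterlim_compose[OF a_rv[OF that] N])
 have pos: "\<forall>\<^sub>F n in sequentially. 0 < a (N n)"
  using eventually_compose_filterlim[OF a_ev_pos N] .
 fix u assume u: "u < c powr \<alpha>"
 have "\<forall>\<^sub>F n in sequentially. u < a (nat \<lfloor>c * real (N n)\<rfloor>) / a (N n)"
  using lim[OF c] u by (rule order_tendstoD)
 then show "\<forall>\<^sub>F n in sequentially. u < a (nat \<lfloor>c * real (N n)\<rfloor> + 1) / a (N n)"
  using pos
 proof eventually_elim
  case (elim n)
  have "a (nat \<lfloor>c * real (N n)\<rfloor>) / a (N n) \<le> a (nat \<lfloor>c * real (N n)\<rfloor> + 1) / a (N n)"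
   using elim(2) by (intro divide_right_mono monoD[OF mono_a]) auto
  with elim(1) show ?case by simp
 qed
next
 have lim: "(\<lambda>n. a (nat \<lfloor>d * real (N n)\<rfloor>) / a (N n)) \<longlonglongrightarrow> d powr \<alpha>" if "0 < d" for d
  by (rule filterlim_compose[OF a_rv[OF that] N])
 have pos: "\<forall>\<^sub>F n in sequentially. 0 < a (N n)"
  using eventually_compose_filterlim[OF a_ev_pos N] .
 fix u assume u: "c powr \<alpha> < u"
 have "((\<lambda>d. d powr \<alpha>) \<longlongrightarrow> c powr \<alpha>) (at_right c)"
  using c by (intro tendsto_intros) auto
 then have "\<forall>\<^sub>F d in at_right c. d powr \<alpha> < u" using u by (rule order_tendstoD)
 moreover have "\<forall>\<^sub>F d in at_right c. c < d" by (simp add: eventually_at_filter)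
 ultimately have "\<forall>\<^sub>F d in at_right c. d powr \<alpha> < u \<and> c < d" by eventually_elim simp
 then obtain d where d: "d powr \<alpha> < u" "c < d"
  using eventually_happens[of _ "at_right c"] by auto
 have "\<forall>\<^sub>F n in sequentially. a (nat \<lfloor>d * real (N n)\<rfloor>) / a (N n) < u"
  using lim[of d] d c by (intro order_tendstoD) auto
 moreover have "\<forall>\<^sub>F n in sequentially. 1 / (d - c) \<le> real (N n)"
  using eventually_compose_filterlim[OF eventually_ge_at_top[of "nat \<lceil>1 / (d - c)\<rceil>"] N]
  by eventually_elim linarith
 ultimately show "\<forall>\<^sub>F n in sequentially. a (nat \<lfloor>c * real (N n)\<rfloor> + 1) / a (N n) < u"
  using pos
 proof eventually_elim
  case (elim n)
  have "1 \<le> (d - c) * real (N n)" using elim(2) d(2) by (simp add: field_simps)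
  then have "c * real (N n) + 1 \<le> d * real (N n)" by (simp add: algebra_simps)
  then have "\<lfloor>c * real (N n)\<rfloor> + 1 \<le> \<lfloor>d * real (N n)\<rfloor>" by linarith
  moreover have "0 \<le> \<lfloor>c * real (N n)\<rfloor>" using c by simp
  ultimately have "nat \<lfloor>c * real (N n)\<rfloor> + 1 \<le> nat \<lfloor>d * real (N n)\<rfloor>" by linarith
  then have "a (nat \<lfloor>c * real (N n)\<rfloor> + 1) / a (N n) \<le> a (nat \<lfloor>d * real (N n)\<rfloor>) / a (N n)"
   using elim(3) by (intro divide_right_mono monoD[OF mono_a]) auto
  with elim(1) show ?case by simp
 qed
qed

section \<open>The generalized inverse of the normalizing sequence\<close>

definition threshold :: "real \<Rightarrow> nat" where
 "threshold y = (LEAST n. y < a n)"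

lemma less_a_threshold: "y < a (threshold y)"
 unfolding threshold_def
proof (rule LeastI_ex)
 show "\<exists>n. y < a n"
  using a_top by (auto simp: filterlim_at_top_dense eventually_sequentially)
qed

lemma a_le_of_less_threshold: "n < threshold y \<Longrightarrow> a n \<le> y"
 unfolding threshold_def using not_less_Least by (metis not_le)

text \<open>Only the integer part of s enters, so the infimum over real s is attained at an
  integer.\<close>

lemma gen_inverse_eq_threshold: "gen_inverse a y = ennreal (real (threshold y))"
 unfolding gen_inverse_def
proof (rule antisym)
 show "Inf {ennreal s |s. 0 \<le> s \<and> y < a (nat \<lfloor>s\<rfloor>)} \<le> ennreal (real (threshold y))"
  using less_a_threshold[of y] by (intro Inf_lower) (auto intro!: exI[of _ "real (threshold y)"])
 show "ennreal (real (threshold y)) \<le> Inf {ennreal s |s. 0 \<le> s \<and> y < a (nat \<lfloor>s\<rfloor>)}"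
 proof (rule Inf_greatest, clarify)
  fix s :: real assume s: "0 \<le> s" "y < a (nat \<lfloor>s\<rfloor>)"
  then have "threshold y \<le> nat \<lfloor>s\<rfloor>"
   using a_le_of_less_threshold[of "nat \<lfloor>s\<rfloor>" y] by (auto simp: not_le[symmetric])
  then show "ennreal (real (threshold y)) \<le> ennreal s"
   using s(1) by (intro ennreal_leI) linarith
 qed
qed

lemma threshold_top:
 assumes "filterlim y at_top sequentially"
 shows "filterlim (\<lambda>n. threshold (y n)) at_top sequentially"
 unfolding filterlim_at_top
proof
 fix m :: nat
 have "\<forall>\<^sub>F n in sequentially. a m < y n" using assms by (simp add: filterlim_at_top_dense)
 then show "\<forall>\<^sub>F n in sequentially. m \<le> threshold (y n)"
 proof eventually_elim
  case (elim n)
  have "a m < a (threshold (y n))" using elim less_a_threshold[of "y n"] by simp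
  then show ?case using monoD[OF mono_a, of "threshold (y n)" m] by (cases "threshold (y n) \<le> m") auto
 qed
qed

text \<open>The sequence exceeds y at the threshold N but not at d N for any d < 1; regular
  variation makes the relative jump at most 1 / d powr \<alpha>, and d tends to 1.\<close>

lemma a_threshold_ratio:
 assumes y: "filterlim y at_top sequentially"
 shows "(\<lambda>n. a (threshold (y n)) / y n) \<longlonglongrightarrow> 1"
proof -
 let ?N = "\<lambda>n. threshold (y n)"
 have N: "filterlim ?N at_top sequentially" by (rule threshold_top[OF y])
 have y_pos: "\<forall>\<^sub>F n in sequentially. 0 < y n" using y by (simp add: filterlim_at_top_dense)
 have N_pos: "\<forall>\<^sub>F n in sequentially. 0 < ?N n"
  using eventually_compose_filterlim[OF eventually_gt_at_top[of 0] N] .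
 have "(\<lambda>n. y n / a (?N n)) \<longlonglongrightarrow> 1"
 proof (rule order_tendstoI)
  fix u :: real assume u: "u < 1"
  have "((\<lambda>d. d powr \<alpha>) \<longlongrightarrow> 1 powr \<alpha>) (at_left 1)" by (intro tendsto_intros) auto
  then have "\<forall>\<^sub>F d in at_left 1. u < d powr \<alpha>" using u by (intro order_tendstoD) auto
  moreover have "\<forall>\<^sub>F d in at_left (1::real). 0 < d \<and> d < 1"
   using eventually_at_left_real[of 0 1] by (rule eventually_mono) auto
  ultimately have "\<forall>\<^sub>F d in at_left 1. u < d powr \<alpha> \<and> 0 < d \<and> d < 1" by eventually_elim simp
  then obtain d where d: "u < d powr \<alpha>" "0 < d" "d < 1"
   using eventually_happens[of _ "at_left (1::real)"] by auto
  have "\<forall>\<^sub>F n in sequentially. u < a (nat \<lfloor>d * real (?N n)\<rfloor>) / a (?N n)"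
   by (rule order_tendstoD(1)[OF filterlim_compose[OF a_rv[OF d(2)] N] d(1)])
  then show "\<forall>\<^sub>F n in sequentially. u < y n / a (?N n)"
   using y_pos N_pos
  proof eventually_elim
   case (elim n)
   have "d * real (?N n) < real (?N n)" using d elim by simp
   then have "\<lfloor>d * real (?N n)\<rfloor> < int (?N n)" by linarith
   then have "nat \<lfloor>d * real (?N n)\<rfloor> < ?N n" using elim(3) by linarith
   then have "a (nat \<lfloor>d * real (?N n)\<rfloor>) \<le> y n" by (rule a_le_of_less_threshold)
   moreover have "0 < a (?N n)" using elim(2) less_a_threshold[of "y n"] by simp
   ultimately show ?case using elim(1) by (meson divide_right_mono less_imp_le less_le_trans)
  qed
 next
  fix u :: real assume u: "1 < u"
  show "\<forall>\<^sub>F n in sequentially. y n / a (?N n) < u"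
   using y_pos
  proof eventually_elim
   case (elim n)
   have "y n / a (?N n) < 1" using elim less_a_threshold[of "y n"] by (simp add: divide_simps)
   then show ?case using u by simp
  qed
 qed
 from tendsto_inverse[OF this] show ?thesis by (simp add: inverse_eq_divide)
qed

end

section \<open>Abel summation and Laplace transforms of regularly varying sequences\<close>

lemma nn_integral_exp_tail:
 "(\<integral>\<^sup>+y. ennreal (exp (- y)) * indicator {t..} y \<partial>lborel) = ennreal (exp (- t))"
proof -
 have "((\<lambda>y::real. - exp (- y)) \<longlongrightarrow> - 0) at_top"
  by (intro tendsto_minus filterlim_compose[OF exp_at_bot] filterlim_uminus_at_bot_at_top)
 then have "(\<integral>\<^sup>+y. ennreal (exp (- y)) * indicator {t..} y \<partial>lborel) = ennreal (- 0 - (- exp (- t)))"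
  by (intro nn_integral_FTC_atLeast) (auto intro!: derivative_eq_intros)
 then show ?thesis by simp
qed

text \<open>Abel summation: exp (- s k) is the integral of exp (- y) over y \<ge> s k, and
  exchanging sum and integral leaves partial sums of \<open>b\<close>.\<close>

lemma exp_sum_eq_integral:
 fixes b :: "nat \<Rightarrow> real"
 assumes b: "\<And>k. 0 \<le> b k" and s: "0 < s"
 shows "(\<Sum>k. ennreal (exp (- s * real k) * b k)) =
  (\<integral>\<^sup>+y. ennreal (exp (- y) * (\<Sum>k<nat \<lfloor>y / s\<rfloor> + 1. b k)) * indicator {0..} y \<partial>lborel)"
proof -
 have "(\<Sum>k. ennreal (exp (- s * real k) * b k)) =
   (\<Sum>k. \<integral>\<^sup>+y. ennreal (b k) * (ennreal (exp (- y)) * indicator {s * real k..} y) \<partial>lborel)"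
  using b by (simp add: nn_integral_cmult nn_integral_exp_tail ennreal_mult[symmetric] mult.commute)
 also have "\<dots> = (\<integral>\<^sup>+y. (\<Sum>k. ennreal (b k) * (ennreal (exp (- y)) * indicator {s * real k..} y)) \<partial>lborel)"
  by (rule nn_integral_suminf[symmetric]) measurable
 also have "\<dots> = (\<integral>\<^sup>+y. ennreal (exp (- y) * (\<Sum>k<nat \<lfloor>y / s\<rfloor> + 1. b k)) * indicator {0..} y \<partial>lborel)"
 proof (rule nn_integral_cong)
  fix y :: real
  show "(\<Sum>k. ennreal (b k) * (ennreal (exp (- y)) * indicator {s * real k..} y)) =
    ennreal (exp (- y) * (\<Sum>k<nat \<lfloor>y / s\<rfloor> + 1. b k)) * indicator {0..} y"
  proof (cases "0 \<le> y")
   case True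
   \<comment> \<open>The index k equal to the integer part of y / s still counts, hence the + 1 in
     the range of the partial sums.\<close>
   have iff: "s * real k \<le> y \<longleftrightarrow> k < nat \<lfloor>y / s\<rfloor> + 1" for k
   proof -
    have "s * real k \<le> y \<longleftrightarrow> real k \<le> y / s" using s by (simp add: field_simps)
    also have "\<dots> \<longleftrightarrow> int k \<le> \<lfloor>y / s\<rfloor>" by (simp add: le_floor_iff)
    also have "\<dots> \<longleftrightarrow> k < nat \<lfloor>y / s\<rfloor> + 1" using True s by (simp add: le_nat_iff less_Suc_eq_le)
    finally show ?thesis .
   qed
   have "(\<Sum>k. ennreal (b k) * (ennreal (exp (- y)) * indicator {s * real k..} y)) =
     (\<Sum>k<nat \<lfloor>y / s\<rfloor> + 1. ennreal (b k) * (ennreal (exp (- y)) * indicator {s * real k..} y))"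
    by (rule suminf_finite) (auto simp: iff indicator_def simp del: add_Suc_right)
   also have "\<dots> = (\<Sum>k<nat \<lfloor>y / s\<rfloor> + 1. ennreal (exp (- y) * b k))"
    by (rule sum.cong) (auto simp: iff indicator_def b ennreal_mult mult.commute simp del: add_Suc_right)
   also have "\<dots> = ennreal (exp (- y) * (\<Sum>k<nat \<lfloor>y / s\<rfloor> + 1. b k))"
    unfolding sum_distrib_left by (rule sum_ennreal) (simp add: b)
   finally show ?thesis using True by simp
  next
   case False
   have "\<not> s * real k \<le> y" for k
    using False s mult_nonneg_nonneg[of s "real k"] by linarith
   then show ?thesis using False by simp
  qed
 qed
 finally show ?thesis .
qed

lemma integrable_power_exp: "integrable lborel (\<lambda>y::real. indicator {0..} y * (y ^ k * exp (- y)))"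
proof (rule integrableI_nonneg)
 have "(\<integral>\<^sup>+y. ennreal (indicator {0..} y * (y ^ k * exp (- y))) \<partial>lborel) =
   (\<integral>\<^sup>+y. ennreal (y ^ k * exp (- y)) * indicator {0..} y \<partial>lborel)"
  by (intro nn_integral_cong) (auto simp: indicator_def)
 then show "(\<integral>\<^sup>+y. ennreal (indicator {0..} y * (y ^ k * exp (- y))) \<partial>lborel) < \<infinity>"
  by (simp add: nn_intergal_power_times_exp_Ici)
qed (auto simp: indicator_def)

text \<open>The Gamma integral after scaling; this is the origin of the constant
  \<open>kappa\<close>.\<close>

lemma integral_powr_exp:
 fixes \<alpha> \<sigma> :: real
 assumes \<alpha>: "0 < \<alpha>" and \<sigma>: "0 < \<sigma>"
 shows "(LINT y|lborel. indicator {0..} y * (exp (- y) * (y / \<sigma>) powr \<alpha>)) = Gamma (1 + \<alpha>) / \<sigma> powr \<alpha>"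
proof -
 have "ennreal (Gamma (1 + \<alpha>)) = (\<integral>\<^sup>+y. ennreal (indicator {0..} y * y powr (1 + \<alpha> - 1) / exp y) \<partial>lborel)"
  using \<alpha> by (intro Gamma_conv_nn_integral_real) simp
 then have "(LINT y|lborel. indicator {0..} y * y powr (1 + \<alpha> - 1) / exp y) = Gamma (1 + \<alpha>)"
  using \<alpha> Gamma_real_pos[of "1 + \<alpha>"]
  by (subst integral_eq_nn_integral) (auto simp: indicator_def less_imp_le)
 moreover have "(LINT y|lborel. indicator {0..} y * (exp (- y) * (y / \<sigma>) powr \<alpha>)) =
   (LINT y|lborel. (indicator {0..} y * y powr (1 + \<alpha> - 1) / exp y) / \<sigma> powr \<alpha>)"
  using \<sigma> by (intro lint_cong) (auto simp: indicator_def powr_divide exp_minus field_simps)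
 ultimately show ?thesis by (simp only: integral_divide_zero)
qed

context rv_seq
begin

text \<open>The sequence may start with negative values, so its positive part is taken; the + 1
  matches the range of the partial sums in \<open>exp_sum_eq_integral\<close>.\<close>

definition laplace_integrand :: "nat \<Rightarrow> real \<Rightarrow> real \<Rightarrow> real" where
 "laplace_integrand N \<sigma> y = indicator {0..} y * (exp (- y) * max 0 (a (nat \<lfloor>y * real N / \<sigma>\<rfloor> + 1)))"

definition laplace_a :: "nat \<Rightarrow> real \<Rightarrow> real" where
 "laplace_a N \<sigma> = (LINT y|lborel. laplace_integrand N \<sigma> y)"

lemma laplace_integrand_measurable [measurable]: "laplace_integrand N \<sigma> \<in> borel_measurable lborel"
proof -
 have "(\<lambda>y. max 0 (a (nat \<lfloor>y * real N / \<sigma>\<rfloor> + 1))) \<in> borel_measurable lborel"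
  by (rule measurable_compose[of _ _ "count_space UNIV"]) measurable
 then show ?thesis unfolding laplace_integrand_def[abs_def] by measurable
qed

lemma laplace_integrand_nonneg: "0 \<le> laplace_integrand N \<sigma> y"
 by (simp add: laplace_integrand_def)

text \<open>The domination is uniform in \<open>N\<close>, by the Potter bound.\<close>

lemma laplace_domination:
 assumes "\<alpha> \<le> 1" and \<sigma>: "0 < \<sigma>"
 obtains x0 w where "integrable lborel w" "\<And>N. x0 \<le> N \<Longrightarrow> 0 < a N"
  "\<And>N y. x0 \<le> N \<Longrightarrow> laplace_integrand N \<sigma> y \<le> w y * a N"
proof -
 obtain x0 K where K: "0 < K" "\<And>x k. x0 \<le> x \<Longrightarrow> 1 \<le> k \<Longrightarrow> 0 < a x \<and> a (k * x) \<le> K * real k powr (\<alpha> + 1) * a x"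
  using potter by metis
 \<comment> \<open>A quadratic majorant suffices because \<alpha> + 1 \<le> 2; the 2 bounds the
   rounding errors in the multiple of N.\<close>
 define w where "w y = indicator {0..} y * (exp (- y) * (K * (y / \<sigma> + 2) ^ 2))" for y :: real
 have "w = (\<lambda>y. K / \<sigma>\<^sup>2 * (indicator {0..} y * (y ^ 2 * exp (- y))) +
   4 * K / \<sigma> * (indicator {0..} y * (y ^ 1 * exp (- y))) + 4 * K * (indicator {0..} y * (y ^ 0 * exp (- y))))"
  using \<sigma> by (intro ext) (simp add: w_def power2_eq_square field_simps)
 moreover have "integrable lborel \<dots>"
  by (intro Bochner_Integration.integrable_add integrable_mult_right integrable_power_exp)
 ultimately have w_int: "integrable lborel w" by simp
 show thesis
 proof (rule that[of w "max 1 x0", OF w_int])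
  show "0 < a N" if "max 1 x0 \<le> N" for N using K(2)[of N 1] that by simp
  fix N y assume N: "max 1 x0 \<le> N"
  show "laplace_integrand N \<sigma> y \<le> w y * a N"
  proof (cases "0 \<le> y")
   case True
   \<comment> \<open>An integer multiple of N that dominates the argument of \<open>a\<close>, as
     the Potter bound speaks of integer multiples only.\<close>
   define k where "k = nat \<lceil>y / \<sigma>\<rceil> + 1"
   have k: "real k \<le> y / \<sigma> + 2" "y / \<sigma> + 1 \<le> real k" "1 \<le> k"
    using True \<sigma> unfolding k_def by (auto simp: of_nat_ceiling) linarith+
   have "real (nat \<lfloor>y * real N / \<sigma>\<rfloor> + 1) \<le> y / \<sigma> * real N + 1"
    using True \<sigma> by (simp add: of_nat_floor)
   also have "\<dots> \<le> (y / \<sigma> + 1) * real N" using N by (simp add: algebra_simps)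
   also have "\<dots> \<le> real k * real N" using k(2) by (intro mult_right_mono) auto
   finally have "nat \<lfloor>y * real N / \<sigma>\<rfloor> + 1 \<le> k * N" by (simp flip: of_nat_mult)
   then have "a (nat \<lfloor>y * real N / \<sigma>\<rfloor> + 1) \<le> a (k * N)" by (rule monoD[OF mono_a])
   also have "\<dots> \<le> K * real k powr (\<alpha> + 1) * a N" using K(2)[of N k] N k(3) by simp
   also have "\<dots> \<le> K * (y / \<sigma> + 2) ^ 2 * a N"
   proof (intro mult_right_mono mult_left_mono)
    have "real k powr (\<alpha> + 1) \<le> real k powr 2"
     using k(3) \<open>\<alpha> \<le> 1\<close> by (intro powr_mono) auto
    also have "\<dots> = real k ^ 2" using k(3) by (simp add: powr_numeral)
    also have "\<dots> \<le> (y / \<sigma> + 2) ^ 2" using k(1) by (intro power_mono) auto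
    finally show "real k powr (\<alpha> + 1) \<le> (y / \<sigma> + 2) ^ 2" .
    show "0 \<le> a N" using K(2)[of N 1] N by simp
   qed (use K in simp)
   finally have "a (nat \<lfloor>y * real N / \<sigma>\<rfloor> + 1) \<le> K * (y / \<sigma> + 2) ^ 2 * a N" .
   moreover have "0 \<le> K * (y / \<sigma> + 2) ^ 2 * a N" using K N K(2)[of N 1] by simp
   ultimately have "max 0 (a (nat \<lfloor>y * real N / \<sigma>\<rfloor> + 1)) \<le> K * (y / \<sigma> + 2) ^ 2 * a N" by simp
   from mult_left_mono[OF this, of "exp (- y)"] show ?thesis
    using True by (simp add: laplace_integrand_def w_def ac_simps)
  qed (simp add: laplace_integrand_def w_def)
 qed
qed

lemma laplace_integrable:
 assumes "\<alpha> \<le> 1" "0 < \<sigma>"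
 shows "\<forall>\<^sub>F N in sequentially. integrable lborel (laplace_integrand N \<sigma>)"
proof -
 obtain x0 w where w: "integrable lborel w" "\<And>N. x0 \<le> N \<Longrightarrow> 0 < a N"
  "\<And>N y. x0 \<le> N \<Longrightarrow> laplace_integrand N \<sigma> y \<le> w y * a N"
  using laplace_domination[OF assms] by metis
 have "integrable lborel (laplace_integrand N \<sigma>)" if N: "x0 \<le> N" for N
 proof (rule lint_bound)
  show "integrable lborel (\<lambda>y. w y * a N)" using w(1) by simp
  show "AE y in lborel. norm (laplace_integrand N \<sigma> y) \<le> norm (w y * a N)"
  proof (rule AE_I2)
   fix y show "norm (laplace_integrand N \<sigma> y) \<le> norm (w y * a N)"
    using w(3)[OF N, of y] laplace_integrand_nonneg[of N \<sigma> y] by simp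
  qed
 qed measurable
 then show ?thesis by (auto simp: eventually_sequentially)
qed

lemma laplace_a_limit:
 assumes "\<alpha> \<le> 1" and \<sigma>: "0 < \<sigma>" and N: "filterlim N at_top sequentially"
 shows "(\<lambda>n. laplace_a (N n) \<sigma> / a (N n)) \<longlonglongrightarrow> Gamma (1 + \<alpha>) / \<sigma> powr \<alpha>"
proof -
 obtain x0 w where w: "integrable lborel w" "\<And>N. x0 \<le> N \<Longrightarrow> 0 < a N"
  "\<And>N y. x0 \<le> N \<Longrightarrow> laplace_integrand N \<sigma> y \<le> w y * a N"
  using laplace_domination[OF assms(1,2)] by metis
 have "\<forall>\<^sub>F n in sequentially. x0 \<le> N n"
  using eventually_compose_filterlim[OF eventually_ge_at_top N] .
 then obtain n0 where n0: "\<And>n. n0 \<le> n \<Longrightarrow> x0 \<le> N n" by (auto simp: eventually_sequentially)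
 \<comment> \<open>The offset n0 makes the domination valid for every index of the sequence.\<close>
 have "(\<lambda>n. LINT y|lborel. laplace_integrand (N (n + n0)) \<sigma> y / a (N (n + n0))) \<longlonglongrightarrow>
   (LINT y|lborel. indicator {0..} y * (exp (- y) * (y / \<sigma>) powr \<alpha>))"
 proof (rule integral_dominated_convergence[where w = w])
  show "AE y in lborel. norm (laplace_integrand (N (n + n0)) \<sigma> y / a (N (n + n0))) \<le> w y" for n
  proof (rule AE_I2)
   fix y
   have "x0 \<le> N (n + n0)" by (rule n0) simp
   from w(2,3)[OF this] show "norm (laplace_integrand (N (n + n0)) \<sigma> y / a (N (n + n0))) \<le> w y"
    using laplace_integrand_nonneg by (simp add: divide_le_eq)
  qed
  \<comment> \<open>Regular variation is stated for positive multiples; the single point y = 0 is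
    null.\<close>
  have "AE y in lborel. y \<noteq> (0::real)" by (rule AE_lborel_singleton)
  then show "AE y in lborel. (\<lambda>n. laplace_integrand (N (n + n0)) \<sigma> y / a (N (n + n0))) \<longlonglongrightarrow>
    indicator {0..} y * (exp (- y) * (y / \<sigma>) powr \<alpha>)"
  proof eventually_elim
   case (elim y)
   show ?case
   proof (cases "0 \<le> y")
    case True
    then have c: "0 < y / \<sigma>" using elim \<sigma> by simp
    have "(\<lambda>n. a (nat \<lfloor>y / \<sigma> * real (N n)\<rfloor> + 1) / a (N n)) \<longlonglongrightarrow> (y / \<sigma>) powr \<alpha>"
     by (rule a_rv_shift[OF c N])
    then have "(\<lambda>n. max 0 (a (nat \<lfloor>y / \<sigma> * real (N n)\<rfloor> + 1) / a (N n))) \<longlonglongrightarrow> max 0 ((y / \<sigma>) powr \<alpha>)"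
     by (intro tendsto_max tendsto_const)
    then have "(\<lambda>n. exp (- y) * max 0 (a (nat \<lfloor>y / \<sigma> * real (N (n + n0))\<rfloor> + 1) / a (N (n + n0)))) \<longlonglongrightarrow>
      exp (- y) * (y / \<sigma>) powr \<alpha>"
     by (intro tendsto_mult_left LIMSEQ_ignore_initial_segment) (simp add: max_def split: if_splits)
    also have "(\<lambda>n. exp (- y) * max 0 (a (nat \<lfloor>y / \<sigma> * real (N (n + n0))\<rfloor> + 1) / a (N (n + n0)))) =
      (\<lambda>n. laplace_integrand (N (n + n0)) \<sigma> y / a (N (n + n0)))"
    proof
     fix n
     have "0 < a (N (n + n0))" by (rule w(2)[OF n0]) simp
     then show "exp (- y) * max 0 (a (nat \<lfloor>y / \<sigma> * real (N (n + n0))\<rfloor> + 1) / a (N (n + n0))) =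
       laplace_integrand (N (n + n0)) \<sigma> y / a (N (n + n0))"
      using True by (auto simp: laplace_integrand_def max_def divide_le_0_iff zero_le_divide_iff)
    qed
    finally show ?thesis using True by simp
   qed (simp add: laplace_integrand_def)
  qed
 qed (use w in auto)
 then have "(\<lambda>n. laplace_a (N (n + n0)) \<sigma> / a (N (n + n0))) \<longlonglongrightarrow> Gamma (1 + \<alpha>) / \<sigma> powr \<alpha>"
  using integral_powr_exp[OF \<alpha> \<sigma>] by (simp add: laplace_a_def)
 then show ?thesis by (rule LIMSEQ_offset)
qed

text \<open>The weight exp (- y) has total mass 1 on the half-line, so an additive error
  \<open>c2\<close> in the partial sums reappears unchanged, and the multiple \<open>c1\<close> of
  \<open>a\<close> becomes the same multiple of its Laplace integral.\<close>

lemma abel_bounds: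
 fixes b :: "nat \<Rightarrow> real"
 assumes \<sigma>: "0 < \<sigma>" and N: "0 < N" and int: "integrable lborel (laplace_integrand N \<sigma>)"
  and b: "\<And>k. 0 \<le> b k" and c: "0 \<le> c1" "0 \<le> c2"
 shows "(\<And>n. (\<Sum>k<n. b k) \<le> c1 * max 0 (a n) + c2) \<Longrightarrow>
   (\<Sum>k. ennreal (exp (- (\<sigma> / real N) * real k) * b k)) \<le> ennreal (c1 * laplace_a N \<sigma> + c2)"
  and "(\<And>n. c1 * max 0 (a n) \<le> (\<Sum>k<n. b k) + c2) \<Longrightarrow>
   ennreal (c1 * laplace_a N \<sigma>) \<le> (\<Sum>k. ennreal (exp (- (\<sigma> / real N) * real k) * b k)) + ennreal c2"
proof -
 let ?n = "\<lambda>y. nat \<lfloor>y * real N / \<sigma>\<rfloor> + 1"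
 let ?S = "\<lambda>y. exp (- y) * (\<Sum>k<?n y. b k)"
 have sum_eq: "(\<Sum>k. ennreal (exp (- (\<sigma> / real N) * real k) * b k)) =
   (\<integral>\<^sup>+y. ennreal (?S y) * indicator {0..} y \<partial>lborel)"
 proof -
  have "0 < \<sigma> / real N" using \<sigma> N by simp
  from exp_sum_eq_integral[of b, OF b this] show ?thesis
   by (simp only: divide_divide_eq_right)
 qed
 have [measurable]: "(\<lambda>y. \<Sum>k<?n y. b k) \<in> borel_measurable lborel"
  by (rule measurable_compose[of ?n _ "count_space UNIV"]) measurable
 have lap: "(\<integral>\<^sup>+y. ennreal (laplace_integrand N \<sigma> y) \<partial>lborel) = ennreal (laplace_a N \<sigma>)"
  unfolding laplace_a_def by (rule nn_integral_eq_integral[OF int]) (simp add: laplace_integrand_nonneg)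
 have lap_nonneg: "0 \<le> laplace_a N \<sigma>"
  unfolding laplace_a_def by (rule lint_nonneg) (rule laplace_integrand_nonneg)
 have const: "(\<integral>\<^sup>+y. ennreal c2 * (ennreal (exp (- y)) * indicator {0..} y) \<partial>lborel) = ennreal c2"
  by (simp add: nn_integral_cmult nn_integral_exp_tail)
 have split: "(\<integral>\<^sup>+y. ennreal c1 * ennreal (laplace_integrand N \<sigma> y) +
   ennreal c2 * (ennreal (exp (- y)) * indicator {0..} y) \<partial>lborel) = ennreal (c1 * laplace_a N \<sigma> + c2)"
  using c lap_nonneg
  by (simp add: nn_integral_add nn_integral_cmult[of "\<lambda>y. ennreal (laplace_integrand N \<sigma> y)"] lap const
    ennreal_mult ennreal_plus)
 { assume up: "\<And>n. (\<Sum>k<n. b k) \<le> c1 * max 0 (a n) + c2"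
  have "(\<integral>\<^sup>+y. ennreal (?S y) * indicator {0..} y \<partial>lborel) \<le>
   (\<integral>\<^sup>+y. ennreal c1 * ennreal (laplace_integrand N \<sigma> y) +
    ennreal c2 * (ennreal (exp (- y)) * indicator {0..} y) \<partial>lborel)"
  proof (rule nn_integral_mono)
   fix y :: real
   have "?S y \<le> exp (- y) * (c1 * max 0 (a (?n y)) + c2)" by (intro mult_left_mono up) auto
   also have "\<dots> = c1 * (exp (- y) * max 0 (a (?n y))) + c2 * exp (- y)" by (simp add: algebra_simps)
   finally have "ennreal (?S y) \<le> ennreal c1 * ennreal (exp (- y) * max 0 (a (?n y))) + ennreal c2 * ennreal (exp (- y))"
    using c by (simp add: ennreal_mult[symmetric] ennreal_plus[symmetric] ennreal_leI del: ennreal_plus)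
   then show "ennreal (?S y) * indicator {0..} y \<le> ennreal c1 * ennreal (laplace_integrand N \<sigma> y) +
    ennreal c2 * (ennreal (exp (- y)) * indicator {0..} y)"
    by (auto simp: laplace_integrand_def indicator_def)
  qed
  then show "(\<Sum>k. ennreal (exp (- (\<sigma> / real N) * real k) * b k)) \<le> ennreal (c1 * laplace_a N \<sigma> + c2)"
   unfolding sum_eq split . }
 { assume low: "\<And>n. c1 * max 0 (a n) \<le> (\<Sum>k<n. b k) + c2"
  have "(\<integral>\<^sup>+y. ennreal c1 * ennreal (laplace_integrand N \<sigma> y) \<partial>lborel) \<le>
   (\<integral>\<^sup>+y. ennreal (?S y) * indicator {0..} y + ennreal c2 * (ennreal (exp (- y)) * indicator {0..} y) \<partial>lborel)"
  proof (rule nn_integral_mono)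
   fix y :: real
   have "c1 * (exp (- y) * max 0 (a (?n y))) = exp (- y) * (c1 * max 0 (a (?n y)))" by simp
   also have "\<dots> \<le> exp (- y) * ((\<Sum>k<?n y. b k) + c2)" by (intro mult_left_mono low) auto
   also have "\<dots> = ?S y + c2 * exp (- y)" by (simp add: algebra_simps)
   finally have "ennreal c1 * ennreal (exp (- y) * max 0 (a (?n y))) \<le> ennreal (?S y) + ennreal c2 * ennreal (exp (- y))"
    using c b by (simp add: ennreal_mult[symmetric] ennreal_plus[symmetric] sum_nonneg ennreal_leI del: ennreal_plus)
   then show "ennreal c1 * ennreal (laplace_integrand N \<sigma> y) \<le>
     ennreal (?S y) * indicator {0..} y + ennreal c2 * (ennreal (exp (- y)) * indicator {0..} y)"
    by (auto simp: laplace_integrand_def indicator_def)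
  qed
  also have "\<dots> = (\<Sum>k. ennreal (exp (- (\<sigma> / real N) * real k) * b k)) + ennreal c2"
   unfolding sum_eq by (subst nn_integral_add) (auto simp: const)
  finally show "ennreal (c1 * laplace_a N \<sigma>) \<le> (\<Sum>k. ennreal (exp (- (\<sigma> / real N) * real k) * b k)) + ennreal c2"
   using c lap_nonneg by (simp add: nn_integral_cmult lap ennreal_mult) }
qed

end

declare hit_time.simps(2) [simp del]

subsection \<open>Averages over cylinders and return times\<close>

definition return_time :: "'v path set \<Rightarrow> 'v path \<Rightarrow> enat" where
 "return_time B x = hit_time B 1 x"

lemma return_time_eq_enat:
 "return_time B x = enat n \<longleftrightarrow> 0 < n \<and> sh n x \<in> B \<and> (\<forall>m. 0 < m \<and> sh m x \<in> B \<longrightarrow> n \<le> m)"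
 unfolding return_time_def by (rule hit_time_1_eq_enat)

lemma return_time_eq_infinity: "return_time B x = \<infinity> \<longleftrightarrow> (\<forall>n>0. sh n x \<notin> B)"
 unfolding return_time_def by (rule hit_time_1_eq_infinity)

lemma hit_time_Suc_return_time:
 "hit_time B (Suc k) x =
  (case return_time B x of enat r \<Rightarrow> enat r + hit_time B k (sh r x) | \<infinity> \<Rightarrow> \<infinity>)"
 unfolding return_time_def by (rule hit_time_first)

lemma (in shift_measure) measurable_return_time [measurable]:
 "B \<in> sets M \<Longrightarrow> return_time B \<in> M \<rightarrow>\<^sub>M count_space UNIV"
 unfolding return_time_def[abs_def] by (rule measurable_hit_time)

context recurrent_shift
begin

lemma distr_funpow: "distr M M (sh k) = M"
 by (rule measure_eqI) (auto simp: emeasure_distr emeasure_funpow_vimage)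

lemma AE_funpow: "AE x in M. P x \<Longrightarrow> AE x in M. P (sh k x)"
 by (rule AE_distrD[OF measurable_funpow_lshift]) (simp only: distr_funpow)

lemma integrable_funpow:
 fixes F :: "'v path \<Rightarrow> real"
 assumes F: "integrable M F"
 shows "integrable M (\<lambda>x. F (sh k x))" and "(LINT x|M. F (sh k x)) = (LINT x|M. F x)"
proof -
 have Fm: "F \<in> borel_measurable M" using F by auto
 note d = distr_funpow[of k]
 show "integrable M (\<lambda>x. F (sh k x))"
  by (rule integrable_distr[OF measurable_funpow_lshift]) (simp add: d F)
 show "(LINT x|M. F (sh k x)) = (LINT x|M. F x)"
  using integral_distr[OF measurable_funpow_lshift Fm, where k1 = k] d by simp
qed

lemma integrable_indicator_funpow:
 fixes F :: "'v path \<Rightarrow> real"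
 assumes F: "integrable M F" and X: "X \<in> sets M"
 shows "integrable M (\<lambda>x. indicator X x * F (sh k x))"
proof -
 have "bounded ((indicator X :: _ \<Rightarrow> real) ` space M)"
  by (rule boundedI[of _ 1]) (auto simp: indicator_def)
 from integrable_mult_bounded[OF integrable_funpow(1)[OF F, of k] _ this] X show ?thesis
  by (simp add: mult.commute)
qed

lemma compare_real:
 fixes F G :: "'v path \<Rightarrow> real"
 assumes w: "w \<noteq> []" and X: "determined A k X"
  and F: "integrable M F" "\<And>x. 0 \<le> F x" "\<And>y. y \<notin> cyl A w \<Longrightarrow> F y = 0"
  and G: "integrable M G" "\<And>x. 0 \<le> G x" "\<And>y. y \<notin> cyl A w \<Longrightarrow> G y = 0"
 shows "corr M X F k * (LINT y|M. G y)
  \<le> exp (D (length w)) * ((LINT y|M. F y) * corr M X G k)"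
proof -
 have X_m: "X \<in> sets M" by (rule determined_sets[OF X])
 have Fm [measurable]: "F \<in> borel_measurable M" and Gm [measurable]: "G \<in> borel_measurable M"
  using F G by auto
 have conv: "(\<integral>\<^sup>+x. indicator X x * ennreal (H (sh k x)) \<partial>M) = ennreal (corr M X H k)"
  if H: "integrable M H" "\<And>x. 0 \<le> H x" for H
 proof -
  have "(\<integral>\<^sup>+x. indicator X x * ennreal (H (sh k x)) \<partial>M) =
    (\<integral>\<^sup>+x. ennreal (indicator X x * H (sh k x)) \<partial>M)"
   by (intro nn_integral_cong) (auto simp: indicator_def)
  also have "\<dots> = ennreal (corr M X H k)"
   by (rule nn_integral_eq_integral[OF integrable_indicator_funpow[OF H(1) X_m]]) (use H in auto)
  finally show ?thesis .
 qed
 have conv1: "(\<integral>\<^sup>+x. ennreal (H x) \<partial>M) = ennreal (LINT x|M. H x)"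
  if H: "integrable M H" "\<And>x. 0 \<le> H x" for H
  by (rule nn_integral_eq_integral[OF H(1)]) (use H in auto)
 have nn: "0 \<le> (LINT x|M. H x)" "0 \<le> corr M X H k"
  if "\<And>x. 0 \<le> H x" for H :: "'v path \<Rightarrow> real"
  by (rule lint_nonneg, use that in simp)+
 have "(\<integral>\<^sup>+x. indicator X x * ennreal (F (sh k x)) \<partial>M) * (\<integral>\<^sup>+y. ennreal (G y) \<partial>M)
   \<le> ennreal (exp (D (length w))) * ((\<integral>\<^sup>+y. ennreal (F y) \<partial>M) * (\<integral>\<^sup>+x. indicator X x * ennreal (G (sh k x)) \<partial>M))"
  by (rule set_kernel_compare[OF kernel w X]) (use F G in auto)
 then show ?thesis
  unfolding conv[OF F(1,2)] conv[OF G(1,2)] conv1[OF F(1,2)] conv1[OF G(1,2)]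
  using nn[where H = F, OF F(2)] nn[where H = G, OF G(2)] by (simp add: ennreal_mult[symmetric])
qed

lemma fmeasurable_cyl: "w \<noteq> [] \<Longrightarrow> cyl A w \<in> fmeasurable M"
 using cyl_finite by (auto simp: fmeasurable_def)

lemma measure_cyl_pos: "w \<noteq> [] \<Longrightarrow> cyl A w \<noteq> {} \<Longrightarrow> 0 < measure M (cyl A w)"
 using cyl_pos cyl_finite by (auto simp: measure_def enn2real_positive_iff)

text \<open>The point is uniformity: \<open>c\<close> is the same for all admissible
  \<open>F\<close> and the error is proportional to the integral of \<open>F\<close>. Later
  \<open>F\<close> is the defect on a shrinking cylinder, so its error vanishes with the measure of
  that cylinder.\<close>

lemma dual_ergodic_bounds:
 assumes u: "u \<noteq> []" and p: "p \<noteq> []" "cyl A p \<noteq> {}" and \<epsilon>: "0 < \<epsilon>" "\<epsilon> < 1" and u_pos: "cyl A u \<noteq> {}"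
 obtains c where "0 \<le> c"
  "\<And>F n. integrable M F \<Longrightarrow> (\<And>x. 0 \<le> F x) \<Longrightarrow> (\<And>y. y \<notin> cyl A p \<Longrightarrow> F y = 0) \<Longrightarrow>
   (\<Sum>k<n. LINT x|M. indicator (cyl A u) x * F (sh k x)) \<le>
    ((1 + \<epsilon>) * exp (D (length p)) * measure M (cyl A u) * (LINT x|M. F x)) * max 0 (a n) + c * (LINT x|M. F x)"
  "\<And>F n. integrable M F \<Longrightarrow> (\<And>x. 0 \<le> F x) \<Longrightarrow> (\<And>y. y \<notin> cyl A p \<Longrightarrow> F y = 0) \<Longrightarrow>
   ((1 - \<epsilon>) * exp (- D (length p)) * measure M (cyl A u) * (LINT x|M. F x)) * max 0 (a n) \<le>
    (\<Sum>k<n. LINT x|M. indicator (cyl A u) x * F (sh k x)) + c * (LINT x|M. F x)"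
proof -
 let ?C = "cyl A u" and ?P = "cyl A p"
 define L where "L = length u"
 define ED where "ED = exp (D (length p))"
 have ED: "1 \<le> ED" using D_nonneg[of "length p"] by (simp add: ED_def)
 have C_int: "integrable M (indicator ?C :: _ \<Rightarrow> real)"
  using cyl_finite[OF u] by simp
 \<comment> \<open>The only set along which convergence of the averages is used; every
   \<open>F\<close> is compared with its indicator through the kernel.\<close>
 obtain E where E: "E \<in> sets M" "E \<subseteq> ?P" "0 < emeasure M E" "emeasure M E < \<infinity>"
  "(\<lambda>n. 1 / a n * (\<Sum>k<n. LINT x|M. indicator ?C x * indicator E (sh k x))) \<longlonglongrightarrow>
   (LINT x|M. indicator ?C x) * measure M E"
  by (rule normalizing_good_set[OF norm_a C_int cyl_sets cyl_pos[OF p]]) (rule that)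
 define s :: "nat \<Rightarrow> real" where "s k = corr M ?C (indicator E) k" for k
 have E_int: "integrable M (indicator E :: _ \<Rightarrow> real)" using E by simp
 define e where "e = measure M E"
 have e_pos: "0 < e" using E by (simp add: e_def measure_def enn2real_positive_iff)
 have e_eq: "(LINT x|M. indicator E x) = e"
  using sets.sets_into_space[OF E(1)] by (simp add: e_def Int_absorb2)
 define m where "m = measure M ?C"
 have m_eq: "(LINT x|M. indicator ?C x) = m"
  using sets.sets_into_space[OF cyl_sets[of u]] by (simp add: m_def Int_absorb2)
 have m_pos: "0 < m" unfolding m_def by (rule measure_cyl_pos[OF u u_pos])
 have lim: "(\<lambda>n. 1 / a n * (\<Sum>k<n. s k)) \<longlonglongrightarrow> m * e"
  using E(5) unfolding s_def[symmetric] m_eq e_def .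
 have a_pos: "\<forall>\<^sub>F n in sequentially. 0 < a n" using a_top by (simp add: filterlim_at_top_dense)
 have "\<forall>\<^sub>F n in sequentially. (1 - \<epsilon>) * (m * e) < 1 / a n * (\<Sum>k<n. s k)"
  using \<epsilon> m_pos e_pos by (intro order_tendstoD(1)[OF lim]) simp
 moreover have "\<forall>\<^sub>F n in sequentially. 1 / a n * (\<Sum>k<n. s k) < (1 + \<epsilon>) * (m * e)"
  using \<epsilon> m_pos e_pos by (intro order_tendstoD(2)[OF lim]) simp
 ultimately have "\<forall>\<^sub>F n in sequentially. 0 < a n \<and> (1 - \<epsilon>) * (m * e) * a n \<le> (\<Sum>k<n. s k) \<and>
   (\<Sum>k<n. s k) \<le> (1 + \<epsilon>) * (m * e) * a n"
  using a_pos by eventually_elim (simp add: field_simps)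
 then obtain n1 where n1: "\<And>n. n1 \<le> n \<Longrightarrow> 0 < a n \<and> (1 - \<epsilon>) * (m * e) * a n \<le> (\<Sum>k<n. s k) \<and>
   (\<Sum>k<n. s k) \<le> (1 + \<epsilon>) * (m * e) * a n"
  by (auto simp: eventually_sequentially)
 \<comment> \<open>Three sources of error: times at which the word \<open>u\<close> does not yet
   belong to the past, trivial upper bounds for n < n1, and the main term of the lower bound for n <
   n1.\<close>
 define c where "c = real L + real n1 + max 0 (a n1) * m"
 have c: "0 \<le> c" using m_pos by (simp add: c_def)
 show thesis
 proof (rule that[OF c])
  fix F :: "'v path \<Rightarrow> real" and n
  assume F: "integrable M F" "\<And>x. 0 \<le> F x" "\<And>y. y \<notin> ?P \<Longrightarrow> F y = 0"
  define I where "I = (LINT x|M. F x)"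
  define t where "t k = corr M ?C F k" for k
  have I: "0 \<le> I" unfolding I_def using F(2) by simp
  have t0: "0 \<le> t k" "t k \<le> I" for k
  proof -
   show "0 \<le> t k" unfolding t_def using F(2) by (intro lint_nonneg) auto
   have "t k \<le> (LINT x|M. F (sh k x))"
    unfolding t_def by (intro integral_mono integrable_indicator_funpow integrable_funpow F(1) cyl_sets)
     (use F(2) in "auto simp: indicator_def")
   then show "t k \<le> I" using integrable_funpow(2)[OF F(1)] by (simp add: I_def)
  qed
  have s0: "0 \<le> s k" "s k \<le> e" for k
  proof -
   show "0 \<le> s k" unfolding s_def by (intro lint_nonneg) auto
   have "s k \<le> (LINT x|M. indicator E (sh k x))"
    unfolding s_def by (intro integral_mono integrable_indicator_funpow integrable_funpow E_int cyl_sets)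
     (auto simp: indicator_def)
   then show "s k \<le> e" using integrable_funpow(2)[OF E_int] e_eq by simp
  qed
  have det: "determined A k ?C" if "L \<le> k" for k
   using determined_mono[OF determined_cyl[of A u]] that by (simp add: L_def)
  have ts: "t k * e \<le> ED * (I * s k)" "s k * I \<le> ED * (e * t k)" if "L \<le> k" for k
  proof -
   have E0: "indicator E y = (0::real)" if "y \<notin> ?P" for y using that E(2) by (auto simp: indicator_def)
   show "t k * e \<le> ED * (I * s k)" "s k * I \<le> ED * (e * t k)"
    using compare_real[OF p(1) det[OF that] F E_int _ E0] compare_real[OF p(1) det[OF that] E_int _ E0 F]
    unfolding t_def s_def I_def ED_def e_eq by auto
  qed
  have up: "t k * e \<le> ED * (I * s k) + (if k < L then I * e else 0)" for k
  proof (cases "k < L")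
   case True
   have "t k * e \<le> I * e" using t0[of k] e_pos by (intro mult_right_mono) auto
   moreover have "0 \<le> ED * (I * s k)" using ED I s0 by simp
   ultimately show ?thesis using True by simp
  qed (use ts in auto)
  have lo: "s k * I \<le> ED * (e * t k) + (if k < L then e * I else 0)" for k
  proof (cases "k < L")
   case True
   have "s k * I \<le> e * I" using s0[of k] I by (intro mult_right_mono) auto
   moreover have "0 \<le> ED * (e * t k)" using ED e_pos t0 by simp
   ultimately show ?thesis using True by simp
  qed (use ts in auto)
  have count: "(\<Sum>k<n. (if k < L then z else 0)) \<le> real L * z" if "0 \<le> z" for z :: real
  proof -
   have "(\<Sum>k<n. (if k < L then z else 0)) = real (min n L) * z"
    by (induction n) (auto simp: min_def algebra_simps)
   also have "\<dots> \<le> real L * z" using that by (intro mult_right_mono) auto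
   finally show ?thesis .
  qed
  have "(\<Sum>k<n. t k) * e \<le> ED * (I * (\<Sum>k<n. s k)) + real L * (I * e)"
  proof -
   have "(\<Sum>k<n. t k) * e \<le> (\<Sum>k<n. ED * (I * s k) + (if k < L then I * e else 0))"
    unfolding sum_distrib_right by (rule sum_mono) (rule up)
   then show ?thesis using count[of "I * e"] I e_pos by (simp add: sum.distrib sum_distrib_left)
  qed
  then have sum_up: "(\<Sum>k<n. t k) \<le> ED * (I * (\<Sum>k<n. s k)) / e + real L * I"
   using e_pos by (simp add: field_simps)
  have sum_lo: "(\<Sum>k<n. s k) * I \<le> ED * (e * (\<Sum>k<n. t k)) + real L * (e * I)"
  proof -
   have "(\<Sum>k<n. s k) * I \<le> (\<Sum>k<n. ED * (e * t k) + (if k < L then e * I else 0))"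
    unfolding sum_distrib_right by (rule sum_mono) (rule lo)
   then show ?thesis using count[of "e * I"] I e_pos by (simp add: sum.distrib sum_distrib_left)
  qed
  have c_ge: "real L * I \<le> c * I" "real n1 * I \<le> c * I" "max 0 (a n1) * m * I \<le> c * I"
   using I m_pos by (auto intro!: mult_right_mono simp: c_def)
  have "(\<Sum>k<n. t k) \<le> ((1 + \<epsilon>) * ED * m * I) * max 0 (a n) + c * I"
  proof (cases "n1 \<le> n")
   case True
   have "ED * (I * (\<Sum>k<n. s k)) / e \<le> ED * (I * ((1 + \<epsilon>) * (m * e) * a n)) / e"
    using n1[OF True] ED I e_pos by (intro divide_right_mono mult_left_mono) auto
   also have "\<dots> = ((1 + \<epsilon>) * ED * m * I) * max 0 (a n)"
    using n1[OF True] e_pos by (simp add: max_def)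
   finally show ?thesis using sum_up c_ge(1) by linarith
  next
   case False
   have "(\<Sum>k<n. t k) \<le> (\<Sum>k<n. I)" by (rule sum_mono) (rule t0)
   also have "\<dots> \<le> real n1 * I" using False I by (simp add: mult_right_mono)
   finally have "(\<Sum>k<n. t k) \<le> c * I" using c_ge(2) by linarith
   moreover have "0 \<le> ((1 + \<epsilon>) * ED * m * I) * max 0 (a n)" using \<epsilon> ED m_pos I by simp
   ultimately show ?thesis by linarith
  qed
  then show "(\<Sum>k<n. LINT x|M. indicator ?C x * F (sh k x)) \<le>
    ((1 + \<epsilon>) * exp (D (length p)) * measure M ?C * (LINT x|M. F x)) * max 0 (a n) + c * (LINT x|M. F x)"
   unfolding t_def I_def ED_def m_def .
  have expm: "exp (- D (length p)) = 1 / ED" by (simp add: ED_def exp_minus field_simps)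
  have "((1 - \<epsilon>) * (1 / ED) * m * I) * max 0 (a n) \<le> (\<Sum>k<n. t k) + c * I"
  proof (cases "n1 \<le> n")
   case True
   have "(1 - \<epsilon>) * (m * e) * a n * I \<le> ED * (e * (\<Sum>k<n. t k)) + real L * (e * I)"
    using mult_right_mono[OF conjunct1[OF conjunct2[OF n1[OF True]]] I] sum_lo by linarith
   also have "\<dots> \<le> ED * (e * (\<Sum>k<n. t k)) + ED * (real L * (e * I))"
    using ED I e_pos mult_right_mono[of 1 ED "real L * (e * I)"] by simp
   finally have "((1 - \<epsilon>) * m * a n * I) * e \<le> (ED * ((\<Sum>k<n. t k) + real L * I)) * e"
    by (simp add: algebra_simps)
   then have "(1 - \<epsilon>) * m * a n * I \<le> ED * ((\<Sum>k<n. t k) + real L * I)"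
    using e_pos by (simp add: mult_le_cancel_right)
   then have "(1 - \<epsilon>) * m * a n * I / ED \<le> (\<Sum>k<n. t k) + real L * I"
    using ED by (simp add: divide_le_eq mult.commute)
   moreover have "((1 - \<epsilon>) * (1 / ED) * m * I) * max 0 (a n) = (1 - \<epsilon>) * m * a n * I / ED"
    using n1[OF True] by (simp add: max_def)
   ultimately show ?thesis using c_ge(1) by linarith
  next
   case False
   have "((1 - \<epsilon>) * (1 / ED)) * (m * I * max 0 (a n)) \<le> 1 * (m * I * max 0 (a n1))"
   proof (intro mult_mono)
    show "(1 - \<epsilon>) * (1 / ED) \<le> 1" using ED \<epsilon> by (intro mult_le_one) auto
    show "max 0 (a n) \<le> max 0 (a n1)" using monoD[OF mono_a, of n n1] False by auto
   qed (use m_pos I in auto)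
   also have "\<dots> \<le> c * I" using c_ge(3) by (simp add: ac_simps)
   moreover have "0 \<le> (\<Sum>k<n. t k)" by (rule sum_nonneg) (rule t0)
   ultimately show ?thesis by (simp add: ac_simps)
  qed
  then show "((1 - \<epsilon>) * exp (- D (length p)) * measure M ?C * (LINT x|M. F x)) * max 0 (a n) \<le>
    (\<Sum>k<n. LINT x|M. indicator ?C x * F (sh k x)) + c * (LINT x|M. F x)"
   unfolding t_def I_def m_def expm .
 qed
qed

text \<open>Points of a letter that never enter the cylinder have vanishing correlations at all
  positive times with every subset of it, whereas dual ergodicity predicts a positive limit of the
  averages if they had positive measure.\<close>

lemma AE_return_finite:
 assumes w: "w \<noteq> []" "cyl A w \<noteq> {}"
 shows "AE x in M. return_time (cyl A w) x < \<infinity>"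
proof -
 let ?B = "cyl A w"
 have "emeasure M {x \<in> space M. x \<in> cyl A [b] \<and> return_time ?B x = \<infinity>} = 0" for b
 proof (rule ccontr)
  define E where "E = {x \<in> space M. x \<in> cyl A [b] \<and> return_time ?B x = \<infinity>}"
  have E [measurable]: "E \<in> sets M" unfolding E_def by measurable
  assume "emeasure M {x \<in> space M. x \<in> cyl A [b] \<and> return_time ?B x = \<infinity>} \<noteq> 0"
  then have E_pos: "0 < emeasure M E" by (simp add: E_def zero_less_iff_neq_zero)
  have "emeasure M E \<le> emeasure M (cyl A [b])" by (intro emeasure_mono) (auto simp: E_def)
  then have E_fin: "emeasure M E < \<infinity>" using cyl_finite[of "[b]"] by (auto intro: le_less_trans)
  then have E_int: "integrable M (indicator E :: _ \<Rightarrow> real)" by simp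
  obtain F where F: "F \<in> sets M" "F \<subseteq> ?B" "0 < emeasure M F" "emeasure M F < \<infinity>"
   "(\<lambda>n. 1 / a n * (\<Sum>k<n. LINT x|M. indicator E x * indicator F (sh k x))) \<longlonglongrightarrow>
    (LINT x|M. indicator E x) * measure M F"
   by (rule normalizing_good_set[OF norm_a E_int cyl_sets cyl_pos[OF w]]) (rule that)
  \<comment> \<open>Only the term at time 0 can be nonzero; it disappears after division by a
    n.\<close>
  define c :: real where "c = integ M E (indicator F)"
  have zero: "corr M E (indicator F) k = (0::real)" if "0 < k" for k
  proof -
   have "corr M E (indicator F) k = (\<integral>x. 0 \<partial>M :: real)"
    using that F(2) by (intro lint_cong)
     (auto simp: E_def return_time_eq_infinity indicator_def)
   then show ?thesis by simp
  qed
  have "(\<Sum>k<n. LINT x|M. indicator E x * indicator F (sh k x)) = (if n = 0 then 0 else c)" for n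
  proof (cases n)
   case (Suc j)
   then show ?thesis by (simp add: sum.lessThan_Suc_shift zero c_def del: sum.lessThan_Suc funpow.simps(2))
  qed simp
  then have "\<forall>\<^sub>F n in sequentially. c / a n = 1 / a n * (\<Sum>k<n. LINT x|M. indicator E x * indicator F (sh k x))"
   by (intro eventually_mono[OF eventually_gt_at_top[of 0]]) simp
  from Lim_transform_eventually[OF filterlim_const_over_top[OF a_top] this]
  have "(LINT x|M. indicator E x) * measure M F = 0"
   using F(5) LIMSEQ_unique by blast
  moreover have "0 < measure M F" using F by (simp add: measure_def enn2real_positive_iff)
  moreover have "0 < measure M E" using E_pos E_fin by (simp add: measure_def enn2real_positive_iff)
  ultimately show False
   using sets.sets_into_space[OF E] by (simp add: Int_absorb2)
 qed
 then have "AE x in M. \<forall>b. x \<notin> {x \<in> space M. x \<in> cyl A [b] \<and> return_time ?B x = \<infinity>}"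
  unfolding AE_all_countable by (intro allI AE_not_in null_setsI) auto
 then show ?thesis
 proof (rule AE_mp, intro AE_I2 impI)
  fix x assume x: "x \<in> space M" "\<forall>b. x \<notin> {x \<in> space M. x \<in> cyl A [b] \<and> return_time ?B x = \<infinity>}"
  have "x \<in> cyl A [x 0]" using x(1) by (simp add: cyl_def space_M)
  then have "return_time ?B x \<noteq> \<infinity>" using x(1) x(2)[rule_format, of "x 0"] by simp
  then show "return_time ?B x < \<infinity>" by simp
 qed
qed

end

section \<open>Discounted return times\<close>

definition disc :: "real \<Rightarrow> enat \<Rightarrow> real" where
 "disc s r = (case r of enat n \<Rightarrow> exp (- s * real n) | \<infinity> \<Rightarrow> 0)"

lemma disc_enat [simp]: "disc s (enat n) = exp (- s * real n)"
 and disc_infinity [simp]: "disc s \<infinity> = 0"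
 by (simp_all add: disc_def)

lemma disc_nonneg: "0 \<le> disc s r"
 by (cases r) auto

lemma disc_le_1: "0 \<le> s \<Longrightarrow> disc s r \<le> 1"
 by (cases r) (auto simp: mult_nonneg_nonneg)

lemma return_time_step:
 "return_time B x = (if lshift x \<in> B then 1 else return_time B (lshift x) + 1)"
proof (cases "lshift x \<in> B")
 case True
 then have "return_time B x = enat 1"
  unfolding return_time_eq_enat by (auto simp: Suc_le_eq)
 then show ?thesis using True by (simp add: one_enat_def)
next
 case False
 show ?thesis
 proof (cases "return_time B (lshift x)")
  case (enat n)
  then have n: "0 < n" "sh (Suc n) x \<in> B" "\<And>m. 0 < m \<Longrightarrow> sh (Suc m) x \<in> B \<Longrightarrow> n \<le> m"
   unfolding return_time_eq_enat funpow_lshift_lshift by auto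
  have "return_time B x = enat (Suc n)"
   unfolding return_time_eq_enat
  proof (intro conjI allI impI)
   show "sh (Suc n) x \<in> B" by (rule n)
   fix m assume m: "0 < m \<and> sh m x \<in> B"
   then obtain j where j: "m = Suc j" by (cases m) auto
   with m False have "0 < j" by (cases j) auto
   then show "Suc n \<le> m" using n(3)[of j] m j by simp
  qed simp
  then show ?thesis using False enat by (simp add: one_enat_def)
 next
  case infinity
  then have "sh m x \<notin> B" if "0 < m" for m
   using that False infinity[unfolded return_time_eq_infinity funpow_lshift_lshift]
   by (cases m; cases "m - 1") auto
  then have "return_time B x = \<infinity>" unfolding return_time_eq_infinity by blast
  then show ?thesis using False infinity by simp
 qed
qed

text \<open>A step into \<open>B\<close> makes the bracket equal to 1, any other step leaves the
  discounted time of the shifted point. Written without cases, the recursion telescopes.\<close>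

lemma disc_return_step:
 "disc s (return_time B x) = exp (- s) *
  (disc s (return_time B (lshift x)) + indicator B (lshift x) * (1 - disc s (return_time B (lshift x))))"
proof (cases "lshift x \<in> B")
 case True
 then have "return_time B x = enat 1" using return_time_step[of B x] by (simp add: one_enat_def)
 then show ?thesis using True by simp
next
 case False
 then have "return_time B x = return_time B (lshift x) + 1" using return_time_step[of B x] by simp
 then show ?thesis using False
  by (cases "return_time B (lshift x)") (auto simp: one_enat_def exp_add[symmetric] algebra_simps)
qed

text \<open>Summing over all visits to \<open>B\<close> the discounted defect up to the next visit telescopes to the
 discounted first hitting time.\<close>

lemma disc_return_sums:
 fixes s :: real and B :: "'v path set"
 assumes s: "0 < s"
 defines "g \<equiv> \<lambda>x. indicator B x * (1 - disc s (return_time B x))"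
 shows "(\<lambda>k. exp (- s * real k) * g (sh k x)) sums (disc s (return_time B x) + g x)"
proof -
 define E where "E k = exp (- s * real k) * disc s (return_time B (sh k x))" for k
 have step: "E k - E (Suc k) = exp (- s * real (Suc k)) * g (sh (Suc k) x)" for k
 proof -
  have "E k = exp (- s * real k) * (exp (- s) * (disc s (return_time B (sh (Suc k) x)) + g (sh (Suc k) x)))"
   unfolding E_def g_def by (subst disc_return_step) simp
  also have "\<dots> = exp (- s * real (Suc k)) * (disc s (return_time B (sh (Suc k) x)) + g (sh (Suc k) x))"
  proof -
   have "exp (- s * real (Suc k)) = exp (- s * real k) * exp (- s)"
    by (simp add: exp_add[symmetric] algebra_simps)
   then show ?thesis by (simp only: mult.assoc)
  qed
  finally show ?thesis by (simp only: E_def[of "Suc k"] distrib_left add_diff_cancel_left')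
 qed
 have "E \<longlonglongrightarrow> 0"
 proof (rule Lim_null_comparison[of _ "\<lambda>k. exp (- s) ^ k"])
  show "\<forall>\<^sub>F k in sequentially. norm (E k) \<le> exp (- s) ^ k"
   using disc_nonneg disc_le_1[of s] s
   by (intro always_eventually allI)
     (auto simp: E_def abs_mult exp_of_nat_mult[symmetric] mult.commute intro!: mult_left_le)
  show "(\<lambda>k. exp (- s) ^ k) \<longlonglongrightarrow> 0" using s by (intro LIMSEQ_power_zero) simp
 qed
 from telescope_sums'[OF this] have "(\<lambda>k. E k - E (Suc k)) sums (E 0 - 0)" .
 then have "(\<lambda>k. exp (- s * real (Suc k)) * g (sh (Suc k) x)) sums disc s (return_time B x)"
  unfolding step by (simp add: E_def)
 from sums_Suc[where f = "\<lambda>k. exp (- s * real k) * g (sh k x)", OF this]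
 show ?thesis by simp
qed

context recurrent_shift
begin

lemma renewal_real:
 fixes F :: "'v path \<Rightarrow> real"
 assumes w: "w \<noteq> []" and Y: "determined A (j + length w) Y" "Y \<subseteq> sh j -` cyl A w"
  and Y_fin: "emeasure M Y < \<infinity>"
  and F [measurable]: "F \<in> borel_measurable M" and F01: "\<And>x. 0 \<le> F x" "\<And>x. F x \<le> 1"
 shows "corr M Y F j * measure M (cyl A w)
   \<le> exp (D (length w)) * (measure M Y * integ M (cyl A w) F)"
  and "measure M Y * integ M (cyl A w) F
   \<le> exp (D (length w)) * (corr M Y F j * measure M (cyl A w))"
proof -
 have [measurable]: "Y \<in> sets M" by (rule determined_sets[OF Y(1)])
 have int: "(\<integral>\<^sup>+x. indicator X x * ennreal (G x) \<partial>M) = ennreal (integ M X G)"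
  if [measurable]: "X \<in> sets M" "G \<in> borel_measurable M" and fin: "emeasure M X < \<infinity>"
   and G: "\<And>x. 0 \<le> G x" "\<And>x. G x \<le> 1" for X G
 proof -
  have i: "integrable M (\<lambda>x. indicator X x * G x)"
  proof (rule lint_bound)
   show "integrable M (indicator X :: _ \<Rightarrow> real)" using fin by simp
   show "AE x in M. norm (indicator X x * G x) \<le> norm (indicator X x :: real)"
    using G by (intro AE_I2) (auto simp: indicator_def)
  qed measurable
  have "(\<integral>\<^sup>+x. indicator X x * ennreal (G x) \<partial>M) = (\<integral>\<^sup>+x. ennreal (indicator X x * G x) \<partial>M)"
   by (intro nn_integral_cong) (auto simp: indicator_def)
  also have "\<dots> = ennreal (integ M X G)"
   by (rule nn_integral_eq_integral[OF i]) (use G in auto)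
  finally show ?thesis .
 qed
 have nn: "0 \<le> integ M X G" if "\<And>x. 0 \<le> G x" for X :: "'v path set" and G :: "_ \<Rightarrow> real"
  by (rule lint_nonneg) (use that in simp)
 have 1: "(\<integral>\<^sup>+x. indicator Y x * ennreal (F (sh j x)) \<partial>M) = ennreal (corr M Y F j)"
  by (rule int) (use F01 Y_fin in auto)
 have 2: "(\<integral>\<^sup>+x. indicator (cyl A w) x * ennreal (F x) \<partial>M) = ennreal (integ M (cyl A w) F)"
  by (rule int) (use F01 cyl_finite[OF w] in auto)
 have 3: "emeasure M Y = ennreal (measure M Y)" "emeasure M (cyl A w) = ennreal (measure M (cyl A w))"
  using Y_fin cyl_finite[OF w] by (auto simp: emeasure_eq_ennreal_measure less_top[symmetric])
 note r = set_kernel_renewal[OF kernel w Y, of "\<lambda>x. ennreal (F x)", unfolded 1 2 3]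
 show "corr M Y F j * measure M (cyl A w)
   \<le> exp (D (length w)) * (measure M Y * integ M (cyl A w) F)"
  using r(1) nn[where G = F] nn[where G = "\<lambda>x. F (sh j x)"] F01(1)
  by (simp add: ennreal_mult[symmetric])
 show "measure M Y * integ M (cyl A w) F
   \<le> exp (D (length w)) * (corr M Y F j * measure M (cyl A w))"
  using r(2) nn[where G = F] nn[where G = "\<lambda>x. F (sh j x)"] F01(1)
  by (simp add: ennreal_mult[symmetric])
qed

lemma measurable_disc [measurable]:
 assumes [measurable]: "B \<in> sets M"
 shows "(\<lambda>x. disc s (return_time B x)) \<in> borel_measurable M"
 by (rule measurable_compose[OF measurable_return_time[OF assms]]) simp

lemma integrable_indicator_mult:
 fixes F :: "'v path \<Rightarrow> real"
 assumes C [measurable]: "C \<in> sets M" and fin: "emeasure M C < \<infinity>" and F [measurable]: "F \<in> borel_measurable M"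
  and b: "\<And>x. x \<in> space M \<Longrightarrow> \<bar>F x\<bar> \<le> K"
 shows "integrable M (\<lambda>x. indicator C x * F x)"
proof (rule lint_bound)
 show "integrable M (\<lambda>x. K * indicator C x :: real)" using fin by simp
 show "AE x in M. norm (indicator C x * F x) \<le> norm (K * indicator C x :: real)"
  using b by (intro AE_I2) (fastforce simp: indicator_def)
qed measurable

text \<open>Integration over \<open>C\<close> turns the transform of the hitting time into a
  discounted sum of correlations, the quantity controlled by dual ergodicity. The extra term
  \<open>integ M C g\<close> is the visit at time 0.\<close>

lemma disc_return_integral:
 fixes s :: real
 assumes s: "0 < s" and C [measurable]: "C \<in> sets M" and fin: "emeasure M C < \<infinity>" and B [measurable]: "B \<in> sets M"
 defines "g \<equiv> \<lambda>x. indicator B x * (1 - disc s (return_time B x))"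
 shows "(\<Sum>k. ennreal (exp (- s * real k) * corr M C g k)) =
  ennreal ((LINT x|M. indicator C x * disc s (return_time B x)) + integ M C g)"
proof -
 have [measurable]: "g \<in> borel_measurable M" unfolding g_def by measurable
 have g01: "0 \<le> g x" "g x \<le> 1" for x
  using disc_nonneg[of s] disc_le_1[of s] s by (auto simp: g_def indicator_def)
 have e01: "0 \<le> disc s (return_time B x)" "disc s (return_time B x) \<le> 1" for x
  using disc_nonneg[of s] disc_le_1[of s] s by auto
 have "(\<Sum>k. ennreal (exp (- s * real k) * corr M C g k)) =
   (\<Sum>k. \<integral>\<^sup>+x. ennreal (indicator C x * (exp (- s * real k) * g (sh k x))) \<partial>M)"
 proof (rule suminf_cong)
  fix k
  have i: "integrable M (\<lambda>x. indicator C x * (exp (- s * real k) * g (sh k x)))"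
   by (rule integrable_indicator_mult[OF C fin, of _ 1])
     (use g01 s in "auto simp: abs_mult intro!: mult_le_one")
  have "(\<integral>\<^sup>+x. ennreal (indicator C x * (exp (- s * real k) * g (sh k x))) \<partial>M) =
    ennreal (LINT x|M. indicator C x * (exp (- s * real k) * g (sh k x)))"
   by (rule nn_integral_eq_integral[OF i]) (use g01 in auto)
  also have "(LINT x|M. indicator C x * (exp (- s * real k) * g (sh k x))) =
    exp (- s * real k) * corr M C g k"
   by (subst integral_mult_right_zero[symmetric]) (simp only: mult.left_commute)
  finally show "ennreal (exp (- s * real k) * corr M C g k) =
    (\<integral>\<^sup>+x. ennreal (indicator C x * (exp (- s * real k) * g (sh k x))) \<partial>M)"
   by (rule sym)
 qed
 also have "\<dots> = (\<integral>\<^sup>+x. (\<Sum>k. ennreal (indicator C x * (exp (- s * real k) * g (sh k x)))) \<partial>M)"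
  by (rule nn_integral_suminf[symmetric]) measurable
 also have "\<dots> = (\<integral>\<^sup>+x. ennreal (indicator C x * (disc s (return_time B x) + g x)) \<partial>M)"
 proof (rule nn_integral_cong)
  fix x
  have "(\<lambda>k. indicator C x * (exp (- s * real k) * g (sh k x))) sums
    (indicator C x * (disc s (return_time B x) + g x))"
   unfolding g_def by (rule sums_mult[OF disc_return_sums[OF s]])
  then show "(\<Sum>k. ennreal (indicator C x * (exp (- s * real k) * g (sh k x)))) =
    ennreal (indicator C x * (disc s (return_time B x) + g x))"
   using g01 by (intro suminf_ennreal_eq) auto
 qed
 also have "\<dots> = ennreal (LINT x|M. indicator C x * (disc s (return_time B x) + g x))"
 proof (rule nn_integral_eq_integral)
  have "\<bar>disc s (return_time B x) + g x\<bar> \<le> 2" for x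
   using g01[of x] e01[of x] by simp
  then show "integrable M (\<lambda>x. indicator C x * (disc s (return_time B x) + g x))"
   by (intro integrable_indicator_mult[OF C fin, of _ 2]) measurable
 qed (use g01 e01 in auto)
 also have "(LINT x|M. indicator C x * (disc s (return_time B x) + g x)) =
   (LINT x|M. indicator C x * disc s (return_time B x)) + integ M C g"
  unfolding distrib_left
  by (rule lint_add; rule integrable_indicator_mult[OF C fin, of _ 1])
    (use g01 e01 in auto)
 finally show ?thesis .
qed

end

subsection \<open>Decay of measure along a recurrent orbit\<close>

lemma count_list_map_upt: "count_list (map y [i..<j]) v = card {k \<in> {i..<j}. y k = v}"
proof (induction j)
 case (Suc j)
 show ?case
 proof (cases "i \<le> j")
  case True
  have "{k \<in> {i..<Suc j}. y k = v} = (if y j = v then insert j {k \<in> {i..<j}. y k = v} else {k \<in> {i..<j}. y k = v})"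
   using True by (auto simp: less_Suc_eq)
  then show ?thesis using True Suc by simp
 qed simp
qed simp

lemma cyl_append_subset: "cyl A (q @ r) \<subseteq> cyl A q"
 by (auto simp: cyl_def nth_append)

lemma cyl_append_eq: "cyl A (q @ r) = cyl A q \<inter> (sh (length q) -` cyl A r)"
proof (intro equalityI subsetI)
 fix y assume y: "y \<in> cyl A (q @ r)"
 then have ys: "y \<in> shift_space A" and eq: "\<And>i. i < length q + length r \<Longrightarrow> y i = (q @ r) ! i"
  by (auto simp: cyl_def)
 have "y i = q ! i" if "i < length q" for i using eq[of i] that by (simp add: nth_append)
 moreover have "y (i + length q) = r ! i" if "i < length r" for i
  using eq[of "i + length q"] that by (simp add: nth_append)
 ultimately show "y \<in> cyl A q \<inter> (sh (length q) -` cyl A r)"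
  using ys funpow_lshift_in_shift_space[OF ys] by (simp add: cyl_def)
next
 fix y assume y: "y \<in> cyl A q \<inter> (sh (length q) -` cyl A r)"
 then have ys: "y \<in> shift_space A" and q: "\<And>i. i < length q \<Longrightarrow> y i = q ! i"
  and r: "\<And>i. i < length r \<Longrightarrow> y (i + length q) = r ! i"
  by (auto simp: cyl_def)
 have "y i = (q @ r) ! i" if "i < length (q @ r)" for i
 proof (cases "i < length q")
  case False
  then show ?thesis using r[of "i - length q"] that by (simp add: nth_append)
 qed (use q in "simp add: nth_append")
 then show "y \<in> cyl A (q @ r)" using ys by (simp add: cyl_def)
qed

lemma map_upt_append: "i \<le> j \<Longrightarrow> j \<le> k \<Longrightarrow> map f [i..<k] = map f [i..<j] @ map f [j..<k]"
 by (metis le_Suc_ex map_append upt_add_eq_append)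

lemma map_funpow_lshift: "map (sh i x) [0..<n] = map x [i..<i + n]"
 by (rule nth_equalityI) (auto simp: add.commute)

locale hitting = recurrent_shift A M D a + rv: rv_seq a \<alpha>
 for A :: "'v::countable \<Rightarrow> 'v \<Rightarrow> bool" and M :: "'v path measure" and D a \<alpha> +
 fixes x :: "nat \<Rightarrow> 'v" and v :: 'v
 assumes alpha_le: "\<alpha> \<le> 1" and infinite_alphabet: "infinite (UNIV :: 'v set)"
  and mixing: "topologically_mixing A" and x_in: "x \<in> shift_space A"
  and aperiodic: "\<And>p. 1 \<le> p \<Longrightarrow> sh p x \<noteq> x" and visits: "infinite {k. x k = v}"
begin

abbreviation mv :: real where "mv \<equiv> measure M (cyl A [v])"

definition t where "t = enumerate {k. x k = v}"

lemma t_visit: "x (t i) = v"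
 using enumerate_in_set[OF visits] by (simp add: t_def)

lemma t_strict_mono: "strict_mono t"
 unfolding t_def using strict_mono_enumerate[OF visits] .

lemma t_step: "t i < k \<Longrightarrow> x k = v \<Longrightarrow> t (Suc i) \<le> k"
 unfolding t_def by (simp add: enumerate_Suc''[OF visits] Least_le)

lemma t_0_le: "x k = v \<Longrightarrow> t 0 \<le> k"
 unfolding t_def by (simp add: enumerate_0 Least_le)

lemma t_ge: "i \<le> t i"
 using t_strict_mono by (rule strict_mono_imp_increasing)

lemma t_surj:
 assumes "x k = v"
 obtains i where "k = t i"
proof -
 obtain i where "enumerate {k. x k = v} i = k" using enumerate_Ex[OF visits, of k] assms by auto
 then show thesis using that[of i] by (simp add: t_def)
qed

lemma t_less_iff: "t i < t j \<longleftrightarrow> i < j"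
 by (rule strict_mono_less[OF t_strict_mono])

lemma no_visit_between: "t i < k \<Longrightarrow> k < t (Suc i) \<Longrightarrow> x k \<noteq> v"
 using t_step[of i k] by auto

lemma sub_cyl_ne: "cyl A (map x [i..<i + n]) \<noteq> {}"
 using mem_cyl_prefix[OF funpow_lshift_in_shift_space[OF x_in], of i n]
 unfolding map_funpow_lshift by blast

lemma v_cyl_ne: "cyl A [v] \<noteq> {}"
 using sub_cyl_ne[of "t 0" 1] t_visit[of 0] by auto

lemma letter_reachable:
 obtains z n where "z \<in> shift_space A" "z 0 = c" "z n = d"
proof -
 obtain p where p: "p \<noteq> []" "admissible A p" "hd p = d" "last p = x 0"
  using mixing[unfolded topologically_mixing_def] by (metis le_refl length_0_conv nat.distinct(1))
 \<comment> \<open>The given point \<open>x\<close> continues the path from d to an infinite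
   sequence, so that d starts a point of the shift space.\<close>
 define y where "y = sapp (butlast p) x"
 have y: "y \<in> shift_space A" "y 0 = d"
  using sapp_path[OF p(2,1) x_in p(4)] p(3) by (auto simp: y_def)
 obtain q where q: "q \<noteq> []" "admissible A q" "hd q = c" "last q = d"
  using mixing[unfolded topologically_mixing_def] by (metis le_refl length_0_conv nat.distinct(1))
 have "sapp (butlast q) y \<in> shift_space A" "sapp (butlast q) y 0 = c"
  using sapp_path[OF q(2,1) y(1)] q y by auto
 moreover have "sapp (butlast q) y (length (butlast q)) = d"
  using y by (simp only: sapp_nth) simp
 ultimately show thesis by (rule that)
qed

text \<open>Two disjoint subcylinders of \<open>[v]\<close> such that every first return word to \<open>v\<close> avoids one of
 them: hence a visit to \<open>v\<close> in a word costs a factor bounded away from 1.\<close>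

lemma return_word_alternatives:
 obtains q1 q2 where "q1 \<noteq> []" "q2 \<noteq> []" "cyl A q1 \<noteq> {}" "cyl A q2 \<noteq> {}"
  "cyl A q1 \<subseteq> cyl A [v]" "cyl A q2 \<subseteq> cyl A [v]"
  "\<And>g. v \<notin> set g \<Longrightarrow> cyl A (v # g @ [v]) \<inter> cyl A q1 = {} \<or> cyl A (v # g @ [v]) \<inter> cyl A q2 = {}"
proof -
 \<comment> \<open>The first return word of \<open>x\<close> serves as reference: all other first
   return words have cylinders disjoint from it.\<close>
 define g0 where "g0 = map x [Suc (t 0)..<t 1]"
 have t01: "t 0 < t 1" by (simp add: t_less_iff)
 have g0_v: "v \<notin> set g0"
 proof
  assume "v \<in> set g0"
  then obtain k where "k \<in> {Suc (t 0)..<t 1}" "x k = v" by (auto simp: g0_def)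
  then show False using no_visit_between[of 0 k] by simp
 qed
 have q1_eq: "v # g0 @ [v] = map x [t 0..<t 0 + (t 1 - t 0 + 1)]"
  using t01 t_visit[of 0] t_visit[of 1] by (simp add: g0_def upt_conv_Cons)
 \<comment> \<open>A letter outside the reference word; this is where the infinite alphabet
   enters.\<close>
 obtain d where d: "d \<notin> set (v # g0)"
  using infinite_alphabet ex_new_if_finite[of "set (v # g0)"] by auto
 obtain z n where z: "z \<in> shift_space A" "z 0 = v" "z n = d" by (rule letter_reachable)
 \<comment> \<open>Starting after the last visit to \<open>v\<close> gives a word \<open>q2\<close>
   that leads from \<open>v\<close> to d without returning to \<open>v\<close>.\<close>
 define j where "j = Max {i. i \<le> n \<and> z i = v}"
 have fin: "finite {i. i \<le> n \<and> z i = v}" by simp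
 have ne: "{i. i \<le> n \<and> z i = v} \<noteq> {}" using z(2) by auto
 have j: "j \<le> n" "z j = v" using Max_in[OF fin ne] by (auto simp: j_def)
 have j_max: "z i \<noteq> v" if "j < i" "i \<le> n" for i
  using Max_ge[OF fin, of i] that by (auto simp: j_def not_le[symmetric])
 have jn: "j < n" using j z(3) d by (cases "j = n") auto
 define q2 where "q2 = map z [j..<j + (n - j + 1)]"
 show thesis
 proof (rule that[of "v # g0 @ [v]" q2])
  show "cyl A (v # g0 @ [v]) \<noteq> {}" unfolding q1_eq by (rule sub_cyl_ne)
  show "q2 \<noteq> []" by (simp add: q2_def)
  show "cyl A q2 \<noteq> {}"
   using mem_cyl_prefix[OF funpow_lshift_in_shift_space[OF z(1)], of j "n - j + 1"]
   unfolding map_funpow_lshift q2_def by blast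
  show "cyl A (v # g0 @ [v]) \<subseteq> cyl A [v]" by (auto simp: cyl_def)
  show "cyl A q2 \<subseteq> cyl A [v]" using j by (auto simp: cyl_def q2_def simp del: upt_Suc)
  fix g assume g: "v \<notin> set g"
  show "cyl A (v # g @ [v]) \<inter> cyl A (v # g0 @ [v]) = {} \<or> cyl A (v # g @ [v]) \<inter> cyl A q2 = {}"
  \<comment> \<open>Different first return words exclude each other by their lengths or letters. A
    point following both the reference word and \<open>q2\<close> would return to \<open>v\<close>
    before reaching d or meet d inside the reference word.\<close>
  proof (cases "g = g0")
   case False
   have "cyl A (v # g @ [v]) \<inter> cyl A (v # g0 @ [v]) = {}"
   proof (rule ccontr)
    assume "\<not> ?thesis"
    then obtain y where y: "y \<in> cyl A (v # g @ [v])" "y \<in> cyl A (v # g0 @ [v])" by auto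
    have r: "(\<forall>i<length h. y (Suc i) = h ! i) \<and> y (Suc (length h)) = v"
     if "y \<in> cyl A (v # h @ [v])" for h
    proof -
     have eq: "\<And>i. i < length h + 2 \<Longrightarrow> y i = (v # h @ [v]) ! i" using that by (auto simp: cyl_def)
     have "y (Suc i) = h ! i" if "i < length h" for i using eq[of "Suc i"] that by (simp add: nth_append)
     moreover have "y (Suc (length h)) = v" using eq[of "Suc (length h)"] by (simp add: nth_append)
     ultimately show ?thesis by blast
    qed
    have "length g = length g0"
    proof (rule linorder_cases[of "length g" "length g0"])
     assume l: "length g < length g0"
     then have "g0 ! length g = v" using r[OF y(1)] r[OF y(2)] by metis
     then show ?thesis using g0_v l nth_mem by metis
    next
     assume l: "length g0 < length g"
     then have "g ! length g0 = v" using r[OF y(1)] r[OF y(2)] by metis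
     then show ?thesis using g l nth_mem by metis
    qed
    then have "g = g0" using r[OF y(1)] r[OF y(2)] by (intro nth_equalityI) auto
    then show False using False by simp
   qed
   then show ?thesis by simp
  next
   case True
   have "cyl A (v # g0 @ [v]) \<inter> cyl A q2 = {}"
   proof (rule ccontr)
    assume "\<not> ?thesis"
    then obtain y where y: "y \<in> cyl A (v # g0 @ [v])" "y \<in> cyl A q2" by auto
    have eq: "y i = (v # g0 @ [v]) ! i" if "i < length g0 + 2" for i using y(1) that by (auto simp: cyl_def)
    have eq2: "y i = z (i + j)" if "i \<le> n - j" for i
     using y(2) that jn by (auto simp: cyl_def q2_def add.commute simp del: upt_Suc)
    have "y (Suc (length g0)) = v" using eq[of "Suc (length g0)"] by (simp add: nth_append)
    then have "\<not> Suc (length g0) \<le> n - j"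
     using eq2[of "Suc (length g0)"] j_max[of "Suc (length g0) + j"] jn by (auto simp: le_diff_conv2)
    then have l: "n - j < Suc (length g0)" by simp
    have "y (n - j) = d" using eq2[of "n - j"] jn z(3) by simp
    then have "(v # g0 @ [v]) ! (n - j) = d" using eq[of "n - j"] l by simp
    then have "d \<in> set (v # g0)" using l jn by (cases "n - j") (auto simp: nth_append)
    then show False using d by simp
   qed
   then show ?thesis using True by simp
  qed
 qed auto
qed

text \<open>After an occurrence of \<open>v\<close> the renewal bound gives each of the two
  alternatives a definite share of the mass, and a prescribed first return word misses at least one
  of them.\<close>

lemma decay_step:
 obtains \<rho> where "0 < \<rho>" "\<rho> < 1"
  "\<And>q g. q \<noteq> [] \<Longrightarrow> last q = v \<Longrightarrow> v \<notin> set g \<Longrightarrow> measure M (cyl A (q @ g @ [v])) \<le> \<rho> * measure M (cyl A q)"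
proof -
 obtain q1 q2 where q: "q1 \<noteq> []" "q2 \<noteq> []" "cyl A q1 \<noteq> {}" "cyl A q2 \<noteq> {}"
  "cyl A q1 \<subseteq> cyl A [v]" "cyl A q2 \<subseteq> cyl A [v]"
  and alt: "\<And>g. v \<notin> set g \<Longrightarrow> cyl A (v # g @ [v]) \<inter> cyl A q1 = {} \<or> cyl A (v # g @ [v]) \<inter> cyl A q2 = {}"
  by (rule return_word_alternatives) (rule that)
 have mv: "0 < mv" by (rule measure_cyl_pos[OF _ v_cyl_ne]) simp
 \<comment> \<open>The minimum is needed because which of the two cylinders is avoided depends on
   the return word.\<close>
 define \<delta> where "\<delta> = exp (- D 1) * min (measure M (cyl A q1)) (measure M (cyl A q2)) / mv"
 have \<delta>: "0 < \<delta>" unfolding \<delta>_def using mv measure_cyl_pos[OF q(1,3)] measure_cyl_pos[OF q(2,4)] by simp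
 have main: "measure M (cyl A (u @ [v] @ g @ [v])) \<le> (1 - \<delta>) * measure M (cyl A (u @ [v]))"
  if g: "v \<notin> set g" for u g
 proof -
  let ?Y = "cyl A (u @ [v])"
  have Y_fin: "emeasure M ?Y < \<infinity>" by (rule cyl_finite) simp
  have Y_eq: "?Y = cyl A u \<inter> sh (length u) -` cyl A [v]" by (rule cyl_append_eq)
  obtain r where r: "r \<noteq> []" "cyl A r \<noteq> {}" "cyl A r \<subseteq> cyl A [v]" "cyl A (v # g @ [v]) \<inter> cyl A r = {}"
   "\<delta> \<le> exp (- D 1) * measure M (cyl A r) / mv"
  proof -
   have "\<delta> \<le> exp (- D 1) * measure M (cyl A q1) / mv"
    "\<delta> \<le> exp (- D 1) * measure M (cyl A q2) / mv"
    unfolding \<delta>_def by (intro divide_right_mono mult_left_mono; simp)+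
   then show thesis using alt[OF g] q that by blast
  qed
  let ?F = "indicator (cyl A r) :: 'v path \<Rightarrow> real"
  let ?R = "cyl A (u @ r)"
  have R_fin: "emeasure M ?R < \<infinity>" using r by (intro cyl_finite) simp
  have R_eq: "?R = cyl A u \<inter> sh (length u) -` cyl A r" by (rule cyl_append_eq)
  have "measure M ?Y * integ M (cyl A [v]) ?F
    \<le> exp (D (length [v])) * (corr M ?Y ?F (length u) * mv)"
  proof (rule renewal_real(2))
   show "determined A (length u + length [v]) ?Y" using determined_cyl[of A "u @ [v]"] by simp
   show "?Y \<subseteq> sh (length u) -` cyl A [v]" unfolding Y_eq by simp
  qed (use Y_fin in auto)
  also have "corr M ?Y ?F (length u) = (LINT y|M. indicator ?R y)"
   using r(3) unfolding Y_eq R_eq by (intro lint_cong) (auto simp: indicator_def)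
  also have "integ M (cyl A [v]) ?F = (LINT y|M. ?F y)"
   using r(3) by (intro lint_cong) (auto simp: indicator_def)
  finally have 1: "measure M ?Y * measure M (cyl A r) \<le> exp (D 1) * (measure M ?R * mv)"
   using sets.sets_into_space[OF cyl_sets] by (simp add: Int_absorb2)
  have "\<delta> * measure M ?Y \<le> exp (- D 1) * measure M (cyl A r) / mv * measure M ?Y"
   by (intro mult_right_mono r) simp
  also have "\<dots> = exp (- D 1) * (measure M ?Y * measure M (cyl A r)) / mv" by simp
  also have "\<dots> \<le> exp (- D 1) * (exp (D 1) * (measure M ?R * mv)) / mv"
   by (intro divide_right_mono mult_left_mono 1) auto
  also have "\<dots> = measure M ?R" using mv by (simp add: exp_minus)
  finally have 2: "\<delta> * measure M ?Y \<le> measure M ?R" .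
  let ?G = "cyl A (u @ [v] @ g @ [v])"
  have G_eq: "?G = cyl A u \<inter> sh (length u) -` cyl A (v # g @ [v])" using cyl_append_eq[of A u "v # g @ [v]"] by simp
  have "?G \<inter> ?R = {}" unfolding G_eq R_eq using r(4) by blast
  moreover have "?G \<in> fmeasurable M" "?R \<in> fmeasurable M" using r(1) by (auto intro!: fmeasurable_cyl)
  ultimately have "measure M ?G + measure M ?R = measure M (?G \<union> ?R)"
   by (subst measure_Un3) auto
  also have "\<dots> \<le> measure M ?Y"
  proof (rule measure_mono_fmeasurable)
   show "?G \<union> ?R \<subseteq> ?Y"
    using cyl_append_subset[of A "u @ [v]" "g @ [v]"] r(3) unfolding R_eq Y_eq by auto
   show "?Y \<in> fmeasurable M" by (rule fmeasurable_cyl) simp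
  qed measurable
  finally show ?thesis using 2 by (simp add: algebra_simps)
 qed
 \<comment> \<open>The maximum with 1/2 keeps the rate strictly positive; later estimates divide by
   it.\<close>
 show thesis
 proof (rule that[of "max (1 - \<delta>) (1 / 2)"])
  show "max (1 - \<delta>) (1 / 2) < 1" using \<delta> by simp
  fix q g assume q: "q \<noteq> []" "last q = v" and g: "v \<notin> set g"
  have qe: "q = butlast q @ [v]" using append_butlast_last_id[OF q(1)] q(2) by simp
  have "measure M (cyl A (q @ g @ [v])) \<le> (1 - \<delta>) * measure M (cyl A q)"
   using main[OF g, of "butlast q"] qe by (metis append.assoc)
  also have "\<dots> \<le> max (1 - \<delta>) (1 / 2) * measure M (cyl A q)" by (intro mult_right_mono) auto
  finally show "measure M (cyl A (q @ g @ [v])) \<le> max (1 - \<delta>) (1 / 2) * measure M (cyl A q)" .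
 qed simp
qed

definition \<rho> where "\<rho> = (SOME \<rho>. 0 < \<rho> \<and> \<rho> < 1 \<and> (\<forall>q g. q \<noteq> [] \<longrightarrow> last q = v \<longrightarrow> v \<notin> set g \<longrightarrow>
  measure M (cyl A (q @ g @ [v])) \<le> \<rho> * measure M (cyl A q)))"

lemma rho: "0 < \<rho>" "\<rho> < 1"
  "\<And>q g. q \<noteq> [] \<Longrightarrow> last q = v \<Longrightarrow> v \<notin> set g \<Longrightarrow> measure M (cyl A (q @ g @ [v])) \<le> \<rho> * measure M (cyl A q)"
proof -
 have "\<exists>\<rho>. 0 < \<rho> \<and> \<rho> < 1 \<and> (\<forall>q g. q \<noteq> [] \<longrightarrow> last q = v \<longrightarrow> v \<notin> set g \<longrightarrow>
  measure M (cyl A (q @ g @ [v])) \<le> \<rho> * measure M (cyl A q))"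
  by (rule decay_step) blast
 from someI_ex[OF this] show "0 < \<rho>" "\<rho> < 1"
  "\<And>q g. q \<noteq> [] \<Longrightarrow> last q = v \<Longrightarrow> v \<notin> set g \<Longrightarrow> measure M (cyl A (q @ g @ [v])) \<le> \<rho> * measure M (cyl A q)"
  unfolding \<rho>_def by blast+
qed

lemma measure_cyl_append_le: "q \<noteq> [] \<Longrightarrow> measure M (cyl A (q @ r)) \<le> measure M (cyl A q)"
 by (rule measure_mono_fmeasurable[OF cyl_append_subset cyl_sets fmeasurable_cyl])

text \<open>Induction on the appended word, cut at its earliest occurrence of \<open>v\<close>: each
  cut costs one factor and leaves a prefix that again ends in \<open>v\<close>.\<close>

lemma decay:
 assumes "q \<noteq> []" "last q = v"
 shows "measure M (cyl A (q @ r)) \<le> \<rho> ^ count_list r v * measure M (cyl A q)"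
 using assms
proof (induction "length r" arbitrary: q r rule: less_induct)
 case less
 show ?case
 proof (cases "v \<in> set r")
  case False
  then show ?thesis using measure_cyl_append_le[OF less.prems(1), of r] by simp
 next
  case True
  then obtain g r' where r: "r = g @ v # r'" "v \<notin> set g" using split_list_first[of v r] by auto
  have "measure M (cyl A ((q @ g @ [v]) @ r')) \<le> \<rho> ^ count_list r' v * measure M (cyl A (q @ g @ [v]))"
   by (rule less.hyps) (auto simp: r)
  also have "\<dots> \<le> \<rho> ^ count_list r' v * (\<rho> * measure M (cyl A q))"
   using rho less.prems r by (intro mult_left_mono) auto
  also have "\<dots> = \<rho> ^ count_list r v * measure M (cyl A q)" using r by simp
  finally show ?thesis using r by simp
 qed
qed

text \<open>Without \<open>v\<close> at the end of \<open>q\<close>, the earliest occurrence in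
  \<open>r\<close> only provides a starting point and yields no factor.\<close>

lemma decay':
 assumes "q \<noteq> []"
 shows "measure M (cyl A (q @ r)) \<le> \<rho> ^ (count_list r v - 1) * measure M (cyl A q)"
proof (cases "v \<in> set r")
 case False
 then show ?thesis using measure_cyl_append_le[OF assms, of r] by simp
next
 case True
 then obtain g r' where r: "r = g @ v # r'" "v \<notin> set g" using split_list_first[of v r] by auto
 have "measure M (cyl A ((q @ g @ [v]) @ r')) \<le> \<rho> ^ count_list r' v * measure M (cyl A (q @ g @ [v]))"
  by (rule decay) auto
 also have "\<dots> \<le> \<rho> ^ count_list r' v * measure M (cyl A q)"
  using rho measure_cyl_append_le[OF assms, of "g @ [v]"] by (intro mult_left_mono) auto
 also have "count_list r' v = count_list r v - 1" using r by simp
 finally show ?thesis using r by simp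
qed

lemma cyl_measure_tendsto_0:
 assumes y: "y \<in> shift_space A" and inf: "infinite {k. y k = v}"
 shows "(\<lambda>n. measure M (cyl A (map y [0..<n]))) \<longlonglongrightarrow> 0"
proof -
 define c where "c n = count_list (map y [1..<n]) v" for n
 have c_top: "filterlim c at_top sequentially"
  unfolding filterlim_at_top
 proof
  fix Z
  have "infinite ({k. y k = v} - {0})" using inf by simp
  then obtain S where S: "S \<subseteq> {k. y k = v} - {0}" "finite S" "card S = Z"
   using infinite_arbitrarily_large by blast
  have "Z \<le> c n" if n: "Suc (Max (insert 0 S)) \<le> n" for n
  proof -
   have "S \<subseteq> {k \<in> {1..<n}. y k = v}"
   proof
    fix k assume k: "k \<in> S"
    then have "k \<le> Max (insert 0 S)" using S(2) by (intro Max_ge) auto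
    then show "k \<in> {k \<in> {1..<n}. y k = v}" using k S(1) n by (auto simp: Suc_le_eq)
   qed
   then show ?thesis unfolding c_def count_list_map_upt using S(3) by (metis card_mono finite_atLeastLessThan finite_Collect_conjI finite_subset mem_Collect_eq subsetI)
  qed
  then show "\<forall>\<^sub>F n in sequentially. Z \<le> c n" by (auto simp: eventually_sequentially)
 qed
 have "filterlim (\<lambda>n. c n - 1) at_top sequentially"
  by (rule filterlim_minus_const_nat_at_top[THEN filterlim_compose, OF c_top])
 then have "(\<lambda>n. \<rho> ^ (c n - 1)) \<longlonglongrightarrow> 0"
  using rho by (intro filterlim_compose[OF LIMSEQ_power_zero]) auto
 then have lim: "(\<lambda>n. \<rho> ^ (c n - 1) * measure M (cyl A [y 0])) \<longlonglongrightarrow> 0"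
  using tendsto_mult_left_zero by blast
 show ?thesis
 proof (rule Lim_null_comparison[OF _ lim])
  show "\<forall>\<^sub>F n in sequentially. norm (measure M (cyl A (map y [0..<n]))) \<le> \<rho> ^ (c n - 1) * measure M (cyl A [y 0])"
   using eventually_ge_at_top[of 1]
  proof eventually_elim
   case (elim n)
   have "map y [0..<n] = [y 0] @ map y [1..<n]" using map_upt_append[of 0 1 n y] elim by simp
   then show ?case using decay'[of "[y 0]" "map y [1..<n]"] by (simp add: c_def)
  qed
 qed
qed

section \<open>The shrinking cylinders around x and their time scale\<close>

definition B :: "nat \<Rightarrow> 'v path set" where "B n = cyl A (map x [0..<n])"
definition b :: "nat \<Rightarrow> real" where "b n = measure M (B n)"
text \<open>The maximum only excludes the value \<open>0\<close>, which is irrelevant for large \<open>n\<close>.\<close>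

definition N :: "nat \<Rightarrow> nat" where "N n = max 1 (rv.threshold (1 / b n))"

lemma B_sets [measurable]: "B n \<in> sets M" by (simp add: B_def)

lemma B_ne: "B n \<noteq> {}" using mem_cyl_prefix[OF x_in, of n] by (auto simp: B_def)

lemma B_finite: "1 \<le> n \<Longrightarrow> emeasure M (B n) < \<infinity>"
 unfolding B_def by (rule cyl_finite) simp

lemma b_pos: "1 \<le> n \<Longrightarrow> 0 < b n"
 unfolding b_def B_def using B_ne[of n] by (intro measure_cyl_pos) (auto simp: B_def)

lemma B_antimono: "m \<le> n \<Longrightarrow> B n \<subseteq> B m"
 unfolding B_def using map_upt_append[of 0 m n x] cyl_append_subset by (metis zero_le)

lemma b_lim: "b \<longlonglongrightarrow> 0"
 unfolding b_def[abs_def] B_def by (rule cyl_measure_tendsto_0[OF x_in visits])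

lemma N_ge_1: "1 \<le> N n" by (simp add: N_def)

lemma inverse_b_top: "filterlim (\<lambda>n. 1 / b n) at_top sequentially"
proof -
 have "\<forall>\<^sub>F n in sequentially. 0 < b n" using eventually_ge_at_top[of 1] by eventually_elim (rule b_pos)
 then have "filterlim (\<lambda>n. inverse (b n)) at_top sequentially"
  by (intro filterlim_inverse_at_top b_lim)
 then show ?thesis by (simp add: inverse_eq_divide)
qed

lemma N_eq_threshold: "\<forall>\<^sub>F n in sequentially. N n = rv.threshold (1 / b n)"
proof -
 have "\<forall>\<^sub>F n in sequentially. 1 \<le> rv.threshold (1 / b n)"
  using rv.threshold_top[OF inverse_b_top] by (simp add: filterlim_at_top)
 then show ?thesis by eventually_elim (simp add: N_def)
qed

lemma N_top: "filterlim N at_top sequentially"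
 using rv.threshold_top[OF inverse_b_top]
 by (rule filterlim_at_top_mono) (simp add: N_def)

lemma a_N_b: "(\<lambda>n. a (N n) * b n) \<longlonglongrightarrow> 1"
proof -
 have "(\<lambda>n. a (rv.threshold (1 / b n)) / (1 / b n)) \<longlonglongrightarrow> 1"
  by (rule rv.a_threshold_ratio[OF inverse_b_top])
 then show ?thesis
  by (rule Lim_transform_eventually) (use N_eq_threshold in "auto elim: eventually_mono")
qed


abbreviation dret :: "real \<Rightarrow> nat \<Rightarrow> 'v path \<Rightarrow> real" where
 "dret \<sigma> n y \<equiv> disc (\<sigma> / real (N n)) (return_time (B n) y)"

text \<open>The transform is left unnormalized, since the estimates are additive in
  \<open>C\<close>; division by the measure of \<open>C\<close> gives the transform under the
  conditional law.\<close>

definition phi :: "real \<Rightarrow> nat \<Rightarrow> 'v path set \<Rightarrow> real" where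
 "phi \<sigma> n C = (LINT y|M. indicator C y * dret \<sigma> n y)"

definition defect :: "real \<Rightarrow> nat \<Rightarrow> real" where "defect \<sigma> n = 1 - phi \<sigma> n (B n) / b n"

definition kappa :: "real \<Rightarrow> real" where "kappa \<sigma> = Gamma (1 + \<alpha>) / \<sigma> powr \<alpha>"

lemma kappa_pos: "0 < \<sigma> \<Longrightarrow> 0 < kappa \<sigma>"
 unfolding kappa_def using rv.\<alpha> by (intro divide_pos_pos Gamma_real_pos) auto

lemma rate_pos: "0 < \<sigma> \<Longrightarrow> 0 < \<sigma> / real (N n)"
 using N_ge_1[of n] by simp

lemma disc_rate: "0 < \<sigma> \<Longrightarrow> 0 \<le> disc (\<sigma> / real (N n)) r \<and> disc (\<sigma> / real (N n)) r \<le> 1"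
 using disc_nonneg disc_le_1 rate_pos[of \<sigma> n] by (meson less_imp_le)

lemma integrable_phi:
 assumes "0 < \<sigma>" "C \<in> sets M" "emeasure M C < \<infinity>"
 shows "integrable M (\<lambda>y. indicator C y * dret \<sigma> n y)"
 by (rule integrable_indicator_mult[OF assms(2,3), of _ 1]) (use disc_rate[OF assms(1)] in auto)

lemma phi_nonneg: "0 < \<sigma> \<Longrightarrow> 0 \<le> phi \<sigma> n C"
 unfolding phi_def by (rule lint_nonneg) (use disc_rate in auto)

lemma phi_le:
 assumes "0 < \<sigma>" "C \<in> sets M" "emeasure M C < \<infinity>"
 shows "phi \<sigma> n C \<le> measure M C"
proof -
 have "integrable M (indicator C :: _ \<Rightarrow> real)" using assms by simp
 then have "phi \<sigma> n C \<le> (LINT y|M. indicator C y)"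
  unfolding phi_def
  by (rule integral_mono[OF integrable_phi[OF assms]])
    (use disc_rate[OF assms(1)] in "auto simp: indicator_def")
 then show ?thesis using assms sets.sets_into_space[OF assms(2)] by (simp add: Int_absorb2)
qed

lemma defect_bounds:
 assumes "0 < \<sigma>" "1 \<le> n"
 shows "0 \<le> defect \<sigma> n" "defect \<sigma> n \<le> 1"
 using phi_le[OF assms(1) B_sets B_finite[OF assms(2)], of n] phi_nonneg[OF assms(1), of n "B n"] b_pos[OF assms(2)]
 by (auto simp: defect_def b_def[symmetric] field_simps)

lemma defect_integral:
 assumes \<sigma>: "0 < \<sigma>" and n: "1 \<le> n"
 defines "g \<equiv> \<lambda>y. indicator (B n) y * (1 - dret \<sigma> n y)"
 shows "integrable M g" "(LINT y|M. g y) = b n * defect \<sigma> n" "\<And>y. 0 \<le> g y" "\<And>y. y \<notin> B n \<Longrightarrow> g y = 0"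
proof -
 have i: "integrable M (indicator (B n) :: _ \<Rightarrow> real)" using B_finite[OF n] by simp
 have "g = (\<lambda>y. indicator (B n) y - indicator (B n) y * dret \<sigma> n y)"
  by (simp add: g_def algebra_simps)
 moreover have "(LINT y|M. indicator (B n) y) = b n"
  using sets.sets_into_space[OF B_sets] by (simp add: b_def Int_absorb2)
 ultimately show "integrable M g" "(LINT y|M. g y) = b n * defect \<sigma> n"
  using integrable_phi[OF \<sigma> B_sets B_finite[OF n], of n] i b_pos[OF n]
  by (simp_all add: phi_def[symmetric] defect_def right_diff_distrib)
 show "0 \<le> g y" for y using disc_rate[OF \<sigma>] by (simp add: g_def)
 show "y \<notin> B n \<Longrightarrow> g y = 0" for y by (simp add: g_def)
qed

lemma b_laplace: "0 < \<sigma> \<Longrightarrow> (\<lambda>n. b n * rv.laplace_a (N n) \<sigma>) \<longlonglongrightarrow> kappa \<sigma>"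
proof -
 assume \<sigma>: "0 < \<sigma>"
 have "(\<lambda>n. (a (N n) * b n) * (rv.laplace_a (N n) \<sigma> / a (N n))) \<longlonglongrightarrow> 1 * kappa \<sigma>"
  unfolding kappa_def by (intro tendsto_mult a_N_b rv.laplace_a_limit alpha_le \<sigma> N_top)
 moreover have "\<forall>\<^sub>F n in sequentially. 0 < a (N n)"
  using eventually_compose_filterlim[OF rv.a_ev_pos N_top] .
 then have "\<forall>\<^sub>F n in sequentially. (a (N n) * b n) * (rv.laplace_a (N n) \<sigma> / a (N n)) = b n * rv.laplace_a (N n) \<sigma>"
  by eventually_elim simp
 ultimately show ?thesis by (simp add: Lim_transform_eventually)
qed

text \<open>The hitting time is decomposed over all visits to \<open>B n\<close>, discounted by the defect up to the next visit.\<close>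

lemma phi_bounds:
 assumes \<sigma>: "0 < \<sigma>" and u: "u \<noteq> []" "cyl A u \<noteq> {}" and m: "1 \<le> m" and \<epsilon>: "0 < \<epsilon>" "\<epsilon> < 1"
 obtains c where "0 \<le> c" "\<And>n. m \<le> n \<Longrightarrow> integrable lborel (rv.laplace_integrand (N n) \<sigma>) \<Longrightarrow>
  phi \<sigma> n (cyl A u) \<le>
   ((1 + \<epsilon>) * exp (D m) * measure M (cyl A u) * (b n * defect \<sigma> n)) * rv.laplace_a (N n) \<sigma> + c * (b n * defect \<sigma> n) \<and>
  ((1 - \<epsilon>) * exp (- D m) * measure M (cyl A u) * (b n * defect \<sigma> n)) * rv.laplace_a (N n) \<sigma> \<le>
   phi \<sigma> n (cyl A u) + c * (b n * defect \<sigma> n)"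
proof -
 \<comment> \<open>For n \<ge> m the cylinder \<open>B n\<close> lies in this fixed one, so the
   bounds hold with a constant independent of n.\<close>
 let ?p = "map x [0..<m]" and ?C = "cyl A u"
 have p: "?p \<noteq> []" "cyl A ?p \<noteq> {}" using m B_ne[of m] by (auto simp: B_def)
 obtain c where c: "0 \<le> c"
  and up: "\<And>F n. integrable M F \<Longrightarrow> (\<And>x. 0 \<le> F x) \<Longrightarrow> (\<And>y. y \<notin> cyl A ?p \<Longrightarrow> F y = 0) \<Longrightarrow>
   (\<Sum>k<n. LINT x|M. indicator ?C x * F (sh k x)) \<le>
    ((1 + \<epsilon>) * exp (D (length ?p)) * measure M ?C * (LINT x|M. F x)) * max 0 (a n) + c * (LINT x|M. F x)"
  and low: "\<And>F n. integrable M F \<Longrightarrow> (\<And>x. 0 \<le> F x) \<Longrightarrow> (\<And>y. y \<notin> cyl A ?p \<Longrightarrow> F y = 0) \<Longrightarrow>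
   ((1 - \<epsilon>) * exp (- D (length ?p)) * measure M ?C * (LINT x|M. F x)) * max 0 (a n) \<le>
    (\<Sum>k<n. LINT x|M. indicator ?C x * F (sh k x)) + c * (LINT x|M. F x)"
 proof (rule dual_ergodic_bounds[OF u(1) p \<epsilon> u(2)], goal_cases)
  case (1 c)
  show ?case by (rule that) (fact 1)+
 qed
 have C_fin: "emeasure M ?C < \<infinity>" by (rule cyl_finite[OF u(1)])
 define g where "g n y = indicator (B n) y * (1 - dret \<sigma> n y)" for n y
 \<comment> \<open>The additional unit in \<open>c + 1\<close> pays for the visit at time 0, which
   is at most the total integral of the defect function.\<close>
 show thesis
 proof (rule that[of "c + 1"])
  fix n assume n: "m \<le> n" and int: "integrable lborel (rv.laplace_integrand (N n) \<sigma>)"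
  have n1: "1 \<le> n" using m n by simp
  note g = defect_integral[OF \<sigma> n1, folded g_def]
  have g0: "y \<notin> cyl A ?p \<Longrightarrow> g n y = 0" for y using B_antimono[OF n] g(4) by (auto simp: B_def)
  define bk where "bk k = (LINT y|M. indicator ?C y * g n (sh k y))" for k
  have bk: "0 \<le> bk k" for k
   unfolding bk_def by (rule lint_nonneg) (use g(3) in simp)
  have J: "0 \<le> b n * defect \<sigma> n" using b_pos[OF n1] defect_bounds[OF \<sigma> n1] by simp
  have M0: "0 \<le> rv.laplace_a (N n) \<sigma>"
   unfolding rv.laplace_a_def by (rule lint_nonneg) (rule rv.laplace_integrand_nonneg)
  have b0: "0 \<le> bk 0" "bk 0 \<le> b n * defect \<sigma> n"
  proof -
   show "0 \<le> bk 0" by (rule bk)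
   have "bk 0 \<le> (LINT y|M. g n y)"
    unfolding bk_def by (rule integral_mono[OF integrable_indicator_funpow[OF g(1)] g(1)])
     (use g(3) in "auto simp: indicator_def")
   then show "bk 0 \<le> b n * defect \<sigma> n" using g(2) by simp
  qed
  have sum: "(\<Sum>k. ennreal (exp (- (\<sigma> / real (N n)) * real k) * bk k)) = ennreal (phi \<sigma> n ?C + bk 0)"
   using disc_return_integral[OF rate_pos[OF \<sigma>] cyl_sets C_fin B_sets, of n n]
   by (simp add: bk_def g_def phi_def)
  have N0: "0 < N n" using N_ge_1[of n] by simp
  have "ennreal (phi \<sigma> n ?C + bk 0) \<le> ennreal (((1 + \<epsilon>) * exp (D m) * measure M ?C * (b n * defect \<sigma> n)) * rv.laplace_a (N n) \<sigma> + c * (b n * defect \<sigma> n))"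
   unfolding sum[symmetric]
  proof (rule rv.abel_bounds(1)[OF \<sigma> N0 int bk])
   show "(\<Sum>k<n'. bk k) \<le> (1 + \<epsilon>) * exp (D m) * measure M ?C * (b n * defect \<sigma> n) * max 0 (a n') + c * (b n * defect \<sigma> n)" for n'
    using up[OF g(1,3) g0, of n'] unfolding bk_def g(2) by simp
  qed (use \<epsilon> J c in auto)
  then have 1: "phi \<sigma> n ?C \<le> ((1 + \<epsilon>) * exp (D m) * measure M ?C * (b n * defect \<sigma> n)) * rv.laplace_a (N n) \<sigma> + c * (b n * defect \<sigma> n)"
   using \<epsilon> J c M0 b0 by (subst (asm) ennreal_le_iff) auto
  have "ennreal (((1 - \<epsilon>) * exp (- D m) * measure M ?C * (b n * defect \<sigma> n)) * rv.laplace_a (N n) \<sigma>)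
    \<le> ennreal (phi \<sigma> n ?C + bk 0) + ennreal (c * (b n * defect \<sigma> n))"
   unfolding sum[symmetric]
  proof (rule rv.abel_bounds(2)[OF \<sigma> N0 int bk])
   show "(1 - \<epsilon>) * exp (- D m) * measure M ?C * (b n * defect \<sigma> n) * max 0 (a n') \<le> (\<Sum>k<n'. bk k) + c * (b n * defect \<sigma> n)" for n'
    using low[OF g(1,3) g0, of n'] unfolding bk_def g(2) by simp
  qed (use \<epsilon> J c in auto)
  also have "\<dots> = ennreal (phi \<sigma> n ?C + bk 0 + c * (b n * defect \<sigma> n))"
   using phi_nonneg[OF \<sigma>] b0 J c by (simp add: ennreal_plus)
  finally have 2: "((1 - \<epsilon>) * exp (- D m) * measure M ?C * (b n * defect \<sigma> n)) * rv.laplace_a (N n) \<sigma> \<le> phi \<sigma> n ?C + (c + 1) * (b n * defect \<sigma> n)"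
   using phi_nonneg[OF \<sigma>, of n ?C] b0 J c by (subst (asm) ennreal_le_iff) (auto simp: algebra_simps)
  have "c * (b n * defect \<sigma> n) \<le> (c + 1) * (b n * defect \<sigma> n)" using J by (intro mult_right_mono) auto
  with 1 2 show "phi \<sigma> n ?C \<le> ((1 + \<epsilon>) * exp (D m) * measure M ?C * (b n * defect \<sigma> n)) * rv.laplace_a (N n) \<sigma> + (c + 1) * (b n * defect \<sigma> n) \<and>
   ((1 - \<epsilon>) * exp (- D m) * measure M ?C * (b n * defect \<sigma> n)) * rv.laplace_a (N n) \<sigma> \<le> phi \<sigma> n ?C + (c + 1) * (b n * defect \<sigma> n)"
   by linarith
 qed (use c in simp)
qed

text \<open>The prefix length m is chosen before n: it brings exp (D m) and 1 + \<epsilon> close to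
  1, and for the resulting constant c the error c * b n still vanishes as n grows.\<close>

lemma phi_cyl_relation:
 assumes \<sigma>: "0 < \<sigma>" and u: "u \<noteq> []" "cyl A u \<noteq> {}"
 shows "(\<lambda>n. phi \<sigma> n (cyl A u) / measure M (cyl A u) - kappa \<sigma> * defect \<sigma> n) \<longlonglongrightarrow> 0"
proof (rule tendstoI)
 fix e :: real assume e: "0 < e"
 let ?C = "cyl A u" and ?\<kappa> = "kappa \<sigma>"
 have Cp: "0 < measure M ?C" by (rule measure_cyl_pos[OF u])
 have l1: "(\<lambda>m. (1 + inverse (real (Suc (Suc m)))) * exp (D m) * ?\<kappa>) \<longlonglongrightarrow> (1 + 0) * exp 0 * ?\<kappa>"
  by (intro tendsto_intros D_lim LIMSEQ_inverse_real_of_nat[THEN LIMSEQ_Suc])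
 have l2: "(\<lambda>m. (1 - inverse (real (Suc (Suc m)))) * exp (- D m) * ?\<kappa>) \<longlonglongrightarrow> (1 - 0) * exp (- 0) * ?\<kappa>"
  by (intro tendsto_intros D_lim LIMSEQ_inverse_real_of_nat[THEN LIMSEQ_Suc])
 have "\<forall>\<^sub>F m in sequentially. 1 \<le> m \<and> (1 + inverse (real (Suc (Suc m)))) * exp (D m) * ?\<kappa> < ?\<kappa> + e / 2 \<and>
   ?\<kappa> - e / 2 < (1 - inverse (real (Suc (Suc m)))) * exp (- D m) * ?\<kappa>"
  using order_tendstoD(2)[OF l1, of "?\<kappa> + e / 2"] order_tendstoD(1)[OF l2, of "?\<kappa> - e / 2"] e
   eventually_ge_at_top[of 1] by (simp add: eventually_conj_iff)
 then obtain m where m: "1 \<le> m" "(1 + inverse (real (Suc (Suc m)))) * exp (D m) * ?\<kappa> < ?\<kappa> + e / 2"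
   "?\<kappa> - e / 2 < (1 - inverse (real (Suc (Suc m)))) * exp (- D m) * ?\<kappa>"
  by (auto simp: eventually_sequentially)
 \<comment> \<open>Tying \<epsilon> to m leaves a single parameter to be sent to its limit; the
   value 1 / (m + 2) is always below 1.\<close>
 define \<epsilon> :: real where "\<epsilon> = inverse (real (Suc (Suc m)))"
 have \<epsilon>: "0 < \<epsilon>" "\<epsilon> < 1" by (auto simp: \<epsilon>_def inverse_less_1_iff)
 obtain c where c: "0 \<le> c" and bounds: "\<And>n. m \<le> n \<Longrightarrow> integrable lborel (rv.laplace_integrand (N n) \<sigma>) \<Longrightarrow>
  phi \<sigma> n ?C \<le>
   ((1 + \<epsilon>) * exp (D m) * measure M ?C * (b n * defect \<sigma> n)) * rv.laplace_a (N n) \<sigma> + c * (b n * defect \<sigma> n) \<and>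
  ((1 - \<epsilon>) * exp (- D m) * measure M ?C * (b n * defect \<sigma> n)) * rv.laplace_a (N n) \<sigma> \<le>
   phi \<sigma> n ?C + c * (b n * defect \<sigma> n)"
  by (rule phi_bounds[OF \<sigma> u m(1) \<epsilon>]) (rule that)
 have lim0: "(\<lambda>n. c * b n / measure M ?C) \<longlonglongrightarrow> c * 0 / measure M ?C"
  using Cp by (intro tendsto_intros b_lim) auto
 have L1: "(\<lambda>n. (1 + \<epsilon>) * exp (D m) * (b n * rv.laplace_a (N n) \<sigma>)) \<longlonglongrightarrow> (1 + \<epsilon>) * exp (D m) * ?\<kappa>"
  and L2: "(\<lambda>n. (1 - \<epsilon>) * exp (- D m) * (b n * rv.laplace_a (N n) \<sigma>)) \<longlonglongrightarrow> (1 - \<epsilon>) * exp (- D m) * ?\<kappa>"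
  by (intro tendsto_intros b_laplace[OF \<sigma>])+
 have "\<forall>\<^sub>F n in sequentially. c * b n / measure M ?C < e / 2"
  by (rule order_tendstoD(2)[OF lim0]) (use e in simp)
 moreover have "\<forall>\<^sub>F n in sequentially. (1 + \<epsilon>) * exp (D m) * (b n * rv.laplace_a (N n) \<sigma>) < ?\<kappa> + e / 2"
  using order_tendstoD(2)[OF L1] m(2) by (simp add: \<epsilon>_def)
 moreover have "\<forall>\<^sub>F n in sequentially. ?\<kappa> - e / 2 < (1 - \<epsilon>) * exp (- D m) * (b n * rv.laplace_a (N n) \<sigma>)"
  using order_tendstoD(1)[OF L2] m(3) by (simp add: \<epsilon>_def)
 ultimately show "\<forall>\<^sub>F n in sequentially. dist (phi \<sigma> n ?C / measure M ?C - ?\<kappa> * defect \<sigma> n) 0 < e"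
  using eventually_compose_filterlim[OF rv.laplace_integrable[OF alpha_le \<sigma>] N_top] eventually_ge_at_top[of m]
 proof eventually_elim
  case (elim n)
  note bd = bounds[OF elim(5,4)]
  have n1: "1 \<le> n" using elim(5) m(1) by simp
  let ?I = "defect \<sigma> n" and ?L = "rv.laplace_a (N n) \<sigma>"
  have I: "0 \<le> ?I" "?I \<le> 1" using defect_bounds[OF \<sigma> n1] by auto
  have cb: "c * b n / measure M ?C * ?I < e / 2"
   by (rule le_less_trans[OF mult_left_le elim(1)]) (use I c b_pos[OF n1] Cp in auto)
  have "phi \<sigma> n ?C / measure M ?C \<le> (1 + \<epsilon>) * exp (D m) * (b n * ?L) * ?I + c * b n / measure M ?C * ?I"
   using bd Cp by (simp add: field_simps)
  moreover have "(1 + \<epsilon>) * exp (D m) * (b n * ?L) * ?I \<le> ?\<kappa> * ?I + e / 2 * ?I"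
   unfolding distrib_right[symmetric] using elim(2) I by (intro mult_right_mono) auto
  moreover have "(1 - \<epsilon>) * exp (- D m) * (b n * ?L) * ?I - c * b n / measure M ?C * ?I \<le> phi \<sigma> n ?C / measure M ?C"
  proof -
   have "(1 - \<epsilon>) * exp (- D m) * (b n * ?L) * ?I - c * b n / measure M ?C * ?I =
     ((1 - \<epsilon>) * exp (- D m) * measure M ?C * (b n * ?I) * ?L - c * (b n * ?I)) / measure M ?C"
    using Cp by (simp add: diff_divide_distrib)
   also have "\<dots> \<le> phi \<sigma> n ?C / measure M ?C"
    using bd Cp by (intro divide_right_mono) auto
   finally show ?thesis .
  qed
  moreover have "?\<kappa> * ?I - e / 2 * ?I \<le> (1 - \<epsilon>) * exp (- D m) * (b n * ?L) * ?I"
   unfolding left_diff_distrib[symmetric] using elim(3) I by (intro mult_right_mono) auto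
  moreover have "e / 2 * ?I \<le> e / 2" using I e by (simp add: mult_left_le)
  ultimately have "\<bar>phi \<sigma> n ?C / measure M ?C - ?\<kappa> * ?I\<bar> < e"
   using cb by linarith
  then show ?case by (simp add: dist_real_def)
 qed
qed

end

subsection \<open>Renewal at a random time\<close>

text \<open>An inequality on every cell of a countable partition sums up to the whole space; the
  cells will be given by a random time together with the next m symbols.\<close>

lemma integral_partition_le:
 fixes f g :: "'a \<Rightarrow> real" and \<pi> :: "'a \<Rightarrow> 'b::countable"
 assumes f: "integrable M f" "\<And>y. 0 \<le> f y" and g: "integrable M g" "\<And>y. 0 \<le> g y"
  and \<pi> [measurable]: "\<pi> \<in> M \<rightarrow>\<^sub>M count_space UNIV"
  and le: "\<And>i. (LINT y|M. indicator {y. \<pi> y = i} y * f y) \<le> (LINT y|M. indicator {y. \<pi> y = i} y * g y)"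
 shows "(LINT y|M. f y) \<le> (LINT y|M. g y)"
proof -
 let ?S = "\<lambda>i y. indicator {y. to_nat (\<pi> y) = i} y :: real"
 have [measurable]: "f \<in> borel_measurable M" "g \<in> borel_measurable M" using f g by auto
 have int: "integrable M (\<lambda>y. ?S i y * h y)" if "integrable M h" for i and h :: "'a \<Rightarrow> real"
  using that by (intro lint_bound[OF that]) (auto simp: indicator_def)
 have eq: "(\<integral>\<^sup>+y. ennreal (h y) \<partial>M) = (\<Sum>i. ennreal (LINT y|M. ?S i y * h y))"
  if h: "integrable M h" "\<And>y. 0 \<le> h y" for h
 proof -
  have [measurable]: "h \<in> borel_measurable M" using h by auto
  have "(\<integral>\<^sup>+y. ennreal (h y) \<partial>M) = (\<integral>\<^sup>+y. (\<Sum>i. ennreal (h y) * indicator {y. to_nat (\<pi> y) = i} y) \<partial>M)"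
  proof (rule nn_integral_cong)
   fix y
   have "disjoint_family (\<lambda>i. {y. to_nat (\<pi> y) = i})" by (auto simp: disjoint_family_on_def)
   from suminf_cmult_indicator[OF this, of y "to_nat (\<pi> y)" "\<lambda>_. ennreal (h y)"]
   show "ennreal (h y) = (\<Sum>i. ennreal (h y) * indicator {y. to_nat (\<pi> y) = i} y)" by simp
  qed
  also have "\<dots> = (\<Sum>i. \<integral>\<^sup>+y. ennreal (h y) * indicator {y. to_nat (\<pi> y) = i} y \<partial>M)"
   by (rule nn_integral_suminf) measurable
  also have "\<dots> = (\<Sum>i. \<integral>\<^sup>+y. ennreal (?S i y * h y) \<partial>M)"
   by (intro suminf_cong nn_integral_cong) (auto simp: indicator_def)
  also have "\<dots> = (\<Sum>i. ennreal (LINT y|M. ?S i y * h y))"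
   by (intro suminf_cong nn_integral_eq_integral int h) (auto simp: h)
  finally show ?thesis .
 qed
 have "(LINT y|M. ?S i y * f y) \<le> (LINT y|M. ?S i y * g y)" for i
 proof (cases "to_nat (from_nat i :: 'b) = i")
  case True
  then have "{y. to_nat (\<pi> y) = i} = {y. \<pi> y = from_nat i}" by (auto simp: from_nat_to_nat dest: sym)
  then show ?thesis using le[of "from_nat i"] by simp
 next
  case False
  then have "{y. to_nat (\<pi> y) = i} = {}" by auto
  then show ?thesis by simp
 qed
 then have "(\<integral>\<^sup>+y. ennreal (f y) \<partial>M) \<le> (\<integral>\<^sup>+y. ennreal (g y) \<partial>M)"
  unfolding eq[OF f] eq[OF g] by (intro suminf_le ennreal_leI) auto
 then have "ennreal (LINT y|M. f y) \<le> ennreal (LINT y|M. g y)"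
  using f g by (simp add: nn_integral_eq_integral)
 then show ?thesis
  using lint_nonneg[of M g] g(2) by (simp add: ennreal_le_iff)
qed

lemma map_upt_eq_iff: "map z [0..<m] = p \<longleftrightarrow> length p = m \<and> (\<forall>i<m. z i = p ! i)"
 by (subst list_eq_iff_nth_eq) auto

context shift_measure
begin

lemma measurable_prefix [measurable]: "(\<lambda>y. map y [0..<m]) \<in> M \<rightarrow>\<^sub>M count_space UNIV"
proof -
 have "(\<lambda>y. map y [0..<m]) -` {p} \<inter> space M \<in> sets M" for p
 proof (cases "length p = m")
  case True
  then have "(\<lambda>y. map y [0..<m]) -` {p} \<inter> space M = cyl A p"
   by (auto simp: space_M cyl_def map_upt_eq_iff)
  then show ?thesis by simp
 next
  case False
  then have "(\<lambda>y. map y [0..<m]) -` {p} = {}" by auto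
  then show ?thesis by simp
 qed
 then show ?thesis
  unfolding measurable_count_space_eq2_countable by simp
qed

lemma measurable_stopped [measurable]:
 assumes [measurable]: "\<tau> \<in> M \<rightarrow>\<^sub>M count_space UNIV"
 shows "(\<lambda>y. sh (\<tau> y) y) \<in> M \<rightarrow>\<^sub>M M"
 by (rule measurable_compose_countable[OF measurable_funpow_lshift assms])

end

context recurrent_shift
begin

text \<open>The conditional expectation of \<open>F\<close> given the initial m coordinates.\<close>

definition avg :: "nat \<Rightarrow> ('v path \<Rightarrow> real) \<Rightarrow> 'v path \<Rightarrow> real" where
 "avg m F y = integ M (cyl A (map y [0..<m])) F / measure M (cyl A (map y [0..<m]))"

lemma measurable_avg [measurable]: "avg m F \<in> borel_measurable M"
 unfolding avg_def[abs_def]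
 by (rule measurable_compose[OF measurable_prefix,
    where g = "\<lambda>p. (integ M (cyl A p) F) / measure M (cyl A p)"]) simp

lemma integral_indicator_const: "X \<in> sets M \<Longrightarrow> (LINT y|M. indicator X y * (c :: real)) = measure M X * c"
 using sets.sets_into_space[of X M] by (simp add: Int_absorb2)

lemma avg_bounds:
 assumes m: "1 \<le> m" and F [measurable]: "F \<in> borel_measurable M" and F01: "\<And>x. 0 \<le> F x" "\<And>x. F x \<le> 1"
 shows "0 \<le> avg m F y" "avg m F y \<le> 1"
proof -
 let ?C = "cyl A (map y [0..<m])"
 have fin: "emeasure M ?C < \<infinity>" by (rule cyl_finite) (use m in simp)
 show "0 \<le> avg m F y"
  unfolding avg_def using F01 by (intro divide_nonneg_nonneg lint_nonneg) auto
 have "integ M ?C F \<le> (LINT z|M. indicator ?C z * 1)"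
  by (rule integral_mono; (rule integrable_indicator_mult[OF cyl_sets fin, of _ 1])?)
    (use F01 in "auto simp: indicator_def")
 then have "integ M ?C F \<le> measure M ?C"
  by (subst (asm) integral_indicator_const) auto
 then show "avg m F y \<le> 1"
  unfolding avg_def by (cases "measure M ?C = 0") (auto simp: divide_le_eq_1 zero_less_measure_iff)
qed

text \<open>The approximate Markov property at a random time: the event that \<tau> equals k,
  together with \<open>X\<close>, is visible k + m coordinates deep, so the renewal bound holds on
  each cell with the same factor. The weight may depend on the time because it is constant on a
  cell.\<close>

lemma stop_average:
 fixes wt :: "nat \<Rightarrow> real"
 assumes X [measurable]: "X \<in> sets M" and fin: "emeasure M X < \<infinity>"
  and \<tau> [measurable]: "\<tau> \<in> M \<rightarrow>\<^sub>M count_space UNIV"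
  and m: "1 \<le> m" and det: "\<And>k. determined A (k + m) (X \<inter> {y. \<tau> y = k})"
  and wt: "\<And>k. 0 \<le> wt k" "\<And>k. wt k \<le> 1" and F [measurable]: "F \<in> borel_measurable M" and F01: "\<And>x. 0 \<le> F x" "\<And>x. F x \<le> 1"
 shows "(LINT y|M. indicator X y * (wt (\<tau> y) * F (sh (\<tau> y) y)))
   \<le> exp (D m) * (LINT y|M. indicator X y * (wt (\<tau> y) * avg m F (sh (\<tau> y) y)))"
  and "(LINT y|M. indicator X y * (wt (\<tau> y) * avg m F (sh (\<tau> y) y)))
   \<le> exp (D m) * (LINT y|M. indicator X y * (wt (\<tau> y) * F (sh (\<tau> y) y)))"
proof -
 let ?S = "\<lambda>y. sh (\<tau> y) y"
 \<comment> \<open>On a cell the time and the next m symbols are fixed, so the averaged function is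
   constant there.\<close>
 let ?\<pi> = "\<lambda>y. (\<tau> y, map (?S y) [0..<m])"
 have [measurable]: "?\<pi> \<in> M \<rightarrow>\<^sub>M count_space UNIV"
  by (rule measurable_Pair_compose_split[OF _ \<tau> measurable_compose[OF measurable_stopped[OF \<tau>] measurable_prefix[of m]], of Pair, simplified])
    (simp add: measurable_count_space_eq1 pair_measure_countable)
 note avg01 = avg_bounds[OF m F F01]
 have i1: "integrable M (\<lambda>y. indicator X y * (wt (\<tau> y) * F (?S y)))"
  by (rule integrable_indicator_mult[OF X fin, of _ 1]) (use F01 wt in "auto simp: abs_mult intro!: mult_le_one")
 have i2: "integrable M (\<lambda>y. indicator X y * (wt (\<tau> y) * avg m F (?S y)))"
  by (rule integrable_indicator_mult[OF X fin, of _ 1]) (use avg01 wt in "auto simp: abs_mult intro!: mult_le_one")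
 have i3: "integrable M (\<lambda>y. exp (D m) * (indicator X y * (wt (\<tau> y) * F (?S y))))"
  "integrable M (\<lambda>y. exp (D m) * (indicator X y * (wt (\<tau> y) * avg m F (?S y))))"
  using i1 i2 by auto
 have nn: "0 \<le> exp (D m) * (indicator X y * (wt (\<tau> y) * F (?S y)))" "0 \<le> indicator X y * (wt (\<tau> y) * F (?S y))"
  "0 \<le> exp (D m) * (indicator X y * (wt (\<tau> y) * avg m F (?S y)))" "0 \<le> indicator X y * (wt (\<tau> y) * avg m F (?S y))" for y
  using F01 avg01 wt by auto
 have c: "(LINT y|M. indicator Z y * (d * h y)) = d * integ M Z h" for Z d and h :: "_ \<Rightarrow> real"
  by (subst integral_mult_right_zero[symmetric]) (simp only: mult.left_commute)
 have piece:
  "(LINT y|M. indicator {y. ?\<pi> y = i} y * (indicator X y * (wt (\<tau> y) * F (?S y))))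
   \<le> exp (D m) * (LINT y|M. indicator {y. ?\<pi> y = i} y * (indicator X y * (wt (\<tau> y) * avg m F (?S y))))"
  "(LINT y|M. indicator {y. ?\<pi> y = i} y * (indicator X y * (wt (\<tau> y) * avg m F (?S y))))
   \<le> exp (D m) * (LINT y|M. indicator {y. ?\<pi> y = i} y * (indicator X y * (wt (\<tau> y) * F (?S y))))" for i
 proof -
  obtain k p where i: "i = (k, p)" by (cases i)
  define Y where "Y = (if length p = m then X \<inter> {y. \<tau> y = k} \<inter> (sh k -` cyl A p) else {})"
  define q where "q = integ M (cyl A p) F / measure M (cyl A p)"
  have Xs: "X \<subseteq> shift_space A" using sets.sets_into_space[OF X] by (simp add: space_M)
  have prefix_iff: "map z [0..<m] = p \<longleftrightarrow> length p = m \<and> z \<in> cyl A p" if "z \<in> shift_space A" for z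
   using that by (auto simp: cyl_def map_upt_eq_iff)
  have mem: "y \<in> Y \<longleftrightarrow> y \<in> X \<and> ?\<pi> y = i" for y
   using Xs prefix_iff[OF funpow_lshift_in_shift_space[of y A k]] by (auto simp: Y_def i)
  have e1: "(LINT y|M. indicator {y. ?\<pi> y = i} y * (indicator X y * (wt (\<tau> y) * G (?S y)))) =
    wt k * corr M Y G k" for G :: "_ \<Rightarrow> real"
   unfolding c[symmetric] using mem by (intro lint_cong) (auto simp: indicator_def i)
  have Y_det: "determined A (k + m) Y"
  proof (cases "length p = m")
   case True
   have "Y = X \<inter> {y. \<tau> y = k} \<inter> (sh k -` cyl A p \<inter> shift_space A)" using Xs True by (auto simp: Y_def)
   moreover have "determined A (m + k) (sh k -` cyl A p \<inter> shift_space A)"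
    using determined_vimage[OF determined_cyl[of A p], of k] True by simp
   ultimately show ?thesis
    using det[of k] by (auto simp: add.commute intro: determined_Int)
  qed (simp add: Y_def determined_def)
  have [measurable]: "Y \<in> sets M" by (rule determined_sets[OF Y_det])
  have Y_fin: "emeasure M Y < \<infinity>"
   by (rule le_less_trans[OF emeasure_mono fin]) (auto simp: Y_def)
  have e2: "(LINT y|M. indicator Y y * avg m F (sh k y)) = measure M Y * q"
  proof -
   have "(LINT y|M. indicator Y y * avg m F (sh k y)) = (LINT y|M. indicator Y y * q)"
    using mem by (intro lint_cong refl) (auto simp: indicator_def i avg_def q_def)
   then show ?thesis by (simp only: integral_indicator_const[OF \<open>Y \<in> sets M\<close>])
  qed
  show "(LINT y|M. indicator {y. ?\<pi> y = i} y * (indicator X y * (wt (\<tau> y) * F (?S y))))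
   \<le> exp (D m) * (LINT y|M. indicator {y. ?\<pi> y = i} y * (indicator X y * (wt (\<tau> y) * avg m F (?S y))))"
   "(LINT y|M. indicator {y. ?\<pi> y = i} y * (indicator X y * (wt (\<tau> y) * avg m F (?S y))))
   \<le> exp (D m) * (LINT y|M. indicator {y. ?\<pi> y = i} y * (indicator X y * (wt (\<tau> y) * F (?S y))))"
   unfolding e1 e2
  proof -
   have "corr M Y F k \<le> exp (D m) * (measure M Y * q) \<and>
    measure M Y * q \<le> exp (D m) * corr M Y F k"
   proof (cases "length p = m \<and> cyl A p \<noteq> {}")
    case True
    then have p: "p \<noteq> []" "length p = m" using m by auto
    have mp: "0 < measure M (cyl A p)" using measure_cyl_pos[OF p(1)] True by simp
    have Yp: "Y \<subseteq> sh k -` cyl A p" by (auto simp: Y_def)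
    note r = renewal_real[OF p(1) Y_det[folded p(2)] Yp Y_fin F F01]
    show "corr M Y F k \<le> exp (D m) * (measure M Y * q) \<and>
     measure M Y * q \<le> exp (D m) * corr M Y F k"
     using r mp by (simp add: q_def p field_simps)
   next
    case False
    then have "Y = {}" by (auto simp: Y_def)
    then show "corr M Y F k \<le> exp (D m) * (measure M Y * q) \<and>
     measure M Y * q \<le> exp (D m) * corr M Y F k" by simp
   qed
   then show "wt k * corr M Y F k \<le> exp (D m) * (wt k * (measure M Y * q))"
    "wt k * (measure M Y * q) \<le> exp (D m) * (wt k * corr M Y F k)"
    using wt(1)[of k] by (simp_all only: mult.left_commute[of "exp _"] mult_left_mono)
  qed
 qed
 have "(LINT y|M. indicator X y * (wt (\<tau> y) * F (?S y))) \<le> (LINT y|M. exp (D m) * (indicator X y * (wt (\<tau> y) * avg m F (?S y))))"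
  by (rule integral_partition_le[of M _ _ ?\<pi>]) (use i1 i3 nn piece(1) in "auto simp only: c", measurable)
 then show "(LINT y|M. indicator X y * (wt (\<tau> y) * F (?S y))) \<le> exp (D m) * (LINT y|M. indicator X y * (wt (\<tau> y) * avg m F (?S y)))"
  by simp
 have "(LINT y|M. indicator X y * (wt (\<tau> y) * avg m F (?S y))) \<le> (LINT y|M. exp (D m) * (indicator X y * (wt (\<tau> y) * F (?S y))))"
  by (rule integral_partition_le[of M _ _ ?\<pi>]) (use i2 i3 nn piece(2) in "auto simp only: c", measurable)
 then show "(LINT y|M. indicator X y * (wt (\<tau> y) * avg m F (?S y))) \<le> exp (D m) * (LINT y|M. indicator X y * (wt (\<tau> y) * F (?S y)))"
  by simp
qed

lemmas stop_average_unweighted =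
 stop_average[where wt = "\<lambda>_. 1", OF _ _ _ _ _ zero_le_one order_refl, unfolded mult_1_left]

end

lemma power_times_square_tendsto_0:
 fixes r :: real
 assumes "0 < r" "r < 1"
 shows "(\<lambda>n. r ^ n * (real n)\<^sup>2) \<longlonglongrightarrow> 0"
proof -
 have "(\<lambda>n. (real n * sqrt r ^ n)\<^sup>2) \<longlonglongrightarrow> 0\<^sup>2"
  by (intro tendsto_power powser_times_n_limit_0) (use assms in "simp add: real_sqrt_lt_1_iff")
 moreover have "(real n * sqrt r ^ n)\<^sup>2 = r ^ n * (real n)\<^sup>2" for n
  using assms by (simp add: power_mult_distrib power_mult[symmetric] power_even_eq[symmetric] power2_eq_square real_sqrt_power[symmetric])
 ultimately show ?thesis by simp
qed

context hitting
begin

section \<open>Tails of the return time to v and the gaps between visits of x\<close>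

definition long :: "nat \<Rightarrow> 'v path set" where
 "long j = {y \<in> cyl A [v]. enat j \<le> return_time (cyl A [v]) y}"

lemma long_sets [measurable]: "long j \<in> sets M"
proof -
 have "long j = cyl A [v] \<inter> {y \<in> space M. enat j \<le> return_time (cyl A [v]) y}"
  using cyl_subset by (auto simp: long_def space_M)
 then show ?thesis by simp
qed

lemma v_fin: "emeasure M (cyl A [v]) < \<infinity>" by (rule cyl_finite) simp

lemma v_pos: "0 < mv" by (rule measure_cyl_pos[OF _ v_cyl_ne]) simp

lemma integral_indicator_eq: "X \<in> sets M \<Longrightarrow> (LINT y|M. indicator X y) = measure M X"
 using sets.sets_into_space[of X M] by (simp add: Int_absorb2)

lemma long_le: "measure M (long j) \<le> mv"
 by (rule measure_mono_fmeasurable) (auto simp: long_def fmeasurable_cyl)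

text \<open>Two visits to \<open>long j\<close> less than j steps apart would contradict the length
  of the return, so along each orbit at most one of the times k < j counts. The dual ergodic lower
  bound then limits a j times the measure of \<open>long j\<close>.\<close>

lemma long_bound:
 obtains K where "0 < K" "\<And>j. max 0 (a j) * measure M (long j) \<le> K"
proof -
 have v: "[v] \<noteq> []" "cyl A [v] \<noteq> {}" using v_cyl_ne by auto
 obtain c where c: "0 \<le> c" and
  low: "\<And>F n. integrable M F \<Longrightarrow> (\<And>x. 0 \<le> F x) \<Longrightarrow> (\<And>y. y \<notin> cyl A [v] \<Longrightarrow> F y = 0) \<Longrightarrow>
   ((1 - 1 / 2) * exp (- D (length [v])) * mv * (LINT x|M. F x)) * max 0 (a n) \<le>
    (\<Sum>k<n. LINT x|M. indicator (cyl A [v]) x * F (sh k x)) + c * (LINT x|M. F x)"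
 proof (rule dual_ergodic_bounds[OF v(1) v _ _ v(2), of "1 / 2"], goal_cases)
  case (3 c)
  show ?case by (rule that) (fact 3)+
 qed auto
 have bound: "(1 / 2 * exp (- D 1) * mv) * (max 0 (a j) * measure M (long j)) \<le> (1 + c) * mv" for j
 proof -
  let ?F = "indicator (long j) :: 'v path \<Rightarrow> real"
  have F_fin: "emeasure M (long j) < \<infinity>"
   by (rule le_less_trans[OF emeasure_mono v_fin]) (auto simp: long_def)
  have Fi: "integrable M ?F" using F_fin by simp
  have "(\<Sum>k<j. LINT y|M. indicator (cyl A [v]) y * ?F (sh k y)) =
    (LINT y|M. (\<Sum>k<j. indicator (cyl A [v]) y * ?F (sh k y)))"
   by (rule Bochner_Integration.integral_sum[symmetric]) (rule integrable_indicator_funpow[OF Fi cyl_sets])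
  also have "\<dots> \<le> (LINT y|M. indicator (cyl A [v]) y)"
  proof (rule integral_mono)
   fix y
   have "(\<Sum>k<j. ?F (sh k y)) \<le> 1"
   proof (cases "\<exists>k<j. sh k y \<in> long j")
    case True
    then obtain k where k: "k < j" "sh k y \<in> long j" by blast
    have "sh k' y \<notin> long j" if k': "k' < j" "k' \<noteq> k" for k'
    proof -
     have no: "sh ((p + d)) y \<notin> cyl A [v]" if "sh p y \<in> long j" "0 < d" "d < j" for p d
     proof
      assume "sh ((p + d)) y \<in> cyl A [v]"
      then have *: "sh d (sh p y) \<in> cyl A [v]" by (simp add: funpow_lshift add_ac)
      have "return_time (cyl A [v]) (sh p y) \<le> enat d"
      proof (cases "return_time (cyl A [v]) (sh p y)")
       case (enat r)
       then have "r \<le> d" using * that(2) unfolding return_time_eq_enat by blast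
       then show ?thesis using enat by simp
      next
       case infinity
       then show ?thesis using * that(2) unfolding return_time_eq_infinity by blast
      qed
      then have "enat j \<le> enat d" using that(1) order_trans[of "enat j" _ "enat d"] by (auto simp only: long_def mem_Collect_eq)
      then show False using that(3) by simp
     qed
     show ?thesis
     proof (cases "k < k'")
      case True
      then show ?thesis using no[OF k(2), of "k' - k"] k' less_imp_diff_less[OF k'(1), of k] by (auto simp: long_def)
     next
      case False
      then show ?thesis using no[of k' "k - k'"] k k' less_imp_diff_less[OF k(1), of k'] by (auto simp: long_def)
     qed
    qed
    then have "(\<Sum>k'<j. ?F (sh k' y)) = (\<Sum>k'<j. if k' = k then 1 else 0)"
     using k by (intro sum.cong) auto
    then show ?thesis using k(1) by simp
   next
    case False
    then have "(\<Sum>k<j. ?F (sh k y)) = (\<Sum>k<j. 0)" by (intro sum.cong) auto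
    then show ?thesis by simp
   qed
   then show "(\<Sum>k<j. indicator (cyl A [v]) y * ?F (sh k y)) \<le> indicator (cyl A [v]) y"
    unfolding sum_distrib_left[symmetric] by (auto simp: indicator_def)
  next
   show "integrable M (\<lambda>y. \<Sum>k<j. indicator (cyl A [v]) y * ?F (sh k y))"
    by (rule Bochner_Integration.integrable_sum) (rule integrable_indicator_funpow[OF Fi cyl_sets])
   show "integrable M (indicator (cyl A [v]) :: _ \<Rightarrow> real)" using v_fin by simp
  qed
  finally have s: "(\<Sum>k<j. LINT y|M. indicator (cyl A [v]) y * ?F (sh k y)) \<le> mv"
   by (simp only: integral_indicator_eq[OF cyl_sets])
  have "((1 - 1 / 2) * exp (- D (length [v])) * mv * (LINT x|M. ?F x)) * max 0 (a j) \<le> mv + c * (LINT x|M. ?F x)"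
   by (rule order_trans[OF low add_right_mono[OF s]]) (use Fi in "auto simp: long_def")
  also have "\<dots> \<le> mv + c * mv"
   unfolding integral_indicator_eq[OF long_sets] using c long_le[of j] by (intro add_left_mono mult_left_mono)
  finally show ?thesis unfolding integral_indicator_eq[OF long_sets] by (simp add: algebra_simps)
 qed
 show thesis
 proof (rule that[of "(1 + c) * mv / (1 / 2 * exp (- D 1) * mv)"])
  show "0 < (1 + c) * mv / (1 / 2 * exp (- D 1) * mv)" using c v_pos by simp
  show "max 0 (a j) * measure M (long j) \<le> (1 + c) * mv / (1 / 2 * exp (- D 1) * mv)" for j
   using bound[of j] v_pos by (subst pos_le_divide_eq) (auto simp: mult_ac)
 qed
qed

text \<open>After any past that ends in \<open>v\<close>, the future is distributed like the
  normalized restriction of \<open>M\<close> to [v] up to a constant; one known symbol suffices for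
  the kernel bound.\<close>

lemma after_v:
 assumes Y: "determined A (Suc j) Y" "Y \<subseteq> sh j -` cyl A [v]" "emeasure M Y < \<infinity>"
  and R [measurable]: "R \<in> sets M" "R \<subseteq> cyl A [v]"
 shows "measure M (Y \<inter> sh j -` R) \<le> exp (D 1) / mv * measure M Y * measure M R"
proof -
 have [measurable]: "Y \<in> sets M" by (rule determined_sets[OF Y(1)])
 have Ys: "Y \<subseteq> space M" using sets.sets_into_space[OF \<open>Y \<in> sets M\<close>] .
 have "Y \<inter> sh j -` R = Y \<inter> (sh j -` R \<inter> space M)" using Ys by auto
 then have S: "Y \<inter> sh j -` R \<in> sets M" by (simp add: measurable_sets[OF measurable_funpow_lshift])
 have "corr M Y (indicator R) j * mv
   \<le> exp (D (length [v])) * (measure M Y * integ M (cyl A [v]) (indicator R))"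
  by (rule renewal_real(1)) (use Y in auto)
 also have "corr M Y (indicator R) j = (\<integral>y. indicator (Y \<inter> sh j -` R) y \<partial>M :: real)"
  by (intro lint_cong) (auto simp: indicator_def)
 also have "\<dots> = measure M (Y \<inter> sh j -` R)" by (rule integral_indicator_eq[OF S])
 also have "integ M (cyl A [v]) (indicator R) = (\<integral>y. indicator R y \<partial>M :: real)"
  using R(2) by (intro lint_cong) (auto simp: indicator_def)
 also have "\<dots> = measure M R" by (rule integral_indicator_eq[OF R(1)])
 finally show ?thesis using v_pos by (simp del: funpow_lshift_apply add: field_simps)
qed

lemma visit_positions: "{k \<in> {Suc (t l)..<Suc (t i)}. x k = v} = t ` {l<..i}"
proof (intro equalityI subsetI)
 fix k assume k: "k \<in> {k \<in> {Suc (t l)..<Suc (t i)}. x k = v}"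
 then obtain j where j: "k = t j" using t_surj[of k] by auto
 then have "l < j" "j \<le> i" using k t_less_iff[of l j] t_less_iff[of i j] by auto
 then show "k \<in> t ` {l<..i}" using j by auto
next
 fix k assume "k \<in> t ` {l<..i}"
 then obtain j where "k = t j" "l < j" "j \<le> i" by auto
 then show "k \<in> {k \<in> {Suc (t l)..<Suc (t i)}. x k = v}"
  using t_visit[of j] t_less_iff[of l j] t_less_iff[of i j] by (auto simp: Suc_le_eq less_Suc_eq_le not_less[symmetric])
qed

lemma count_visits: "count_list (map x [Suc (t l)..<Suc (t i)]) v = i - l"
proof -
 have "card (t ` {l<..i}) = i - l"
  using strict_mono_imp_inj_on[OF t_strict_mono, of "{l<..i}"] by (subst card_image) (auto simp: inj_on_def)
 then show ?thesis by (simp only: count_list_map_upt visit_positions)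
qed

lemma b_decay: "l \<le> i \<Longrightarrow> b (Suc (t i)) \<le> \<rho> ^ (i - l) * b (Suc (t l))"
proof -
 assume li: "l \<le> i"
 then have "t l \<le> t i" using t_less_iff[of i l] by (auto simp: not_less[symmetric])
 then have "map x [0..<Suc (t i)] = map x [0..<Suc (t l)] @ map x [Suc (t l)..<Suc (t i)]"
  by (intro map_upt_append) auto
 moreover have "last (map x [0..<Suc (t l)]) = v" using t_visit[of l] by simp
 ultimately show ?thesis
  using decay[of "map x [0..<Suc (t l)]" "map x [Suc (t l)..<Suc (t i)]"] count_visits[of l i]
  by (simp add: b_def B_def del: upt_Suc)
qed

lemma B_visit_determined: "determined A (Suc (t l)) (B (Suc (t l)))"
 using determined_cyl[of A "map x [0..<Suc (t l)]"] by (simp add: B_def del: upt_Suc)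

lemma B_visit_subset: "B (Suc (t l)) \<subseteq> sh (t l) -` cyl A [v]"
proof
 fix y assume "y \<in> B (Suc (t l))"
 then have ys: "y \<in> shift_space A" and "y (t l) = x (t l)"
  by (auto simp: B_def cyl_eq_Collect[OF x_in] agree_def simp del: upt_Suc)
 then show "y \<in> sh (t l) -` cyl A [v]"
  using funpow_lshift_in_shift_space[OF ys, of "t l"] t_visit[of l] by (simp add: cyl_def)
qed

lemma B_after_v:
 assumes R [measurable]: "R \<in> sets M" "R \<subseteq> cyl A [v]" and Y: "Y \<subseteq> B (Suc (t l)) \<inter> sh (t l) -` R" "Y \<in> sets M"
 shows "measure M Y \<le> exp (D 1) / mv * b (Suc (t l)) * measure M R"
proof -
 have "measure M Y \<le> measure M (B (Suc (t l)) \<inter> sh (t l) -` R)"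
 proof (rule measure_mono_fmeasurable[OF Y])
  have "B (Suc (t l)) \<inter> sh (t l) -` R = B (Suc (t l)) \<inter> (sh (t l) -` R \<inter> space M)"
   using sets.sets_into_space[OF B_sets] by auto
  then show "B (Suc (t l)) \<inter> sh (t l) -` R \<in> fmeasurable M"
   by (simp only:) (rule fmeasurable_Int_fmeasurable[OF fmeasurableI[OF B_sets B_finite]
    measurable_sets[OF measurable_funpow_lshift R(1)]]; simp)
 qed
 also have "\<dots> \<le> exp (D 1) / mv * measure M (B (Suc (t l))) * measure M R"
  by (rule after_v[OF B_visit_determined B_visit_subset B_finite R]) simp
 finally show ?thesis by (simp add: b_def)
qed

text \<open>Following \<open>x\<close> to its next visit forces a return time to \<open>v\<close> at
  least as long as the gap.\<close>

lemma b_gap: "b (Suc (t (Suc l))) \<le> exp (D 1) / mv * b (Suc (t l)) * measure M (long (t (Suc l) - t l))"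
proof -
 let ?g = "t (Suc l) - t l"
 have lt: "t l < t (Suc l)" by (simp add: t_less_iff)
 show ?thesis
  unfolding b_def[of "Suc (t (Suc l))"]
 proof (rule B_after_v)
  show "B (Suc (t (Suc l))) \<subseteq> B (Suc (t l)) \<inter> sh (t l) -` long ?g"
  proof
   fix y assume y: "y \<in> B (Suc (t (Suc l)))"
   then have ys: "y \<in> shift_space A" and eq: "\<And>i. i < Suc (t (Suc l)) \<Longrightarrow> y i = x i"
    by (auto simp: B_def cyl_eq_Collect[OF x_in] agree_def simp del: upt_Suc)
   have "y \<in> B (Suc (t l))" using y B_antimono[of "Suc (t l)" "Suc (t (Suc l))"] lt by auto
   moreover have "sh (t l) y \<in> cyl A [v]"
    using funpow_lshift_in_shift_space[OF ys, of "t l"] eq[of "t l"] lt t_visit[of l] by (simp add: cyl_def)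
   moreover have "enat ?g \<le> return_time (cyl A [v]) (sh (t l) y)"
   proof (cases "return_time (cyl A [v]) (sh (t l) y)")
    case (enat r)
    then have r: "0 < r" "y (r + t l) = v" unfolding return_time_eq_enat by (auto simp: cyl_def)
    have "\<not> r < ?g" using r eq[of "r + t l"] no_visit_between[of l "r + t l"] by (auto simp: less_diff_conv)
    then show ?thesis using enat by simp
   qed simp
   ultimately show "y \<in> B (Suc (t l)) \<inter> sh (t l) -` long ?g" by (simp add: long_def)
  qed
 qed (auto simp: long_def)
qed

text \<open>The index l marks the largest gap before visit i, so every earlier visit time is bounded
  by that gap times the number of visits.\<close>

lemma max_gap:
 "0 < i \<Longrightarrow> \<exists>l<i. \<forall>j\<le>i. t j \<le> t 0 + j * (t (Suc l) - t l)"
proof -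
 assume i: "0 < i"
 let ?gap = "\<lambda>l. t (Suc l) - t l"
 have ne: "finite (?gap ` {..<i})" "?gap ` {..<i} \<noteq> {}" using i by auto
 from Max_in[OF ne] obtain l where l: "Max (?gap ` {..<i}) = ?gap l" "l \<in> {..<i}" by (rule imageE)
 have gap: "?gap j \<le> ?gap l" if "j < i" for j
  using Max_ge[OF ne(1), of "?gap j"] that by (simp add: l(1))
 have "t j \<le> t 0 + j * ?gap l" if "j \<le> i" for j
  using that
 proof (induction j)
  case (Suc j)
  then have "t (Suc j) - t j \<le> ?gap l" "t j \<le> t 0 + j * ?gap l" using gap[of j] by auto
  then show ?case by simp
 qed simp
 then show ?thesis using l(2) by blast
qed

text \<open>A word with \<open>i\<close> visits has measure at most \<open>\<rho> ^ i\<close> divided by \<open>a\<close> of its largest gap, while its length is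
  at most \<open>i\<close> times the largest gap; the Potter bound compares the two.\<close>

lemma visit_decay: "(\<lambda>i. max 0 (a (t i)) * b (Suc (t i))) \<longlonglongrightarrow> 0"
proof -
 obtain K where K: "0 < K" "\<And>j. max 0 (a j) * measure M (long j) \<le> K" by (rule long_bound) (rule that)
 obtain x0 P where P: "0 < P" "\<And>x k. x0 \<le> x \<Longrightarrow> 1 \<le> k \<Longrightarrow> 0 < a x \<and> a (k * x) \<le> P * real k powr (\<alpha> + 1) * a x"
  by (rule rv.potter) (rule that)
 define C1 where "C1 = exp (D 1) / mv * b (Suc (t 0))"
 \<comment> \<open>Absorbs the initial stretch before the earliest visit of \<open>x\<close> into a
   multiple of the largest gap.\<close>
 define r where "r = Suc (t 0 + x0)"
 define C where "C = P * (P * real r ^ 2) * (K + a x0 * mv) * C1 / \<rho>"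
 have C1: "0 \<le> C1" using v_pos b_pos[of "Suc (t 0)"] by (simp add: C1_def)
 have powr_le: "real k powr (\<alpha> + 1) \<le> real k ^ 2" if "1 \<le> k" for k
  using powr_mono[of "\<alpha> + 1" 2 "real k"] alpha_le that by (simp add: powr_numeral)
 have main: "max 0 (a (t i)) * b (Suc (t i)) \<le> C * (\<rho> ^ i * (real i)\<^sup>2)" if i: "1 \<le> i" for i
 proof -
  obtain l where l: "l < i" "\<forall>j\<le>i. t j \<le> t 0 + j * (t (Suc l) - t l)" using max_gap[of i] i by auto
  define G where "G = t (Suc l) - t l"
  \<comment> \<open>The Potter bound holds only from x0 on. Smaller gaps are replaced by x0, which
    accounts for the summand a x0 * mv in the constant \<open>C\<close>.\<close>
  define X where "X = max G x0"
  have aX: "0 < a X" "0 < a x0" using P(2)[of X 1] P(2)[of x0 1] by (auto simp: X_def)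
  have G1: "1 \<le> G" using t_less_iff[of l "Suc l"] by (simp add: G_def)
  have "t i \<le> t 0 + i * G" using l(2) by (simp add: G_def)
  also have "\<dots> \<le> i * (t 0 + G)" using i by (simp add: algebra_simps)
  also have "t 0 + G \<le> r * X"
  proof -
   have "t 0 * 1 \<le> t 0 * X" using G1 by (intro mult_left_mono) (auto simp: X_def)
   moreover have "G \<le> X" by (simp add: X_def)
   ultimately show ?thesis unfolding r_def mult_Suc add_mult_distrib by linarith
  qed
  finally have ti: "t i \<le> i * (r * X)" by simp
  have x0X: "x0 \<le> r * X" by (auto simp: X_def r_def intro!: trans_le_add1)
  have "a (t i) \<le> a (i * (r * X))" by (rule monoD[OF rv.mono_a ti])
  also have "\<dots> \<le> P * real i powr (\<alpha> + 1) * a (r * X)"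
   using P(2)[OF x0X i] by simp
  also have "\<dots> \<le> P * real i ^ 2 * (P * real r ^ 2 * a X)"
  proof (intro mult_mono powr_le i)
   have "a (r * X) \<le> P * real r powr (\<alpha> + 1) * a X" using P(2)[of X r] by (simp add: X_def r_def)
   also have "\<dots> \<le> P * real r ^ 2 * a X"
    using aX P(1) by (intro mult_right_mono mult_left_mono powr_le) (auto simp: r_def)
   finally show "a (r * X) \<le> P * real r ^ 2 * a X" .
   show "0 \<le> a (r * X)"
    using P(2)[OF x0X order_refl] by simp
  qed (use P in auto)
  finally have ati: "max 0 (a (t i)) \<le> P * real i ^ 2 * (P * real r ^ 2 * a X)" using aX P(1) by simp
  \<comment> \<open>The word is cut at its largest gap: geometric decay before and after it, and the
    tail of the return time across it.\<close>
  have "b (Suc (t i)) \<le> \<rho> ^ (i - Suc l) * b (Suc (t (Suc l)))" using l(1) by (intro b_decay) simp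
  also have "\<dots> \<le> \<rho> ^ (i - Suc l) * (exp (D 1) / mv * b (Suc (t l)) * measure M (long G))"
   unfolding G_def using rho by (intro mult_left_mono b_gap) auto
  also have "\<dots> \<le> \<rho> ^ (i - Suc l) * (exp (D 1) / mv * (\<rho> ^ l * b (Suc (t 0))) * measure M (long G))"
   using b_decay[of 0 l] rho by (intro mult_left_mono mult_right_mono) auto
  also have "\<dots> = C1 / \<rho> * \<rho> ^ i * measure M (long G)"
  proof -
   have "\<rho> ^ (i - Suc l) * \<rho> ^ l * \<rho> = \<rho> ^ i"
    unfolding power_add[symmetric] power_Suc2[symmetric] using l(1) by simp
   then have *: "\<rho> ^ (i - Suc l) * \<rho> ^ l = \<rho> ^ i / \<rho>" using rho(1) by (simp add: field_simps)
   have "\<rho> ^ (i - Suc l) * (exp (D 1) / mv * (\<rho> ^ l * b (Suc (t 0))) * measure M (long G)) =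
     C1 * (\<rho> ^ (i - Suc l) * \<rho> ^ l) * measure M (long G)" by (simp add: C1_def)
   then show ?thesis unfolding * by simp
  qed
  finally have bti: "b (Suc (t i)) \<le> C1 / \<rho> * \<rho> ^ i * measure M (long G)" .
  have aXG: "a X * measure M (long G) \<le> K + a x0 * mv"
  proof (cases "x0 \<le> G")
   case True
   then show ?thesis using K(2)[of G] aX by (simp add: X_def max_def mult_nonneg_nonneg split: if_splits) (smt (verit) measure_nonneg mult_nonneg_nonneg)
  next
   case False
   then have "a X * measure M (long G) \<le> a x0 * mv"
    using aX long_le[of G] by (auto simp: X_def max_def intro!: mult_left_mono)
   then show ?thesis using K(1) by simp
  qed
  have "max 0 (a (t i)) * b (Suc (t i)) \<le> (P * real i ^ 2 * (P * real r ^ 2 * a X)) * (C1 / \<rho> * \<rho> ^ i * measure M (long G))"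
   by (rule mult_mono[OF ati bti]) (use aX P b_pos[of "Suc (t i)"] in auto)
  also have "\<dots> = (P * (P * real r ^ 2) * C1 / \<rho> * (\<rho> ^ i * (real i)\<^sup>2)) * (a X * measure M (long G))"
   by simp
  also have "\<dots> \<le> (P * (P * real r ^ 2) * C1 / \<rho> * (\<rho> ^ i * (real i)\<^sup>2)) * (K + a x0 * mv)"
   using P C1 rho by (intro mult_left_mono aXG) auto
  also have "\<dots> = C * (\<rho> ^ i * (real i)\<^sup>2)" by (simp add: C_def)
  finally show ?thesis .
 qed
 have lim: "(\<lambda>i. C * (\<rho> ^ i * (real i)\<^sup>2)) \<longlonglongrightarrow> 0"
  using tendsto_mult_right_zero[OF power_times_square_tendsto_0[OF rho(1,2)]] .
 show ?thesis
 proof (rule Lim_null_comparison[OF _ lim])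
  show "\<forall>\<^sub>F i in sequentially. norm (max 0 (a (t i)) * b (Suc (t i))) \<le> C * (\<rho> ^ i * (real i)\<^sup>2)"
   using eventually_ge_at_top[of 1]
  proof eventually_elim
   case (elim i)
   then show ?case using main[of i] b_pos[of "Suc (t i)"] by (simp add: abs_mult)
  qed
 qed
qed

end

subsection \<open>First entry to a recurrent letter\<close>

lemma return_time_shift:
 "(\<And>j. 1 \<le> j \<Longrightarrow> j \<le> e \<Longrightarrow> sh j y \<notin> B) \<Longrightarrow>
  return_time B y = enat e + return_time B (sh e y)"
proof (induction e)
 case 0
 then show ?case by (simp add: zero_enat_def[symmetric] funpow_lshift)
next
 case (Suc e)
 have "return_time B y = enat e + return_time B (sh e y)" by (rule Suc.IH) (use Suc.prems in simp)
 moreover have "lshift (sh e y) \<notin> B" using Suc.prems[of "Suc e"] by simp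
 then have "return_time B (sh e y) = return_time B (sh (Suc e) y) + 1"
  using return_time_step[of B "sh e y"] by simp
 ultimately have "return_time B y = enat e + (return_time B (sh (Suc e) y) + 1)" by (simp only:)
 moreover have "enat (Suc e) = enat e + 1" by (simp add: one_enat_def)
 ultimately show ?case by (simp only: ac_simps)
qed

lemma (in shift_measure) measurable_coord [measurable]: "(\<lambda>y. y k) \<in> M \<rightarrow>\<^sub>M count_space UNIV"
proof -
 have "(\<lambda>y. map y [0..<Suc k] ! k) \<in> M \<rightarrow>\<^sub>M count_space UNIV"
  by (rule measurable_compose[OF measurable_prefix]) simp
 then show ?thesis by (simp del: upt_Suc)
qed

context hitting
begin

text \<open>The last visit of \<open>x\<close> to \<open>v\<close> within the word of length n;
  meaningful once n exceeds \<open>t 0\<close>.\<close>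

definition idx :: "nat \<Rightarrow> nat" where "idx n = Max {i. t i < n}"

lemma idx_finite: "finite {i. t i < n}"
 by (rule finite_subset[of _ "{..<n}"]) (use t_ge le_less_trans in auto)

lemma idx: "t 0 < n \<Longrightarrow> t (idx n) < n \<and> n \<le> t (Suc (idx n))"
proof -
 assume n: "t 0 < n"
 then have "{i. t i < n} \<noteq> {}" by auto
 from Max_in[OF idx_finite this] have "t (idx n) < n" by (simp add: idx_def)
 moreover have "\<not> t (Suc (idx n)) < n"
  using Max_ge[OF idx_finite, of "Suc (idx n)" n] by (auto simp: idx_def)
 ultimately show ?thesis by simp
qed

lemma idx_top: "filterlim idx at_top sequentially"
 unfolding filterlim_at_top
proof
 fix Z
 show "\<forall>\<^sub>F n in sequentially. Z \<le> idx n"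
  using eventually_gt_at_top[of "t Z"]
  by eventually_elim (use Max_ge[OF idx_finite] in "auto simp: idx_def")
qed

text \<open>\<open>entry n y\<close> is meaningful only for \<open>y\<close> in \<open>X n\<close>, which is almost all of \<open>B n\<close>.\<close>

definition entry :: "nat \<Rightarrow> 'v path \<Rightarrow> nat" where
 "entry n y = (LEAST k. n \<le> k \<and> y k = v)"

definition X :: "nat \<Rightarrow> 'v path set" where "X n = {y \<in> B n. \<exists>k\<ge>n. y k = v}"

lemma entry_measurable [measurable]: "entry n \<in> M \<rightarrow>\<^sub>M count_space UNIV"
 unfolding entry_def by measurable

lemma B_space: "y \<in> B n \<Longrightarrow> y \<in> space M"
 using sets.sets_into_space[OF B_sets] by auto

lemma X_sets [measurable]: "X n \<in> sets M"
proof -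
 have "X n = {y \<in> space M. y \<in> B n \<and> (\<exists>k\<ge>n. y k = v)}" using B_space by (auto simp: X_def)
 then show ?thesis by simp
qed

lemma X_subset: "X n \<subseteq> B n" by (auto simp: X_def)

lemma X_finite: "1 \<le> n \<Longrightarrow> emeasure M (X n) < \<infinity>"
 by (rule le_less_trans[OF emeasure_mono[OF X_subset B_sets] B_finite])

lemma X_entry:
 assumes "y \<in> X n"
 shows "n \<le> entry n y" "y (entry n y) = v" "\<And>k. n \<le> k \<Longrightarrow> y k = v \<Longrightarrow> entry n y \<le> k"
proof -
 have "\<exists>k. n \<le> k \<and> y k = v" using assms by (auto simp: X_def)
 from LeastI_ex[OF this] show "n \<le> entry n y" "y (entry n y) = v" by (auto simp: entry_def)
 show "\<And>k. n \<le> k \<Longrightarrow> y k = v \<Longrightarrow> entry n y \<le> k" by (auto simp: entry_def intro: Least_le)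
qed

lemma B_eq: "y \<in> B n \<longleftrightarrow> y \<in> shift_space A \<and> (\<forall>i<n. y i = x i)"
 by (auto simp: B_def cyl_eq_Collect[OF x_in] agree_def)

lemma X_determined:
 assumes m: "1 \<le> m"
 shows "determined A (k + m) (X n \<inter> {y. entry n y = k})"
 unfolding determined_def
proof (intro conjI ballI impI)
 show "X n \<inter> {y. entry n y = k} \<subseteq> shift_space A" by (auto simp: X_def B_eq)
 fix y z assume y: "y \<in> X n \<inter> {y. entry n y = k}" and z: "z \<in> shift_space A" and yz: "agree (k + m) y z"
 then have e: "n \<le> k" "y k = v" "\<And>j. n \<le> j \<Longrightarrow> y j = v \<Longrightarrow> k \<le> j" using X_entry[of y n] by auto
 have eq: "z i = y i" if "i \<le> k" for i using yz that m by (auto simp: agree_def)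
 have "z \<in> X n" using y z e eq by (auto simp: X_def B_eq)
 moreover have "entry n z = k"
  unfolding entry_def
 proof (rule Least_equality)
  show "n \<le> k \<and> z k = v" using e eq by simp
  fix j assume "n \<le> j \<and> z j = v"
  then show "k \<le> j" using e(3)[of j] eq[of j] by (cases "j \<le> k") auto
 qed
 ultimately show "z \<in> X n \<inter> {y. entry n y = k}" by simp
qed

lemma AE_X: "AE y in M. y \<in> B n \<longrightarrow> y \<in> X n"
proof -
 have "AE y in M. return_time (cyl A [v]) (sh n y) < \<infinity>"
  by (rule AE_funpow[OF AE_return_finite]) (use v_cyl_ne in auto)
 then show ?thesis
 proof eventually_elim
  case (elim y)
  then obtain k where "return_time (cyl A [v]) (sh n y) = enat k" by auto
  then have "y (k + n) = v" unfolding return_time_eq_enat by (auto simp: cyl_def)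
  then show ?case by (auto simp: X_def intro!: exI[of _ "k + n"])
 qed
qed

lemma measure_X: "measure M (X n) = b n"
proof -
 have "measure M (X n) = measure M (B n)"
  by (rule measure_eq_AE) (use AE_X[of n] X_subset in "auto elim!: AE_mp")
 then show ?thesis by (simp add: b_def)
qed

definition slow :: "nat \<Rightarrow> real \<Rightarrow> 'v path set" where
 "slow n r = {y \<in> X n. r < real (entry n y)}"

lemma slow_sets [measurable]: "slow n r \<in> sets M"
proof -
 have "slow n r = X n \<inter> {y \<in> space M. r < real (entry n y)}"
  using sets.sets_into_space[OF X_sets] by (auto simp: slow_def)
 then show ?thesis by simp
qed

text \<open>Between the last visit inside the word and the entry the orbit avoids \<open>v\<close>,
  so a late entry is a long return from that visit.\<close>

lemma entry_tail:
 assumes n: "t 0 < n" and r: "real (t (idx n) + j) \<le> r"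
 shows "measure M (slow n r) \<le> exp (D 1) / mv * b (Suc (t (idx n))) * measure M (long j)"
proof (rule B_after_v[OF long_sets _ _ slow_sets])
 let ?l = "t (idx n)"
 have l: "?l < n" "n \<le> t (Suc (idx n))" using idx[OF n] by auto
 show "slow n r \<subseteq> B (Suc ?l) \<inter> sh ?l -` long j"
 proof
  fix y assume "y \<in> slow n r"
  then have y: "y \<in> X n" "?l + j < entry n y" using r by (auto simp: slow_def)
  then have yB: "y \<in> B n" using X_subset by auto
  then have ys: "y \<in> shift_space A" and eq: "\<And>i. i < n \<Longrightarrow> y i = x i" by (auto simp: B_eq)
  have "y \<in> B (Suc ?l)" using yB B_antimono[of "Suc ?l" n] l by auto
  moreover have "sh ?l y \<in> cyl A [v]"
   using funpow_lshift_in_shift_space[OF ys, of ?l] eq[OF l(1)] t_visit[of "idx n"] by (simp add: cyl_def)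
  moreover have "enat j \<le> return_time (cyl A [v]) (sh ?l y)"
  proof (cases "return_time (cyl A [v]) (sh ?l y)")
   case (enat k)
   then have k: "0 < k" "y (k + ?l) = v" unfolding return_time_eq_enat by (auto simp: cyl_def)
   have "n \<le> k + ?l"
    using k eq[of "k + ?l"] no_visit_between[of "idx n" "k + ?l"] l by (cases "k + ?l < n") auto
   then show ?thesis using X_entry(3)[OF y(1) _ k(2)] y(2) enat by auto
  qed simp
  ultimately show "y \<in> B (Suc ?l) \<inter> sh ?l -` long j" by (simp add: long_def)
 qed
qed (auto simp: long_def)

lemma b_antimono: "1 \<le> m \<Longrightarrow> m \<le> n \<Longrightarrow> b n \<le> b m"
 unfolding b_def using B_finite[of m] by (intro measure_mono_fmeasurable B_antimono) (auto simp: fmeasurable_def)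

lemma a_scaled_lim:
 assumes \<delta>: "0 < \<delta>"
 shows "(\<lambda>n. a (nat \<lfloor>\<delta> * real (N n)\<rfloor>) * b n) \<longlonglongrightarrow> \<delta> powr \<alpha>"
proof -
 have "(\<lambda>n. (a (nat \<lfloor>\<delta> * real (N n)\<rfloor>) / a (N n)) * (a (N n) * b n)) \<longlonglongrightarrow> \<delta> powr \<alpha> * 1"
  by (intro tendsto_mult a_N_b filterlim_compose[OF rv.a_rv[OF \<delta>] N_top])
 moreover have "\<forall>\<^sub>F n in sequentially. 0 < a (N n)" using eventually_compose_filterlim[OF rv.a_ev_pos N_top] .
 then have "\<forall>\<^sub>F n in sequentially. (a (nat \<lfloor>\<delta> * real (N n)\<rfloor>) / a (N n)) * (a (N n) * b n) = a (nat \<lfloor>\<delta> * real (N n)\<rfloor>) * b n"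
  by eventually_elim simp
 ultimately show ?thesis by (simp add: Lim_transform_eventually)
qed

text \<open>If the last visit came later than \<delta> N, monotonicity would bound a (\<delta> N) *
  b n by the product in \<open>visit_decay\<close>, which tends to 0, whereas regular variation
  gives the positive limit \<delta> powr \<alpha>.\<close>

lemma last_visit_small:
 assumes \<delta>: "0 < \<delta>"
 shows "\<forall>\<^sub>F n in sequentially. real (t (idx n)) \<le> \<delta> * real (N n)"
proof -
 have p: "0 < \<delta> powr \<alpha>" using \<delta> by simp
 have "\<forall>\<^sub>F n in sequentially. max 0 (a (t (idx n))) * b (Suc (t (idx n))) < \<delta> powr \<alpha> / 2"
  by (rule order_tendstoD(2)[OF filterlim_compose[OF visit_decay idx_top]]) (use p in simp)
 moreover have "\<forall>\<^sub>F n in sequentially. \<delta> powr \<alpha> / 2 < a (nat \<lfloor>\<delta> * real (N n)\<rfloor>) * b n"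
  by (rule order_tendstoD(1)[OF a_scaled_lim[OF \<delta>]]) (use p in simp)
 ultimately show ?thesis
  using eventually_gt_at_top[of "t 0"]
 proof eventually_elim
  case (elim n)
  show ?case
  proof (rule ccontr)
   assume "\<not> ?case"
   then have "nat \<lfloor>\<delta> * real (N n)\<rfloor> \<le> t (idx n)" by linarith
   then have "a (nat \<lfloor>\<delta> * real (N n)\<rfloor>) \<le> a (t (idx n))" by (rule monoD[OF rv.mono_a])
   then have "a (nat \<lfloor>\<delta> * real (N n)\<rfloor>) * b n \<le> max 0 (a (t (idx n))) * b (Suc (t (idx n)))"
    using idx[OF elim(3)] b_pos[of n] b_antimono[of "Suc (t (idx n))" n] elim(3)
    by (intro mult_mono) auto
   then show False using elim by simp
  qed
 qed
qed

text \<open>The factor 2 grants one \<delta> N to the last visit and one to the excursion after it.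
  The excursion has probability of order 1 / a (\<delta> N), comparable with b n, and the measure of
  the word up to the last visit supplies the vanishing factor.\<close>

lemma entry_slow:
 assumes \<delta>: "0 < \<delta>"
 shows "(\<lambda>n. measure M (slow n (2 * \<delta> * real (N n))) / b n) \<longlonglongrightarrow> 0"
proof -
 obtain K where K: "0 < K" "\<And>j. max 0 (a j) * measure M (long j) \<le> K" by (rule long_bound) (rule that)
 let ?C = "exp (D 1) / mv" and ?j = "\<lambda>n. nat \<lfloor>\<delta> * real (N n)\<rfloor>"
 have "filterlim (\<lambda>n. Suc (t (idx n))) at_top sequentially"
  using filterlim_at_top_mono[OF idx_top, of "\<lambda>n. Suc (t (idx n))"] t_ge by (simp add: le_Suc_eq)
 then have "(\<lambda>n. ?C * K * b (Suc (t (idx n))) / (a (?j n) * b n)) \<longlonglongrightarrow> ?C * K * 0 / \<delta> powr \<alpha>"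
  using \<delta> by (intro tendsto_intros a_scaled_lim filterlim_compose[OF b_lim]) auto
 then have lim: "(\<lambda>n. ?C * K * b (Suc (t (idx n))) / (a (?j n) * b n)) \<longlonglongrightarrow> 0" by simp
 have "\<forall>\<^sub>F n in sequentially. 0 < a (?j n) * b n"
  by (rule order_tendstoD(1)[OF a_scaled_lim[OF \<delta>]]) (use \<delta> in simp)
 then have "\<forall>\<^sub>F n in sequentially. norm (measure M (slow n (2 * \<delta> * real (N n))) / b n) \<le> ?C * K * b (Suc (t (idx n))) / (a (?j n) * b n)"
  using last_visit_small[OF \<delta>] eventually_gt_at_top[of "t 0"]
 proof eventually_elim
  case (elim n)
  have bn: "0 < b n" "0 < a (?j n)" using b_pos[of n] elim by (auto simp: zero_less_mult_iff)
  have "real (t (idx n) + ?j n) \<le> 2 * \<delta> * real (N n)"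
  proof -
   have "real (?j n) \<le> \<delta> * real (N n)" using \<delta> by (simp add: of_nat_floor)
   then show ?thesis using elim(2) unfolding of_nat_add by linarith
  qed
  from entry_tail[OF elim(3) this]
  have "measure M (slow n (2 * \<delta> * real (N n))) \<le> ?C * b (Suc (t (idx n))) * measure M (long (?j n))" .
  also have "\<dots> \<le> ?C * b (Suc (t (idx n))) * (K / a (?j n))"
   using K(2)[of "?j n"] bn b_pos[of "Suc (t (idx n))"]
   by (intro mult_left_mono) (auto simp: pos_le_divide_eq mult.commute)
  finally have "measure M (slow n (2 * \<delta> * real (N n))) / b n \<le> ?C * b (Suc (t (idx n))) * (K / a (?j n)) / b n"
   by (rule divide_right_mono) (use bn in simp)
  then show ?case using bn by (simp add: mult_ac)
 qed
 then show ?thesis by (rule Lim_null_comparison[OF _ lim])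
qed

section \<open>Returns to the cylinder before the entry to the letter\<close>

definition short :: "nat \<Rightarrow> 'v path set" where
 "short n = {y \<in> X n. \<exists>j. 1 \<le> j \<and> j \<le> entry n y \<and> sh j y \<in> B n}"

lemma short_sets [measurable]: "short n \<in> sets M"
proof -
 have "short n = X n \<inter> {y \<in> space M. \<exists>j. 1 \<le> j \<and> j \<le> entry n y \<and> sh j y \<in> B n}"
  using sets.sets_into_space[OF X_sets] by (auto simp: short_def)
 then show ?thesis by simp
qed

text \<open>The word of \<open>x\<close> from its earliest visit on. A return to \<open>B n\<close>
  shows this word at an occurrence of \<open>v\<close>, where the renewal bound applies.\<close>

definition tail_cyl :: "nat \<Rightarrow> 'v path set" where "tail_cyl n = cyl A (map x [t 0..<n])"

lemma tail_cyl_sets [measurable]: "tail_cyl n \<in> sets M" by (simp add: tail_cyl_def)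

lemma tail_cyl_eq: "y \<in> tail_cyl n \<longleftrightarrow> y \<in> shift_space A \<and> (\<forall>i. i + t 0 < n \<longrightarrow> y i = x (i + t 0))"
 by (auto simp: tail_cyl_def cyl_def less_diff_conv add.commute)

lemma tail_cyl_subset: "t 0 < n \<Longrightarrow> tail_cyl n \<subseteq> cyl A [v]"
proof
 fix y assume n: "t 0 < n" and "y \<in> tail_cyl n"
 then have "y \<in> shift_space A" "y 0 = v" using t_visit[of 0] unfolding tail_cyl_eq by (auto dest: spec[of _ 0])
 then show "y \<in> cyl A [v]" by (simp add: cyl_def)
qed

definition tail_const :: real where
 "tail_const = exp (D 1) * mv / b (Suc (t 0))"

lemma tail_const_nonneg: "0 \<le> tail_const"
 using b_pos[of "Suc (t 0)"] by (simp add: tail_const_def)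

text \<open>Restoring the fixed piece of \<open>x\<close> before its earliest visit changes the
  measure by a bounded factor only, again by the renewal bound at \<open>v\<close>.\<close>

lemma tail_cyl_le:
 assumes n: "t 0 < n"
 shows "measure M (tail_cyl n) \<le> tail_const * b n"
proof -
 have "B n = cyl A (map x [0..<t 0] @ map x [t 0..<n])" using n map_upt_append[of 0 "t 0" n x] by (simp add: B_def)
 then have Bn: "B n = B (t 0) \<inter> sh (t 0) -` tail_cyl n" by (simp add: cyl_append_eq B_def tail_cyl_def)
 have eq: "B (Suc (t 0)) \<inter> sh (t 0) -` tail_cyl n = B n"
  using Bn B_antimono[of "Suc (t 0)" n] B_antimono[of "t 0" "Suc (t 0)"] n by auto
 have "measure M (B (Suc (t 0))) * integ M (cyl A [v]) (indicator (tail_cyl n))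
  \<le> exp (D (length [v])) * (corr M (B (Suc (t 0))) (indicator (tail_cyl n)) (t 0) * mv)"
  by (rule renewal_real(2)) (use B_visit_determined[of 0] B_visit_subset[of 0] B_finite in auto)
 also have "corr M (B (Suc (t 0))) (indicator (tail_cyl n)) (t 0) = (\<integral>y. indicator (B n) y \<partial>M :: real)"
  unfolding eq[symmetric] by (intro lint_cong) (auto simp: indicator_def)
 also have "\<dots> = b n" unfolding b_def by (rule integral_indicator_eq) simp
 also have "integ M (cyl A [v]) (indicator (tail_cyl n)) = (\<integral>y. indicator (tail_cyl n) y \<partial>M :: real)"
  using tail_cyl_subset[OF n] by (intro lint_cong) (auto simp: indicator_def)
 also have "\<dots> = measure M (tail_cyl n)" by (rule integral_indicator_eq) simp
 finally show ?thesis using b_pos[of "Suc (t 0)"] by (simp add: tail_const_def b_def[symmetric] field_simps)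
qed

text \<open>A return at time j puts \<open>v\<close> at position t 0 + j. Inside the word this
  position is a visit t k of \<open>x\<close>; beyond it, it must be the entry itself.\<close>

lemma short_subset:
 assumes n: "t 0 < n" and y: "y \<in> short n"
 shows "(\<exists>k. 1 \<le> k \<and> t k < n \<and> sh ((t k - t 0)) y \<in> B n) \<or> sh (entry n y) y \<in> tail_cyl n"
proof -
 from y obtain j where yX: "y \<in> X n" and j: "1 \<le> j" "j \<le> entry n y" "sh j y \<in> B n" by (auto simp: short_def)
 have yB: "\<And>i. i < n \<Longrightarrow> y i = x i" and ys: "y \<in> shift_space A" using yX by (auto simp: X_def B_eq)
 have jB: "\<And>i. i < n \<Longrightarrow> y (i + j) = x i" using j(3) by (auto simp: B_eq)
 have v: "y (t 0 + j) = v" using jB[OF n] t_visit[of 0] by simp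
 show ?thesis
 proof (cases "t 0 + j < n")
  case True
  then have "x (t 0 + j) = v" using v yB by simp
  then obtain k where k: "t 0 + j = t k" by (rule t_surj)
  then have "1 \<le> k" using j(1) by (cases k) auto
  moreover have "t k - t 0 = j" using k by simp
  ultimately show ?thesis using True k j(3) by (intro disjI1 exI[of _ k]) (simp del: funpow_lshift_apply)
 next
  case False
  then have e1: "entry n y \<le> t 0 + j" using X_entry(3)[OF yX _ v] by simp
  \<comment> \<open>An earlier entry, read in the returned copy of the word, would be an occurrence
    of \<open>v\<close> in \<open>x\<close> before \<open>t 0\<close>.\<close>
  have "entry n y = t 0 + j"
  proof (rule ccontr)
   assume "entry n y \<noteq> t 0 + j"
   then have lt: "entry n y - j < t 0" using e1 j(2) by simp
   then have "x (entry n y - j) = v" using jB[of "entry n y - j"] n X_entry(2)[OF yX] j(2) by simp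
   then show False using t_0_le lt by fastforce
  qed
  then have "sh (entry n y) y \<in> tail_cyl n"
   unfolding tail_cyl_eq
  proof (intro conjI allI impI)
   fix i assume "i + t 0 < n"
   then show "sh (entry n y) y i = x (i + t 0)"
    using jB[of "i + t 0"] \<open>entry n y = t 0 + j\<close> by (simp add: add_ac)
  qed (rule funpow_lshift_in_shift_space[OF ys])
  then show ?thesis by simp
 qed
qed

text \<open>A return after \<open>t k - t 0\<close> steps shows the word of \<open>x\<close> up to \<open>t k\<close> followed by a further copy of the word
  from \<open>t 0\<close> on, which costs a factor \<open>\<rho> ^ k\<close>; for fixed \<open>k\<close> it is excluded by aperiodicity.\<close>

lemma short_small: "(\<lambda>n. measure M (short n) / b n) \<longlonglongrightarrow> 0"
proof -
 let ?C = "exp (D 1) / mv"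
 define E where "E k n = {y \<in> B n. sh ((t k - t 0)) y \<in> B n}" for k n
 define F where "F n = {y \<in> X n. sh (entry n y) y \<in> tail_cyl n}" for n
 \<comment> \<open>Extended by 0 to all k, so that the sum over visits inside the word becomes a
   series with terms indexed independently of n.\<close>
 define e where "e k n = (if 1 \<le> k \<and> t k < n then measure M (E k n) / b n else 0)" for k n
 have E_sets [measurable]: "E k n \<in> sets M" for k n
 proof -
  have "E k n = B n \<inter> (sh ((t k - t 0)) -` B n \<inter> space M)" using B_space by (auto simp: E_def)
  then show ?thesis using measurable_sets[OF measurable_funpow_lshift B_sets] by simp
 qed
 have F_eq: "F n = X n \<inter> ((\<lambda>y. sh (entry n y) y) -` tail_cyl n \<inter> space M)" for n
  using sets.sets_into_space[OF X_sets] by (auto simp: F_def)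
 have F_sets [measurable]: "F n \<in> sets M" for n
  unfolding F_eq using measurable_sets[OF measurable_stopped[OF entry_measurable] tail_cyl_sets] by simp
 have E_bound: "e k n \<le> ?C * tail_const * b (Suc (t 0)) * \<rho> ^ k" for k n
 proof (cases "1 \<le> k \<and> t k < n")
  case True
  then have n: "t 0 < n" "t 0 \<le> t k" using t_less_iff[of 0 k] by auto
  have "measure M (E k n) \<le> ?C * b (Suc (t k)) * measure M (tail_cyl n)"
  proof (rule B_after_v[OF tail_cyl_sets tail_cyl_subset[OF n(1)] _ E_sets])
   show "E k n \<subseteq> B (Suc (t k)) \<inter> sh (t k) -` tail_cyl n"
   proof
    fix y assume y: "y \<in> E k n"
    then have "y \<in> B (Suc (t k))" using B_antimono[of "Suc (t k)" n] True by (auto simp: E_def)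
    moreover have "sh (t k) y \<in> tail_cyl n"
     unfolding tail_cyl_eq
    proof (intro conjI allI impI)
     show "sh (t k) y \<in> shift_space A" using y by (intro funpow_lshift_in_shift_space) (auto simp: E_def B_eq)
     fix i assume i: "i + t 0 < n"
     then have "y (i + t 0 + (t k - t 0)) = x (i + t 0)" using y by (auto simp: E_def B_eq)
     then show "sh (t k) y i = x (i + t 0)" using n(2) by simp
    qed
    ultimately show "y \<in> B (Suc (t k)) \<inter> sh (t k) -` tail_cyl n" by simp
   qed
  qed
  also have "\<dots> \<le> ?C * (\<rho> ^ k * b (Suc (t 0))) * (tail_const * b n)"
   using b_decay[of 0 k] tail_cyl_le[OF n(1)] rho(1) b_pos[of "Suc (t 0)"] b_pos[of "Suc (t k)"]
   by (intro mult_mono) auto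
  finally have "measure M (E k n) / b n \<le> ?C * (\<rho> ^ k * b (Suc (t 0))) * (tail_const * b n) / b n"
   using b_pos[of n] n by (intro divide_right_mono) auto
  then show ?thesis using True b_pos[of n] n by (simp add: e_def mult_ac)
 qed (use tail_const_nonneg rho(1) b_pos[of "Suc (t 0)"] in "auto simp: e_def")
 have e_nonneg: "0 \<le> e k n" for k n using b_pos[of n] by (auto simp: e_def)
 have e_lim: "(\<lambda>n. e k n) \<longlonglongrightarrow> 0" for k
 proof (cases "1 \<le> k")
  case True
  then have "1 \<le> t k - t 0" using t_less_iff[of 0 k] by simp
  from aperiodic[OF this] obtain i where i: "x (i + (t k - t 0)) \<noteq> x i" by (auto simp: fun_eq_iff)
  have "e k n = 0" if n: "i + t k < n" for n
  proof -
   have "E k n = {}"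
   proof (rule ccontr)
    assume "E k n \<noteq> {}"
    then obtain y where y: "y \<in> B n" "sh ((t k - t 0)) y \<in> B n" by (auto simp: E_def)
    have "x (i + (t k - t 0)) = y (i + (t k - t 0))" using y(1) n by (simp add: B_eq)
    also have "\<dots> = x i" using y(2) n by (simp add: B_eq)
    finally show False using i by simp
   qed
   then show ?thesis by (simp add: e_def)
  qed
  then have "\<forall>\<^sub>F n in sequentially. e k n = 0"
   by (rule eventually_mono[OF eventually_gt_at_top])
  then show ?thesis by (rule tendsto_eventually)
 qed (simp add: e_def)
 \<comment> \<open>Exchange of limit and series: each term vanishes for large n, and the geometric
   majorant does not depend on n.\<close>
 have "(\<lambda>n. \<Sum>k. e k n) \<longlonglongrightarrow> (\<Sum>k. 0)"
 proof (rule tannerys_theorem[THEN conjunct2, THEN conjunct2])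
  show "\<forall>\<^sub>F (k, n) in sequentially \<times>\<^sub>F sequentially. norm (e k n) \<le> ?C * tail_const * b (Suc (t 0)) * \<rho> ^ k"
   using E_bound e_nonneg by (intro always_eventually) auto
  show "summable (\<lambda>k. ?C * tail_const * b (Suc (t 0)) * \<rho> ^ k)"
   using rho by (intro summable_mult summable_geometric) simp
 qed (use e_lim in auto)
 then have l1: "(\<lambda>n. (\<Sum>k. e k n)) \<longlonglongrightarrow> 0" by simp
 have l2: "(\<lambda>n. ?C * (tail_const * b n)) \<longlonglongrightarrow> 0"
  using b_lim by (intro tendsto_mult_right_zero)
 have l: "(\<lambda>n. (\<Sum>k. e k n) + ?C * (tail_const * b n)) \<longlonglongrightarrow> 0" using tendsto_add[OF l1 l2] by simp
 have "\<forall>\<^sub>F n in sequentially. norm (measure M (short n) / b n) \<le> (\<Sum>k. e k n) + ?C * (tail_const * b n)"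
  using eventually_gt_at_top[of "t 0"]
 proof eventually_elim
  case (elim n)
  have bn: "0 < b n" and n1: "1 \<le> n" using b_pos[of n] elim by auto
  let ?I = "{k. 1 \<le> k \<and> t k < n}"
  have fin: "finite ?I" by (rule finite_subset[OF _ idx_finite[of n]]) auto
  \<comment> \<open>A return that matches the entry is of second order: the word is repeated after
    \<open>v\<close> essentially independently of the past, so its measure is of order b n
    squared.\<close>
  have FF: "measure M (F n) \<le> ?C * b n * measure M (tail_cyl n)"
  proof -
   let ?G = "indicator (tail_cyl n) :: _ \<Rightarrow> real"
   have "(LINT y|M. indicator (X n) y * ?G (sh (entry n y) y))
     \<le> exp (D 1) * (LINT y|M. indicator (X n) y * avg 1 ?G (sh (entry n y) y))"
    by (rule stop_average_unweighted(1)[OF X_sets X_finite[OF n1] entry_measurable _ X_determined]) auto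
   also have "(LINT y|M. indicator (X n) y * ?G (sh (entry n y) y)) = (LINT y|M. indicator (F n) y)"
    by (intro lint_cong) (auto simp: indicator_def F_def)
   also have "\<dots> = measure M (F n)" by (rule integral_indicator_eq) simp
   also have "(LINT y|M. indicator (X n) y * avg 1 ?G (sh (entry n y) y)) =
     (LINT y|M. indicator (X n) y * (measure M (tail_cyl n) / mv))"
   proof (rule lint_cong[OF refl])
    fix y
    have "integ M (cyl A [v]) ?G = (LINT z|M. ?G z)"
     using tail_cyl_subset[OF elim] by (intro lint_cong) (auto simp: indicator_def)
    also have "\<dots> = measure M (tail_cyl n)" by (rule integral_indicator_eq) simp
    finally show "indicator (X n) y * avg 1 ?G (sh (entry n y) y) =
      indicator (X n) y * (measure M (tail_cyl n) / mv)"
     using X_entry(2)[of y n] by (auto simp: avg_def indicator_def)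
   qed
   also have "\<dots> = b n * (measure M (tail_cyl n) / mv)"
    using integral_indicator_const[OF X_sets] by (simp add: measure_X)
   finally show ?thesis by (simp add: mult_ac)
  qed
  have "measure M (short n) \<le> measure M ((\<Union>k\<in>?I. E k n) \<union> F n)"
  proof (rule measure_mono_fmeasurable)
   show "short n \<subseteq> (\<Union>k\<in>?I. E k n) \<union> F n"
   proof
    fix y assume y: "y \<in> short n"
    have yX: "y \<in> X n" using y by (auto simp: short_def)
    show "y \<in> (\<Union>k\<in>?I. E k n) \<union> F n"
     using short_subset[OF elim y] yX X_subset[of n] by (auto simp only: E_def F_def)
   qed
   have "(\<Union>k\<in>?I. E k n) \<union> F n \<subseteq> B n" using X_subset[of n] by (auto simp: E_def F_def)
   moreover have "(\<Union>k\<in>?I. E k n) \<union> F n \<in> sets M" using fin by (intro sets.Un sets.finite_UN) auto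
   ultimately show "(\<Union>k\<in>?I. E k n) \<union> F n \<in> fmeasurable M"
    using fmeasurableI2[OF fmeasurableI[OF B_sets B_finite[OF n1]]] by blast
  qed simp
  also have "\<dots> \<le> measure M (\<Union>k\<in>?I. E k n) + measure M (F n)"
   by (rule measure_Un_le) (use fin in "auto intro!: sets.finite_UN")
  also have "\<dots> \<le> (\<Sum>k\<in>?I. measure M (E k n)) + ?C * b n * (tail_const * b n)"
  proof (rule add_mono)
   show "measure M (\<Union>k\<in>?I. E k n) \<le> (\<Sum>k\<in>?I. measure M (E k n))" by (rule measure_UNION_le[OF fin]) simp
   show "measure M (F n) \<le> ?C * b n * (tail_const * b n)"
    by (rule order_trans[OF FF]) (use bn in "intro mult_left_mono tail_cyl_le[OF elim], auto")
  qed
  finally have "measure M (short n) / b n \<le> ((\<Sum>k\<in>?I. measure M (E k n)) + ?C * b n * (tail_const * b n)) / b n"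
   using bn by (intro divide_right_mono) auto
  also have "\<dots> = (\<Sum>k\<in>?I. e k n) + ?C * (tail_const * b n)"
   using bn by (simp add: e_def add_divide_distrib sum_divide_distrib)
  also have "(\<Sum>k\<in>?I. e k n) \<le> (\<Sum>k. e k n)"
  proof (rule sum_le_suminf[OF _ fin])
   show "summable (\<lambda>k. e k n)"
    by (rule summable_comparison_test'[of "\<lambda>k. ?C * tail_const * b (Suc (t 0)) * \<rho> ^ k" 0])
      (use rho E_bound e_nonneg in "auto intro!: summable_mult summable_geometric")
  qed (use e_nonneg in auto)
  finally show ?case using bn by simp
 qed
 then show ?thesis by (rule Lim_null_comparison[OF _ l])
qed

end

section \<open>The hitting transform seen from the entry to the letter\<close>

lemma disc_add: "disc s (enat e + r) = exp (- s * real e) * disc s r"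
 by (cases r) (auto simp: exp_add[symmetric] algebra_simps)

context hitting
begin

text \<open>The mean transform of the hitting time of \<open>B n\<close> when the clock starts at
  the entry to \<open>v\<close>, under the conditional law on \<open>B n\<close>.\<close>

definition after :: "real \<Rightarrow> nat \<Rightarrow> real" where
 "after \<sigma> n = (LINT y|M. indicator (X n) y * disc (\<sigma> / real (N n)) (return_time (B n) (sh (entry n y) y))) / b n"

text \<open>Off \<open>short\<close> the hitting time is the entry time plus the remaining time. Off
  the slow set the resulting discount differs from 1 by at most 2 \<delta> \<sigma>; on the
  exceptional sets the trivial bound 1 is used.\<close>

lemma stopped_disc:
 assumes \<sigma>: "0 < \<sigma>" and \<delta>: "0 < \<delta>" and y: "y \<in> X n"
 defines "F \<equiv> dret \<sigma> n"
 shows "F y \<le> indicator (short n) y + F (sh (entry n y) y)"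
  and "F (sh (entry n y) y) \<le> F y + indicator (short n) y + 2 * \<delta> * \<sigma> + indicator (slow n (2 * \<delta> * real (N n))) y"
proof -
 let ?e = "entry n y" and ?s = "\<sigma> / real (N n)"
 have F01: "0 \<le> F z" "F z \<le> 1" for z using disc_rate[OF \<sigma>] by (auto simp: F_def)
 have \<delta>\<sigma>: "0 \<le> 2 * \<delta> * \<sigma>" using \<delta> \<sigma> by simp
 have *: "F y \<le> indicator (short n) y + F (sh ?e y) \<and>
  F (sh ?e y) \<le> F y + indicator (short n) y + 2 * \<delta> * \<sigma> + indicator (slow n (2 * \<delta> * real (N n))) y"
 proof (cases "y \<in> short n")
  case True
  then have i: "indicator (short n) y = (1 :: real)" by simp
  have "0 \<le> (indicator (slow n (2 * \<delta> * real (N n))) y :: real)" by simp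
  then show ?thesis unfolding i using F01[of y] F01[of "sh ?e y"] \<delta>\<sigma> by linarith
 next
  case False
  then have "return_time (B n) y = enat ?e + return_time (B n) (sh ?e y)"
   using y by (intro return_time_shift) (auto simp: short_def)
  then have eq: "F y = exp (- ?s * real ?e) * F (sh ?e y)" unfolding F_def by (simp only: disc_add)
  have s: "0 < ?s" by (rule rate_pos[OF \<sigma>])
  have ex: "exp (- ?s * real ?e) \<le> 1"
   using mult_nonneg_nonneg[OF less_imp_le[OF s], of "real ?e"]
   by (simp only: mult_minus_left exp_le_one_iff neg_le_0_iff_le)
  have le: "F y \<le> F (sh ?e y)"
   unfolding eq using mult_right_mono[OF ex F01(1)[of "sh ?e y"]] by (simp only: mult_1_left)
  have "F (sh ?e y) \<le> F y + 2 * \<delta> * \<sigma> + indicator (slow n (2 * \<delta> * real (N n))) y"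
  proof (cases "y \<in> slow n (2 * \<delta> * real (N n))")
   case True
   then have i: "indicator (slow n (2 * \<delta> * real (N n))) y = (1 :: real)" by simp
   show ?thesis unfolding i using F01[of y] F01[of "sh ?e y"] \<delta>\<sigma> by linarith
  next
   case False
   then have "real ?e \<le> 2 * \<delta> * real (N n)" using y by (simp add: slow_def)
   then have "?s * real ?e \<le> ?s * (2 * \<delta> * real (N n))" using s by (intro mult_left_mono) auto
   also have "\<dots> = 2 * \<delta> * \<sigma>" using N_ge_1[of n] by simp
   finally have "1 - exp (- ?s * real ?e) \<le> 2 * \<delta> * \<sigma>" using exp_ge_add_one_self[of "- ?s * real ?e"] by linarith
   then have "(1 - exp (- ?s * real ?e)) * F (sh ?e y) \<le> 2 * \<delta> * \<sigma> * 1"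
    using F01[of "sh ?e y"] \<delta>\<sigma> by (intro mult_mono) auto
   then have "F (sh ?e y) - exp (- ?s * real ?e) * F (sh ?e y) \<le> 2 * \<delta> * \<sigma>"
    by (simp only: left_diff_distrib mult_1_left mult_1_right)
   moreover have "indicator (slow n (2 * \<delta> * real (N n))) y = (0 :: real)" using False by simp
   ultimately show ?thesis unfolding eq by linarith
  qed
  moreover have "indicator (short n) y = (0 :: real)" using False by simp
  ultimately show ?thesis using le by linarith
 qed
 then show "F y \<le> indicator (short n) y + F (sh ?e y)"
  "F (sh ?e y) \<le> F y + indicator (short n) y + 2 * \<delta> * \<sigma> + indicator (slow n (2 * \<delta> * real (N n))) y"
  by blast+
qed

lemma phi_B_eq: "phi \<sigma> n (B n) = (LINT y|M. indicator (X n) y * dret \<sigma> n y)"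
 unfolding phi_def
proof (rule integral_cong_AE)
 show "AE y in M. indicator (B n) y * dret \<sigma> n y =
   indicator (X n) y * dret \<sigma> n y"
  using AE_X[of n]
 proof eventually_elim
  case (elim y)
  then have "y \<in> X n \<longleftrightarrow> y \<in> B n" using X_subset[of n] by auto
  then show ?case by (simp add: indicator_def)
 qed
qed measurable

lemma phi_after:
 assumes \<sigma>: "0 < \<sigma>"
 shows "(\<lambda>n. phi \<sigma> n (B n) / b n - after \<sigma> n) \<longlonglongrightarrow> 0"
proof (rule tendstoI)
 fix e :: real assume e: "0 < e"
 \<comment> \<open>Chosen so that the discount error 2 \<delta> \<sigma> is e / 3, matching the
   shares of the short and slow events.\<close>
 define \<delta> where "\<delta> = e / (6 * \<sigma>)"
 have \<delta>: "0 < \<delta>" using e \<sigma> by (simp add: \<delta>_def)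
 have \<delta>\<sigma>: "2 * \<delta> * \<sigma> = e / 3" using \<sigma> by (simp add: \<delta>_def)
 have "\<forall>\<^sub>F n in sequentially. measure M (short n) / b n < e / 3"
  by (rule order_tendstoD(2)[OF short_small]) (use e in simp)
 moreover have "\<forall>\<^sub>F n in sequentially. measure M (slow n (2 * \<delta> * real (N n))) / b n < e / 3"
  by (rule order_tendstoD(2)[OF entry_slow[OF \<delta>]]) (use e in simp)
 ultimately show "\<forall>\<^sub>F n in sequentially. dist (phi \<sigma> n (B n) / b n - after \<sigma> n) 0 < e"
  using eventually_ge_at_top[of 1]
 proof eventually_elim
  case (elim n)
  let ?F = "dret \<sigma> n" and ?S = "\<lambda>y. sh (entry n y) y"
  let ?slow = "slow n (2 * \<delta> * real (N n))"
  note fin = X_finite[OF elim(3)]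
  have bn: "0 < b n" by (rule b_pos[OF elim(3)])
  have [measurable]: "?S \<in> M \<rightarrow>\<^sub>M M" by (rule measurable_stopped[OF entry_measurable])
  have i: "integrable M (\<lambda>y. indicator (X n) y * f y)" if "f \<in> borel_measurable M" "\<And>y. \<bar>f y\<bar> \<le> 1" for f :: "_ \<Rightarrow> real"
   by (rule integrable_indicator_mult[OF X_sets fin that(1), of 1]) (rule that(2))
  have i1: "integrable M (\<lambda>y. indicator (X n) y * ?F y)" by (rule i) (use disc_rate[OF \<sigma>] in auto)
  have i2: "integrable M (\<lambda>y. indicator (X n) y * ?F (?S y))"
  proof (rule i)
   show "(\<lambda>y. ?F (?S y)) \<in> borel_measurable M"
    by (rule measurable_compose[OF measurable_stopped[OF entry_measurable] measurable_disc[OF B_sets]])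
  qed (use disc_rate[OF \<sigma>] in auto)
  have i3: "integrable M (indicator (short n) :: _ \<Rightarrow> real)" "integrable M (indicator ?slow :: _ \<Rightarrow> real)"
   "integrable M (indicator (X n) :: _ \<Rightarrow> real)"
   using fin le_less_trans[OF emeasure_mono[of "short n" "X n" M] fin] le_less_trans[OF emeasure_mono[of ?slow "X n" M] fin]
   by (auto simp: short_def slow_def)
  have "integ M (X n) ?F \<le> (LINT y|M. indicator (X n) y * ?F (?S y) + indicator (short n) y)"
  proof (rule integral_mono[OF i1 Bochner_Integration.integrable_add[OF i2 i3(1)]])
   fix y show "indicator (X n) y * ?F y \<le> indicator (X n) y * ?F (?S y) + indicator (short n) y"
    using stopped_disc(1)[OF \<sigma> \<delta>, of y n] by (auto simp: indicator_def)
  qed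
  also have "\<dots> = (LINT y|M. indicator (X n) y * ?F (?S y)) + measure M (short n)"
   by (subst lint_add[OF i2 i3(1)]) (simp only: integral_indicator_eq[OF short_sets])
  finally have 1: "phi \<sigma> n (B n) \<le> after \<sigma> n * b n + measure M (short n)"
   using bn by (simp add: phi_B_eq after_def)
  have i4: "integrable M (\<lambda>y. indicator (X n) y * ?F y + indicator (short n) y + indicator (X n) y * (2 * \<delta> * \<sigma>) + indicator ?slow y)"
   using i1 i3 by (intro Bochner_Integration.integrable_add integrable_mult_left)
  have "(LINT y|M. indicator (X n) y * ?F (?S y)) \<le> (LINT y|M. indicator (X n) y * ?F y + indicator (short n) y + indicator (X n) y * (2 * \<delta> * \<sigma>) + indicator ?slow y)"
  proof (rule integral_mono[OF i2 i4])
   fix y show "indicator (X n) y * ?F (?S y) \<le> indicator (X n) y * ?F y + indicator (short n) y + indicator (X n) y * (2 * \<delta> * \<sigma>) + indicator ?slow y"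
   proof (cases "y \<in> X n")
    case True
    then have "indicator (X n) y = (1 :: real)" by simp
    then show ?thesis using stopped_disc(2)[OF \<sigma> \<delta> True] by (simp only: mult_1_left)
   next
    case False
    then have "indicator (X n) y = (0 :: real)" by simp
    then show ?thesis by (simp only: mult_zero_left) (simp add: indicator_def)
   qed
  qed
  also have "\<dots> = phi \<sigma> n (B n) + measure M (short n) + b n * (2 * \<delta> * \<sigma>) + measure M ?slow"
   using i1 i3 integral_indicator_const[OF X_sets, of n "2 * \<delta> * \<sigma>"]
   by (simp add: phi_B_eq measure_X integral_indicator_eq[OF short_sets] integral_indicator_eq[OF slow_sets])
  finally have 2: "after \<sigma> n * b n \<le> phi \<sigma> n (B n) + measure M (short n) + b n * (2 * \<delta> * \<sigma>) + measure M ?slow"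
   using bn by (simp add: after_def)
  have "phi \<sigma> n (B n) / b n \<le> after \<sigma> n + measure M (short n) / b n"
   using divide_right_mono[OF 1, of "b n"] bn by (simp add: add_divide_distrib)
  moreover have "after \<sigma> n \<le> phi \<sigma> n (B n) / b n + measure M (short n) / b n + 2 * \<delta> * \<sigma> + measure M ?slow / b n"
   using divide_right_mono[OF 2, of "b n"] bn by (simp add: add_divide_distrib)
  ultimately have "\<bar>phi \<sigma> n (B n) / b n - after \<sigma> n\<bar> < e" using elim(1,2) \<delta>\<sigma> e by linarith
  then show ?case by (simp add: dist_real_def)
 qed
qed

text \<open>The relation for single cylinders is not uniform over the infinitely many words of
  length m inside [v]; dominated convergence gives it in the mean, which is enough because the entry
  position has a bounded density on [v].\<close>

lemma avg_relation:
 assumes \<sigma>: "0 < \<sigma>" and m: "1 \<le> m"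
 shows "(\<lambda>n. LINT y|M. indicator (cyl A [v]) y *
   \<bar>avg m (dret \<sigma> n) y - kappa \<sigma> * defect \<sigma> n\<bar>) \<longlonglongrightarrow> 0"
proof -
 let ?F = "dret \<sigma>" and ?\<kappa> = "kappa \<sigma>"
 \<comment> \<open>The index is shifted by 1 because the bounds on the defect require a nonempty
   word.\<close>
 let ?f = "\<lambda>n y. indicator (cyl A [v]) y * \<bar>avg m (?F (n + 1)) y - ?\<kappa> * defect \<sigma> (n + 1)\<bar>"
 have "(\<lambda>n. LINT y|M. ?f n y) \<longlonglongrightarrow> (LINT y|M. 0)"
 proof (rule integral_dominated_convergence[where w = "\<lambda>y. (1 + ?\<kappa>) * indicator (cyl A [v]) y"])
  show "integrable M (\<lambda>y. (1 + ?\<kappa>) * indicator (cyl A [v]) y)" using v_fin by simp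
  show "AE y in M. norm (?f n y) \<le> (1 + ?\<kappa>) * indicator (cyl A [v]) y" for n
  proof (rule AE_I2)
   fix y
   have "0 \<le> avg m (?F (n + 1)) y" "avg m (?F (n + 1)) y \<le> 1"
    by (rule avg_bounds[OF m measurable_disc[OF B_sets]]; use disc_rate[OF \<sigma>] in simp)+
   moreover have "0 \<le> ?\<kappa> * defect \<sigma> (n + 1)" "?\<kappa> * defect \<sigma> (n + 1) \<le> ?\<kappa>"
    using defect_bounds[OF \<sigma>, of "n + 1"] kappa_pos[OF \<sigma>] by (auto intro: mult_left_le)
   ultimately have "\<bar>avg m (?F (n + 1)) y - ?\<kappa> * defect \<sigma> (n + 1)\<bar> \<le> 1 + ?\<kappa>" by linarith
   then show "norm (?f n y) \<le> (1 + ?\<kappa>) * indicator (cyl A [v]) y" by (auto simp: indicator_def)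
  qed
  show "AE y in M. (\<lambda>n. ?f n y) \<longlonglongrightarrow> 0"
  proof (rule AE_I2)
   fix y assume y: "y \<in> space M"
   let ?u = "map y [0..<m]"
   have "cyl A ?u \<noteq> {}" using mem_cyl_prefix[of y A m] y by (auto simp: space_M)
   then have "(\<lambda>n. phi \<sigma> n (cyl A ?u) / measure M (cyl A ?u) - ?\<kappa> * defect \<sigma> n) \<longlonglongrightarrow> 0"
    using m by (intro phi_cyl_relation[OF \<sigma>]) auto
   then have "(\<lambda>n. avg m (?F n) y - ?\<kappa> * defect \<sigma> n) \<longlonglongrightarrow> 0" by (simp add: avg_def phi_def)
   then have "(\<lambda>n. \<bar>avg m (?F (n + 1)) y - ?\<kappa> * defect \<sigma> (n + 1)\<bar>) \<longlonglongrightarrow> 0"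
    by (intro tendsto_rabs_zero LIMSEQ_ignore_initial_segment)
   then show "(\<lambda>n. ?f n y) \<longlonglongrightarrow> 0" by (rule tendsto_mult_right_zero)
  qed
 qed measurable
 then have "(\<lambda>n. LINT y|M. ?f n y) \<longlonglongrightarrow> 0" by simp
 then show ?thesis by (rule LIMSEQ_offset[of _ 1])
qed

text \<open>Two scales of averaging at the entry: knowing m symbols replaces the transform by its
  cylinder averages with a factor near 1, while knowing only the letter \<open>v\<close> bounds the
  law of the entry position by a constant multiple of \<open>M\<close> on [v] and so controls the
  error in the mean.\<close>

lemma after_relation:
 assumes \<sigma>: "0 < \<sigma>"
 shows "(\<lambda>n. after \<sigma> n - kappa \<sigma> * defect \<sigma> n) \<longlonglongrightarrow> 0"
proof (rule tendstoI)
 fix e :: real assume e: "0 < e"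
 let ?F = "dret \<sigma>" and ?\<kappa> = "kappa \<sigma>"
 have \<kappa>: "0 < ?\<kappa>" by (rule kappa_pos[OF \<sigma>])
 have l1: "(\<lambda>m. (exp (D m) - 1) * ?\<kappa>) \<longlonglongrightarrow> (exp 0 - 1) * ?\<kappa>"
  and l2: "(\<lambda>m. (1 - exp (- D m)) * ?\<kappa>) \<longlonglongrightarrow> (1 - exp (- 0)) * ?\<kappa>"
  by (intro tendsto_intros D_lim)+
 have "\<forall>\<^sub>F m in sequentially. 1 \<le> m \<and> (exp (D m) - 1) * ?\<kappa> < e / 2 \<and> (1 - exp (- D m)) * ?\<kappa> < e / 2"
  using order_tendstoD(2)[OF l1, of "e / 2"] order_tendstoD(2)[OF l2, of "e / 2"] e eventually_ge_at_top[of 1]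
  by (simp add: eventually_conj_iff)
 then obtain m where m: "1 \<le> m" "(exp (D m) - 1) * ?\<kappa> < e / 2" "(1 - exp (- D m)) * ?\<kappa> < e / 2"
  by (auto simp: eventually_sequentially)
 define G where "G n y = avg m (?F n) y" for n y
 define w where "w n = exp (D 1) * (1 / mv * (LINT y|M. indicator (cyl A [v]) y * \<bar>G n y - ?\<kappa> * defect \<sigma> n\<bar>))" for n
 have "w \<longlonglongrightarrow> 0"
  unfolding w_def[abs_def] G_def by (intro tendsto_mult_right_zero avg_relation[OF \<sigma> m(1)])
 then have "(\<lambda>n. exp (D m) * w n) \<longlonglongrightarrow> 0" by (rule tendsto_mult_right_zero)
 then have "\<forall>\<^sub>F n in sequentially. exp (D m) * w n < e / 2" by (rule order_tendstoD(2)) (use e in simp)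
 then show "\<forall>\<^sub>F n in sequentially. dist (after \<sigma> n - ?\<kappa> * defect \<sigma> n) 0 < e"
  using eventually_ge_at_top[of 1]
 proof eventually_elim
  case (elim n)
  let ?S = "\<lambda>y. sh (entry n y) y" and ?I = "defect \<sigma> n"
  \<comment> \<open>Division by 1 + \<kappa> brings the error function into [0, 1], the range
    required for averaging at a random time.\<close>
  let ?H = "\<lambda>y. indicator (cyl A [v]) y * \<bar>G n y - ?\<kappa> * ?I\<bar> / (1 + ?\<kappa>)"
  note fin = X_finite[OF elim(2)]
  have bn: "0 < b n" by (rule b_pos[OF elim(2)])
  have I: "0 \<le> ?\<kappa> * ?I" "?\<kappa> * ?I \<le> ?\<kappa>"
   using defect_bounds[OF \<sigma> elim(2)] \<kappa> by (auto intro: mult_left_le)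
  have G01: "0 \<le> G n y" "G n y \<le> 1" for y
   unfolding G_def by (rule avg_bounds[OF m(1) measurable_disc[OF B_sets]]; use disc_rate[OF \<sigma>] in simp)+
  have [measurable]: "G n \<in> borel_measurable M" unfolding G_def[abs_def] by (rule measurable_avg)
  have GS [measurable]: "(\<lambda>y. G n (?S y)) \<in> borel_measurable M"
   by (rule measurable_compose[OF measurable_stopped[OF entry_measurable]]) simp
  define W where "W = (LINT y|M. indicator (X n) y * G n (?S y)) / b n"
  have up: "after \<sigma> n \<le> exp (D m) * W" and low: "W \<le> exp (D m) * after \<sigma> n"
  proof -
   note st = stop_average_unweighted[OF X_sets fin entry_measurable m(1) X_determined[OF m(1)] measurable_disc[OF B_sets], of "\<sigma> / real (N n)" n]
   have "(LINT y|M. indicator (X n) y * ?F n (?S y)) \<le> exp (D m) * (LINT y|M. indicator (X n) y * G n (?S y))"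
    unfolding G_def by (rule st(1)) (use disc_rate[OF \<sigma>] in auto)
   from divide_right_mono[OF this, of "b n"] show "after \<sigma> n \<le> exp (D m) * W"
    using bn unfolding after_def W_def by simp
   have "(LINT y|M. indicator (X n) y * G n (?S y)) \<le> exp (D m) * (LINT y|M. indicator (X n) y * ?F n (?S y))"
    unfolding G_def by (rule st(2)) (use disc_rate[OF \<sigma>] in auto)
   from divide_right_mono[OF this, of "b n"] show "W \<le> exp (D m) * after \<sigma> n"
    using bn unfolding after_def W_def by simp
  qed
  have H01: "0 \<le> ?H y" "?H y \<le> 1" for y
  proof -
   have "\<bar>G n y - ?\<kappa> * ?I\<bar> \<le> 1 + ?\<kappa>" using G01[of y] I by linarith
   then show "0 \<le> ?H y" "?H y \<le> 1" using \<kappa> by (auto simp: indicator_def)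
  qed
  have Hm [measurable]: "?H \<in> borel_measurable M" by measurable
  have W: "\<bar>W - ?\<kappa> * ?I\<bar> \<le> w n"
  proof -
   have iG: "integrable M (\<lambda>y. indicator (X n) y * G n (?S y))"
    by (rule integrable_indicator_mult[OF X_sets fin GS, of 1]) (use G01 in auto)
   have ic: "integrable M (\<lambda>y. indicator (X n) y * (?\<kappa> * ?I))"
    by (rule integrable_indicator_mult[OF X_sets fin, of _ "?\<kappa> * ?I"]) (use I in auto)
   have "(W - ?\<kappa> * ?I) * b n = (LINT y|M. indicator (X n) y * G n (?S y)) - (LINT y|M. indicator (X n) y * (?\<kappa> * ?I))"
    unfolding integral_indicator_const[OF X_sets] measure_X W_def using bn by (simp add: left_diff_distrib)
   also have "\<dots> = (LINT y|M. indicator (X n) y * G n (?S y) - indicator (X n) y * (?\<kappa> * ?I))"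
    by (rule lint_diff[symmetric, OF iG ic])
   finally have eq: "(W - ?\<kappa> * ?I) * b n = (LINT y|M. indicator (X n) y * G n (?S y) - indicator (X n) y * (?\<kappa> * ?I))" .
   have "\<bar>(W - ?\<kappa> * ?I) * b n\<bar> \<le> (LINT y|M. \<bar>indicator (X n) y * G n (?S y) - indicator (X n) y * (?\<kappa> * ?I)\<bar>)"
    unfolding eq by (rule integral_abs_bound)
   also have "\<dots> = (LINT y|M. (1 + ?\<kappa>) * (indicator (X n) y * ?H (?S y)))"
   proof (rule lint_cong[OF refl])
    fix y
    show "\<bar>indicator (X n) y * G n (?S y) - indicator (X n) y * (?\<kappa> * ?I)\<bar> = (1 + ?\<kappa>) * (indicator (X n) y * ?H (?S y))"
    proof (cases "y \<in> X n")
     case True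
     then have "y \<in> shift_space A" by (simp add: X_def B_eq)
     then have "?S y \<in> cyl A [v]"
      using funpow_lshift_in_shift_space[of y A "entry n y"] X_entry(2)[OF True] by (simp add: cyl_def)
     then have "indicator (cyl A [v]) (?S y) = (1 :: real)" by (rule indicator_eq_1_iff[THEN iffD2])
     moreover have "indicator (X n) y = (1 :: real)" using True by simp
     ultimately show ?thesis using \<kappa> by (simp only: mult_1_left) simp
    qed simp
   qed
   also have "\<dots> = (1 + ?\<kappa>) * (LINT y|M. indicator (X n) y * ?H (?S y))" by (rule integral_mult_right_zero)
   also have "\<dots> \<le> (1 + ?\<kappa>) * (exp (D 1) * (LINT y|M. indicator (X n) y * avg 1 ?H (?S y)))"
    using \<kappa> by (intro mult_left_mono stop_average_unweighted(1)[OF X_sets fin entry_measurable _ X_determined Hm H01]) auto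
   also have "(LINT y|M. indicator (X n) y * avg 1 ?H (?S y)) = (LINT y|M. indicator (X n) y * ((LINT z|M. ?H z) / mv))"
   proof (rule lint_cong[OF refl])
    fix y
    have "integ M (cyl A [v]) ?H = (LINT z|M. ?H z)"
     by (intro lint_cong) (auto simp: indicator_def)
    then show "indicator (X n) y * avg 1 ?H (?S y) = indicator (X n) y * ((LINT z|M. ?H z) / mv)"
     using X_entry(2)[of y n] by (cases "y \<in> X n") (auto simp: avg_def)
   qed
   also have "\<dots> = b n * ((LINT z|M. ?H z) / mv)" unfolding integral_indicator_const[OF X_sets] measure_X ..
   also have "(LINT z|M. ?H z) = (LINT z|M. indicator (cyl A [v]) z * \<bar>G n z - ?\<kappa> * ?I\<bar>) / (1 + ?\<kappa>)"
    by (rule integral_divide_zero)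
   finally have "\<bar>(W - ?\<kappa> * ?I) * b n\<bar> \<le> w n * b n" using \<kappa> by (simp add: w_def mult_ac)
   then show ?thesis using bn by (simp add: abs_mult)
  qed
  have "after \<sigma> n \<le> exp (D m) * (?\<kappa> * ?I + w n)"
   by (rule order_trans[OF up]) (use W in "intro mult_left_mono; simp")
  also have "\<dots> = ?\<kappa> * ?I + (exp (D m) - 1) * (?\<kappa> * ?I) + exp (D m) * w n"
   by (simp add: algebra_simps)
  also have "(exp (D m) - 1) * (?\<kappa> * ?I) \<le> (exp (D m) - 1) * ?\<kappa>"
   using I D_nonneg[of m] by (intro mult_left_mono) auto
  finally have 1: "after \<sigma> n \<le> ?\<kappa> * ?I + (exp (D m) - 1) * ?\<kappa> + exp (D m) * w n" by simp
  have "?\<kappa> * ?I - (1 - exp (- D m)) * (?\<kappa> * ?I) - exp (- D m) * w n = exp (- D m) * (?\<kappa> * ?I - w n)"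
   by (simp add: algebra_simps)
  also have "\<dots> \<le> exp (- D m) * (exp (D m) * after \<sigma> n)"
   using W low by (intro mult_left_mono) auto
  also have "\<dots> = (exp (- D m) * exp (D m)) * after \<sigma> n" by (rule mult.assoc[symmetric])
  also have "\<dots> = after \<sigma> n" unfolding exp_add[symmetric] by simp
  finally have 2: "?\<kappa> * ?I - (1 - exp (- D m)) * (?\<kappa> * ?I) - exp (- D m) * w n \<le> after \<sigma> n" .
  have 3: "(1 - exp (- D m)) * (?\<kappa> * ?I) \<le> (1 - exp (- D m)) * ?\<kappa>"
   using I D_nonneg[of m] by (intro mult_left_mono) auto
  have 4: "exp (- D m) * w n \<le> exp (D m) * w n"
   using D_nonneg[of m] W by (intro mult_right_mono) auto
  have "\<bar>after \<sigma> n - ?\<kappa> * ?I\<bar> < e" using 1 2 3 4 m(2,3) elim(1) by linarith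
  then show ?case by (simp add: dist_real_def)
 qed
qed

definition limit :: "real \<Rightarrow> real" where "limit \<sigma> = Gamma (1 + \<alpha>) / (Gamma (1 + \<alpha>) + \<sigma> powr \<alpha>)"

lemma limit_eq: "0 < \<sigma> \<Longrightarrow> limit \<sigma> = kappa \<sigma> / (1 + kappa \<sigma>)"
 using kappa_pos[of \<sigma>] by (simp add: limit_def kappa_def field_simps)

text \<open>As the defect is 1 minus the transform, the two vanishing errors determine (1 +
  \<kappa>) times the transform up to o(1), hence its limit, without passing to
  subsequences.\<close>

lemma phi_B_lim:
 assumes \<sigma>: "0 < \<sigma>"
 shows "(\<lambda>n. phi \<sigma> n (B n) / b n) \<longlonglongrightarrow> limit \<sigma>"
proof -
 let ?\<psi> = "\<lambda>n. phi \<sigma> n (B n) / b n" and ?\<kappa> = "kappa \<sigma>"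
 have \<kappa>: "0 < 1 + ?\<kappa>" using kappa_pos[OF \<sigma>] by simp
 have "(\<lambda>n. (?\<psi> n - after \<sigma> n) + (after \<sigma> n - ?\<kappa> * defect \<sigma> n)) \<longlonglongrightarrow> 0 + 0"
  by (intro tendsto_add phi_after after_relation \<sigma>)
 then have "(\<lambda>n. ((?\<psi> n - after \<sigma> n) + (after \<sigma> n - ?\<kappa> * defect \<sigma> n) + ?\<kappa>) / (1 + ?\<kappa>)) \<longlonglongrightarrow> (0 + 0 + ?\<kappa>) / (1 + ?\<kappa>)"
  by (rule tendsto_divide[OF tendsto_add[OF _ tendsto_const] tendsto_const]) (use \<kappa> in auto)
 moreover have "((?\<psi> n - after \<sigma> n) + (after \<sigma> n - ?\<kappa> * defect \<sigma> n) + ?\<kappa>) / (1 + ?\<kappa>) = ?\<psi> n" for n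
 proof -
  have "(?\<psi> n - after \<sigma> n) + (after \<sigma> n - ?\<kappa> * defect \<sigma> n) + ?\<kappa> = ?\<psi> n * (1 + ?\<kappa>)"
   by (simp add: defect_def algebra_simps add_divide_distrib)
  then show ?thesis using \<kappa> by simp
 qed
 ultimately show ?thesis by (simp add: limit_eq[OF \<sigma>])
qed

lemma phi_cyl_lim:
 assumes \<sigma>: "0 < \<sigma>" and u: "u \<noteq> []" "cyl A u \<noteq> {}"
 shows "(\<lambda>n. phi \<sigma> n (cyl A u) / measure M (cyl A u)) \<longlonglongrightarrow> limit \<sigma>"
proof -
 have "(\<lambda>n. (phi \<sigma> n (cyl A u) / measure M (cyl A u) - kappa \<sigma> * defect \<sigma> n) + kappa \<sigma> * defect \<sigma> n) \<longlonglongrightarrow> 0 + kappa \<sigma> * (1 - limit \<sigma>)"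
  unfolding defect_def by (intro tendsto_intros phi_cyl_relation[OF \<sigma> u, unfolded defect_def] phi_B_lim \<sigma>)
 moreover have "kappa \<sigma> * (1 - limit \<sigma>) = limit \<sigma>"
  using kappa_pos[OF \<sigma>] by (simp add: limit_eq[OF \<sigma>] field_simps)
 ultimately show ?thesis by simp
qed

end

subsection \<open>Successive gaps\<close>

definition ret_nat :: "'v path set \<Rightarrow> 'v path \<Rightarrow> nat" where
 "ret_nat B y = (case return_time B y of enat r \<Rightarrow> r | \<infinity> \<Rightarrow> 0)"

definition induced :: "'v path set \<Rightarrow> 'v path \<Rightarrow> nat \<Rightarrow> 'v" where
 "induced B y = sh (ret_nat B y) y"

text \<open>Infinity is propagated, so hit times are sums of gaps at every point, without an
  exceptional set.\<close>

primrec gap :: "'v path set \<Rightarrow> nat \<Rightarrow> 'v path \<Rightarrow> enat" where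
 "gap B 0 y = return_time B y"
| "gap B (Suc i) y = (if return_time B y = \<infinity> then \<infinity> else gap B i (induced B y))"

lemma hit_time_eq_sum_gaps: "hit_time B k y = (\<Sum>i<k. gap B i y)"
proof (induction k arbitrary: y)
 case (Suc k)
 have "hit_time B (Suc k) y = return_time B y + (\<Sum>i<k. gap B (Suc i) y)"
 proof (cases "return_time B y")
  case (enat r)
  then show ?thesis
   unfolding hit_time_Suc_return_time using Suc[of "sh r y"]
   by (simp add: induced_def ret_nat_def del: funpow_lshift_apply)
 qed (simp add: hit_time_Suc_return_time)
 then show ?case by (simp add: sum.lessThan_Suc_shift del: sum.lessThan_Suc)
qed simp

lemma disc_sum: "disc s (a + b) = disc s a * disc s b"
 by (cases a) (auto simp: disc_add)

lemma prod_disc_gap: "(\<Prod>i<k. disc s (gap B i y)) = disc s (hit_time B k y)"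
proof -
 have "(\<Prod>i<k. disc s (f i)) = disc s (\<Sum>i<k. f i)" for f :: "nat \<Rightarrow> enat"
  by (induction k) (auto simp: disc_sum zero_enat_def)
 then show ?thesis by (simp add: hit_time_eq_sum_gaps)
qed

text \<open>The excluded case is genuine: for exponent 0 and infinite time the left side is 0 ^ 0 =
  1, while the discounted value on the right is 0.\<close>

lemma disc_power: "0 < m \<or> r \<noteq> \<infinity> \<Longrightarrow> disc s r ^ m = disc (real m * s) r"
 by (cases r) (auto simp: exp_of_nat_mult[symmetric] algebra_simps)

lemma gap_finite: "(\<And>j. return_time B (sh j y) < \<infinity>) \<Longrightarrow> gap B i y < \<infinity>"
proof (induction i arbitrary: y)
 case 0
 then show ?case using 0[of 0] by (simp add: funpow_lshift)
next
 case (Suc i)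
 have "return_time B y \<noteq> \<infinity>" using Suc.prems[of 0] by (simp add: funpow_lshift)
 moreover have "gap B i (induced B y) < \<infinity>"
 proof (rule Suc.IH)
  fix j
  have "sh j (induced B y) = sh ((j + ret_nat B y)) y" by (simp add: induced_def funpow_add)
  then show "return_time B (sh j (induced B y)) < \<infinity>" using Suc.prems by (simp only:)
 qed
 ultimately show ?case by simp
qed

context shift_measure
begin

lemma measurable_ret_nat [measurable]: "B \<in> sets M \<Longrightarrow> ret_nat B \<in> M \<rightarrow>\<^sub>M count_space UNIV"
 unfolding ret_nat_def[abs_def]
 by (rule measurable_compose[OF measurable_return_time, where g = "case_enat (\<lambda>r. r) 0"]) auto

lemma measurable_induced [measurable]: "B \<in> sets M \<Longrightarrow> induced B \<in> M \<rightarrow>\<^sub>M M"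
 unfolding induced_def[abs_def] by (rule measurable_stopped[OF measurable_ret_nat])

lemma measurable_gap [measurable]:
 assumes [measurable]: "B \<in> sets M"
 shows "gap B i \<in> M \<rightarrow>\<^sub>M count_space UNIV"
proof (induction i)
 case 0
 then show ?case by (simp add: gap.simps(1)[abs_def])
next
 case (Suc i)
 have [measurable]: "(\<lambda>y. gap B i (induced B y)) \<in> M \<rightarrow>\<^sub>M count_space UNIV"
  by (rule measurable_compose[OF measurable_induced Suc]) simp
 show ?case unfolding gap.simps(2)[abs_def] by measurable
qed


end

context hitting
begin

text \<open>Whether a visit to \<open>B n\<close> takes place at time m is visible m + n coordinates
  deep, so comparing all times up to r requires r + n coordinates.\<close>

lemma return_determined:
 assumes Y: "determined A n Y"
 shows "determined A (r + n) (Y \<inter> {y. return_time (B n) y = enat r})"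
 unfolding determined_def
proof (intro conjI ballI impI)
 show "Y \<inter> {y. return_time (B n) y = enat r} \<subseteq> shift_space A" using Y by (auto simp: determined_def)
 fix y z assume y: "y \<in> Y \<inter> {y. return_time (B n) y = enat r}" and z: "z \<in> shift_space A" and yz: "agree (r + n) y z"
 have ys: "y \<in> shift_space A" using y Y by (auto simp: determined_def)
 have eq: "sh m y \<in> B n \<longleftrightarrow> sh m z \<in> B n" if "m \<le> r" for m
  using yz that funpow_lshift_in_shift_space[OF ys, of m] funpow_lshift_in_shift_space[OF z, of m]
  by (auto simp: B_eq agree_def)
 have yr: "0 < r" "sh r y \<in> B n" "\<And>m. 0 < m \<Longrightarrow> sh m y \<in> B n \<Longrightarrow> r \<le> m"
  using y unfolding return_time_eq_enat[symmetric] by (auto simp: return_time_eq_enat)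
 have "return_time (B n) z = enat r"
  unfolding return_time_eq_enat
 proof (intro conjI allI impI)
  show "sh r z \<in> B n" using yr(2) eq[of r] by simp
  fix m assume m: "0 < m \<and> sh m z \<in> B n"
  show "r \<le> m"
  proof (cases "m \<le> r")
   case True
   then show ?thesis using yr(3)[of m] m eq[of m] by blast
  qed simp
 qed (rule yr(1))
 moreover have "z \<in> Y" using determinedD[OF Y _ z agree_mono[OF yz]] y by simp
 ultimately show "z \<in> Y \<inter> {y. return_time (B n) y = enat r}" by simp
qed

text \<open>At a return to \<open>B n\<close> the next n symbols are those of \<open>x\<close>, so
  the conditional average of \<open>G\<close> is one constant. The process starts afresh from the
  conditional law on \<open>B n\<close>, up to exp (D n), which tends to 1.\<close>

lemma regeneration:
 fixes s :: real
 assumes n: "1 \<le> n" and Y: "determined A n Y" and fin: "emeasure M Y < \<infinity>" and s: "0 \<le> s"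
  and G [measurable]: "G \<in> borel_measurable M" and G01: "\<And>y. 0 \<le> G y" "\<And>y. G y \<le> 1"
 defines "c \<equiv> (integ M (B n) G) / b n"
 shows "(LINT y|M. indicator Y y * (disc s (return_time (B n) y) * G (induced (B n) y)))
   \<le> exp (D n) * ((LINT y|M. indicator Y y * disc s (return_time (B n) y)) * c)" (is "?I1 \<le> _")
  and "(LINT y|M. indicator Y y * disc s (return_time (B n) y)) * c \<le>
   exp (D n) * (LINT y|M. indicator Y y * (disc s (return_time (B n) y) * G (induced (B n) y)))"
proof -
 have [measurable]: "Y \<in> sets M" by (rule determined_sets[OF Y])
 let ?X = "Y \<inter> {y. return_time (B n) y \<noteq> \<infinity>}" and ?wt = "\<lambda>k. exp (- s * real k)"
 have X: "?X \<in> sets M"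
 proof -
  have "?X = {y \<in> space M. y \<in> Y \<and> return_time (B n) y \<noteq> \<infinity>}"
   using sets.sets_into_space[OF \<open>Y \<in> sets M\<close>] by auto
  then show ?thesis by simp
 qed
 have X_fin: "emeasure M ?X < \<infinity>" by (rule le_less_trans[OF emeasure_mono fin]) auto
 have det: "determined A (k + n) (?X \<inter> {y. ret_nat (B n) y = k})" for k
 proof -
  have "?X \<inter> {y. ret_nat (B n) y = k} = Y \<inter> {y. return_time (B n) y = enat k}"
   by (auto simp: ret_nat_def)
  then show ?thesis using return_determined[OF Y] by (simp only:)
 qed
 have f: "indicator ?X y * (?wt (ret_nat (B n) y) * G (sh (ret_nat (B n) y) y)) =
   indicator Y y * (disc s (return_time (B n) y) * G (induced (B n) y))" for y
  by (cases "return_time (B n) y") (auto simp: indicator_def ret_nat_def induced_def)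
 have g: "indicator ?X y * (?wt (ret_nat (B n) y) * avg n G (sh (ret_nat (B n) y) y)) =
   indicator Y y * disc s (return_time (B n) y) * c" for y
 proof (cases "return_time (B n) y")
  case (enat r)
  then have "sh r y \<in> cyl A (map x [0..<n])" unfolding return_time_eq_enat B_def by blast
  from cyl_prefix_eq[OF this] have "avg n G (sh r y) = c"
   unfolding avg_def c_def b_def B_def by (simp del: funpow_lshift_apply)
  then show ?thesis using enat by (auto simp: indicator_def ret_nat_def simp del: funpow_lshift_apply)
 qed simp
 have wt: "0 \<le> ?wt k" "?wt k \<le> 1" for k using s by (auto simp: mult_nonneg_nonneg)
 note st = stop_average[where wt = ?wt, OF X X_fin measurable_ret_nat[OF B_sets] n det wt G G01, unfolded f g]
 show "?I1 \<le> exp (D n) * ((LINT y|M. indicator Y y * disc s (return_time (B n) y)) * c)"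
  "(LINT y|M. indicator Y y * disc s (return_time (B n) y)) * c \<le> exp (D n) * ?I1"
  using st by simp_all
qed

definition joint :: "(nat \<Rightarrow> real) \<Rightarrow> nat \<Rightarrow> nat \<Rightarrow> 'v path \<Rightarrow> real" where
 "joint \<sigma> k n y = (\<Prod>i<k. disc (\<sigma> i / real (N n)) (gap (B n) i y))"

lemma measurable_joint [measurable]: "joint \<sigma> k n \<in> borel_measurable M"
 unfolding joint_def[abs_def]
 by (intro borel_measurable_prod measurable_compose[OF measurable_gap[OF B_sets]]) simp

lemma joint_bounds: "(\<And>i. 0 \<le> \<sigma> i) \<Longrightarrow> 0 \<le> joint \<sigma> k n y \<and> joint \<sigma> k n y \<le> 1"
 unfolding joint_def by (intro conjI prod_nonneg prod_le_1) (auto simp: disc_nonneg disc_le_1)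

lemma joint_Suc:
 "joint \<sigma> (Suc k) n y = disc (\<sigma> 0 / real (N n)) (return_time (B n) y) * joint (\<lambda>i. \<sigma> (Suc i)) k n (induced (B n) y)"
 by (cases "return_time (B n) y") (simp_all add: joint_def prod.lessThan_Suc_shift del: prod.lessThan_Suc)

lemma AE_returns_finite: "1 \<le> n \<Longrightarrow> AE y in M. \<forall>j. return_time (B n) (sh j y) < \<infinity>"
 unfolding AE_all_countable B_def
 by (intro allI AE_funpow AE_return_finite) (use B_ne[of n] in "auto simp: B_def")

lemma limit_0: "limit 0 = 1"
proof -
 have "0 < Gamma (1 + \<alpha>)" using rv.\<alpha> by (intro Gamma_real_pos) simp
 then show ?thesis by (simp add: limit_def)
qed

text \<open>The initial set \<open>E n\<close>, a fixed cylinder or \<open>B n\<close> itself,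
  influences only the leading gap; all later gaps see the law conditioned on \<open>B n\<close>,
  whence the asymptotic product.\<close>

lemma joint_lim_step:
 assumes E: "\<forall>\<^sub>F n in sequentially. determined A n (E n) \<and> emeasure M (E n) < \<infinity> \<and> 0 < measure M (E n)"
  and E_lim: "\<And>\<sigma>. 0 < \<sigma> \<Longrightarrow> (\<lambda>n. phi \<sigma> n (E n) / measure M (E n)) \<longlonglongrightarrow> limit \<sigma>"
  and \<sigma>: "\<And>i. 0 \<le> \<sigma> i"
  and IH: "(\<lambda>n. (LINT y|M. indicator (B n) y * joint (\<lambda>i. \<sigma> (Suc i)) k n y) / b n) \<longlonglongrightarrow> (\<Prod>i<k. limit (\<sigma> (Suc i)))"
 shows "(\<lambda>n. (LINT y|M. indicator (E n) y * joint \<sigma> (Suc k) n y) / measure M (E n)) \<longlonglongrightarrow> (\<Prod>i<Suc k. limit (\<sigma> i))"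
proof -
 define p where "p n = phi (\<sigma> 0) n (E n) / measure M (E n)" for n
 define q where "q n = (LINT y|M. indicator (B n) y * joint (\<lambda>i. \<sigma> (Suc i)) k n y) / b n" for n
 define r where "r n = (LINT y|M. indicator (E n) y * joint \<sigma> (Suc k) n y) / measure M (E n)" for n
 \<comment> \<open>The parameter 0 is treated apart because the Laplace limit is known for positive
   parameters only; there the claim is that the return time is almost everywhere finite.\<close>
 have p: "p \<longlonglongrightarrow> limit (\<sigma> 0)"
 proof (cases "\<sigma> 0 = 0")
  case True
  have "\<forall>\<^sub>F n in sequentially. p n = 1"
   using E eventually_ge_at_top[of 1]
  proof eventually_elim
   case (elim n)
   have [measurable]: "E n \<in> sets M" using determined_sets elim by blast
   have "phi 0 n (E n) = (LINT y|M. indicator (E n) y)"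
    unfolding phi_def
   proof (rule integral_cong_AE)
    show "AE y in M. indicator (E n) y * disc (0 / real (N n)) (return_time (B n) y) = (indicator (E n) y :: real)"
     using AE_returns_finite[OF elim(2)]
    proof eventually_elim
     case (elim y)
     then obtain r where "return_time (B n) y = enat r" by (auto dest!: spec[of _ 0] simp: funpow_lshift)
     then show ?case by simp
    qed
   qed measurable
   then show ?case using elim True integral_indicator_eq[of "E n"] by (simp add: p_def)
  qed
  then show ?thesis using True by (simp add: limit_0 tendsto_eventually)
 next
  case False
  then have "0 < \<sigma> 0" using \<sigma>[of 0] by simp
  then show ?thesis unfolding p_def[abs_def] by (rule E_lim)
 qed
 have q: "q \<longlonglongrightarrow> (\<Prod>i<k. limit (\<sigma> (Suc i)))" unfolding q_def[abs_def] by (rule IH)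
 have "\<forall>\<^sub>F n in sequentially. exp (- D n) * (p n * q n) \<le> r n \<and> r n \<le> exp (D n) * (p n * q n)"
  using E eventually_ge_at_top[of 1]
 proof eventually_elim
  case (elim n)
  let ?m = "measure M (E n)"
  have m: "0 < ?m" using elim by simp
  have s: "0 \<le> \<sigma> 0 / real (N n)" using \<sigma>[of 0] by simp
  note g = regeneration[OF elim(2), of "E n" "\<sigma> 0 / real (N n)" "joint (\<lambda>i. \<sigma> (Suc i)) k n", folded phi_def joint_Suc q_def]
  have j: "0 \<le> joint (\<lambda>i. \<sigma> (Suc i)) k n y" "joint (\<lambda>i. \<sigma> (Suc i)) k n y \<le> 1" for y
   using joint_bounds[of "\<lambda>i. \<sigma> (Suc i)" k n y] \<sigma> by auto
  have 1: "(LINT y|M. indicator (E n) y * joint \<sigma> (Suc k) n y) \<le> exp (D n) * (phi (\<sigma> 0) n (E n) * q n)"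
   by (rule g(1)) (use elim s j in auto)
  have 2: "phi (\<sigma> 0) n (E n) * q n \<le> exp (D n) * (LINT y|M. indicator (E n) y * joint \<sigma> (Suc k) n y)"
   by (rule g(2)) (use elim s j in auto)
  have "r n \<le> exp (D n) * (p n * q n)"
   using divide_right_mono[OF 1, of ?m] m by (simp add: r_def p_def)
  moreover have "p n * q n \<le> exp (D n) * r n"
   using divide_right_mono[OF 2, of ?m] m by (simp add: r_def p_def)
  then have "exp (- D n) * (p n * q n) \<le> exp (- D n) * (exp (D n) * r n)" by (rule mult_left_mono) simp
  moreover have "exp (- D n) * (exp (D n) * r n) = r n"
   unfolding mult.assoc[symmetric] exp_add[symmetric] by simp
  ultimately show ?case by simp
 qed
 then have ev: "\<forall>\<^sub>F n in sequentially. exp (- D n) * (p n * q n) \<le> r n" "\<forall>\<^sub>F n in sequentially. r n \<le> exp (D n) * (p n * q n)"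
  by (auto elim: eventually_mono)
 have "(\<lambda>n. exp (- D n) * (p n * q n)) \<longlonglongrightarrow> exp (- 0) * (limit (\<sigma> 0) * (\<Prod>i<k. limit (\<sigma> (Suc i))))"
  by (intro tendsto_intros D_lim p q)
 moreover have "(\<lambda>n. exp (D n) * (p n * q n)) \<longlonglongrightarrow> exp 0 * (limit (\<sigma> 0) * (\<Prod>i<k. limit (\<sigma> (Suc i))))"
  by (intro tendsto_intros D_lim p q)
 ultimately have "r \<longlonglongrightarrow> limit (\<sigma> 0) * (\<Prod>i<k. limit (\<sigma> (Suc i)))"
  using tendsto_sandwich[OF ev] by simp
 then show ?thesis unfolding r_def[abs_def] by (simp only: prod.lessThan_Suc_shift)
qed

lemma joint_lim_B:
 "(\<And>i. 0 \<le> \<sigma> i) \<Longrightarrow> (\<lambda>n. (LINT y|M. indicator (B n) y * joint \<sigma> k n y) / b n) \<longlonglongrightarrow> (\<Prod>i<k. limit (\<sigma> i))"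
proof (induction k arbitrary: \<sigma>)
 case 0
 have "(LINT y|M. indicator (B n) y * joint \<sigma> 0 n y) / b n = 1" if "1 \<le> n" for n
  using b_pos[OF that] integral_indicator_eq[OF B_sets, of n] by (simp add: joint_def b_def)
 then have "\<forall>\<^sub>F n in sequentially. (LINT y|M. indicator (B n) y * joint \<sigma> 0 n y) / b n = 1"
  using eventually_ge_at_top[of 1] by (rule eventually_mono[rotated])
 then show ?case by (simp add: tendsto_eventually)
next
 case (Suc k)
 have "\<forall>\<^sub>F n in sequentially. determined A n (B n) \<and> emeasure M (B n) < \<infinity> \<and> 0 < measure M (B n)"
  using eventually_ge_at_top[of 1]
 proof eventually_elim
  case (elim n)
  then show ?case using determined_cyl[of A "map x [0..<n]"] B_finite b_pos[of n] by (simp add: B_def b_def)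
 qed
 from joint_lim_step[OF this phi_B_lim[unfolded b_def] Suc.prems Suc.IH] show ?case
  using Suc.prems by (simp add: b_def)
qed

lemma joint_lim_cyl:
 assumes u: "u \<noteq> []" "cyl A u \<noteq> {}" and \<sigma>: "\<And>i. 0 \<le> \<sigma> i"
 shows "(\<lambda>n. (LINT y|M. indicator (cyl A u) y * joint \<sigma> k n y) / measure M (cyl A u)) \<longlonglongrightarrow> (\<Prod>i<k. limit (\<sigma> i))"
proof (cases k)
 case 0
 then show ?thesis
  using measure_cyl_pos[OF u] integral_indicator_eq[OF cyl_sets, of u] by (simp add: joint_def)
next
 case (Suc k')
 have "\<forall>\<^sub>F n in sequentially. determined A n (cyl A u) \<and> emeasure M (cyl A u) < \<infinity> \<and> 0 < measure M (cyl A u)"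
  using eventually_ge_at_top[of "length u"]
 proof eventually_elim
  case (elim n)
  then show ?case using determined_mono[OF determined_cyl elim] cyl_finite[OF u(1)] measure_cyl_pos[OF u] by simp
 qed
 from joint_lim_step[OF this phi_cyl_lim[OF _ u] \<sigma> joint_lim_B] show ?thesis
  using \<sigma> Suc by simp
qed

end

subsection \<open>Absolutely continuous initial laws\<close>

text \<open>The measures of the pieces form a summable majorant, so limit and series may be
  exchanged.\<close>

lemma tendsto_integral_countable_union:
 fixes f :: "nat \<Rightarrow> 'a \<Rightarrow> real"
 assumes D: "\<And>i :: nat. D i \<in> sets M" "disjoint_family D" "emeasure M (\<Union>i. D i) < \<infinity>"
  and f [measurable]: "\<And>n. f n \<in> borel_measurable M" and f1: "\<And>n y. \<bar>f n y\<bar> \<le> 1"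
  and lim: "\<And>i. (\<lambda>n. LINT y|M. indicator (D i) y * f n y) \<longlonglongrightarrow> 0"
 shows "(\<lambda>n. LINT y|M. indicator (\<Union>i. D i) y * f n y) \<longlonglongrightarrow> 0"
proof -
 note [measurable] = D(1)
 have int: "integrable M (\<lambda>y. indicator S y * f n y)" if [measurable]: "S \<in> sets M" and "emeasure M S < \<infinity>" for S n
 proof (rule lint_bound)
  show "integrable M (indicator S :: _ \<Rightarrow> real)" using that by simp
  show "AE y in M. norm (indicator S y * f n y) \<le> norm (indicator S y :: real)"
   using f1 by (intro AE_I2) (auto simp: indicator_def)
 qed measurable
 have fin: "emeasure M (D i) < \<infinity>" for i
  by (rule le_less_trans[OF emeasure_mono D(3)]) auto
 have eq: "(LINT y|M. indicator (\<Union>i. D i) y * f n y) = (\<Sum>i. LINT y|M. indicator (D i) y * f n y)" for n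
  using lebesgue_integral_countable_add[of D M "f n"] D(2) int[of "\<Union>i. D i" n] D(3)
  by (simp add: set_lebesgue_integral_def set_integrable_def disjoint_family_on_def)
 have bound: "\<bar>\<integral>y. indicator (D i) y * f n y \<partial>M\<bar> \<le> measure M (D i)" for i n
 proof -
  have "\<bar>\<integral>y. indicator (D i) y * f n y \<partial>M\<bar> \<le> (LINT y|M. \<bar>indicator (D i) y * f n y\<bar>)" by (rule integral_abs_bound)
  also have "\<dots> \<le> (LINT y|M. indicator (D i) y)"
  proof (rule integral_mono[OF integrable_abs[OF int[OF D(1) fin]]])
   show "integrable M (indicator (D i) :: _ \<Rightarrow> real)" using fin by simp
   show "\<bar>indicator (D i) y * f n y\<bar> \<le> indicator (D i) y" for y using f1 by (auto simp: indicator_def)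
  qed
  also have "\<dots> = measure M (D i)" using sets.sets_into_space[OF D(1)[of i]] by (simp add: Int_absorb2)
  finally show ?thesis .
 qed
 have summ: "summable (\<lambda>i. measure M (D i))"
  by (rule sums_summable[OF measure_UNION[OF _ D(2)]]) (use D in auto)
 have "(\<lambda>n. \<Sum>i. LINT y|M. indicator (D i) y * f n y) \<longlonglongrightarrow> (\<Sum>i. 0)"
 proof (rule tannerys_theorem[THEN conjunct2, THEN conjunct2])
  show "\<forall>\<^sub>F (i, n) in sequentially \<times>\<^sub>F sequentially. norm (LINT y|M. indicator (D i) y * f n y) \<le> measure M (D i)"
   using bound by (intro always_eventually) auto
 qed (use lim summ in auto)
 then show ?thesis by (simp add: eq)
qed

text \<open>Since |f n| \<le> 1, the integrals are contractions in g, uniformly in n; the claim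
  passes from indicators to sums and to limits in mean.\<close>

lemma tendsto_integral_L1_closed:
 fixes f :: "nat \<Rightarrow> 'a \<Rightarrow> real"
 assumes f [measurable]: "\<And>n. f n \<in> borel_measurable M" and f1: "\<And>n y. \<bar>f n y\<bar> \<le> 1"
  and fin: "\<And>S. S \<in> sets M \<Longrightarrow> emeasure M S < \<infinity> \<Longrightarrow> (\<lambda>n. LINT y|M. indicator S y * f n y) \<longlonglongrightarrow> 0"
  and g: "integrable M g"
 shows "(\<lambda>n. LINT y|M. g y * f n y) \<longlonglongrightarrow> 0"
proof -
 have int: "integrable M (\<lambda>y. g y * f n y)" if "integrable M g" for g :: "'a \<Rightarrow> real" and n
  using that f1 by (intro lint_bound[OF that]) (auto simp: abs_mult intro!: mult_left_le)
 have int_le: "\<bar>\<integral>y. g y * f n y \<partial>M\<bar> \<le> (LINT y|M. \<bar>g y\<bar>)" if "integrable M g" for g :: "'a \<Rightarrow> real" and n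
 proof -
  have "\<bar>\<integral>y. g y * f n y \<partial>M\<bar> \<le> (LINT y|M. \<bar>g y * f n y\<bar>)" by (rule integral_abs_bound)
  also have "\<dots> \<le> (LINT y|M. \<bar>g y\<bar>)"
   using that f1 by (intro integral_mono integrable_abs int) (auto simp: abs_mult intro!: mult_left_le)
  finally show ?thesis .
 qed
 show ?thesis
  using g
 proof (induction rule: integrable_induct)
  case (base S c)
  have "(\<lambda>n. c * (LINT y|M. indicator S y * f n y)) \<longlonglongrightarrow> 0"
   by (rule tendsto_mult_right_zero[OF fin[OF base]])
  then show ?case by (simp add: mult_ac flip: integral_mult_right_zero)
 next
  case (add g h)
  have "(\<lambda>n. (LINT y|M. g y * f n y) + (LINT y|M. h y * f n y)) \<longlonglongrightarrow> 0 + 0"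
   by (rule tendsto_add[OF add.IH])
  then show ?case using add.hyps int by (simp add: distrib_right)
 next
  case (lim g s)
  have [measurable]: "g \<in> borel_measurable M" "s i \<in> borel_measurable M" for i using lim.hyps by auto
  have "(\<lambda>i. LINT y|M. \<bar>g y - s i y\<bar>) \<longlonglongrightarrow> (LINT y|M. 0)"
  proof (rule integral_dominated_convergence[where w = "\<lambda>y. 3 * \<bar>g y\<bar>"])
   show "AE y in M. (\<lambda>i. \<bar>g y - s i y\<bar>) \<longlonglongrightarrow> 0"
   proof (rule AE_I2)
    fix y assume "y \<in> space M"
    from tendsto_diff[OF tendsto_const[of "g y"] lim.hyps(2)[OF this]] show "(\<lambda>i. \<bar>g y - s i y\<bar>) \<longlonglongrightarrow> 0"
     by (intro tendsto_rabs_zero) simp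
   qed
   show "AE y in M. norm \<bar>g y - s i y\<bar> \<le> 3 * \<bar>g y\<bar>" for i
   proof (rule AE_I2)
    fix y assume "y \<in> space M"
    from lim.hyps(3)[OF this, of i] show "norm \<bar>g y - s i y\<bar> \<le> 3 * \<bar>g y\<bar>" by simp
   qed
  qed (use lim.hyps in auto)
  then have l: "(\<lambda>i. LINT y|M. \<bar>g y - s i y\<bar>) \<longlonglongrightarrow> 0" by simp
  show ?case
  proof (rule tendstoI)
   fix e :: real assume e: "0 < e"
   have "\<forall>\<^sub>F i in sequentially. (LINT y|M. \<bar>g y - s i y\<bar>) < e / 2" by (rule order_tendstoD(2)[OF l]) (use e in simp)
   then obtain i where i: "(LINT y|M. \<bar>g y - s i y\<bar>) < e / 2" by (auto simp: eventually_sequentially)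
   have "\<forall>\<^sub>F n in sequentially. dist (LINT y|M. s i y * f n y) 0 < e / 2" by (rule tendstoD[OF lim.IH]) (use e in simp)
   then show "\<forall>\<^sub>F n in sequentially. dist (LINT y|M. g y * f n y) 0 < e"
   proof eventually_elim
    case (elim n)
    have d: "integrable M (\<lambda>y. g y - s i y)" using lim.hyps by auto
    have "(LINT y|M. g y * f n y) = (LINT y|M. (g y - s i y) * f n y + s i y * f n y)" by (simp add: algebra_simps)
    also have "\<dots> = (LINT y|M. (g y - s i y) * f n y) + (LINT y|M. s i y * f n y)"
     by (rule lint_add[OF int[OF d] int[OF lim.hyps(1)]])
    finally show ?case using int_le[OF d, of n] i elim by (simp add: dist_real_def)
   qed
  qed
 qed
qed

lemma integral_uniform_measure:
 fixes f :: "'a \<Rightarrow> real"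
 assumes [measurable]: "f \<in> borel_measurable M" "S \<in> sets M" and S: "0 < measure M S"
 shows "(LINT y|(uniform_measure M S). f y) = integ M S f / measure M S"
proof -
 have "emeasure M S = ennreal (measure M S)" using S by (intro emeasure_eq_ennreal_measure) (auto simp: measure_def)
 then have "uniform_measure M S = density M (\<lambda>y. ennreal (indicator S y / measure M S))"
  unfolding uniform_measure_def using S
  by (intro arg_cong[where f = "density M"] ext) (auto simp: indicator_def divide_ennreal[symmetric])
 then have "(LINT y|(uniform_measure M S). f y) = (LINT y|M. (indicator S y / measure M S) *\<^sub>R f y)"
  by (simp add: integral_density)
 then show ?thesis by simp
qed

lemma cyl_Int: "cyl A u \<inter> cyl A w = {} \<or> cyl A u \<inter> cyl A w = cyl A u \<or> cyl A u \<inter> cyl A w = cyl A w"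
proof -
 have *: "cyl A u \<inter> cyl A w = {} \<or> cyl A w \<subseteq> cyl A u" if "length u \<le> length w" for u w
 proof (cases "cyl A u \<inter> cyl A w = {}")
  case False
  then obtain y where y: "y \<in> cyl A u" "y \<in> cyl A w" by auto
  then have "u ! i = w ! i" if "i < length u" for i using \<open>length u \<le> length w\<close> that by (auto simp: cyl_def)
  then show ?thesis using that by (auto simp: cyl_def)
 qed simp
 show ?thesis using *[of u w] *[of w u] by (cases "length u \<le> length w") auto
qed

context recurrent_shift
begin

text \<open>The Dynkin argument runs inside a one-letter cylinder, where complements have finite
  measure. Sets of finite measure are then assembled from countably many letters, and integrable
  functions by closure in mean.\<close>

lemma tendsto_integral_cylinders:
 fixes f :: "nat \<Rightarrow> 'v path \<Rightarrow> real"
 assumes f [measurable]: "\<And>n. f n \<in> borel_measurable M" and f1: "\<And>n y. \<bar>f n y\<bar> \<le> 1"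
  and cyl_lim: "\<And>u. u \<noteq> [] \<Longrightarrow> cyl A u \<noteq> {} \<Longrightarrow> (\<lambda>n. LINT y|M. indicator (cyl A u) y * f n y) \<longlonglongrightarrow> 0"
  and g: "integrable M g"
 shows "(\<lambda>n. LINT y|M. g y * f n y) \<longlonglongrightarrow> 0"
proof (rule tendsto_integral_L1_closed[OF f f1 _ g])
 let ?T = "\<lambda>S. (\<lambda>n. LINT y|M. indicator S y * f n y) \<longlonglongrightarrow> 0"
 have int: "integrable M (\<lambda>y. indicator S y * f n y)" if "S \<in> sets M" "emeasure M S < \<infinity>" for S n
  by (rule integrable_indicator_mult[OF that f]) (rule f1)
 have cyl_fin: "emeasure M (S \<inter> cyl A [c]) < \<infinity>" if "S \<in> sets M" for S c
  by (rule le_less_trans[OF emeasure_mono cyl_finite[of "[c]"]]) auto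
 have cyl_lim': "?T (cyl A u)" if "u \<noteq> []" for u
  using cyl_lim[OF that] by (cases "cyl A u = {}") auto
 have dynkin: "?T (S \<inter> cyl A [c])" if S: "S \<in> sets M" for S c
 proof -
  \<comment> \<open>The empty set is adjoined because disjoint cylinders meet in it; otherwise two
    cylinders are nested.\<close>
  let ?G = "insert {} (range (cyl A))"
  have sub: "sigma_sets (shift_space A) ?G \<subseteq> sets M"
  proof -
   have "?G \<subseteq> sets M" using cyl_sets by auto
   from sets.sigma_sets_subset[OF this] show ?thesis by (simp only: space_M)
  qed
  have "Int_stable ?G"
   unfolding Int_stable_def
  proof (intro ballI)
   fix S T assume ST: "S \<in> ?G" "T \<in> ?G"
   show "S \<inter> T \<in> ?G"
   proof (cases "S = {} \<or> T = {}")
    case False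
    obtain u where u: "S = cyl A u" using ST(1) False by auto
    obtain w where w: "T = cyl A w" using ST(2) False by auto
    show ?thesis unfolding u w using cyl_Int[of A u w] by (elim disjE) simp_all
   qed auto
  qed
  moreover have "insert {} (range (cyl A)) \<subseteq> Pow (shift_space A)" by (auto simp: cyl_def)
  moreover have "S \<in> sigma_sets (shift_space A) (insert {} (range (cyl A)))"
   using S sigma_sets_mono'[of "range (cyl A)" "insert {} (range (cyl A))"] by (auto simp: sets_M)
  ultimately show ?thesis
  proof (induction rule: sigma_sets_induct_disjoint)
   case (basic S)
   then show ?case
   proof
    assume "S \<in> range (cyl A)"
    then obtain u where u: "S = cyl A u" by auto
    show ?thesis
    proof (cases "u = []")
     case True
     then have "S \<inter> cyl A [c] = cyl A [c]" using u by (auto simp: cyl_def)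
     then show ?thesis using cyl_lim'[of "[c]"] by simp
    next
     case False
     have "cyl A u \<inter> cyl A [c] = {} \<or> cyl A u \<inter> cyl A [c] = cyl A u"
      using False by (cases u) (auto simp: cyl_def)
     then show ?thesis using cyl_lim'[OF False] u by auto
    qed
   qed simp
  next
   case (compl S)
   have S: "S \<in> sets M" using compl(1) sub by blast
   have eq: "(LINT y|M. indicator ((shift_space A - S) \<inter> cyl A [c]) y * f n y) =
     (LINT y|M. indicator (cyl A [c]) y * f n y) - (LINT y|M. indicator (S \<inter> cyl A [c]) y * f n y)" for n
   proof -
    have "(LINT y|M. indicator ((shift_space A - S) \<inter> cyl A [c]) y * f n y) =
      (LINT y|M. indicator (cyl A [c]) y * f n y - indicator (S \<inter> cyl A [c]) y * f n y)"
     using cyl_subset[of A "[c]"] by (intro lint_cong) (auto simp: indicator_def)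
    also have "\<dots> = (LINT y|M. indicator (cyl A [c]) y * f n y) - (LINT y|M. indicator (S \<inter> cyl A [c]) y * f n y)"
     by (rule lint_diff; rule int) (use S cyl_fin[OF S] cyl_finite[of "[c]"] in auto)
    finally show ?thesis .
   qed
   show ?case unfolding eq using tendsto_diff[OF cyl_lim'[of "[c]"] compl(2)] by simp
  next
   case (union D)
   have D: "D i \<in> sets M" for i
    using union(2) sub by blast
   have eq: "(\<Union>i. D i) \<inter> cyl A [c] = (\<Union>i. D i \<inter> cyl A [c])" by auto
   show ?case unfolding eq
   proof (rule tendsto_integral_countable_union[OF _ _ _ f f1 union(3)])
    show "disjoint_family (\<lambda>i. D i \<inter> cyl A [c])" using union(1) by (auto simp: disjoint_family_on_def)
    show "emeasure M (\<Union>i. D i \<inter> cyl A [c]) < \<infinity>" unfolding eq[symmetric] using D by (intro cyl_fin) auto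
   qed (use D in auto)
  qed simp
 qed
 fix S assume S [measurable]: "S \<in> sets M" and fin: "emeasure M S < \<infinity>"
 define D where "D i = {y \<in> S. to_nat (y 0) = i}" for i
 have Ss: "S \<subseteq> shift_space A" using sets.sets_into_space[OF S] by (simp add: space_M)
 have D: "D i = (if to_nat (from_nat i :: 'v) = i then S \<inter> cyl A [from_nat i] else {})" for i
  using Ss by (auto simp: D_def cyl_def) 
 have eq: "S = (\<Union>i. D i)" by (auto simp: D_def)
 have "?T (\<Union>i. D i)"
 proof (rule tendsto_integral_countable_union[OF _ _ _ f f1])
  show "D i \<in> sets M" for i unfolding D by simp
  show "?T (D i)" for i unfolding D using dynkin[OF S] by simp
  show "disjoint_family D" by (auto simp: disjoint_family_on_def D_def)
  show "emeasure M (\<Union>i. D i) < \<infinity>" using fin eq by simp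
 qed
 then show "?T S" using eq by simp
qed

end

section \<open>From gap transforms to convergence of the point processes\<close>

lemma disc_le_exp:
 assumes "0 \<le> s" "enat k \<le> r"
 shows "disc s r \<le> exp (- s * real k)"
 using assms by (cases r) (auto simp: mult_left_mono)

lemma disc_powr: "0 < p \<Longrightarrow> disc s r powr p = disc (p * s) r"
 by (cases r) (auto simp: powr_def)

text \<open>The k-th hit occurs no earlier than time k, so only finitely many rescaled hits lie
  below a given level; the argument is pointwise.\<close>

lemma locally_finite_hit_times:
 assumes c: "0 < c"
 shows "locally_finite_seq (\<lambda>k. c * ennreal_of_enat (hit_time B k y))"
 unfolding locally_finite_seq_def
proof
 fix R :: nat
 obtain K where K: "of_nat R < c * of_nat (Suc K)"
 proof (cases c)
  case (real r)
  then have r: "0 < r" using c by simp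
  obtain K where "real R / r < real K" using reals_Archimedean2 by blast
  then have "real R < r * real (Suc K)" using r by (simp add: field_simps)
  then have "ennreal (real R) < ennreal (r * real (Suc K))" by (intro ennreal_lessI) auto
  also have "\<dots> = c * of_nat (Suc K)" using real r by (simp add: ennreal_mult'' ennreal_of_nat_eq_real_of_nat)
  finally show thesis using that by (simp add: ennreal_of_nat_eq_real_of_nat)
 next
  \<comment> \<open>An infinite scaling factor occurs when the threshold is 0; every positive hit
    time is then sent to infinity.\<close>
  case top
  then show thesis using that[of 0] by (simp add: ennreal_top_mult of_nat_less_top)
 qed
 have "k \<le> K" if k: "c * ennreal_of_enat (hit_time B k y) \<le> of_nat R" for k
 proof (rule ccontr)
  assume "\<not> k \<le> K"
  then have "enat (Suc K) \<le> enat k" by simp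
  then have "enat (Suc K) \<le> hit_time B k y" by (rule order_trans[OF _ hit_time_ge])
  then have "of_nat (Suc K) \<le> ennreal_of_enat (hit_time B k y)"
   using ennreal_of_enat_le_iff[of "enat (Suc K)" "hit_time B k y"] by simp
  then have "c * of_nat (Suc K) \<le> c * ennreal_of_enat (hit_time B k y)" by (rule mult_left_mono) simp
  then have "c * of_nat (Suc K) \<le> of_nat R" using k by (rule order_trans)
  then show False using K by (rule leD[THEN notE])
 qed
 then show "finite {k. 1 \<le> k \<and> c * ennreal_of_enat (hit_time B k y) \<le> of_nat R}"
  by (intro finite_subset[OF _ finite_atMost[of K]]) auto
qed

context hitting
begin

lemma scaling_eq: "scaling a s = 1 / ennreal (real (rv.threshold (1 / s)))"
 unfolding scaling_def rv.gen_inverse_eq_threshold ..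

lemma scaling_pos: "0 < scaling a s"
 unfolding scaling_eq by (simp add: ennreal_zero_less_divide)

lemma N_proc_measurable:
 assumes [measurable]: "C \<in> sets M"
 shows "N_proc M a C \<in> M \<rightarrow>\<^sub>M borel_of weak_sharp_topology"
 unfolding N_proc_def[abs_def]
proof (rule measurable_dirac_sum)
 fix k
 have "(\<lambda>y. ennreal_of_enat (hit_time C k y)) \<in> borel_measurable M"
  by (rule measurable_compose[OF measurable_hit_time]) auto
 then show "(\<lambda>y. scaling a (measure M C) * ennreal_of_enat (hit_time C k y)) \<in> borel_measurable M"
  by measurable
qed (rule locally_finite_hit_times[OF scaling_pos])

definition V :: "nat \<Rightarrow> 'v path \<Rightarrow> nat \<Rightarrow> real" where
 "V n y i = disc (1 / real (N n)) (gap (B n) i y)"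

lemma V_measurable [measurable]: "(\<lambda>y. V n y i) \<in> borel_measurable M"
 unfolding V_def by (rule measurable_compose[OF measurable_gap[OF B_sets]]) simp

lemma prod_V: "(\<Prod>i<k. V n y i) = disc (1 / real (N n)) (hit_time (B n) k y)"
 unfolding V_def by (rule prod_disc_gap)

text \<open>As the k-th hit is at least k, the products decay at least geometrically at every point,
  so no null set has to be removed.\<close>

lemma V_in_exp_seqs: "V n y \<in> exp_seqs"
proof -
 let ?s = "1 / real (N n)"
 have s: "0 < ?s" using rate_pos[of 1 n] by simp
 have "V n y \<in> unit_cube" using disc_nonneg disc_le_1[OF less_imp_le[OF s]] by (auto simp: unit_cube_def V_def)
 moreover have "(\<lambda>k. \<Prod>i<k. V n y i) \<longlonglongrightarrow> 0"
 proof (rule Lim_null_comparison[of _ "\<lambda>k. exp (- ?s) ^ k"])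
  show "\<forall>\<^sub>F k in sequentially. norm (\<Prod>i<k. V n y i) \<le> exp (- ?s) ^ k"
  proof (intro always_eventually allI)
   fix k
   have "norm (\<Prod>i<k. V n y i) \<le> exp (- ?s * real k)"
    unfolding prod_V using disc_le_exp[OF less_imp_le[OF s] hit_time_ge[of k "B n" y]] disc_nonneg by simp
   then show "norm (\<Prod>i<k. V n y i) \<le> exp (- ?s) ^ k" by (simp add: exp_of_nat_mult[symmetric] mult.commute)
  qed
  show "(\<lambda>k. exp (- ?s) ^ k) \<longlonglongrightarrow> 0" using s by (intro LIMSEQ_power_zero) simp
 qed
 ultimately show ?thesis by (simp add: exp_seqs_def)
qed

lemma N_proc_eq:
 assumes "N n = rv.threshold (1 / b n)"
 shows "N_proc M a (B n) y = renewal_of (V n y)"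
 unfolding N_proc_def renewal_of_def prod_V
proof (intro arg_cong[where f = dirac_sum] ext)
 fix k
 have N: "0 < real (N n)" using N_ge_1[of n] by simp
 have sc: "scaling a (measure M (B n)) = ennreal (1 / real (N n))"
  unfolding scaling_eq b_def[symmetric] assms[symmetric]
  using divide_ennreal[of 1 "real (N n)"] N by simp
 show "scaling a (measure M (B n)) * ennreal_of_enat (hit_time (B n) k y) = neg_log (disc (1 / real (N n)) (hit_time (B n) k y))"
 proof (cases "hit_time (B n) k y")
  case (enat r)
  then show ?thesis
   unfolding sc using N by (simp add: neg_log_def ennreal_of_nat_eq_real_of_nat ennreal_mult''[symmetric])
 next
  case infinity
  then show ?thesis unfolding sc using N by (simp add: neg_log_def ennreal_mult_top)
 qed
qed

text \<open>The two sides can differ only for exponent 0 at an infinite gap. Gaps are finite almost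
  everywhere for \<open>M\<close>, hence for every absolutely continuous law.\<close>

lemma moment_joint:
 assumes Q: "sets Q = sets M" "absolutely_continuous M Q" and n: "1 \<le> n"
 shows "(LINT y|Q. (\<Prod>i<k. V n y i ^ m i)) = (LINT y|Q. joint (\<lambda>i. real (m i)) k n y)"
proof (rule integral_cong_AE)
 have meas: "(\<lambda>y. V n y i) \<in> borel_measurable Q" for i
  unfolding measurable_cong_sets[OF Q(1) refl] by measurable
 show "(\<lambda>y. \<Prod>i<k. V n y i ^ m i) \<in> borel_measurable Q" using meas by measurable
 show "joint (\<lambda>i. real (m i)) k n \<in> borel_measurable Q"
  unfolding measurable_cong_sets[OF Q(1) refl] by measurable
 show "AE y in Q. (\<Prod>i<k. V n y i ^ m i) = joint (\<lambda>i. real (m i)) k n y"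
  using absolutely_continuous_AE[OF Q(1) Q(2) AE_returns_finite[OF n]]
 proof eventually_elim
  case (elim y)
  then have "gap (B n) i y \<noteq> \<infinity>" for i using gap_finite[of "B n" y i] by auto
  then show ?case by (auto simp: joint_def V_def disc_power intro!: prod.cong)
 qed
qed

text \<open>Indices start at \<open>Suc n\<close> because \<open>B 0\<close> is the whole space, on
  which the conditional law need not exist.\<close>

lemma joint_lim_uniform:
 assumes "\<And>i. 0 \<le> \<sigma> i"
 shows "(\<lambda>n. LINT y|(uniform_measure M (B (Suc n))). joint \<sigma> k (Suc n) y) \<longlonglongrightarrow> (\<Prod>i<k. limit (\<sigma> i))"
proof -
 have "(LINT y|(uniform_measure M (B (Suc n))). joint \<sigma> k (Suc n) y) =
   (LINT y|M. indicator (B (Suc n)) y * joint \<sigma> k (Suc n) y) / b (Suc n)" for n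
  using b_pos[of "Suc n"] by (subst integral_uniform_measure) (auto simp: b_def)
 then show ?thesis using LIMSEQ_Suc[OF joint_lim_B[of \<sigma> k]] assms by simp
qed

lemma joint_lim_density:
 assumes P: "prob_space P" "sets P = sets M" "absolutely_continuous M P" and \<sigma>: "\<And>i. 0 \<le> \<sigma> i"
 shows "(\<lambda>n. LINT y|P. joint \<sigma> k n y) \<longlonglongrightarrow> (\<Prod>i<k. limit (\<sigma> i))"
proof -
 let ?L = "\<Prod>i<k. limit (\<sigma> i)"
 interpret P: prob_space P by (rule P(1))
 obtain g where g_int: "integrable M g" and g0: "\<And>y. 0 \<le> g y" and P_eq: "P = density M (\<lambda>y. ennreal (g y))"
  and gP: "(LINT y|M. g y) = measure P (space P)"
  by (rule integrable_density_exists[OF P.finite_measure_axioms P(3,2)]) (rule that)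
 have g1: "(LINT y|M. g y) = 1" unfolding gP by (rule P.prob_space)
 have [measurable]: "g \<in> borel_measurable M" using g_int by auto
 have limit01: "0 \<le> limit (\<sigma> i) \<and> limit (\<sigma> i) \<le> 1" for i
 proof -
  have "0 < Gamma (1 + \<alpha>)" using rv.\<alpha> by (intro Gamma_real_pos) simp
  then show ?thesis by (auto simp: limit_def divide_le_eq_1 add_pos_nonneg intro!: divide_nonneg_nonneg)
 qed
 then have L01: "0 \<le> ?L" "?L \<le> 1" by (auto intro: prod_nonneg prod_le_1)
 have j01: "0 \<le> joint \<sigma> k n y \<and> joint \<sigma> k n y \<le> 1" for n y by (rule joint_bounds[OF \<sigma>])
 \<comment> \<open>Subtracting the limit makes all cylinder integrals tend to 0, the form in which
   they extend to the density g.\<close>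
 have "(\<lambda>n. LINT y|M. g y * (joint \<sigma> k n y - ?L)) \<longlonglongrightarrow> 0"
 proof (rule tendsto_integral_cylinders[OF _ _ _ g_int])
  show "\<bar>joint \<sigma> k n y - ?L\<bar> \<le> 1" for n y using j01[of n y] L01 by linarith
  fix u :: "'v list" assume u: "u \<noteq> []" "cyl A u \<noteq> {}"
  let ?m = "measure M (cyl A u)"
  have m: "0 < ?m" by (rule measure_cyl_pos[OF u])
  have eq: "(LINT y|M. indicator (cyl A u) y * (joint \<sigma> k n y - ?L)) =
    ((LINT y|M. indicator (cyl A u) y * joint \<sigma> k n y) / ?m - ?L) * ?m" for n
  proof -
   have "(LINT y|M. indicator (cyl A u) y * (joint \<sigma> k n y - ?L)) =
     (LINT y|M. indicator (cyl A u) y * joint \<sigma> k n y - indicator (cyl A u) y * ?L)"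
    by (simp only: right_diff_distrib)
   also have "\<dots> = (LINT y|M. indicator (cyl A u) y * joint \<sigma> k n y) - (LINT y|M. indicator (cyl A u) y * ?L)"
    by (rule lint_diff; rule integrable_indicator_mult[OF cyl_sets cyl_finite[OF u(1)], of _ 1])
      (use j01 L01 in auto)
   finally show ?thesis using m by (simp only: integral_indicator_const[OF cyl_sets]) (simp add: left_diff_distrib)
  qed
  have "(\<lambda>n. ((LINT y|M. indicator (cyl A u) y * joint \<sigma> k n y) / ?m - ?L) * ?m) \<longlonglongrightarrow> (?L - ?L) * ?m"
   by (intro tendsto_mult tendsto_diff tendsto_const joint_lim_cyl[OF u \<sigma>])
  then show "(\<lambda>n. LINT y|M. indicator (cyl A u) y * (joint \<sigma> k n y - ?L)) \<longlonglongrightarrow> 0"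
   unfolding eq by simp
 qed measurable
 moreover have "(LINT y|M. g y * (joint \<sigma> k n y - ?L)) = (LINT y|P. joint \<sigma> k n y) - ?L" for n
 proof -
  have i: "integrable M (\<lambda>y. g y * joint \<sigma> k n y)"
   using j01 g0 by (intro lint_bound[OF g_int]) (auto simp: abs_mult intro!: mult_left_le)
  have "(LINT y|M. g y * (joint \<sigma> k n y - ?L)) = (LINT y|M. g y * joint \<sigma> k n y - g y * ?L)" by (simp only: right_diff_distrib)
  also have "\<dots> = (LINT y|M. g y * joint \<sigma> k n y) - (LINT y|M. g y * ?L)"
   by (rule lint_diff[OF i]) (use g_int in simp)
  also have "(LINT y|M. g y * joint \<sigma> k n y) = (LINT y|P. joint \<sigma> k n y)"
   unfolding P_eq using g0 by (subst integral_density) auto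
  finally show ?thesis using g1 by simp
 qed
 ultimately have "(\<lambda>n. (LINT y|P. joint \<sigma> k n y) - ?L) \<longlonglongrightarrow> 0" by simp
 then show ?thesis by (simp add: LIM_zero_iff)
qed

lemma prob_space_uniform: "prob_space (uniform_measure M (B (Suc n)))"
 using b_pos[of "Suc n"] B_finite[of "Suc n"]
 by (intro prob_space_uniform_measure) (auto simp: b_def measure_def)

lemma uniform_absolutely_continuous: "absolutely_continuous M (uniform_measure M (B n))"
 unfolding uniform_measure_def by (rule absolutely_continuousI_density) measurable

text \<open>The rescaled return times from \<open>B n\<close> have transforms converging to the
  required formula at every positive parameter, and thereby produce the law.\<close>

lemma H_law_exists: "is_H_law \<alpha> (Gamma (1 + \<alpha>)) (H_law \<alpha> (Gamma (1 + \<alpha>)))"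
proof (rule is_H_law_H_law[where P = "\<lambda>n. uniform_measure M (B (Suc n))" and V = "\<lambda>n y. V (Suc n) y 0"])
 show "0 < \<alpha>" "0 < Gamma (1 + \<alpha>)" using rv.\<alpha> by (auto intro: Gamma_real_pos)
 show "(\<lambda>y. V (Suc n) y 0) \<in> borel_measurable (uniform_measure M (B (Suc n)))" for n
  unfolding measurable_cong_sets[OF sets_uniform_measure refl] by measurable
 show "V (Suc n) y 0 \<in> {0..1}" for n y
  using disc_nonneg disc_le_1[of "1 / real (N (Suc n))"] by (simp add: V_def)
 fix s :: real assume s: "0 < s"
 have "(\<lambda>n. LINT y|(uniform_measure M (B (Suc n))). joint (\<lambda>_. s) 1 (Suc n) y) \<longlonglongrightarrow> (\<Prod>i<1::nat. limit s)"
  by (rule joint_lim_uniform) (use s in simp)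
 then show "(\<lambda>n. LINT y|(uniform_measure M (B (Suc n))). V (Suc n) y 0 powr s) \<longlonglongrightarrow>
   Gamma (1 + \<alpha>) / (Gamma (1 + \<alpha>) + s powr \<alpha>)"
  using s by (simp add: joint_def V_def disc_powr limit_def)
qed (rule prob_space_uniform)

lemma hitting_converges:
 assumes Q: "\<And>n. prob_space (Q n)" "\<And>n. sets (Q n) = sets M" "\<And>n. absolutely_continuous M (Q n)"
  and lim: "\<And>\<sigma> k. (\<And>i. 0 \<le> \<sigma> i) \<Longrightarrow> (\<lambda>n. LINT y|(Q n). joint \<sigma> k (Suc n) y) \<longlonglongrightarrow> (\<Prod>i<k. limit (\<sigma> i))"
 shows "converges_in_law weak_sharp_topology Q (\<lambda>n. N_proc M a (B (Suc n))) (fpp_law \<alpha> (Gamma (1 + \<alpha>)))"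
proof (rule converges_in_law_fpp[where V = "\<lambda>n. V (Suc n)"])
 show "0 < \<alpha>" "0 < Gamma (1 + \<alpha>)" using rv.\<alpha> by (auto intro: Gamma_real_pos)
 show "(\<lambda>y. V (Suc n) y i) \<in> borel_measurable (Q n)" for n i
  unfolding measurable_cong_sets[OF Q(2) refl] by measurable
 show "V (Suc n) y \<in> exp_seqs" for n y by (rule V_in_exp_seqs)
 show "(\<lambda>n. LINT y|(Q n). (\<Prod>i<k. V (Suc n) y i ^ m i)) \<longlonglongrightarrow> (\<Prod>i<k. Gamma (1 + \<alpha>) / (Gamma (1 + \<alpha>) + real (m i) powr \<alpha>))" for k m
  using lim[of "\<lambda>i. real (m i)" k] by (simp add: moment_joint[OF Q(2,3)] limit_def)
 show "N_proc M a (B (Suc n)) \<in> Q n \<rightarrow>\<^sub>M borel_of weak_sharp_topology" for n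
  unfolding measurable_cong_sets[OF Q(2) refl] by (rule N_proc_measurable) simp
 have "\<forall>\<^sub>F n in sequentially. N (Suc n) = rv.threshold (1 / b (Suc n))"
  by (rule eventually_compose_filterlim[OF N_eq_threshold filterlim_Suc])
 then show "\<forall>\<^sub>F n in sequentially. \<forall>y\<in>space (Q n). N_proc M a (B (Suc n)) y = renewal_of (V (Suc n) y)"
  by eventually_elim (auto intro: N_proc_eq)
qed (use Q H_law_exists in auto)

theorem hitting_process_converges:
 "prob_space P \<Longrightarrow> sets P = sets M \<Longrightarrow> absolutely_continuous M P \<Longrightarrow>
  converges_in_law weak_sharp_topology (\<lambda>n. P) (\<lambda>n. N_proc M a (B (Suc n))) (fpp_law \<alpha> (Gamma (1 + \<alpha>)))"
 "converges_in_law weak_sharp_topology (\<lambda>n. uniform_measure M (B (Suc n))) (\<lambda>n. N_proc M a (B (Suc n)))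
  (fpp_law \<alpha> (Gamma (1 + \<alpha>)))"
proof -
 show "converges_in_law weak_sharp_topology (\<lambda>n. P) (\<lambda>n. N_proc M a (B (Suc n))) (fpp_law \<alpha> (Gamma (1 + \<alpha>)))"
  if P: "prob_space P" "sets P = sets M" "absolutely_continuous M P"
  by (rule hitting_converges[OF P]) (rule LIMSEQ_Suc[OF joint_lim_density[OF P]])
 show "converges_in_law weak_sharp_topology (\<lambda>n. uniform_measure M (B (Suc n))) (\<lambda>n. N_proc M a (B (Suc n)))
  (fpp_law \<alpha> (Gamma (1 + \<alpha>)))"
  by (rule hitting_converges[OF prob_space_uniform sets_uniform_measure uniform_absolutely_continuous joint_lim_uniform])
qed

end

theorem theorem4p1:
  fixes A :: "'v::countable \<Rightarrow> 'v \<Rightarrow> bool"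
    and \<eta> \<alpha> :: real
    and \<phi> h :: "(nat \<Rightarrow> 'v) \<Rightarrow> real"
    and \<nu> \<mu> :: "(nat \<Rightarrow> 'v) measure"
    and a :: "nat \<Rightarrow> real"
    and x :: "nat \<Rightarrow> 'v"
    and B :: "nat \<Rightarrow> (nat \<Rightarrow> 'v) set"
  assumes "infinite (UNIV :: 'v set)"
    and "0 < \<eta>" "\<eta> < 1"
    and "topologically_mixing A"
    and "\<phi> \<in> borel_measurable (borel_of (shift_topology \<eta> A))"
    and "walters A \<phi>"
    and "gurevich_pressure A \<phi> < \<infinity>"
    and "null_recurrent A \<phi>"
    and "null_rpf \<eta> A \<phi> h \<nu>"
    and "\<mu> = density \<nu> (\<lambda>y. ennreal (h y))"
    and "mono a" "normalizing_seq \<mu> a"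
    and "0 < \<alpha>" "\<alpha> \<le> 1" "regularly_varying_seq a \<alpha>"
    and "x \<in> shift_space A"
    and "\<And>n. B n = cyl A (map x [0..<n])"
    and "\<forall>p\<ge>1. (lshift ^^ p) x \<noteq> x"
    and "\<exists>v. infinite {k. (lshift ^^ k) x \<in> cyl A [v]}"
  shows "(\<forall>P. prob_space P \<and> sets P = sets \<mu> \<and> absolutely_continuous \<mu> P \<longrightarrow>
            converges_in_law weak_sharp_topology (\<lambda>n. P) (\<lambda>n. N_proc \<mu> a (B (Suc n)))
              (fpp_law \<alpha> (Gamma (1 + \<alpha>)))) \<and>
         converges_in_law weak_sharp_topology (\<lambda>n. uniform_measure \<mu> (B (Suc n)))
           (\<lambda>n. N_proc \<mu> a (B (Suc n))) (fpp_law \<alpha> (Gamma (1 + \<alpha>)))"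
proof -
  obtain v where v: "infinite {k. (lshift ^^ k) x \<in> cyl A [v]}" using assms(19) by blast
  have visits: "infinite {k. x k = v}"
    by (rule infinite_super[OF _ v]) (auto simp: cyl_def)
  have rpf: "continuous_map (shift_topology \<eta> A) euclideanreal h" "\<And>y. y \<in> shift_space A \<Longrightarrow> 0 < h y"
      "sets \<nu> = sets (borel_of (shift_topology \<eta> A))" "\<And>w. w \<noteq> [] \<Longrightarrow> emeasure \<nu> (cyl A w) < \<infinity>"
      "\<And>y. y \<in> shift_space A \<Longrightarrow> ruelle_op A \<phi> (\<lambda>y. ennreal (h y)) y = ennreal (lam A \<phi> * h y)"
      "\<And>f. f \<in> borel_measurable \<nu> \<Longrightarrow> (\<integral>\<^sup>+y. ruelle_op A \<phi> f y \<partial>\<nu>) = ennreal (lam A \<phi>) * (\<integral>\<^sup>+y. f y \<partial>\<nu>)"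
      "(\<integral>\<^sup>+y. ennreal (h y) \<partial>\<nu>) = \<infinity>"
    using assms(9) unfolding null_rpf_def by blast+
  have sets_\<nu>: "sets \<nu> = sigma_sets (shift_space A) (range (cyl A))"
    using rpf(3) sets_borel_of_shift[OF assms(2,3)] by simp
  have open_vimage: "openin (shift_topology \<eta> A) {y \<in> shift_space A. h y \<in> U}" if "open U" for U
    using openin_continuous_map_preimage[OF rpf(1), of U] that by (simp add: topspace_shift_topology[OF assms(2,3)])
  \<comment> \<open>Continuity of \<open>h\<close> in terms of cylinders; half-lines for U yield the
    two semicontinuity conditions.\<close>
  have near: "\<exists>n. \<forall>z\<in>cyl A (map y [0..<n]). h z \<in> U" if "y \<in> shift_space A" "open U" "h y \<in> U" for y U
    using open_vimage[OF that(2)] that unfolding openin_shift_topology[OF assms(2,3)] by blast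
  have h_meas: "h \<in> borel_measurable \<nu>"
  proof (rule borel_measurableI)
    fix U :: "real set" assume "open U"
    then have "{y \<in> shift_space A. h y \<in> U} \<in> sets \<nu>"
      unfolding rpf(3) sets_borel_of by (intro sigma_sets.Basic) (simp add: open_vimage)
    moreover have "space \<nu> = shift_space A"
      using sets_eq_imp_space_eq[OF rpf(3)] by (simp add: space_borel_of topspace_shift_topology[OF assms(2,3)])
    ultimately show "h -` U \<inter> space \<nu> \<in> sets \<nu>" by (simp add: vimage_def Int_def conj_commute)
  qed
  have rv: "rv_seq a \<alpha>" by (rule rv_seq.intro[OF assms(11,13,15)])
  have "conformal_measure A \<nu> \<phi> (lam A \<phi>)"
  proof (intro conformal_measure.intro shift_measure.intro conformal_measure_axioms.intro sets_\<nu> rpf(6))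
    show "\<phi> \<in> borel_measurable \<nu>" using assms(5) by (simp add: measurable_cong_sets[OF rpf(3) refl])
    show "0 < lam A \<phi>" by (simp add: lam_def)
  qed
  then have "walters_eigen A \<nu> \<phi> (lam A \<phi>) h a"
  proof (intro walters_eigen.intro walters_eigen_axioms.intro assms(4,6,11) h_meas rpf(2,4,5,7))
    show "filterlim a at_top sequentially" by (rule rv_seq.a_top[OF rv])
    show "normalizing_seq (density \<nu> (\<lambda>y. ennreal (h y))) a" using assms(10,12) by simp
    show "\<exists>n. \<forall>z\<in>cyl A (map y [0..<n]). c < h z" if "y \<in> shift_space A" "c < h y" for y c
      using near[OF that(1), of "{c<..}"] that(2) by simp
    show "\<exists>n. \<forall>z\<in>cyl A (map y [0..<n]). h z < c" if "y \<in> shift_space A" "h y < c" for y c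
      using near[OF that(1), of "{..<c}"] that(2) by simp
  qed
  \<comment> \<open>Passage from the conformal measure \<nu> to the invariant measure with density
    \<open>h\<close>; the oscillation bound becomes three times the Walters bound, as in
    \<open>word_kernel_density\<close>.\<close>
  then have "recurrent_shift A \<mu> (\<lambda>m. 3 * walters_bound A \<phi> m) a"
    unfolding assms(10) by (rule walters_eigen.recurrent_shift_M')
  then interpret hitting A \<mu> "\<lambda>m. 3 * walters_bound A \<phi> m" a \<alpha> x v
    by (intro hitting.intro hitting_axioms.intro rv assms(14,1,4,16) visits) (use assms(18) in auto)
  have B_eq: "hitting.B A x = B" by (rule ext) (simp add: B_def assms(17))
  show ?thesis
    using hitting_process_converges unfolding B_eq by blast
qed

end
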